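(* Let $I=\langle f_1,\dots,f_n\rangle\subset S$, where $n=\dim X$ and $f_i\in S_{\alpha_i}$ with $\alpha_i\in\mathrm{Pic}^\circ(X)$ for $i=1,\dots,n$, and suppose that $V_X(I)$ is zero-dimensional. Then for any nef $V_X(I)$-basepoint free $\alpha_0\in\mathbb{Q}\mathrm{Pic}^\circ(X)$, the degree $\beta=\sum_{i=1}^n\alpha_i+\alpha_0$ belongs to $\mathrm{Reg}(I)$. In particular, $\sum_{i=1}^n\alpha_i\in\mathrm{Reg}(I)$ and $\left(\sum_{i=1}^n\alpha_i,\alpha_0\right)$ is a regularity pair for $I$.
   Context: $X=X_\Sigma$ is the normal toric variety over $\mathbb{C}$ of a complete rational polyhedral fan $\Sigma$ in $\mathbb{R}^n$, with rays $\rho_1,\dots,\rho_k$ and corresponding torus-invariant prime divisors $D_1,\dots,D_k$. The Cox ring is $S=\mathbb{C}[x_1,\dots,x_k]$, graded by the class group $\mathrm{Cl}(X)$ via $\deg x_i=[D_i]$, with graded pieces $S_\alpha$; $x^{\hat\sigma}=\prod_{\rho_i\notin\sigma}x_i$ and $B=\langle x^{\hat\sigma}\mid\sigma\in\Sigma\rangle$ is the irrelevant ideal. $\pi:\mathbb{C}^k\setminus\mathrm{Var}_{\mathbb{C}^k}(B)\to X$ is the Cox quotient map; for homogeneous $f$, $\mathrm{Var}_X(f)=\{\zeta\in X\mid f(x)=0\text{ for some }x\in\pi^{-1}(\zeta)\}$. A homogeneous ideal $I\subset S$ defines a closed subscheme $V_X(I)\subset X$, given on the chart $U_\sigma$ by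 $(I_{x^{\hat\sigma}})_0\subset(S_{x^{\hat\sigma}})_0\simeq\mathbb{C}[U_\sigma]$; $\mathrm{Var}_X(I)$ is its reduced variety. A point $\zeta\in X$ is a basepoint of $\alpha\in\mathrm{Cl}(X)$ (or of $S_\alpha$) if $\zeta\in\mathrm{Var}_X(f)$ for all $f\in S_\alpha$; $\alpha$ is basepoint free if it has no basepoints, and $V_X(I)$-basepoint free if no point of $\mathrm{Var}_X(I)$ is a basepoint of $\alpha$ (for $V_X(I)$ zero-dimensional, equivalently some $h\in S_\alpha$ vanishes at no point of $\mathrm{Var}_X(I)$). $\mathrm{Pic}^\circ(X)=\{\alpha\in\mathrm{Pic}(X)\mid\alpha\text{ basepoint free}\}$ (classes of nef Cartier divisors) and $\mathbb{Q}\mathrm{Pic}^\circ(X)=\{\alpha\in\mathrm{Cl}(X)\mid\ell\alpha\in\mathrm{Pic}^\circ(X)\text{ for some integer }\ell>0\}$ (classes of nef $\mathbb{Q}$-Cartier divisors). For $V_X(I)$ zero-dimensional of degree $\delta^+$ (number of points counted with multiplicity), $\mathrm{Reg}(I)=\{\alpha\in\mathrm{Cl}(X)\mid\dim_{\mathbb C}(S/I)_\alpha=\delta^+,\ I_\alpha=(I:B^\infty)_\alpha,\ \alpha\text{ is }V_X(I)\text{-basepoint free}\}$. A pair $(\alpha,\alpha_0)\in\mathrm{Cl}(X)^2$ is a regularity pair if $\alpha,\alpha+\alpha_0\in\mathrm{Reg}(I)$ and $\alpha_0$ is $V_X(I)$-basepoint free. *)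

theory Defs
  imports
    "HOL-Analysis.Analysis"
    "HOL-Library.Poly_Mapping"
    "HOL-Algebra.Ideal_Product"
    "HOL-Algebra.Embedded_Algebras"
    "HOL-Algebra.QuotRing"
begin

section \<open>Localization, Krull dimension and powers of ideals\<close>

text \<open>The fraction \<open>a/s\<close> of the localization of \<open>R\<close> at the multiplicative set \<open>S\<close>, as the class of
  all pairs \<open>(b, t)\<close> with \<open>u (a t - b s) = 0\<close> for some \<open>u \<in> S\<close>.\<close>

definition fraction ::
  "('a, 'b) ring_scheme \<Rightarrow> 'a set \<Rightarrow> 'a \<Rightarrow> 'a \<Rightarrow> ('a \<times> 'a) set" where
  "fraction R S a s = {(b, t). b \<in> carrier R \<and> t \<in> S \<and>
     (\<exists>u\<in>S. u \<otimes>\<^bsub>R\<^esub> (a \<otimes>\<^bsub>R\<^esub> t) = u \<otimes>\<^bsub>R\<^esub> (b \<otimes>\<^bsub>R\<^esub> s))}"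

text \<open>The unions below are unions of equal sets, since the operations do not depend on the
  representatives.\<close>

definition localization :: "('a, 'b) ring_scheme \<Rightarrow> 'a set \<Rightarrow> ('a \<times> 'a) set ring" where
  "localization R S =
     \<lparr>carrier = {fraction R S a s | a s. a \<in> carrier R \<and> s \<in> S},
      mult = (\<lambda>A B. \<Union>p\<in>A. \<Union>q\<in>B.
               fraction R S (fst p \<otimes>\<^bsub>R\<^esub> fst q) (snd p \<otimes>\<^bsub>R\<^esub> snd q)),
      one = fraction R S \<one>\<^bsub>R\<^esub> \<one>\<^bsub>R\<^esub>,
      zero = fraction R S \<zero>\<^bsub>R\<^esub> \<one>\<^bsub>R\<^esub>,
      add = (\<lambda>A B. \<Union>p\<in>A. \<Union>q\<in>B.
               fraction R S ((fst p \<otimes>\<^bsub>R\<^esub> snd q) \<oplus>\<^bsub>R\<^esub> (fst q \<otimes>\<^bsub>R\<^esub> snd p))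
                 (snd p \<otimes>\<^bsub>R\<^esub> snd q))\<rparr>"

text \<open>The supremum of the lengths of chains of prime ideals; the zero ring has dimension
  \<open>-\<infinity>\<close>.\<close>

definition krull_dim :: "('a, 'b) ring_scheme \<Rightarrow> ereal" where
  "krull_dim R = Sup {ereal (real l) | l.
     \<exists>P :: nat \<Rightarrow> 'a set. (\<forall>i\<le>l. primeideal (P i) R) \<and> (\<forall>i<l. P i \<subset> P (Suc i))}"

definition ideal_power :: "('a, 'b) ring_scheme \<Rightarrow> 'a set \<Rightarrow> nat \<Rightarrow> 'a set" where
  "ideal_power R J l = ((\<lambda>K. J \<cdot>\<^bsub>R\<^esub> K) ^^ l) (carrier R)"

definition saturation :: "('a, 'b) ring_scheme \<Rightarrow> 'a set \<Rightarrow> 'a set \<Rightarrow> 'a set" where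
  "saturation R I J =
     {f \<in> carrier R. \<exists>l. \<forall>b \<in> ideal_power R J l. f \<otimes>\<^bsub>R\<^esub> b \<in> I}"


section \<open>Complete rational fans\<close>

text \<open>The lattices \<open>N\<close> and \<open>M\<close> are both \<^typ>\<open>int ^ 'n\<close>, with the standard pairing.\<close>

definition real_vec :: "int ^ 'n \<Rightarrow> real ^ 'n" where
  "real_vec v = (\<chi> j. real_of_int (v $ j))"

definition pairing :: "int ^ 'n::finite \<Rightarrow> int ^ 'n \<Rightarrow> int" where
  "pairing m u = (\<Sum>j\<in>UNIV. m $ j * u $ j)"

definition rational_polyhedral_cone :: "(real ^ 'n::finite) set \<Rightarrow> bool" where
  "rational_polyhedral_cone \<sigma> \<longleftrightarrow>
     (\<exists>V :: (int ^ 'n) set. finite V \<and> \<sigma> = convex_cone hull (real_vec ` V))"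

definition strongly_convex :: "(real ^ 'n::finite) set \<Rightarrow> bool" where
  "strongly_convex \<sigma> \<longleftrightarrow> \<sigma> \<inter> uminus ` \<sigma> = {0}"

text \<open>The empty set is a face in the sense of \<open>face_of\<close>, but not a face of a cone in toric
  geometry.\<close>

definition rational_fan :: "(real ^ 'n::finite) set set \<Rightarrow> bool" where
  "rational_fan \<Sigma> \<longleftrightarrow> finite \<Sigma> \<and>
     (\<forall>\<sigma>\<in>\<Sigma>. rational_polyhedral_cone \<sigma> \<and> strongly_convex \<sigma>) \<and>
     (\<forall>\<sigma>\<in>\<Sigma>. \<forall>\<tau>. \<tau> face_of \<sigma> \<and> \<tau> \<noteq> {} \<longrightarrow> \<tau> \<in> \<Sigma>) \<and>
     (\<forall>\<sigma>\<in>\<Sigma>. \<forall>\<tau>\<in>\<Sigma>. (\<sigma> \<inter> \<tau>) face_of \<sigma> \<and> (\<sigma> \<inter> \<tau>) face_of \<tau>)"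

definition complete_rational_fan :: "(real ^ 'n::finite) set set \<Rightarrow> bool" where
  "complete_rational_fan \<Sigma> \<longleftrightarrow> rational_fan \<Sigma> \<and> \<Union>\<Sigma> = UNIV"

text \<open>The rays are indexed by a finite type \<open>'k\<close>, so that \<open>k\<close> is the number of its elements.\<close>

definition ray_enumeration ::
  "(real ^ 'n::finite) set set \<Rightarrow> ('k::finite \<Rightarrow> (real ^ 'n) set) \<Rightarrow> bool" where
  "ray_enumeration \<Sigma> \<rho> \<longleftrightarrow> bij_betw \<rho> UNIV {\<tau>\<in>\<Sigma>. aff_dim \<tau> = 1}"

definition ray_generator :: "(real ^ 'n::finite) set \<Rightarrow> int ^ 'n" where
  "ray_generator r = (THE u. {v. real_vec v \<in> r} = range (\<lambda>c. int c *s u))"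


section \<open>Class group and Picard group\<close>

text \<open>A torus-invariant Weil divisor \<open>\<Sum> a\<^sub>i D\<^sub>i\<close> is the vector \<open>a\<close>.  The class group is presented
  as torus-invariant Weil divisors modulo divisors of characters, that is, by the exact
  sequence \<open>M \<rightarrow> \<Oplus> \<int> D\<^sub>i \<rightarrow> Cl(X) \<rightarrow> 0\<close>.  It is written multiplicatively, following HOL-Algebra:
  \<open>\<otimes>\<close> is the sum of classes and \<open>[^]\<close> is the multiple of a class.\<close>

definition torus_divisors :: "(int ^ 'k) monoid" where
  "torus_divisors = \<lparr>carrier = UNIV, mult = (+), one = 0\<rparr>"

definition character_divisor ::
  "('k \<Rightarrow> (real ^ 'n::finite) set) \<Rightarrow> int ^ 'n \<Rightarrow> int ^ 'k::finite" where
  "character_divisor \<rho> m = (\<chi> i. pairing m (ray_generator (\<rho> i)))"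

definition class_group ::
  "('k::finite \<Rightarrow> (real ^ 'n::finite) set) \<Rightarrow> (int ^ 'k) set monoid" where
  "class_group \<rho> = torus_divisors Mod range (character_divisor \<rho>)"

definition divisor_class ::
  "('k::finite \<Rightarrow> (real ^ 'n::finite) set) \<Rightarrow> int ^ 'k \<Rightarrow> (int ^ 'k) set" where
  "divisor_class \<rho> a = range (character_divisor \<rho>) #>\<^bsub>torus_divisors\<^esub> a"

text \<open>Cartier: on every chart \<open>U\<^sub>\<sigma>\<close> the divisor agrees with the divisor of a character.\<close>

definition cartier_divisor ::
  "(real ^ 'n::finite) set set \<Rightarrow> ('k \<Rightarrow> (real ^ 'n) set) \<Rightarrow> int ^ 'k::finite \<Rightarrow> bool" where
  "cartier_divisor \<Sigma> \<rho> a \<longleftrightarrow>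
     (\<forall>\<sigma>\<in>\<Sigma>. \<exists>m. \<forall>i. \<rho> i \<subseteq> \<sigma> \<longrightarrow> a $ i = character_divisor \<rho> m $ i)"

definition picard_group ::
  "(real ^ 'n::finite) set set \<Rightarrow> ('k::finite \<Rightarrow> (real ^ 'n) set) \<Rightarrow> (int ^ 'k) set set" where
  "picard_group \<Sigma> \<rho> = divisor_class \<rho> ` {a. cartier_divisor \<Sigma> \<rho> a}"


section \<open>The Cox ring\<close>

type_synonym 'k cox = "('k \<Rightarrow>\<^sub>0 nat) \<Rightarrow>\<^sub>0 complex"

definition cox_ring :: "'k cox ring" where
  "cox_ring = \<lparr>carrier = UNIV, mult = (*), one = 1, zero = 0, add = (+)\<rparr>"

definition scalar :: "complex \<Rightarrow> 'k cox" where
  "scalar c = Poly_Mapping.single 0 c"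

definition variable :: "'k \<Rightarrow> 'k cox" where
  "variable i = Poly_Mapping.single (Poly_Mapping.single i 1) 1"

definition cox_eval :: "complex ^ 'k::finite \<Rightarrow> 'k cox \<Rightarrow> complex" where
  "cox_eval x f =
     (\<Sum>e\<in>Poly_Mapping.keys f. Poly_Mapping.lookup f e *
        (\<Prod>i\<in>UNIV. (x $ i) ^ Poly_Mapping.lookup e i))"

definition monomial_degree ::
  "('k::finite \<Rightarrow> (real ^ 'n::finite) set) \<Rightarrow> ('k \<Rightarrow>\<^sub>0 nat) \<Rightarrow> (int ^ 'k) set" where
  "monomial_degree \<rho> e = divisor_class \<rho> (\<chi> i. int (Poly_Mapping.lookup e i))"

definition graded_piece ::
  "('k::finite \<Rightarrow> (real ^ 'n::finite) set) \<Rightarrow> (int ^ 'k) set \<Rightarrow> 'k cox set" where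
  "graded_piece \<rho> \<alpha> = {f. \<forall>e\<in>Poly_Mapping.keys f. monomial_degree \<rho> e = \<alpha>}"

definition cone_monomial ::
  "('k::finite \<Rightarrow> (real ^ 'n::finite) set) \<Rightarrow> (real ^ 'n) set \<Rightarrow> 'k cox" where
  "cone_monomial \<rho> \<sigma> = (\<Prod>i | \<not> \<rho> i \<subseteq> \<sigma>. variable i)"

definition irrelevant_ideal ::
  "(real ^ 'n::finite) set set \<Rightarrow> ('k::finite \<Rightarrow> (real ^ 'n) set) \<Rightarrow> 'k cox set" where
  "irrelevant_ideal \<Sigma> \<rho> = Idl\<^bsub>cox_ring\<^esub> (cone_monomial \<rho> ` \<Sigma>)"

definition irrelevant_locus ::
  "(real ^ 'n::finite) set set \<Rightarrow> ('k::finite \<Rightarrow> (real ^ 'n) set) \<Rightarrow> (complex ^ 'k) set" where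
  "irrelevant_locus \<Sigma> \<rho> = {x. \<forall>b\<in>irrelevant_ideal \<Sigma> \<rho>. cox_eval x b = 0}"


section \<open>The toric variety and the Cox quotient map\<close>

definition dual_semigroup :: "(real ^ 'n::finite) set \<Rightarrow> (int ^ 'n) set" where
  "dual_semigroup \<sigma> = {m. \<forall>v\<in>\<sigma>. 0 \<le> real_vec m \<bullet> v}"

text \<open>Points of the affine toric variety \<open>U\<^sub>\<sigma> = Spec \<complex>[\<sigma>\<^sup>\<or> \<inter> M]\<close>, as monoid
  homomorphisms \<open>\<sigma>\<^sup>\<or> \<inter> M \<rightarrow> (\<complex>, \<cdot>)\<close>.\<close>

definition affine_points :: "(real ^ 'n::finite) set \<Rightarrow> (int ^ 'n \<Rightarrow> complex) set" where
  "affine_points \<sigma> = {\<gamma> \<in> extensional (dual_semigroup \<sigma>). \<gamma> 0 = 1 \<and>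
     (\<forall>m\<in>dual_semigroup \<sigma>. \<forall>m'\<in>dual_semigroup \<sigma>. \<gamma> (m + m') = \<gamma> m * \<gamma> m')}"

text \<open>\<open>X\<close> is obtained by gluing \<open>U\<^sub>\<sigma>\<close> and \<open>U\<^sub>\<tau>\<close> along \<open>U\<^bsub>\<sigma> \<inter> \<tau>\<^esub>\<close>.\<close>

definition gluing ::
  "(real ^ 'n::finite) set set \<Rightarrow>
     (((real ^ 'n) set \<times> (int ^ 'n \<Rightarrow> complex)) \<times> ((real ^ 'n) set \<times> (int ^ 'n \<Rightarrow> complex))) set" where
  "gluing \<Sigma> = {((\<sigma>, \<gamma>), (\<tau>, \<delta>)). \<sigma> \<in> \<Sigma> \<and> \<tau> \<in> \<Sigma> \<and>
     (\<exists>\<epsilon>\<in>affine_points (\<sigma> \<inter> \<tau>).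
        \<gamma> = restrict \<epsilon> (dual_semigroup \<sigma>) \<and> \<delta> = restrict \<epsilon> (dual_semigroup \<tau>))}"

type_synonym 'n toric_point = "((real ^ 'n) set \<times> (int ^ 'n \<Rightarrow> complex)) set"

definition toric_variety :: "(real ^ 'n::finite) set set \<Rightarrow> 'n toric_point set" where
  "toric_variety \<Sigma> = (SIGMA \<sigma>:\<Sigma>. affine_points \<sigma>) // gluing \<Sigma>"

definition chart_points ::
  "(real ^ 'n::finite) set set \<Rightarrow> (real ^ 'n) set \<Rightarrow> 'n toric_point set" where
  "chart_points \<Sigma> \<sigma> = {\<zeta> \<in> toric_variety \<Sigma>. \<exists>\<gamma>. (\<sigma>, \<gamma>) \<in> \<zeta>}"

text \<open>Where \<open>x^\<sigma>\<close> (hat) does not vanish, the Cox map pulls the character \<open>m\<close> back to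
  \<open>\<Prod>\<^sub>i x\<^sub>i\<^bsup>\<langle>m, u\<^sub>i\<rangle>\<^esup>\<close>; negative exponents occur only at nonzero \<open>x\<^sub>i\<close>, and \<open>0 powi 0 = 1\<close>.
  All \<open>\<sigma>\<close> admitted in the union give the same point of \<open>X\<close>.\<close>

definition cox_map ::
  "(real ^ 'n::finite) set set \<Rightarrow> ('k::finite \<Rightarrow> (real ^ 'n) set) \<Rightarrow> complex ^ 'k \<Rightarrow> 'n toric_point" where
  "cox_map \<Sigma> \<rho> x =
     (\<Union>\<sigma>\<in>{\<sigma>\<in>\<Sigma>. cox_eval x (cone_monomial \<rho> \<sigma>) \<noteq> 0}.
        gluing \<Sigma> `` {(\<sigma>, restrict (\<lambda>m. \<Prod>i\<in>UNIV. (x $ i) powi (character_divisor \<rho> m $ i))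
                          (dual_semigroup \<sigma>))})"

definition cox_fibre ::
  "(real ^ 'n::finite) set set \<Rightarrow> ('k::finite \<Rightarrow> (real ^ 'n) set) \<Rightarrow> 'n toric_point \<Rightarrow> (complex ^ 'k) set" where
  "cox_fibre \<Sigma> \<rho> \<zeta> = {x. x \<notin> irrelevant_locus \<Sigma> \<rho> \<and> cox_map \<Sigma> \<rho> x = \<zeta>}"

definition hypersurface ::
  "(real ^ 'n::finite) set set \<Rightarrow> ('k::finite \<Rightarrow> (real ^ 'n) set) \<Rightarrow> 'k cox \<Rightarrow> 'n toric_point set" where
  "hypersurface \<Sigma> \<rho> f = {\<zeta> \<in> toric_variety \<Sigma>. \<exists>x\<in>cox_fibre \<Sigma> \<rho> \<zeta>. cox_eval x f = 0}"


section \<open>Basepoints and nef classes\<close>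

definition basepoint ::
  "(real ^ 'n::finite) set set \<Rightarrow> ('k::finite \<Rightarrow> (real ^ 'n) set) \<Rightarrow> (int ^ 'k) set \<Rightarrow> 'n toric_point \<Rightarrow> bool" where
  "basepoint \<Sigma> \<rho> \<alpha> \<zeta> \<longleftrightarrow>
     \<zeta> \<in> toric_variety \<Sigma> \<and> (\<forall>f\<in>graded_piece \<rho> \<alpha>. \<zeta> \<in> hypersurface \<Sigma> \<rho> f)"

definition basepoint_free ::
  "(real ^ 'n::finite) set set \<Rightarrow> ('k::finite \<Rightarrow> (real ^ 'n) set) \<Rightarrow> (int ^ 'k) set \<Rightarrow> bool" where
  "basepoint_free \<Sigma> \<rho> \<alpha> \<longleftrightarrow> \<not> (\<exists>\<zeta>. basepoint \<Sigma> \<rho> \<alpha> \<zeta>)"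

text \<open>Classes of nef Cartier divisors, and of nef \<open>\<rat>\<close>-Cartier divisors.\<close>

definition nef_pic ::
  "(real ^ 'n::finite) set set \<Rightarrow> ('k::finite \<Rightarrow> (real ^ 'n) set) \<Rightarrow> (int ^ 'k) set set" where
  "nef_pic \<Sigma> \<rho> = {\<alpha> \<in> picard_group \<Sigma> \<rho>. basepoint_free \<Sigma> \<rho> \<alpha>}"

definition nef_rat_pic ::
  "(real ^ 'n::finite) set set \<Rightarrow> ('k::finite \<Rightarrow> (real ^ 'n) set) \<Rightarrow> (int ^ 'k) set set" where
  "nef_rat_pic \<Sigma> \<rho> = {\<alpha> \<in> carrier (class_group \<rho>).
     \<exists>l::nat. l > 0 \<and> \<alpha> [^]\<^bsub>class_group \<rho>\<^esub> l \<in> nef_pic \<Sigma> \<rho>}"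


section \<open>The closed subscheme of a homogeneous ideal\<close>

definition cone_powers ::
  "('k::finite \<Rightarrow> (real ^ 'n::finite) set) \<Rightarrow> (real ^ 'n) set \<Rightarrow> 'k cox set" where
  "cone_powers \<rho> \<sigma> = range (\<lambda>l::nat. cone_monomial \<rho> \<sigma> ^ l)"

text \<open>The degree-zero part of the localization of \<open>S\<close> at the powers of the monomial of \<open>\<sigma>\<close>, which is
  the coordinate ring of \<open>U\<^sub>\<sigma>\<close>.\<close>

definition chart_ring ::
  "('k::finite \<Rightarrow> (real ^ 'n::finite) set) \<Rightarrow> (real ^ 'n) set \<Rightarrow> ('k cox \<times> 'k cox) set ring" where
  "chart_ring \<rho> \<sigma> = localization cox_ring (cone_powers \<rho> \<sigma>)
     \<lparr>carrier := {fraction cox_ring (cone_powers \<rho> \<sigma>) f h | f h.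
        h \<in> cone_powers \<rho> \<sigma> \<and> (\<exists>\<alpha>. f \<in> graded_piece \<rho> \<alpha> \<and> h \<in> graded_piece \<rho> \<alpha>)}\<rparr>"

definition chart_ideal ::
  "('k::finite \<Rightarrow> (real ^ 'n::finite) set) \<Rightarrow> 'k cox set \<Rightarrow> (real ^ 'n) set \<Rightarrow> ('k cox \<times> 'k cox) set set" where
  "chart_ideal \<rho> I \<sigma> = {fraction cox_ring (cone_powers \<rho> \<sigma>) f h | f h.
     f \<in> I \<and> h \<in> cone_powers \<rho> \<sigma>} \<inter> carrier (chart_ring \<rho> \<sigma>)"

definition chart_quotient ::
  "('k::finite \<Rightarrow> (real ^ 'n::finite) set) \<Rightarrow> 'k cox set \<Rightarrow> (real ^ 'n) set \<Rightarrow> ('k cox \<times> 'k cox) set set ring" where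
  "chart_quotient \<rho> I \<sigma> = chart_ring \<rho> \<sigma> Quot chart_ideal \<rho> I \<sigma>"

definition scheme_dim ::
  "(real ^ 'n::finite) set set \<Rightarrow> ('k::finite \<Rightarrow> (real ^ 'n) set) \<Rightarrow> 'k cox set \<Rightarrow> ereal" where
  "scheme_dim \<Sigma> \<rho> I = (SUP \<sigma>\<in>\<Sigma>. krull_dim (chart_quotient \<rho> I \<sigma>))"

text \<open>The functions in the coordinate ring of \<open>U\<^sub>\<sigma>\<close> that vanish at \<open>\<zeta>\<close>.  The identification of
  degree-zero fractions \<open>f/h\<close> with functions on \<open>U\<^sub>\<sigma>\<close> is pullback along the Cox map, so \<open>f/h\<close> is
  evaluated at a point over \<open>\<zeta>\<close>; there \<open>h\<close> is nonzero when \<open>\<zeta>\<close> lies in \<open>U\<^sub>\<sigma>\<close>.\<close>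

definition point_ideal ::
  "(real ^ 'n::finite) set set \<Rightarrow> ('k::finite \<Rightarrow> (real ^ 'n) set) \<Rightarrow> (real ^ 'n) set \<Rightarrow> 'n toric_point \<Rightarrow>
     ('k cox \<times> 'k cox) set set" where
  "point_ideal \<Sigma> \<rho> \<sigma> \<zeta> = {g \<in> carrier (chart_ring \<rho> \<sigma>).
     \<exists>x\<in>cox_fibre \<Sigma> \<rho> \<zeta>. \<exists>(f, h)\<in>g. cox_eval x f = 0}"

definition reduced_variety ::
  "(real ^ 'n::finite) set set \<Rightarrow> ('k::finite \<Rightarrow> (real ^ 'n) set) \<Rightarrow> 'k cox set \<Rightarrow> 'n toric_point set" where
  "reduced_variety \<Sigma> \<rho> I = {\<zeta> \<in> toric_variety \<Sigma>. \<exists>\<sigma>\<in>\<Sigma>. \<zeta> \<in> chart_points \<Sigma> \<sigma> \<and>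
     chart_ideal \<rho> I \<sigma> \<subseteq> point_ideal \<Sigma> \<rho> \<sigma> \<zeta>}"

text \<open>The complement, in the coordinate ring of the scheme on \<open>U\<^sub>\<sigma>\<close>, of the maximal ideal of
  \<open>\<zeta>\<close>.\<close>

definition nonvanishing_at ::
  "(real ^ 'n::finite) set set \<Rightarrow> ('k::finite \<Rightarrow> (real ^ 'n) set) \<Rightarrow> 'k cox set \<Rightarrow> (real ^ 'n) set \<Rightarrow> 'n toric_point \<Rightarrow>
     ('k cox \<times> 'k cox) set set set" where
  "nonvanishing_at \<Sigma> \<rho> I \<sigma> \<zeta> = carrier (chart_quotient \<rho> I \<sigma>) -
     (\<lambda>g. chart_ideal \<rho> I \<sigma> +>\<^bsub>chart_ring \<rho> \<sigma>\<^esub> g) ` point_ideal \<Sigma> \<rho> \<sigma> \<zeta>"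

definition local_ring ::
  "(real ^ 'n::finite) set set \<Rightarrow> ('k::finite \<Rightarrow> (real ^ 'n) set) \<Rightarrow> 'k cox set \<Rightarrow> (real ^ 'n) set \<Rightarrow> 'n toric_point \<Rightarrow>
     (('k cox \<times> 'k cox) set set \<times> ('k cox \<times> 'k cox) set set) set ring" where
  "local_ring \<Sigma> \<rho> I \<sigma> \<zeta> = localization (chart_quotient \<rho> I \<sigma>) (nonvanishing_at \<Sigma> \<rho> I \<sigma> \<zeta>)"

text \<open>The image of \<open>\<complex>\<close> in the local ring.\<close>

definition local_scalars ::
  "(real ^ 'n::finite) set set \<Rightarrow> ('k::finite \<Rightarrow> (real ^ 'n) set) \<Rightarrow> 'k cox set \<Rightarrow> (real ^ 'n) set \<Rightarrow> 'n toric_point \<Rightarrow>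
     (('k cox \<times> 'k cox) set set \<times> ('k cox \<times> 'k cox) set set) set set" where
  "local_scalars \<Sigma> \<rho> I \<sigma> \<zeta> = range (\<lambda>c.
     fraction (chart_quotient \<rho> I \<sigma>) (nonvanishing_at \<Sigma> \<rho> I \<sigma> \<zeta>)
       (chart_ideal \<rho> I \<sigma> +>\<^bsub>chart_ring \<rho> \<sigma>\<^esub> fraction cox_ring (cone_powers \<rho> \<sigma>) (scalar c) 1)
       \<one>\<^bsub>chart_quotient \<rho> I \<sigma>\<^esub>)"

text \<open>The \<open>\<complex>\<close>-dimension of the local ring at \<open>\<zeta>\<close>, which is the same on all charts containing
  \<open>\<zeta>\<close>.\<close>

definition multiplicity_at ::
  "(real ^ 'n::finite) set set \<Rightarrow> ('k::finite \<Rightarrow> (real ^ 'n) set) \<Rightarrow> 'k cox set \<Rightarrow> 'n toric_point \<Rightarrow> nat" where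
  "multiplicity_at \<Sigma> \<rho> I \<zeta> =
     (let \<sigma> = (SOME \<sigma>. \<sigma> \<in> \<Sigma> \<and> \<zeta> \<in> chart_points \<Sigma> \<sigma>); L = local_ring \<Sigma> \<rho> I \<sigma> \<zeta>
      in ring.dim L (local_scalars \<Sigma> \<rho> I \<sigma> \<zeta>) (carrier L))"

text \<open>Only meaningful when the scheme has dimension zero.\<close>

definition scheme_degree ::
  "(real ^ 'n::finite) set set \<Rightarrow> ('k::finite \<Rightarrow> (real ^ 'n) set) \<Rightarrow> 'k cox set \<Rightarrow> nat" where
  "scheme_degree \<Sigma> \<rho> I = (\<Sum>\<zeta>\<in>reduced_variety \<Sigma> \<rho> I. multiplicity_at \<Sigma> \<rho> I \<zeta>)"


section \<open>Regularity\<close>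

definition basepoint_free_on ::
  "(real ^ 'n::finite) set set \<Rightarrow> ('k::finite \<Rightarrow> (real ^ 'n) set) \<Rightarrow> 'k cox set \<Rightarrow> (int ^ 'k) set \<Rightarrow> bool" where
  "basepoint_free_on \<Sigma> \<rho> I \<alpha> \<longleftrightarrow> (\<forall>\<zeta>\<in>reduced_variety \<Sigma> \<rho> I. \<not> basepoint \<Sigma> \<rho> \<alpha> \<zeta>)"

text \<open>The Hilbert function \<open>dim\<^sub>\<complex> (S/I)\<^sub>\<alpha>\<close>.\<close>

definition hilbert_function ::
  "('k::finite \<Rightarrow> (real ^ 'n::finite) set) \<Rightarrow> 'k cox set \<Rightarrow> (int ^ 'k) set \<Rightarrow> nat" where
  "hilbert_function \<rho> I \<alpha> =
     ring.dim (cox_ring Quot I)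
       (range (\<lambda>c. I +>\<^bsub>cox_ring\<^esub> scalar c))
       ((\<lambda>f. I +>\<^bsub>cox_ring\<^esub> f) ` graded_piece \<rho> \<alpha>)"

definition regularity ::
  "(real ^ 'n::finite) set set \<Rightarrow> ('k::finite \<Rightarrow> (real ^ 'n) set) \<Rightarrow> 'k cox set \<Rightarrow> (int ^ 'k) set set" where
  "regularity \<Sigma> \<rho> I = {\<alpha> \<in> carrier (class_group \<rho>).
     hilbert_function \<rho> I \<alpha> = scheme_degree \<Sigma> \<rho> I \<and>
     I \<inter> graded_piece \<rho> \<alpha> =
       saturation cox_ring I (irrelevant_ideal \<Sigma> \<rho>) \<inter> graded_piece \<rho> \<alpha> \<and>
     basepoint_free_on \<Sigma> \<rho> I \<alpha>}"

definition regularity_pair ::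
  "(real ^ 'n::finite) set set \<Rightarrow> ('k::finite \<Rightarrow> (real ^ 'n) set) \<Rightarrow> 'k cox set \<Rightarrow>
     (int ^ 'k) set \<Rightarrow> (int ^ 'k) set \<Rightarrow> bool" where
  "regularity_pair \<Sigma> \<rho> I \<alpha> \<alpha>\<^sub>0 \<longleftrightarrow>
     \<alpha> \<in> carrier (class_group \<rho>) \<and> \<alpha>\<^sub>0 \<in> carrier (class_group \<rho>) \<and>
     \<alpha> \<in> regularity \<Sigma> \<rho> I \<and> \<alpha> \<otimes>\<^bsub>class_group \<rho>\<^esub> \<alpha>\<^sub>0 \<in> regularity \<Sigma> \<rho> I \<and>
     basepoint_free_on \<Sigma> \<rho> I \<alpha>\<^sub>0"

end

theory Submission
 imports Defs "HOL-Computational_Algebra.Fundamental_Theorem_Algebra"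
begin

text \<open>On the chart of a maximal cone the dehomogenised generators form a system of parameters of the
 affine semigroup ring of the dual cone. This ring, and the modules of Laurent polynomials attached to
 twists by nef rational divisors, are Cohen-Macaulay, so the Koszul complex of the generators is exact on
 every chart. For a nef twist the Cech complex is exact in each character degree: the cones on which a
 character is regular are those avoiding a convex set. Chasing the Cech-Koszul double complex in
 degree \<open>\<beta> = \<Sum>\<alpha>\<^sub>i + \<alpha>\<^sub>0\<close> yields two facts: a form of degree \<open>\<beta>\<close> lying in the ideal on every chart lies in \<open>I\<close>,
 and compatible local sections modulo \<open>I\<close> lift to a global form. Dividing by a section of degree \<open>\<beta>\<close> without zeros
 on the finitely many points of the scheme identifies \<open>(S/I)\<^sub>\<beta>\<close> with the product of their local rings,
 which gives the Hilbert function value, and the local-global principle gives saturation in degree \<open>\<beta>\<close>.\<close>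

section \<open>Koszul complexes\<close>

text \<open>The degree is chosen so that every column is acyclic: in degree \<beta> the Koszul term
  of an index set J is twisted by \<alpha>_0 plus the sum of the \<alpha>_j with j outside J, and
  all these twists are nef. Two obstacles shape the rest. X may be far from simplicial and
  \<alpha>_0 is only Q-Cartier, so the local modules are spanned by the lattice points of a cone
  with rational apex and need not be free; their exactness comes from sweeping the apex along an
  interior direction and removing one facet slice at a time, down to modules over group algebras of
  lattices, where regular sequences are explicit. And \<beta> need not be a line bundle: it is
  trivial near the points of the scheme because it has, at each of them, a section that is nonzero
  on the whole fibre of the Cox map. Modules, ideals and stalks are all subsets of one Laurent
  polynomial ring; the rings of the statement are compared with them at the end. Dimension zero
  enters as algebraicity of every function on a chart modulo the ideal, which rests on the
  uncountability of the complex numbers.\<close>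

definition ksign :: "nat => nat set => 'r::comm_ring_1" where "ksign j J = (- 1) ^ card {i \<in> J. i < j}"

text \<open>The Koszul boundary from degree p + 1 to degree p. A chain is its table of coefficients
  on subsets of {1..n}, with the signs of the exterior algebra; \<open>khom\<close> is the opposite
  operator, exterior multiplication by the vector \<open>a\<close>.\<close>

definition kd :: "nat => (nat => 'r::comm_ring_1) => (nat set => 'r) => nat set => 'r" where
 "kd n g z J = (\<Sum>j\<in>{1..n} - J. ksign j J * g j * z (insert j J))"

definition khom :: "(nat => 'r::comm_ring_1) => (nat set => 'r) => nat set => 'r" where
 "khom a z J = (\<Sum>j\<in>J. ksign j J * a j * z (J - {j}))"

definition kchain :: "nat => nat => 'r::zero set => (nat set => 'r) set" where
 "kchain n p T = {z. (\<forall>J. z J \<in> T) \<and> (\<forall>J. z J \<noteq> 0 --> J \<subseteq> {1..n} \<and> card J = p)}"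

lemma ksign_insert:
 assumes "finite J" "k \<notin> J"
 shows "ksign j (insert k J) = (if k < j then - ksign j J else ksign j J)"
proof -
 have "{i \<in> insert k J. i < j} = (if k < j then insert k {i \<in> J. i < j} else {i \<in> J. i < j})" by auto
 thus ?thesis using assms by (simp add: ksign_def)
qed

lemma ksign_self: "ksign j (insert j J) = ksign j J" "ksign j (J - {j}) = ksign j J"
proof -
 have "{i \<in> insert j J. i < j} = {i \<in> J. i < j}" "{i \<in> J - {j}. i < j} = {i \<in> J. i < j}" by auto
 thus "ksign j (insert j J) = ksign j J" "ksign j (J - {j}) = ksign j J" by (simp_all add: ksign_def)
qed

lemma ksign_square: "ksign j J * ksign j J = 1" by (simp add: ksign_def minus_one_mult_self)

text \<open>Splitting the inner sum at j pairs each term with its negative. Equating the double sum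
  with its own negative would not suffice, since the group may have 2-torsion.\<close>

lemma sum_antisymmetric:
 fixes F :: "nat => nat => 'r::ab_group_add"
 assumes "finite B" and "\<And>j k. j \<in> B ==> k \<in> B ==> j \<noteq> k ==> F j k = - F k j"
 shows "(\<Sum>j\<in>B. \<Sum>k\<in>B - {j}. F j k) = 0"
proof -
 have "(\<Sum>k\<in>B - {j}. F j k) = (\<Sum>k\<in>{k\<in>B. k < j}. F j k) + (\<Sum>k\<in>{k\<in>B. j < k}. F j k)" if "j \<in> B" for j
 proof -
  have *: "B - {j} = {k\<in>B. k < j} \<union> {k\<in>B. j < k}" by auto
  show ?thesis unfolding * by (rule sum.union_disjoint) (use assms(1) in auto)
 qed
 hence "(\<Sum>j\<in>B. \<Sum>k\<in>B - {j}. F j k)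
   = (\<Sum>j\<in>B. \<Sum>k\<in>{k\<in>B. k < j}. F j k) + (\<Sum>j\<in>B. \<Sum>k\<in>{k\<in>B. j < k}. F j k)" by (simp add: sum.distrib)
 also have "(\<Sum>j\<in>B. \<Sum>k\<in>{k\<in>B. j < k}. F j k) = (\<Sum>k\<in>B. \<Sum>j\<in>{j\<in>B. j < k}. F j k)"
  by (rule sum.swap_restrict) (use assms(1) in auto)
 also have "\<dots> = (\<Sum>j\<in>B. \<Sum>k\<in>{k\<in>B. k < j}. - F j k)" by (intro sum.cong refl assms(2)) auto
 finally show ?thesis by (simp add: sum_negf)
qed

lemma kd_kd:
 assumes "J \<subseteq> {1..n}"
 shows "kd n g (kd n g z) J = 0"
proof -
 have fJ: "finite J" using assms finite_subset by blast
 define F where "F j k = ksign j J * g j * (ksign k (insert j J) * g k * z (insert k (insert j J)))" for j k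
 have "kd n g (kd n g z) J = (\<Sum>j\<in>{1..n} - J. \<Sum>k\<in>{1..n} - J - {j}. F j k)" unfolding kd_def F_def sum_distrib_left
  by (intro sum.cong refl) auto
 also have "\<dots> = 0"
 proof (rule sum_antisymmetric)
  fix j k assume "j \<in> {1..n} - J" "k \<in> {1..n} - J" "j \<noteq> k"
  thus "F j k = - F k j" using fJ by (auto simp: F_def ksign_insert insert_commute algebra_simps)
 qed simp
 finally show ?thesis .
qed

lemma kd_diff: "kd n g (\<lambda>J. y J - z J) J = kd n g y J - kd n g z J" by (simp add: kd_def algebra_simps sum_subtractf)

lemma kd_mult: "kd n g (\<lambda>J. r * z J) J = r * kd n g z J" by (simp add: kd_def sum_distrib_left mult_ac)

lemma kd_zero: "kd n g (\<lambda>J. 0) J = 0" by (simp add: kd_def)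

text \<open>The diagonal terms cover the indices outside J in the one summand and those inside J in
  the other. Each mixed term occurs twice with opposite signs, because exactly one of the two signs
  changes when j and k are exchanged.\<close>

lemma khom_homotopy:
 assumes "J \<subseteq> {1..n}"
 shows "kd n g (khom a z) J + khom a (kd n g z) J = (\<Sum>j\<in>{1..n}. a j * g j) * z J"
proof -
 have fJ: "finite J" using assms finite_subset by blast
 define G where "G j k = ksign j J * ksign k (insert j J) * g j * a k * z (insert j (J - {k}))" for j k
 have 1: "kd n g (khom a z) J
   = (\<Sum>j\<in>{1..n} - J. a j * g j * z J) + (\<Sum>j\<in>{1..n} - J. \<Sum>k\<in>J. G j k)"
 proof -
  have "ksign j J * g j * khom a z (insert j J) = a j * g j * z J + (\<Sum>k\<in>J. G j k)" if j: "j \<in> {1..n} - J" for j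
  proof -
   have "khom a z (insert j J) = ksign j J * a j * z J
     + (\<Sum>k\<in>J. ksign k (insert j J) * a k * z (insert j J - {k}))" using j fJ by (simp add: khom_def ksign_self)
   moreover have "insert j J - {k} = insert j (J - {k})" if "k \<in> J" for k using that j by auto
   moreover have "ksign j J * g j * (ksign j J * a j * z J) = (ksign j J * ksign j J) * (a j * g j * z J)"
    by (simp only: mult_ac)
   ultimately show ?thesis by (simp add: distrib_left sum_distrib_left G_def ksign_square mult_ac cong: sum.cong)
  qed
  thus ?thesis unfolding kd_def by (simp add: sum.distrib)
 qed
 have 2: "khom a (kd n g z) J
   = (\<Sum>j\<in>J. a j * g j * z J) + (\<Sum>k\<in>J. \<Sum>j\<in>{1..n} - J. - G j k)"
 proof -
  have "ksign k J * a k * kd n g z (J - {k}) = a k * g k * z J + (\<Sum>j\<in>{1..n} - J. - G j k)" if k: "k \<in> J" for k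
  proof -
   have e: "{1..n} - (J - {k}) = insert k ({1..n} - J)" using k assms by auto
   have "kd n g z (J - {k}) = ksign k J * g k * z J
     + (\<Sum>j\<in>{1..n} - J. ksign j (J - {k}) * g j * z (insert j (J - {k})))"
    unfolding kd_def e using k by (simp add: ksign_self insert_absorb)
   moreover have "ksign k J * a k * (ksign j (J - {k}) * g j * z (insert j (J - {k}))) = - G j k"
    if j: "j \<in> {1..n} - J" for j
   proof -
    have "(ksign j J :: 'a) = (if k < j then - ksign j (J - {k}) else ksign j (J - {k}))"
     using ksign_insert[of "J - {k}" k j] fJ k by (simp add: insert_absorb)
    moreover have "(ksign k (insert j J) :: 'a) = (if j < k then - ksign k J else ksign k J)"
     using ksign_insert[of J j k] fJ j by simp
    moreover have "j \<noteq> k" using j k by auto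
    ultimately have "ksign k J * ksign j (J - {k}) = - (ksign j J * ksign k (insert j J) :: 'a)"
     by (cases "j < k") (auto simp: not_less_iff_gr_or_eq mult_ac)
    thus ?thesis unfolding G_def by (metis (no_types) mult.assoc mult.left_commute mult_minus_left)
   qed
   moreover have "ksign k J * a k * (ksign k J * g k * z J) = (ksign k J * ksign k J) * (a k * g k * z J)"
    by (simp only: mult_ac)
   ultimately show ?thesis by (simp add: distrib_left sum_distrib_left ksign_square)
  qed
  thus ?thesis unfolding khom_def by (simp add: sum.distrib)
 qed
 have "(\<Sum>j\<in>J. \<Sum>k\<in>{1..n} - J. - G k j) = - (\<Sum>j\<in>{1..n} - J. \<Sum>k\<in>J. G j k)" by (subst sum.swap) (simp add: sum_negf)
 moreover have "(\<Sum>j\<in>{1..n}. a j * g j) * z J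
   = (\<Sum>j\<in>{1..n} - J. a j * g j * z J) + (\<Sum>j\<in>J. a j * g j * z J)"
  unfolding sum_distrib_right by (rule sum.subset_diff[OF assms]) simp
 ultimately show ?thesis unfolding 1 2 by simp
qed

text \<open>\<open>R\<close> is merely a set of multipliers inside the ambient ring. With
  \<open>R = {0}\<close> this is an additive subgroup, with \<open>R = UNIV\<close> an ideal, so one
  notion serves modules, ideals and kernels.\<close>

definition submod :: "'r::comm_ring_1 set => 'r set => bool" where
 "submod R T \<longleftrightarrow> 0 \<in> T \<and> (\<forall>x\<in>T. \<forall>y\<in>T. x - y \<in> T) \<and> (\<forall>r\<in>R. \<forall>x\<in>T. r * x \<in> T)"

lemma submod_zero: "submod R T ==> 0 \<in> T"
 and submod_diff: "submod R T ==> x \<in> T ==> y \<in> T ==> x - y \<in> T"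
 and submod_mult: "submod R T ==> r \<in> R ==> x \<in> T ==> r * x \<in> T" by (auto simp: submod_def)

lemma submod_minus: "submod R T ==> x \<in> T ==> - x \<in> T" using submod_diff[of R T 0 x] submod_zero by fastforce

lemma submod_add: "submod R T ==> x \<in> T ==> y \<in> T ==> x + y \<in> T" using submod_diff[of R T x "- y"] submod_minus by fastforce

lemma submod_sum: "submod R T ==> (\<And>i. i \<in> A ==> f i \<in> T) ==> sum f A \<in> T"
 by (induction A rule: infinite_finite_induct) (auto intro: submod_zero submod_add)

lemma submod_ksign: "submod R T ==> x \<in> T ==> ksign j J * x \<in> T"
 unfolding ksign_def by (cases "even (card {i \<in> J. i < j})") (auto intro: submod_minus)

lemma submod_kd:
 assumes "submod R T" "\<And>j. j \<in> {1..n} ==> g j \<in> R" "\<And>J. z J \<in> T"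
 shows "kd n g z J \<in> T" unfolding kd_def mult.assoc
 by (intro submod_sum[OF assms(1)] submod_ksign[OF assms(1)] submod_mult[OF assms(1)]) (use assms in auto)

lemma submod_khom:
 assumes "submod R T" "\<And>j. j \<in> J ==> a j \<in> R" "\<And>J. J \<subseteq> {1..n} ==> z J \<in> T" "J \<subseteq> {1..n}"
 shows "khom a z J \<in> T"
proof -
 have "z (J - {i}) \<in> T" for i using assms(3)[of "J - {i}"] assms(4) by blast
 thus ?thesis unfolding khom_def mult.assoc
  by (intro submod_sum[OF assms(1)] submod_ksign[OF assms(1)] submod_mult[OF assms(1)]) (use assms in auto)
qed

lemma kd_kchain:
 assumes "submod R T" "\<And>j. j \<in> {1..n} ==> g j \<in> R" "z \<in> kchain n (Suc p) T"
 shows "(\<lambda>J. if J \<subseteq> {1..n} then kd n g z J else 0) \<in> kchain n p T"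
proof -
 have "card J = p" if "kd n g z J \<noteq> 0" "J \<subseteq> {1..n}" for J
 proof -
  from that obtain j where "j \<in> {1..n} - J" "z (insert j J) \<noteq> 0"
   unfolding kd_def by (metis (no_types, lifting) mult_zero_right sum.neutral)
  moreover have "finite J" using that finite_subset by blast
  ultimately show ?thesis using assms(3) by (auto simp: kchain_def)
 qed
 thus ?thesis using submod_kd[OF assms(1,2), where z = z] submod_zero[OF assms(1)] assms(3)
  by (auto simp: kchain_def split: if_splits)
qed

lemma kd_cong:
 assumes "\<And>K. K \<subseteq> {1..n} ==> y K = z K" "J \<subseteq> {1..n}"
 shows "kd n g y J = kd n g z J" unfolding kd_def by (intro sum.cong refl) (use assms in auto)

text \<open>The submodule h_1 T + ... + h_i T. The recursive form makes regularity of a sequence a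
  statement about consecutive stages; the numbering of h starts at 1.\<close>

primrec seq_span :: "'r::comm_ring_1 set => (nat => 'r) => nat => 'r set" where "seq_span T h 0 = {0}"
| "seq_span T h (Suc i) = {b + h (Suc i) * t | b t. b \<in> seq_span T h i \<and> t \<in> T}"

lemma submod_seq_span: "submod R T ==> submod R (seq_span T h i)"
proof (induction i)
 case (Suc i)
 note S = Suc.IH[OF Suc.prems] note T = Suc.prems
 have "0 + h (Suc i) * 0 \<in> seq_span T h (Suc i)"
  using submod_zero[OF S] submod_zero[OF T] unfolding seq_span.simps by blast
 moreover have "x - y \<in> seq_span T h (Suc i)" if xy: "x \<in> seq_span T h (Suc i)" "y \<in> seq_span T h (Suc i)" for x y
 proof -
  obtain b t b' t' where "x = b + h (Suc i) * t" "y = b' + h (Suc i) * t'"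
   "b \<in> seq_span T h i" "b' \<in> seq_span T h i" "t \<in> T" "t' \<in> T" using xy by auto
  moreover from this have "x - y = (b - b') + h (Suc i) * (t - t')" by (simp add: algebra_simps)
  ultimately show ?thesis using submod_diff[OF S] submod_diff[OF T] unfolding seq_span.simps by blast
 qed
 moreover have "r * x \<in> seq_span T h (Suc i)" if rx: "r \<in> R" "x \<in> seq_span T h (Suc i)" for r x
 proof -
  obtain b t where "x = b + h (Suc i) * t" "b \<in> seq_span T h i" "t \<in> T" using rx by auto
  moreover from this have "r * x = r * b + h (Suc i) * (r * t)" by (simp add: algebra_simps)
  ultimately show ?thesis using submod_mult[OF S] submod_mult[OF T] rx unfolding seq_span.simps by blast
 qed
 ultimately show ?case unfolding submod_def by auto
qed (simp add: submod_def)

text \<open>Depth sensitivity: an element \<open>h\<close> of the ideal \<open>(g)\<close> acts as zero on Koszul homology, so passing to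
 \<open>T / hT\<close> for a nonzerodivisor \<open>h\<close> shifts the vanishing range by one.\<close>

lemma koszul_exact_aux:
 assumes T: "submod R T" and gR: "\<And>j. j \<in> {1..n} ==> g j \<in> R"
  and aR: "\<And>i j. i \<in> {1..c} ==> j \<in> {1..n} ==> a i j \<in> R"
  and h: "\<And>i. i \<in> {1..c} ==> h i = (\<Sum>j\<in>{1..n}. a i j * g j)"
  and reg: "\<And>i x. i < c ==> x \<in> T ==> h (Suc i) * x \<in> seq_span T h i ==> x \<in> seq_span T h i"
 shows "i \<le> c ==> n + i < p + c ==> z \<in> kchain n p T ==> (\<And>J. J \<subseteq> {1..n} ==> kd n g z J \<in> seq_span T h i) ==>
   \<exists>y\<in>kchain n (Suc p) T. \<forall>J. J \<subseteq> {1..n} --> z J - kd n g y J \<in> seq_span T h i"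
proof (induction "c - i" arbitrary: i p z)
 case 0
 \<comment> \<open>At i = c the numerical hypothesis reads n < p, and {1..n} has no subset of that
   size.\<close>
 have "z J = 0" for J
 proof (rule ccontr)
  assume "z J \<noteq> 0"
  hence "J \<subseteq> {1..n}" "card J = p" using 0 by (auto simp: kchain_def)
  thus False using card_mono[of "{1..n}" J] 0 by auto
 qed
 moreover have "(\<lambda>J. 0) \<in> kchain n (Suc p) T" using submod_zero[OF T] by (simp add: kchain_def)
 ultimately show ?case by (intro bexI[of _ "\<lambda>J. 0"]) (auto simp: kd_zero intro: submod_zero[OF submod_seq_span[OF T]])
next
 case (Suc d)
 define A where "A = {1..n}"
 define H where "H = h (Suc i)"
 define B where "B = seq_span T h i"
 have B: "submod R B" unfolding B_def by (rule submod_seq_span[OF T])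
 have i: "Suc i \<in> {1..c}" using Suc by auto
 have zT: "z J \<in> T" for J using Suc.prems by (simp add: kchain_def)
 \<comment> \<open>Exterior multiplication by the coefficients of h_{i+1}. By the homotopy formula
   the boundary of w is H z up to an element of B, hence zero modulo the next stage, where the
   induction hypothesis applies in degree p + 1.\<close>
 define w where "w J = (if J \<subseteq> A then khom (a (Suc i)) z J else 0)" for J
 have w: "w \<in> kchain n (Suc p) T"
 proof -
  have "card J = Suc p" if "khom (a (Suc i)) z J \<noteq> 0" "J \<subseteq> A" for J
  proof -
   have fJ: "finite J" using that finite_subset unfolding A_def by blast
   obtain j where "j \<in> J" "z (J - {j}) \<noteq> 0"
    using \<open>khom (a (Suc i)) z J \<noteq> 0\<close> unfolding khom_def by (metis (no_types, lifting) mult_zero_right sum.neutral)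
   thus ?thesis using Suc.prems fJ card_Suc_Diff1[of J j] by (auto simp: kchain_def)
  qed
  moreover have "khom (a (Suc i)) z J \<in> T" if "J \<subseteq> A" for J
   by (rule submod_khom[OF T]) (use aR i zT that in \<open>auto simp: A_def\<close>)
  ultimately show ?thesis using submod_zero[OF T] by (auto simp: kchain_def w_def A_def split: if_splits)
 qed
 have dw: "kd n g w J = H * z J - khom (a (Suc i)) (kd n g z) J" if "J \<subseteq> A" for J
 proof -
  have "kd n g w J = kd n g (khom (a (Suc i)) z) J" by (rule kd_cong) (use that in \<open>auto simp: w_def A_def\<close>)
  also have "\<dots> = H * z J - khom (a (Suc i)) (kd n g z) J"
   using khom_homotopy[of J n g "a (Suc i)" z] that h[OF i] by (simp add: A_def H_def algebra_simps)
  finally show ?thesis .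
 qed
 have kB: "khom (a (Suc i)) (kd n g z) J \<in> B" if "J \<subseteq> A" for J
  by (rule submod_khom[OF B, where n = n]) (use aR i Suc.prems that in \<open>auto simp: A_def B_def\<close>)
 have dwB: "kd n g w J \<in> seq_span T h (Suc i)" if "J \<subseteq> A" for J
 proof -
  have "kd n g w J = - khom (a (Suc i)) (kd n g z) J + h (Suc i) * z J" using dw[OF that] by (simp add: H_def)
  thus ?thesis using submod_minus[OF B kB[OF that]] zT unfolding B_def seq_span.simps by blast
 qed
 have "\<exists>v\<in>kchain n (Suc (Suc p)) T. \<forall>J. J \<subseteq> {1..n} --> w J - kd n g v J \<in> seq_span T h (Suc i)"
  by (rule Suc.hyps(1)) (use Suc.hyps(2) Suc.prems(2) i w dwB in \<open>auto simp: A_def\<close>)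
 then obtain v where v: "v \<in> kchain n (Suc (Suc p)) T"
  and wv: "\<And>J. J \<subseteq> A ==> \<exists>b t. w J - kd n g v J = b + H * t \<and> b \<in> B \<and> t \<in> T" by (auto simp: A_def B_def H_def)
 have kdv: "kd n g v J = 0" if "J \<subseteq> A" "card J \<noteq> Suc p" for J
  using kd_kchain[OF T, of n g v "Suc p"] gR v that by (auto simp: kchain_def A_def split: if_splits)
 \<comment> \<open>In sizes other than p + 1 both w and the boundary of v vanish, so the multiplier
   of H may be taken to be 0 there; this makes u a chain of degree p + 1.\<close>
 have "\<exists>t. t \<in> T \<and> (t \<noteq> 0 --> J \<subseteq> A \<and> card J = Suc p) \<and> (J \<subseteq> A --> w J - kd n g v J - H * t \<in> B)" for J
 proof (cases "J \<subseteq> A \<and> card J = Suc p")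
  case True
  then obtain b t where "w J - kd n g v J = b + H * t" "b \<in> B" "t \<in> T" using wv by blast
  thus ?thesis using True by (intro exI[of _ t]) auto
 next
  case False
  have "w J = 0" "J \<subseteq> A ==> kd n g v J = 0" using w False kdv by (auto simp: kchain_def A_def)
  thus ?thesis using submod_zero[OF T] submod_zero[OF B] by (intro exI[of _ 0]) auto
 qed
 then obtain u where u: "\<And>J. u J \<in> T" "\<And>J. u J \<noteq> 0 ==> J \<subseteq> A \<and> card J = Suc p"
  "\<And>J. J \<subseteq> A ==> w J - kd n g v J - H * u J \<in> B" by metis
 have "u \<in> kchain n (Suc p) T" using u by (auto simp: kchain_def A_def)
 moreover have "z J - kd n g u J \<in> B" if J: "J \<subseteq> A" for J
 proof -
  \<comment> \<open>The chain w - dv - H u has coefficients in B. Its boundary is H (z - du) up to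
    an element of B, and regularity cancels H.\<close>
  define b where "b K = (if K \<subseteq> A then w K - kd n g v K - H * u K else 0)" for K
  have "kd n g b J \<in> B" by (rule submod_kd[OF B gR]) (auto simp: b_def u submod_zero[OF B])
  moreover have "kd n g b J = kd n g (\<lambda>K. w K - kd n g v K - H * u K) J"
   by (rule kd_cong) (use J in \<open>auto simp: b_def A_def\<close>)
  hence "kd n g b J = kd n g w J - H * kd n g u J" using kd_kd[of J n g v] J by (simp add: kd_diff kd_mult A_def)
  hence "kd n g b J = H * (z J - kd n g u J) - khom (a (Suc i)) (kd n g z) J"
   using dw[OF J] by (simp add: algebra_simps)
  ultimately have "H * (z J - kd n g u J) \<in> B" using submod_add[OF B _ kB[OF J], of "kd n g b J"] by simp
  moreover have "z J - kd n g u J \<in> T" by (intro submod_diff[OF T] zT submod_kd[OF T gR]) (auto simp: u)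
  ultimately show ?thesis using reg[of i] i by (simp add: B_def H_def)
 qed
 ultimately show ?case by (auto simp: A_def B_def)
qed

lemma koszul_exact:
 assumes T: "submod R T" and gR: "\<And>j. j \<in> {1..n} ==> g j \<in> R"
  and aR: "\<And>i j. i \<in> {1..c} ==> j \<in> {1..n} ==> a i j \<in> R"
  and h: "\<And>i. i \<in> {1..c} ==> h i = (\<Sum>j\<in>{1..n}. a i j * g j)"
  and reg: "\<And>i x. i < c ==> x \<in> T ==> h (Suc i) * x \<in> seq_span T h i ==> x \<in> seq_span T h i"
  and "n < p + c" "z \<in> kchain n p T" "\<And>J. J \<subseteq> {1..n} ==> kd n g z J = 0"
 obtains y where "y \<in> kchain n (Suc p) T" "\<And>J. J \<subseteq> {1..n} ==> kd n g y J = z J"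
 using koszul_exact_aux[of R T n g c a h 0 p z, OF T gR aR h reg] assms(6-8) that by fastforce

section \<open>Monomial submodules of Laurent rings\<close>

definition restr :: "'g set => ('g \<Rightarrow>\<^sub>0 complex) => ('g \<Rightarrow>\<^sub>0 complex)" where
 "restr S x = Poly_Mapping.Abs_poly_mapping (\<lambda>m. if m \<in> S then Poly_Mapping.lookup x m else 0)"

definition spn :: "'g set => ('g \<Rightarrow>\<^sub>0 complex) set" where "spn S = {x. Poly_Mapping.keys x \<subseteq> S}"

type_synonym 'n laurent = "int ^ 'n \<Rightarrow>\<^sub>0 complex"

abbreviation "sgl \<equiv> Poly_Mapping.single"
abbreviation "lkp \<equiv> Poly_Mapping.lookup"
abbreviation "keys \<equiv> Poly_Mapping.keys"

lemma lookup_restr: "lkp (restr S x) m = (if m \<in> S then lkp x m else 0)" unfolding restr_def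
 by (subst lookup_Abs_poly_mapping) (auto intro: finite_subset[OF _ finite_lookup[of x]])

lemma keys_restr: "keys (restr S x) = keys x \<inter> S" by (auto simp: in_keys_iff lookup_restr split: if_splits)

lemma restr_zero [simp]: "restr S 0 = 0"
 and restr_add: "restr S (x + y) = restr S x + restr S y"
 and restr_diff: "restr S (x - y) = restr S x - restr S y"
 and restr_restr: "restr S (restr S' x) = restr (S \<inter> S') x"
 by (auto intro!: poly_mapping_eqI simp: lookup_restr lookup_add lookup_minus)

lemma restr_sum: "restr S (sum f A) = (\<Sum>i\<in>A. restr S (f i))"
 by (induction A rule: infinite_finite_induct) (auto simp: restr_add)

lemma restr_eq_0: "keys x \<inter> S = {} ==> restr S x = 0"
 using keys_restr keys_eq_empty by (metis keys_zero poly_mapping_eqI lookup_restr lookup_zero disjoint_iff in_keys_iff)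

lemma restr_id: "x \<in> spn S ==> restr S x = x" by (auto intro!: poly_mapping_eqI simp: lookup_restr spn_def in_keys_iff)

lemma restr_spn: "restr S x \<in> spn S" by (simp add: spn_def keys_restr)

lemma spn_zero [simp]: "0 \<in> spn S" by (simp add: spn_def)

lemma spn_diff: "x \<in> spn S ==> y \<in> spn S ==> x - y \<in> spn S" unfolding spn_def using keys_diff[of x y] by auto

lemma spn_add: "x \<in> spn S ==> y \<in> spn S ==> x + y \<in> spn S" unfolding spn_def using keys_add[of x y] by auto

lemma spn_sum: "(\<And>i. i \<in> A ==> f i \<in> spn S) ==> sum f A \<in> spn S"
 by (induction A rule: infinite_finite_induct) (auto intro: spn_add)

lemma spn_mono: "x \<in> spn S ==> S \<subseteq> S' ==> x \<in> spn S'" unfolding spn_def by auto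

lemma spn_mult: "x \<in> spn S ==> y \<in> spn S' ==> (\<And>a b. a \<in> S ==> b \<in> S' ==> a + b \<in> S'') ==> x * y \<in> spn S''"
 unfolding spn_def using keys_mult[of x y] by blast

lemma spn_single [simp]: "sgl m c \<in> spn S \<longleftrightarrow> c = 0 \<or> m \<in> S" by (auto simp: spn_def)

lemma submod_spn:
 assumes "\<And>a b. a \<in> D ==> b \<in> S ==> a + b \<in> S"
 shows "submod (spn D) (spn S)" unfolding submod_def using spn_diff spn_mult[of _ D _ S S] assms by auto

lemma lookup_single_mult:
 fixes x :: "'g::ab_group_add \<Rightarrow>\<^sub>0 complex"
 shows "lkp (sgl a c * x) m = c * lkp x (m - a)"
proof -
 have "lkp (sgl a c * x) m = c * Sum_any (\<lambda>q. lkp x q when m = a + q)"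
  by (simp add: lookup_mult lookup_single when_mult)
 also have "(\<lambda>q. lkp x q when m = a + q) = (\<lambda>q. lkp x q when q = m - a)"
  by (intro ext) (auto simp: when_def algebra_simps)
 finally show ?thesis by simp
qed

lemma restr_mult_0:
 assumes "\<And>a b. a \<in> keys x ==> b \<in> keys y ==> a + b \<notin> S"
 shows "restr S (x * y) = 0" using keys_mult[of x y] assms by (intro restr_eq_0) auto

lemma diff_restr_keys: "keys (x - restr S x) = keys x - S"
 by (auto simp: in_keys_iff lookup_minus lookup_restr split: if_splits)

lemma restr_mult:
 assumes "\<And>a b. a \<in> keys x ==> b \<in> keys y ==> a + b \<in> S'' \<longleftrightarrow> a \<in> S"
 shows "restr S'' (x * y) = restr S x * y"
proof -
 have "x * y = restr S x * y + (x - restr S x) * y" by (simp add: algebra_simps)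
 moreover have "restr S'' ((x - restr S x) * y) = 0" by (rule restr_mult_0) (use assms in \<open>auto simp: diff_restr_keys\<close>)
 moreover have "restr S x * y \<in> spn S''" using keys_mult[of "restr S x" y] assms by (auto simp: spn_def keys_restr)
 ultimately show ?thesis by (simp add: restr_add restr_id)
qed

lemma kd_spn:
 assumes "\<And>j. j \<in> {1..n} ==> g j \<in> spn D" "\<And>J. z J \<in> spn S"
  and "\<And>a b. a \<in> D ==> b \<in> S ==> a + b \<in> S'"
 shows "kd n g z J \<in> spn S'"
proof -
 have "ksign j J * x \<in> spn S'" if "x \<in> spn S'" for j J x by (rule submod_ksign[OF submod_spn[of "{}"] that]) simp
 moreover have "g j * z J \<in> spn S'" if "j \<in> {1..n}" for j J using spn_mult[OF assms(1,2)] that assms(3) by blast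
 ultimately show ?thesis unfolding kd_def mult.assoc by (intro spn_sum) auto
qed

text \<open>Monomials outside S stay outside S'' after multiplication by D, so the truncated
  boundary only sees the truncated chain. This allows a chain to be replaced by its part on a
  slice.\<close>

lemma restr_kd_cong:
 assumes "\<And>J. restr S (y J) = restr S (z J)"
  and "\<And>j. j \<in> {1..n} ==> g j \<in> spn D" "\<And>J. y J \<in> spn S'" "\<And>J. z J \<in> spn S'"
  and "\<And>a b. a \<in> D ==> b \<in> S' ==> b \<notin> S ==> a + b \<notin> S''"
 shows "restr S'' (kd n g y J) = restr S'' (kd n g z J)"
proof -
 have "y J - z J \<in> spn (S' - S)" for J
 proof -
  have "lkp (y J) m = lkp (z J) m" if "m \<in> S" for m
   using arg_cong[OF assms(1)[of J], of "\<lambda>x. lkp x m"] that by (simp add: lookup_restr)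
  thus ?thesis using spn_diff[OF assms(3,4), of J J] by (auto simp: spn_def in_keys_iff lookup_minus)
 qed
 hence "kd n g (\<lambda>J. y J - z J) J \<in> spn (- S'')" by (intro kd_spn[OF assms(2)]) (use assms(5) in auto)
 hence "restr S'' (kd n g (\<lambda>J. y J - z J) J) = 0" by (intro restr_eq_0) (auto simp: spn_def)
 thus ?thesis by (simp add: kd_diff restr_diff)
qed

text \<open>Exactness at \<open>p\<close> of the Koszul complex with coefficients in the module spanned by the monomials in
 \<open>S\<close>, where a product leaving \<open>S\<close> counts as zero.\<close>

definition koszul_acyclic :: "nat => (nat => ('g::comm_monoid_add \<Rightarrow>\<^sub>0 complex)) => 'g set => nat => bool" where
 "koszul_acyclic n g S p \<longleftrightarrow> (\<forall>z\<in>kchain n p (spn S). (\<forall>J\<subseteq>{1..n}. restr S (kd n g z J) = 0) -->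
   (\<exists>y\<in>kchain n (Suc p) (spn S). \<forall>J\<subseteq>{1..n}. restr S (kd n g y J) = z J))"

text \<open>A Laurent polynomial with a unique leading monomial for the grading \<open>l\<close> is a nonzerodivisor modulo any
 graded submodule: compare leading components.\<close>

lemma graded_regular:
 fixes h :: "'g::ab_group_add \<Rightarrow>\<^sub>0 complex" and l :: "'g => int"
 assumes B: "submod (spn L) B" and graded: "\<And>x d. x \<in> B ==> restr {m. l m = d} x \<in> B"
  and add: "\<And>a b. l (a + b) = l a + l b" and h: "h \<noteq> 0" "inj_on l (keys h)" "keys h \<subseteq> L"
  and neg: "\<And>m. m \<in> L ==> - m \<in> L" and hx: "h * x \<in> B"
 shows "x \<in> B" using hx
proof (induction "card (l ` keys x)" arbitrary: x rule: less_induct)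
 case less
 show ?case
 proof (cases "x = 0")
  case True
  thus ?thesis using submod_zero[OF B] by simp
 next
  case False
  define d where "d = Max (l ` keys x)"
  have "l ` keys x \<noteq> {}" using False by simp
  hence d: "d \<in> l ` keys x" "\<And>m. m \<in> keys x ==> l m \<le> d" unfolding d_def using Max_in Max_ge by auto
  obtain m0 where m0: "m0 \<in> keys h" "\<And>m. m \<in> keys h ==> l m \<le> l m0"
   using Max_in[of "l ` keys h"] Max_ge[of "l ` keys h"] h(1) by fastforce
  have m0': "l m < l m0" if "m \<in> keys h" "m \<noteq> m0" for m using m0 that h(2) by (metis inj_onD order_le_imp_less_or_eq)
  define c where "c = lkp h m0"
  have c: "c \<noteq> 0" using m0 by (simp add: c_def in_keys_iff)
  define h' where "h' = h - sgl m0 c"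
  have h': "l m < l m0" if "m \<in> keys h'" for m
  proof -
   have "m \<noteq> m0" using that by (auto simp: h'_def in_keys_iff lookup_minus lookup_single c_def)
   moreover from this have "m \<in> keys h"
    using that by (auto simp: h'_def in_keys_iff lookup_minus lookup_single when_def)
   ultimately show ?thesis using m0' by simp
  qed
  define X where "X = restr {m. l m = d} x"
  have "restr {m. l m = l m0 + d} (h' * x) = 0" by (rule restr_mult_0) (use h' d in \<open>fastforce simp: add\<close>)
  moreover have "restr {m. l m = l m0 + d} (sgl m0 c * x) = sgl m0 c * X"
  proof (rule poly_mapping_eqI)
   fix m
   have "l m = l m0 + d \<longleftrightarrow> l (m - m0) = d" using add[of "m - m0" m0] by auto
   thus "lkp (restr {m. l m = l m0 + d} (sgl m0 c * x)) m = lkp (sgl m0 c * X) m"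
    by (simp add: lookup_restr lookup_single_mult X_def)
  qed
  ultimately have "restr {m. l m = l m0 + d} (h * x) = sgl m0 c * X" by (simp add: h'_def restr_diff algebra_simps)
  hence "sgl m0 c * X \<in> B" using graded[OF less.prems] by metis
  \<comment> \<open>The leading monomial of h is a unit of the group algebra of L, so the leading
    component X of x lies in B; what remains of x has fewer degrees.\<close>
  hence "sgl (- m0) (1 / c) * (sgl m0 c * X) \<in> B" by (rule submod_mult[OF B, rotated]) (use neg m0 h(3) in auto)
  hence XB: "X \<in> B" using c by (simp add: mult_single flip: mult.assoc)
  have "d \<notin> l ` keys (x - X)" "l ` keys (x - X) \<subseteq> l ` keys x" by (auto simp: X_def diff_restr_keys)
  hence "l ` keys (x - X) \<subset> l ` keys x" using d(1) by blast
  hence "card (l ` keys (x - X)) < card (l ` keys x)" by (intro psubset_card_mono) auto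
  moreover have "h * (x - X) \<in> B" using submod_diff[OF B less.prems submod_mult[OF B _ XB, of h]] h(3)
   by (simp add: right_diff_distrib spn_def)
  ultimately have "x - X \<in> B" using less.hyps by blast
  thus ?thesis using submod_add[OF B _ XB] by fastforce
 qed
qed

lemma seq_span_graded:
 fixes h :: "nat => 'g::ab_group_add \<Rightarrow>\<^sub>0 complex" and l :: "'g => int"
 assumes add: "\<And>a b. l (a + b) = l a + l b"
 shows "(\<And>j m. j \<in> {1..i} ==> m \<in> keys (h j) ==> l m = 0) ==> x \<in> seq_span (spn S) h i ==>
  restr {m. l m = d} x \<in> seq_span (spn S) h i"
proof (induction i arbitrary: x)
 case (Suc i)
 then obtain b t where x: "x = b + h (Suc i) * t" "b \<in> seq_span (spn S) h i" "t \<in> spn S" by auto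
 have "restr {m. l m = d} (t * h (Suc i)) = restr {m. l m = d} t * h (Suc i)"
  by (rule restr_mult) (use Suc.prems(1)[of "Suc i"] in \<open>auto simp: add\<close>)
 hence "restr {m. l m = d} x = restr {m. l m = d} b + h (Suc i) * restr {m. l m = d} t"
  by (simp add: x restr_add mult.commute)
 moreover have "restr {m. l m = d} t \<in> spn S" using x(3) by (auto simp: spn_def keys_restr)
 moreover have "restr {m. l m = d} b \<in> seq_span (spn S) h i" by (rule Suc.IH[OF Suc.prems(1) x(2)]) auto
 ultimately show ?case unfolding seq_span.simps by blast
qed simp

text \<open>S is empty or a coset of L, so its span is zero or free of rank one over the group
  algebra of L, and g acts through its truncation to L. By \<open>face\<close> this truncation is
  multiplicative on the span of D, so each h_i remains a combination of the truncated g_j. Since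
  h_1, ..., h_{i-1} have degree 0 for l_i, their span is graded and h_i is a nonzerodivisor modulo
  it: a regular sequence of length c.\<close>

lemma torus_koszul_acyclic:
 fixes L S D :: "'g::ab_group_add set" and l :: "nat => 'g => int"
 assumes L: "0 \<in> L" "\<And>a b. a \<in> L ==> b \<in> L ==> a - b \<in> L"
  and S: "\<And>a m. m \<in> S ==> a + m \<in> S \<longleftrightarrow> a \<in> L"
  and face: "\<And>a b. a \<in> D ==> b \<in> D ==> a + b \<in> L ==> a \<in> L"
  and g: "\<And>j. j \<in> {1..n} ==> g j \<in> spn D"
  and a: "\<And>i j. i \<in> {1..c} ==> j \<in> {1..n} ==> a i j \<in> spn D"
  and h: "\<And>i. i \<in> {1..c} ==> h i = (\<Sum>j\<in>{1..n}. a i j * g j)"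
   "\<And>i. i \<in> {1..c} ==> h i \<noteq> 0 \<and> keys (h i) \<subseteq> L \<and> inj_on (l i) (keys (h i))"
  and l: "\<And>i a b. l i (a + b) = l i a + l i b" "\<And>i j m. i \<in> {1..c} ==> j \<in> {1..<i} ==> m \<in> keys (h j) ==> l i m = 0"
  and p: "n < p + c"
 shows "koszul_acyclic n g S p"
proof -
 have Ladd: "a + b \<in> L" "- a \<in> L" if "a \<in> L" "b \<in> L" for a b
  using L(2)[OF L(1), of b] L(2)[of a "- b"] L(2)[OF L(1), of a] that by auto
 have T: "submod (spn L) (spn S)" by (rule submod_spn) (use S in auto)
 define g' where "g' j = restr L (g j)" for j
 have restr_kd: "restr S (kd n g z J) = kd n g' z J" if "\<And>J. z J \<in> spn S" for z J
 proof -
  have 1: "restr S (g j * z K) = g' j * z K" if "j \<in> {1..n}" for j K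
   unfolding g'_def by (rule restr_mult) (use S \<open>\<And>J. z J \<in> spn S\<close>[of K] in \<open>auto simp: spn_def\<close>)
  have "restr S (ksign j J * x) = ksign j J * restr S x" for j J and x :: "'g \<Rightarrow>\<^sub>0 complex"
   by (cases "even (card {i \<in> J. i < j})") (auto simp: ksign_def restr_diff[of S 0, simplified])
  thus ?thesis unfolding kd_def by (simp add: restr_sum mult.assoc 1)
 qed
 define a' where "a' i j = restr L (a i j)" for i j
 have hs: "h i = (\<Sum>j\<in>{1..n}. a' i j * g' j)" if i: "i \<in> {1..c}" for i
 proof -
  have "restr L (a i j * g j) = a' i j * g' j" if j: "j \<in> {1..n}" for j
  proof -
   have "restr L (a i j * g j) = a' i j * g j - (a' i j * g j - restr L (a' i j * g j))"
    using restr_mult_0[of "a i j - a' i j" "g j" L] face a[OF i j] g[OF j] unfolding a'_def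
    by (auto simp: diff_restr_keys spn_def subset_iff left_diff_distrib restr_diff)
   moreover have "restr L (g j * a' i j) = g' j * a' i j" unfolding g'_def
   proof (rule restr_mult)
    fix m k assume "m \<in> keys (g j)" "k \<in> keys (a' i j)"
    thus "m + k \<in> L \<longleftrightarrow> m \<in> L" using Ladd[of "m + k" "- k"] Ladd[of k k] Ladd[of m k] by (auto simp: a'_def keys_restr)
   qed
   ultimately show ?thesis by (simp add: mult.commute)
  qed
  moreover have "h i = restr L (h i)" using h(2)[OF i] by (simp add: restr_id spn_def)
  ultimately show ?thesis using h(1)[OF i] by (simp add: restr_sum)
 qed
 have reg: "x \<in> seq_span (spn S) h i" if i: "i < c" and x: "x \<in> spn S" "h (Suc i) * x \<in> seq_span (spn S) h i" for i x
 proof (rule graded_regular[OF submod_seq_span[OF T] _ l(1)[of "Suc i"] _ _ _ _ x(2)])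
  show "restr {m. l (Suc i) m = d} x \<in> seq_span (spn S) h i" if "x \<in> seq_span (spn S) h i" for x d
   by (rule seq_span_graded[OF l(1) _ that]) (use l(2)[of "Suc i"] i in force)
 qed (use h(2)[of "Suc i"] i Ladd in auto)
 have exact: "\<exists>y\<in>kchain n (Suc p) (spn S). \<forall>J\<subseteq>{1..n}. kd n g' y J = z J"
  if "z \<in> kchain n p (spn S)" "\<And>J. J \<subseteq> {1..n} ==> kd n g' z J = 0" for z
  by (rule koszul_exact[OF T _ _ hs reg p that]) (auto simp: g'_def a'_def restr_spn)
 show ?thesis unfolding koszul_acyclic_def
 proof (intro ballI impI)
  fix z assume z: "z \<in> kchain n p (spn S)" "\<forall>J\<subseteq>{1..n}. restr S (kd n g z J) = 0"
  hence "\<exists>y\<in>kchain n (Suc p) (spn S). \<forall>J\<subseteq>{1..n}. kd n g' y J = z J" by (intro exact) (auto simp: restr_kd kchain_def)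
  thus "\<exists>y\<in>kchain n (Suc p) (spn S). \<forall>J\<subseteq>{1..n}. restr S (kd n g y J) = z J" by (auto simp: restr_kd kchain_def)
 qed
qed

section \<open>Rational linear algebra\<close>

abbreviation lattice_inner :: "int ^ 'n::finite => real ^ 'n => real" (infixl "\<star>" 70) where "u \<star> x \<equiv> real_vec u \<bullet> x"

lemma real_vec_add: "real_vec (a + b) = real_vec a + real_vec b"
 and real_vec_diff: "real_vec (a - b) = real_vec a - real_vec b"
 and real_vec_minus: "real_vec (- a) = - real_vec a"
 and real_vec_zero [simp]: "real_vec 0 = 0"
 and real_vec_scale: "real_vec (c *s a) = of_int c *\<^sub>R real_vec a"
 and real_vec_eq: "real_vec a = real_vec b \<longleftrightarrow> a = b" by (auto simp: real_vec_def vec_eq_iff)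

lemma real_vec_inner: "a \<star> real_vec b = of_int (pairing a b)" by (simp add: real_vec_def pairing_def inner_vec_def)

lemma pairing_add: "pairing (a + b) u = pairing a u + pairing b u"
 and pairing_diff: "pairing (a - b) u = pairing a u - pairing b u"
 and pairing_minus: "pairing (- a) u = - pairing a u"
 and pairing_zero [simp]: "pairing 0 u = 0" "pairing u 0 = 0"
 and pairing_scale: "pairing (c *s a) u = c * pairing a u" "pairing u (c *s a) = c * pairing u a"
 and pairing_add_right: "pairing u (a + b) = pairing u a + pairing u b"
 by (simp_all add: pairing_def algebra_simps sum.distrib sum_subtractf sum_negf sum_distrib_left)

lemma pairing_sum: "pairing (sum f A) u = (\<Sum>x\<in>A. pairing (f x) u)"
 by (induction A rule: infinite_finite_induct) (auto simp: pairing_add)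

lemma pairing_commute: "pairing a b = pairing b a" by (simp add: pairing_def mult.commute)

lemma pairing_self_pos: "a \<noteq> 0 ==> 0 < pairing a a"
 using inner_gt_zero_iff[of "real_vec a"] real_vec_eq[of a 0] by (simp add: real_vec_inner)

text \<open>Fewer than n vectors, completed by zero rows, form a singular rational matrix. A kernel
  vector times the product of its denominators is integral.\<close>

lemma exists_orthogonal:
 fixes F :: "(int ^ 'n::finite) set"
 assumes "finite F" "card F < CARD('n)"
 obtains b where "b \<noteq> 0" "\<And>f. f \<in> F ==> pairing f b = 0"
proof -
 obtain idx :: "int ^ 'n => 'n" where idx: "inj_on idx F"
  using assms by (metis finite_code card_le_inj finite_class.finite_UNIV order_less_imp_le)
 have "idx ` F \<noteq> UNIV" using card_image[OF idx] assms by (metis less_irrefl)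
 then obtain i0 where i0: "i0 \<notin> idx ` F" by auto
 define A :: "rat ^ 'n ^ 'n" where "A = (\<chi> i. if i \<in> idx ` F then (\<chi> j. of_int (the_inv_into F idx i $ j)) else 0)"
 have "row i0 A = 0" using i0 by (simp add: row_def A_def vec_eq_iff)
 hence "det A = 0" by (rule det_zero_row)
 hence "\<not> invertible A" by (simp add: invertible_det_nz)
 then obtain x where x: "x \<noteq> 0" "A *v x = 0" unfolding invertible_left_inverse matrix_left_invertible_ker by auto
 define N where "N = (\<Prod>j\<in>UNIV. snd (quotient_of (x $ j)))"
 have den: "snd (quotient_of r) > 0" for r by (rule quotient_of_denom_pos')
 have N: "N > 0" unfolding N_def by (rule prod_pos) (use den in auto)
 have "\<exists>k. of_int N * x $ j = of_int k" for j
 proof -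
  obtain p q where pq: "quotient_of (x $ j) = (p, q)" by force
  have "q dvd N" unfolding N_def using dvd_prodI[of UNIV j "\<lambda>j. snd (quotient_of (x $ j))"] pq by simp
  then obtain t where "N = q * t" by blast
  moreover have "x $ j = of_int p / of_int q" using quotient_of_div[OF pq] .
  moreover have "q > 0" using quotient_of_denom_pos[OF pq] .
  ultimately have "of_int N * x $ j = of_int (t * p)" by simp
  thus ?thesis by blast
 qed
 then obtain k where k: "\<And>j. of_int N * x $ j = of_int (k j)" by metis
 define b where "b = (\<chi> j. k j)"
 have "b \<noteq> 0"
 proof
  assume "b = 0"
  hence "k j = 0" for j by (metis b_def vec_lambda_beta zero_index)
  hence "x $ j = 0" for j using k[of j] N by simp
  thus False using x(1) by (simp add: vec_eq_iff)
 qed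
 moreover have "pairing f b = 0" if "f \<in> F" for f
 proof -
  have "(A *v x) $ idx f = (\<Sum>j\<in>UNIV. of_int (f $ j) * x $ j)"
   using that idx by (simp add: matrix_vector_mult_def A_def the_inv_into_f_f)
  hence "0 = of_int N * (\<Sum>j\<in>UNIV. of_int (f $ j) * x $ j)" using x(2) by simp
  also have "\<dots> = (\<Sum>j\<in>UNIV. of_int (f $ j) * (of_int N * x $ j))" by (simp add: sum_distrib_left mult.left_commute)
  also have "\<dots> = of_int (pairing f b)" by (simp add: k pairing_def b_def)
  finally show ?thesis by simp
 qed
 ultimately show ?thesis using that by blast
qed

text \<open>Orthogonalization without normalization: E and the vectors found so far number fewer
  than n. The first vector is prescribed to be w, when w is nonzero, so that all later ones are
  orthogonal to w and can be displaced along w without spoiling their mutual pairings.\<close>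

lemma exists_orthogonal_system:
 fixes E :: "(int ^ 'n::finite) set"
 assumes "finite E" "\<And>e. e \<in> E ==> pairing e w = 0"
 shows "card E + c \<le> CARD('n) ==> \<exists>b. (\<forall>i\<in>{1..c}. b i \<noteq> 0 \<and> (\<forall>e\<in>E. pairing e (b i) = 0) \<and>
   (\<forall>j\<in>{1..<i}. pairing (b i) (b j) = 0)) \<and> (1 \<le> c --> w \<noteq> 0 --> b (1::nat) = w)"
proof (induction c)
 case (Suc c)
 then obtain b where b: "\<forall>i\<in>{1..c}. b i \<noteq> 0 \<and> (\<forall>e\<in>E. pairing e (b i) = 0) \<and>
   (\<forall>j\<in>{1..<i}. pairing (b i) (b j) = 0)" "1 \<le> c --> w \<noteq> 0 --> b 1 = w" by auto
 have "card (E \<union> b ` {1..c}) \<le> card E + card {1..c}"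
  using card_Un_le[of E "b ` {1..c}"] card_image_le[of "{1..c}" b] by auto
 hence "card (E \<union> b ` {1..c}) < CARD('n)" using Suc.prems by simp
 moreover have "finite (E \<union> b ` {1..c})" using assms by simp
 ultimately obtain b0 where b0: "b0 \<noteq> 0" "\<And>f. f \<in> E \<union> b ` {1..c} ==> pairing f b0 = 0" using exists_orthogonal by blast
 define b1 where "b1 = (if c = 0 \<and> w \<noteq> 0 then w else b0)"
 have b1: "b1 \<noteq> 0" "\<And>e. e \<in> E ==> pairing e b1 = 0" "\<And>j. j \<in> {1..c} ==> pairing b1 (b j) = 0"
  using b0 assms(2) by (auto simp: b1_def pairing_commute[of b0])
 show ?case by (rule exI[of _ "b(Suc c := b1)"]) (use b b1 in \<open>auto simp: b1_def le_Suc_eq\<close>)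
qed auto

text \<open>Rational points are dense in a rational subspace. A new equation e either holds for
  every integral solution of the earlier equations, or is nonzero on one of them, s. In the second
  case subtracting a multiple of s restores e, and by Cauchy-Schwarz the error grows at most by the
  factor K.\<close>

lemma rational_approx:
 fixes w :: "real ^ 'n::finite"
 assumes "finite E" "\<And>e. e \<in> E ==> e \<star> w = 0" "\<epsilon> > 0"
 shows "\<exists>b N. N > 0 \<and> (\<forall>e\<in>E. pairing e b = 0) \<and> norm (real_vec b /\<^sub>R of_nat N - w) < \<epsilon>" using assms
proof (induction E arbitrary: \<epsilon> rule: finite_induct)
 case empty
 define C where "C = real CARD('n)"
 obtain N :: nat where N: "N > 0" "C / of_nat N < \<epsilon>" using reals_Archimedean2[of "C / \<epsilon>"] empty
  by (metis C_def divide_less_eq gr0I mult.commute of_nat_0 of_nat_0_less_iff of_nat_0_le_iff not_less pos_divide_less_eq zero_le_divide_iff order_less_imp_le)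
 define b :: "int ^ 'n" where "b = (\<chi> j. \<lfloor>of_nat N * w $ j\<rfloor>)"
 have "\<bar>(real_vec b /\<^sub>R of_nat N - w) $ j\<bar> \<le> 1 / of_nat N" for j
 proof -
  have "(real_vec b /\<^sub>R of_nat N - w) $ j = (of_int \<lfloor>of_nat N * w $ j\<rfloor> - of_nat N * w $ j) / of_nat N"
   using N by (simp add: b_def real_vec_def field_simps)
  moreover have "\<bar>of_int \<lfloor>of_nat N * w $ j\<rfloor> - of_nat N * w $ j\<bar> \<le> 1" by linarith
  ultimately show ?thesis using N by (simp add: divide_right_mono)
 qed
 hence "norm (real_vec b /\<^sub>R of_nat N - w) \<le> (\<Sum>j\<in>(UNIV::'n set). 1 / of_nat N)"
  using norm_le_l1_cart[of "real_vec b /\<^sub>R of_nat N - w"] by (meson order_trans sum_mono)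
 hence "norm (real_vec b /\<^sub>R of_nat N - w) < \<epsilon>" using N by (simp add: C_def)
 thus ?case using N by blast
next
 case (insert e E)
 show ?case
 proof (cases "\<exists>s. (\<forall>e\<in>E. pairing e s = 0) \<and> pairing e s \<noteq> 0")
  case False
  thus ?thesis using insert.IH[of \<epsilon>] insert.prems by (metis insert_iff)
 next
  case True
  then obtain s0 where "\<forall>e\<in>E. pairing e s0 = 0" "pairing e s0 \<noteq> 0" by blast
  then obtain s where s: "\<forall>e\<in>E. pairing e s = 0" "pairing e s > 0" using pairing_scale(2)[of _ "- 1" s0]
   by (metis mult_minus1 neg_0_less_iff_less neg_equal_0_iff_equal linorder_neqE_linordered_idom)
  define c :: real where "c = of_int (pairing e s)"
  have c: "c > (0::real)" using s by (simp add: c_def)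
  define K where "K = 1 + norm (real_vec e) * norm (real_vec s) / c"
  have K: "K > 0" unfolding K_def using c by (simp add: add_pos_nonneg)
  obtain b N where bN: "N > 0" "\<forall>e\<in>E. pairing e b = 0" "norm (real_vec b /\<^sub>R of_nat N - w) < \<epsilon> / K"
   using insert.IH[of "\<epsilon> / K"] insert.prems K by auto
  define b' where "b' = pairing e s *s b - pairing e b *s s"
  define N' where "N' = N * nat (pairing e s)"
  have N': "N' > 0" "real N' = real N * c" using bN s by (simp_all add: N'_def c_def)
  define r where "r = real_vec b /\<^sub>R of_nat N"
  have er: "e \<star> r = of_int (pairing e b) / of_nat N" by (simp add: r_def real_vec_inner divide_inverse mult.commute)
  have "real_vec b' /\<^sub>R of_nat N' - w = (r - w) - ((e \<star> (r - w)) / c) *\<^sub>R real_vec s"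
  proof -
   have "real_vec b' /\<^sub>R of_nat N' = r - ((e \<star> r) / c) *\<^sub>R real_vec s" unfolding er using bN(1) c N'(2)
    by (simp add: b'_def r_def real_vec_diff real_vec_scale c_def[symmetric] algebra_simps divide_simps)
   thus ?thesis using insert.prems(1)[of e] by (simp add: inner_diff_right)
  qed
  hence "norm (real_vec b' /\<^sub>R of_nat N' - w)
   \<le> norm (r - w) + norm (((e \<star> (r - w)) / c) *\<^sub>R real_vec s)" by (metis norm_triangle_ineq4)
  also have "norm (((e \<star> (r - w)) / c) *\<^sub>R real_vec s)
   \<le> (norm (real_vec e) * norm (r - w)) / c * norm (real_vec s)" using c Cauchy_Schwarz_ineq2[of "real_vec e" "r - w"]
   by (auto simp: abs_divide intro!: mult_right_mono divide_right_mono)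
  also have "norm (r - w) + \<dots> = norm (r - w) * K" by (simp add: K_def algebra_simps)
  also have "\<dots> < \<epsilon>" using bN(3) K by (simp add: r_def pos_less_divide_eq)
  finally have "norm (real_vec b' /\<^sub>R of_nat N' - w) < \<epsilon>" by simp
  moreover have "\<forall>f\<in>insert e E. pairing f b' = 0" using bN(2) s(1)
   by (auto simp: b'_def pairing_diff pairing_scale pairing_commute[of _ "_ - _"] pairing_commute[of b] pairing_commute[of s])
  ultimately show ?thesis using N' by blast
 qed
qed

text \<open>Strict positivity on a finite set is an open condition, so it survives approximation by
  rational points of the subspace, and clearing the denominator keeps the signs.\<close>

lemma integral_solution:
 fixes w :: "real ^ 'n::finite"
 assumes "finite E" "\<And>e. e \<in> E ==> e \<star> w = 0" "finite U" "\<And>u. u \<in> U ==> u \<star> w > 0"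
 obtains b where "\<And>e. e \<in> E ==> pairing e b = 0" "\<And>u. u \<in> U ==> pairing u b > 0"
proof -
 have "open (\<Inter>u\<in>U. {x. u \<star> x > 0})" using assms(3) by (intro open_INT ballI) (auto simp: open_halfspace_gt)
 moreover have "w \<in> (\<Inter>u\<in>U. {x. u \<star> x > 0})" using assms(4) by auto
 ultimately obtain \<epsilon> where \<epsilon>: "\<epsilon> > 0" "ball w \<epsilon> \<subseteq> (\<Inter>u\<in>U. {x. u \<star> x > 0})" using open_contains_ball by blast
 obtain b N where b: "N > 0" "\<forall>e\<in>E. pairing e b = 0" "norm (real_vec b /\<^sub>R of_nat N - w) < \<epsilon>"
  using rational_approx[OF assms(1,2) \<epsilon>(1)] by auto
 have "pairing u b > 0" if "u \<in> U" for u
 proof -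
  have "real_vec b /\<^sub>R of_nat N \<in> ball w \<epsilon>" using b(3) by (simp add: dist_norm norm_minus_commute)
  hence "u \<star> (real_vec b /\<^sub>R of_nat N) > 0" using \<epsilon>(2) that by blast
  thus ?thesis using b(1) by (simp add: real_vec_inner zero_less_mult_iff)
 qed
 thus ?thesis using that b(2) by blast
qed

text \<open>Finitely many proper hyperplanes do not cover a subspace: on the line x + t x' each of
  them excludes at most one value of t.\<close>

lemma avoid_hyperplanes:
 fixes S :: "'a::real_inner set"
 assumes "finite Y" "subspace S" "\<And>y. y \<in> Y ==> \<exists>x\<in>S. y \<bullet> x \<noteq> 0"
 shows "\<exists>x\<in>S. \<forall>y\<in>Y. y \<bullet> x \<noteq> 0" using assms(1,3)
proof (induction Y rule: finite_induct)
 case empty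
 thus ?case using subspace_0[OF assms(2)] by auto
next
 case (insert y Y)
 then obtain x where x: "x \<in> S" "\<forall>y\<in>Y. y \<bullet> x \<noteq> 0" by blast
 obtain x' where x': "x' \<in> S" "y \<bullet> x' \<noteq> 0" using insert.prems by blast
 define bad where "bad = insert (- (y \<bullet> x) / (y \<bullet> x')) ((\<lambda>y'. - (y' \<bullet> x) / (y' \<bullet> x')) ` Y)"
 have "finite bad" using insert.hyps by (simp add: bad_def)
 then obtain t where t: "t \<notin> bad" using ex_new_if_finite[OF infinite_UNIV_char_0] by blast
 have "y' \<bullet> (x + t *\<^sub>R x') \<noteq> 0" if "y' \<in> insert y Y" for y'
 proof
  assume "y' \<bullet> (x + t *\<^sub>R x') = 0"
  hence eq: "y' \<bullet> x + t * (y' \<bullet> x') = 0" by (simp add: inner_add_right)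
  have "y' \<bullet> x' \<noteq> 0" using eq x(2) x'(2) that by auto
  hence "t = - (y' \<bullet> x) / (y' \<bullet> x')" using eq by (simp add: field_simps)
  thus False using t that by (auto simp: bad_def)
 qed
 thus ?case using x x' subspace_add[OF assms(2)] subspace_scale[OF assms(2)] by blast
qed

section \<open>Cohen--Macaulayness of conic modules\<close>

lemma pairing_diff_right: "pairing u (a - b) = pairing u a - pairing u b"
 using pairing_diff[of a b u] by (simp only: pairing_commute)

lemma kchain_mono: "y \<in> kchain n p (spn S) ==> S \<subseteq> S' ==> y \<in> kchain n p (spn S')"
 by (auto simp: kchain_def intro: spn_mono)

text \<open>Lattice points of a translated cone with apex v. For v = 0 and no equations this is a
  dual semigroup; a general v accommodates the twist by a Q-Cartier divisor and the moving apex of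
  the sweep, and an inequality moved from U to E passes to a facet.\<close>

definition conic_points :: "(int ^ 'n) set => (int ^ 'n) set => real ^ 'n => (int ^ 'n::finite) set" where
 "conic_points E U v = {m. (\<forall>e\<in>E. e \<star> (real_vec m - v) = 0) \<and> (\<forall>u\<in>U. u \<star> (real_vec m - v) \<ge> 0)}"

text \<open>Dimension zero of the quotient by g, in the form needed for depth: for each nontrivial
  monomial of D some nonzero polynomial in that monomial alone lies in the ideal generated by
  g.\<close>

definition algebraic_monomials :: "nat => (nat => (int ^ 'n::finite \<Rightarrow>\<^sub>0 complex)) => (int ^ 'n) set => bool" where
 "algebraic_monomials n g D \<longleftrightarrow> (\<forall>m\<in>D. m \<noteq> 0 --> (\<exists>h a. h \<noteq> 0 \<and> keys h \<subseteq> range (\<lambda>k::nat. int k *s m) \<and> (\<forall>j. a j \<in> spn D) \<and>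
    h = (\<Sum>j\<in>{1..n}. a j * g j)))"

text \<open>Without inequalities the lattice points form a coset of the lattice orthogonal to E, or
  none at all. Displacing b_i along w gives t_i in D, while the pairings of the b_i with the t_j
  stay triangular. The polynomials in the monomials t_i that lie in (g) then form a regular sequence
  of length c, graded by the b_i.\<close>

lemma conic_torus_acyclic:
 fixes E V :: "(int ^ 'n::finite) set"
 assumes fin: "finite V" and g: "\<And>j. j \<in> {1..CARD('n)} ==> g j \<in> spn (conic_points {} V 0)"
  and alg: "algebraic_monomials CARD('n) g (conic_points {} V 0)"
  and EV: "E \<subseteq> V" and U: "finite U" and w: "\<And>e. e \<in> E ==> pairing e w = 0" "\<And>u. u \<in> U ==> pairing u w > 0"
  and inv: "\<And>x::real ^ 'n. (\<forall>e\<in>E. e \<star> x = 0) ==> (\<forall>u\<in>U. u \<star> x \<ge> 0) ==>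
    \<forall>u\<in>V. u \<star> x \<ge> 0"
  and p: "card E < p"
 shows "koszul_acyclic CARD('n) g (conic_points E {} v) p"
proof -
 define D where "D = conic_points {} V 0"
 define L where "L = {m. \<forall>e\<in>E. pairing e m = 0}"
 \<comment> \<open>Truncated subtraction does no harm: if card E exceeds n then c = 0, and card E <
   p already gives n < p.\<close>
 define c where "c = CARD('n) - card E"
 have finE: "finite E" using EV fin finite_subset by blast
 have D: "m \<in> D \<longleftrightarrow> (\<forall>u\<in>V. pairing u m \<ge> 0)" for m by (simp add: D_def conic_points_def real_vec_inner)
 have "\<exists>b. (\<forall>i\<in>{1..c}. b i \<noteq> 0 \<and> (\<forall>e\<in>E. pairing e (b i) = 0) \<and>
   (\<forall>j\<in>{1..<i}. pairing (b i) (b j) = 0)) \<and> (1 \<le> c --> w \<noteq> 0 --> b (1::nat) = w)"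
 proof (cases "card E \<le> CARD('n)")
  case True
  thus ?thesis by (intro exists_orthogonal_system[OF finE w(1)]) (auto simp: c_def)
 qed (simp add: c_def)
 then obtain b where b: "\<And>i. i \<in> {1..c} ==> b i \<noteq> 0" "\<And>i e. i \<in> {1..c} ==> e \<in> E ==> pairing e (b i) = 0"
  "\<And>i j. i \<in> {1..c} ==> j \<in> {1..<i} ==> pairing (b i) (b j) = 0" "1 \<le> c ==> w \<noteq> 0 ==> b 1 = w" by blast
 \<comment> \<open>By integrality w pairs to at least 1 with every u in U, so K i copies of w
   outweigh any negative pairing of b_i; \<open>inv\<close> carries nonnegativity from U to
   V.\<close>
 define K where "K i = (\<Sum>u\<in>U. \<bar>pairing u (b i)\<bar>)" for i
 define t where "t i = b i + K i *s w" for i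
 have K: "K i \<ge> 0" "\<And>u. u \<in> U ==> \<bar>pairing u (b i)\<bar> \<le> K i" for i
  unfolding K_def using member_le_sum[of _ U "\<lambda>u. \<bar>pairing u (b i)\<bar>"] U by (auto intro: sum_nonneg)
 have bw: "pairing (b i) w = 0" if "i \<in> {1..c}" "i \<noteq> 1" for i using b(3)[of i 1] b(4) that by (cases "w = 0") auto
 have tL: "t i \<in> L" if "i \<in> {1..c}" for i
  using b(2)[OF that] w(1) by (simp add: L_def t_def pairing_add_right pairing_scale)
 have tD: "t i \<in> D" if "i \<in> {1..c}" for i
 proof -
  have "pairing u (t i) \<ge> 0" if "u \<in> U" for u
  proof -
   have "K i * 1 \<le> K i * pairing u w" using K(1) w(2)[OF that] by (intro mult_left_mono) auto
   thus ?thesis using K(2)[OF that, of i] by (simp add: t_def pairing_add_right pairing_scale)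
  qed
  hence "\<forall>u\<in>V. u \<star> real_vec (t i) \<ge> 0" using tL[OF that] by (intro inv) (auto simp: real_vec_inner L_def)
  thus ?thesis by (simp add: D real_vec_inner)
 qed
 have tt: "pairing (b i) (t i) > 0" if "i \<in> {1..c}" for i
 proof (cases "i = 1 \<and> w \<noteq> 0")
  case True
  hence "pairing (b i) (t i) = (1 + K i) * pairing w w"
   using b(4) that by (simp add: t_def pairing_add_right pairing_scale algebra_simps)
  thus ?thesis using K(1)[of i] pairing_self_pos[of w] True by (simp add: add_pos_nonneg)
 next
  case False
  hence "K i * pairing (b i) w = 0" using bw[OF that] by auto
  moreover have "pairing (b i) (t i) = pairing (b i) (b i) + K i * pairing (b i) w"
   by (simp add: t_def pairing_add_right pairing_scale)
  ultimately show ?thesis using pairing_self_pos[OF b(1)[OF that]] by linarith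
 qed
 have t0: "t i \<noteq> 0" if "i \<in> {1..c}" for i using tt[OF that] by auto
 have lt: "pairing (b i) (t j) = 0" if "i \<in> {1..c}" "j \<in> {1..<i}" for i j
  using b(3)[OF that] bw[OF that(1)] that by (simp add: t_def pairing_add_right pairing_scale)
 define Q where "Q i h a \<longleftrightarrow> h \<noteq> 0 \<and> keys h \<subseteq> range (\<lambda>k::nat. int k *s t i) \<and> (\<forall>j. a j \<in> spn D) \<and>
    h = (\<Sum>j\<in>{1..CARD('n)}. a j * g j)" for i h a
 have "\<exists>h a. Q i h a" if "i \<in> {1..c}" for i
  using alg tD[OF that] t0[OF that] unfolding algebraic_monomials_def D_def Q_def by blast
 then obtain h a where Q: "\<And>i. i \<in> {1..c} ==> Q i (h i) (a i)" by metis
 note ha = Q[unfolded Q_def, THEN conjunct1] Q[unfolded Q_def, THEN conjunct2, THEN conjunct1]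
  Q[unfolded Q_def, THEN conjunct2, THEN conjunct2, THEN conjunct1, THEN spec]
  Q[unfolded Q_def, THEN conjunct2, THEN conjunct2, THEN conjunct2]
 show ?thesis
 proof (rule torus_koszul_acyclic[where L = L and D = D and c = c and l = "\<lambda>i. pairing (b i)" and h = h and a = a])
  show "0 \<in> L" by (simp add: L_def)
  show "x - y \<in> L" if "x \<in> L" "y \<in> L" for x y using that by (simp add: L_def pairing_diff_right)
  show "x + m \<in> conic_points E {} v \<longleftrightarrow> x \<in> L" if "m \<in> conic_points E {} v" for x m
  proof -
   have "e \<star> (real_vec (x + m) - v) = of_int (pairing e x)" if "e \<in> E" for e
   proof -
    have "real_vec (x + m) - v = real_vec x + (real_vec m - v)" by (simp add: real_vec_add)
    thus ?thesis unfolding \<open>real_vec (x + m) - v = _\<close> using that \<open>m \<in> conic_points E {} v\<close>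
     by (simp add: inner_add_right conic_points_def real_vec_inner)
   qed
   thus ?thesis by (auto simp: conic_points_def L_def)
  qed
  show "x \<in> L" if "x \<in> D" "y \<in> D" "x + y \<in> L" for x y
  proof -
   have "pairing e x = 0" if "e \<in> E" for e
   proof -
    have "pairing e x \<ge> 0" "pairing e y \<ge> 0" using D EV that \<open>x \<in> D\<close> \<open>y \<in> D\<close> by auto
    moreover have "pairing e x + pairing e y = 0" using \<open>x + y \<in> L\<close> that by (simp add: L_def pairing_add_right)
    ultimately show ?thesis by linarith
   qed
   thus ?thesis by (simp add: L_def)
  qed
  show "g j \<in> spn D" if "j \<in> {1..CARD('n)}" for j using g[OF that] by (simp add: D_def)
  show "h i \<noteq> 0 \<and> keys (h i) \<subseteq> L \<and> inj_on (pairing (b i)) (keys (h i))" if i: "i \<in> {1..c}" for i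
  proof (intro conjI inj_onI)
   show "keys (h i) \<subseteq> L" using ha(2)[OF i] tL[OF i] by (auto simp: L_def pairing_scale)
   fix x y assume xy: "x \<in> keys (h i)" "y \<in> keys (h i)" "pairing (b i) x = pairing (b i) y"
   then obtain k k' where "x = int k *s t i" "y = int k' *s t i" using ha(2)[OF i] by blast
   thus "x = y" using xy(3) tt[OF i] by (simp add: pairing_scale)
  qed (rule ha(1)[OF i])
  show "pairing (b i) m = 0" if ij: "i \<in> {1..c}" "j \<in> {1..<i}" and m: "m \<in> keys (h j)" for i j m
  proof -
   have "j \<in> {1..c}" using ij by auto
   then obtain k where "m = int k *s t j" using ha(2) m by blast
   thus ?thesis using lt[OF ij] by (simp add: pairing_scale)
  qed
  show "CARD('n) < p + c" using p by (auto simp: c_def)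
 qed (use ha in \<open>auto simp: pairing_add_right\<close>)
qed

lemma finite_levels:
 fixes \<alpha> \<beta> :: real
 assumes "\<beta> > 0"
 shows "finite {t. \<exists>k::int. t = (of_int k - \<alpha>) / \<beta> \<and> s < t \<and> t < 0}"
proof (rule finite_surj)
 show "{t. \<exists>k::int. t = (of_int k - \<alpha>) / \<beta> \<and> s < t \<and> t < 0}
   \<subseteq> (\<lambda>k. (of_int k - \<alpha>) / \<beta>) ` {\<lfloor>s * \<beta> + \<alpha>\<rfloor>..\<lceil>\<alpha>\<rceil>}"
 proof
  fix t assume "t \<in> {t. \<exists>k::int. t = (of_int k - \<alpha>) / \<beta> \<and> s < t \<and> t < 0}"
  then obtain k :: int where k: "t = (of_int k - \<alpha>) / \<beta>" "s < t" "t < 0" by blast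
  hence "s * \<beta> + \<alpha> < of_int k" "of_int k < \<alpha>"
   using assms mult_strict_right_mono[OF k(2) assms] mult_neg_pos[OF k(3) assms] by auto
  hence "k \<in> {\<lfloor>s * \<beta> + \<alpha>\<rfloor>..\<lceil>\<alpha>\<rceil>}" by (auto; linarith)
  thus "t \<in> (\<lambda>k. (of_int k - \<alpha>) / \<beta>) ` {\<lfloor>s * \<beta> + \<alpha>\<rfloor>..\<lceil>\<alpha>\<rceil>}" using k(1) by blast
 qed
qed simp

text \<open>Lattice points cannot distinguish \<open>v\<close> from a small displacement away from the cone, so the apex may be
 assumed to be in general position: no two facet hyperplanes moving along \<open>w\<close> meet lattice points at the
 same time.\<close>

lemma generic_apex:
 fixes v W :: "real ^ 'n::finite" and U :: "(int ^ 'n) set"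
 assumes U: "finite U" and W: "\<And>e. e \<in> E ==> e \<star> W = 0" "\<And>u. u \<in> U ==> u \<star> W > 0"
  and y: "\<And>u. u \<in> U ==> \<exists>y. (\<forall>e\<in>E. e \<star> y = 0) \<and> u \<star> y = 0 \<and> (\<forall>u'\<in>U - {u}. u' \<star> y > 0)"
 obtains v' where "conic_points E U v' = conic_points E U v" "\<And>u u' k k'. u \<in> U ==> u' \<in> U ==> u \<noteq> u' ==>
    (of_int k - u \<star> v') / (u \<star> W) \<noteq> (of_int k' - u' \<star> v') / (u' \<star> W)"
proof -
 define S where "S = {x. \<forall>e\<in>E. e \<star> x = 0}"
 have S: "subspace S" by (auto simp: S_def subspace_def inner_add_right)
 define P where "P = {q \<in> U \<times> U. fst q \<noteq> snd q}"
 have P: "finite P" unfolding P_def using U by auto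
 \<comment> \<open>Displacing the apex along a vector x changes the levels of u and u' by the same
   amount exactly if this covector kills x. It is nonzero on the subspace orthogonal to E because u
   vanishes and u' is positive at the facet point of u.\<close>
 define \<delta> where "\<delta> q = ((snd q) \<star> W) *\<^sub>R real_vec (fst q) - ((fst q) \<star> W) *\<^sub>R real_vec (snd q)" for q
 have "\<exists>x\<in>S. \<forall>z\<in>\<delta> ` P. z \<bullet> x \<noteq> 0"
 proof (rule avoid_hyperplanes[OF _ S])
  fix z assume "z \<in> \<delta> ` P"
  then obtain u u' where q: "z = \<delta> (u, u')" "u \<in> U" "u' \<in> U" "u \<noteq> u'" by (auto simp: P_def)
  obtain y where "\<forall>e\<in>E. e \<star> y = 0" "u \<star> y = 0" "\<forall>u'\<in>U - {u}. u' \<star> y > 0" using assms(4)[OF q(2)] by blast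
  moreover from this have "u' \<star> y > 0" using q by auto
  moreover from this have "(u \<star> W) * (u' \<star> y) > 0" using W(2)[OF q(2)] by simp
  ultimately have "y \<in> S" "z \<bullet> y \<noteq> 0" using q(1) W(2)[OF q(2)] by (simp_all add: S_def \<delta>_def inner_diff_left)
  thus "\<exists>x\<in>S. z \<bullet> x \<noteq> 0" by blast
 qed (use P in simp)
 then obtain x where x: "x \<in> S" "\<And>q. q \<in> P ==> \<delta> q \<bullet> x \<noteq> 0" by blast
 \<comment> \<open>Large enough to make \<xi> positive on U. Adding a multiple of W does not affect
   \<delta>, which vanishes on W.\<close>
 define K where "K = (\<Sum>u\<in>U. (1 + \<bar>u \<star> x\<bar>) / (u \<star> W))"
 define \<xi> where "\<xi> = x + K *\<^sub>R W"
 have \<xi>pos: "u \<star> \<xi> > 0" if "u \<in> U" for u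
 proof -
  have "(1 + \<bar>u \<star> x\<bar>) / (u \<star> W) \<le> K"
   unfolding K_def using W(2) by (intro member_le_sum that U) (auto intro!: divide_nonneg_pos)
  hence "1 + \<bar>u \<star> x\<bar> \<le> K * (u \<star> W)" using W(2)[OF that] by (simp add: pos_divide_le_eq)
  thus ?thesis by (simp add: \<xi>_def inner_add_right)
 qed
 have \<xi>E: "e \<star> \<xi> = 0" if "e \<in> E" for e using x(1) W(1)[OF that] that by (simp add: \<xi>_def inner_add_right S_def)
 have \<xi>P: "\<delta> q \<bullet> \<xi> \<noteq> 0" if "q \<in> P" for q using x(2)[OF that] by (simp add: \<xi>_def inner_add_right \<delta>_def inner_diff_left)
 have "\<exists>\<epsilon>>0. \<forall>\<eta>. 0 < \<eta> \<and> \<eta> < \<epsilon> --> (\<forall>m. u \<star> real_vec m \<ge> u \<star> v - \<eta> * (u \<star> \<xi>) --> u \<star> real_vec m \<ge> u \<star> v)"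
  if u: "u \<in> U" for u
 proof -
  define \<alpha> where "\<alpha> = u \<star> v"
  define \<beta> where "\<beta> = u \<star> \<xi>"
  \<comment> \<open>The numerator is the distance from \<alpha> to the largest integer strictly
    below it; a smaller displacement of the facet lets in no new lattice point.\<close>
  define \<epsilon> where "\<epsilon> = (\<alpha> - (\<lceil>\<alpha>\<rceil> - 1)) / \<beta>"
  have b: "\<beta> > 0" using \<xi>pos[OF u] by (simp add: \<beta>_def)
  have "\<alpha> - (\<lceil>\<alpha>\<rceil> - 1) > 0" by linarith
  hence "\<epsilon> > 0" unfolding \<epsilon>_def using b by (rule divide_pos_pos)
  moreover have "of_int k \<ge> \<alpha>" if "\<eta> < \<epsilon>" "of_int k \<ge> \<alpha> - \<eta> * \<beta>" for \<eta> and k :: int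
  proof -
   have "\<eta> * \<beta> < \<alpha> - (\<lceil>\<alpha>\<rceil> - 1)" using that(1) b by (simp add: \<epsilon>_def pos_less_divide_eq)
   hence "of_int k > (of_int (\<lceil>\<alpha>\<rceil> - 1) :: real)" using that(2) by simp
   hence "\<lceil>\<alpha>\<rceil> \<le> k" unfolding of_int_less_iff by simp
   thus ?thesis by (simp add: ceiling_le_iff)
  qed
  ultimately show ?thesis unfolding \<alpha>_def[symmetric] \<beta>_def[symmetric] real_vec_inner by blast
 qed
 then obtain \<epsilon> where \<epsilon>: "\<And>u. u \<in> U ==> \<epsilon> u > 0" "\<And>u \<eta> m. u \<in> U ==> 0 < \<eta> ==> \<eta> < \<epsilon> u ==> u \<star> real_vec m \<ge> u \<star> v - \<eta> * (u \<star> \<xi>) ==>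
    u \<star> real_vec m \<ge> u \<star> v" by metis
 define \<epsilon>0 where "\<epsilon>0 = Min (insert 1 (\<epsilon> ` U))"
 have \<epsilon>0: "\<epsilon>0 > 0" "\<And>u. u \<in> U ==> \<epsilon>0 \<le> \<epsilon> u" unfolding \<epsilon>0_def using U \<epsilon>(1) by auto
 \<comment> \<open>The displacements at which two levels coincide, one for each pair of forms and
   each pair of integers. They are countable, so an open interval contains a good \<eta>.\<close>
 define bad where "bad = (\<Union>q\<in>P. \<Union>k::int. \<Union>k'::int.
  {(((fst q) \<star> W) * (of_int k' - (snd q) \<star> v) - ((snd q) \<star> W) * (of_int k - (fst q) \<star> v))
   / (\<delta> q \<bullet> \<xi>)})"
 have "countable bad" unfolding bad_def using P by (intro countable_UN) (auto intro: countable_finite)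
 then obtain \<eta> where \<eta>: "0 < \<eta>" "\<eta> < \<epsilon>0" "\<eta> \<notin> bad"
 proof -
  have "\<not> {0<..<\<epsilon>0} \<subseteq> bad" using \<open>countable bad\<close> countable_subset uncountable_open_interval \<epsilon>0(1) by blast
  thus ?thesis using that unfolding subset_iff greaterThanLessThan_iff by blast
 qed
 define v' where "v' = v - \<eta> *\<^sub>R \<xi>"
 have "conic_points E U v' = conic_points E U v"
 proof -
  have "e \<star> (real_vec m - v') = e \<star> (real_vec m - v)" if "e \<in> E" for e m
   using \<xi>E[OF that] by (simp add: v'_def inner_diff_right inner_add_right)
  moreover have "u \<star> (real_vec m - v') \<ge> 0 \<longleftrightarrow> u \<star> (real_vec m - v) \<ge> 0" if "u \<in> U" for u m
  proof -
   have e: "u \<star> (real_vec m - v') = u \<star> real_vec m - (u \<star> v - \<eta> * (u \<star> \<xi>))"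
    by (simp add: v'_def inner_diff_right algebra_simps)
   have "\<eta> < \<epsilon> u" using \<eta>(2) \<epsilon>0(2)[OF that] by simp
   thus ?thesis unfolding e
    using \<epsilon>(2)[OF that \<eta>(1), of m] mult_pos_pos[OF \<eta>(1) \<xi>pos[OF that]] by (auto simp: inner_diff_right)
  qed
  ultimately show ?thesis unfolding conic_points_def by auto
 qed
 moreover have "(of_int k - u \<star> v') / (u \<star> W) \<noteq> (of_int k' - u' \<star> v') / (u' \<star> W)"
  if u: "u \<in> U" "u' \<in> U" "u \<noteq> u'" for u u' and k k' :: int
 proof
  assume "(of_int k - u \<star> v') / (u \<star> W) = (of_int k' - u' \<star> v') / (u' \<star> W)"
  hence "(u' \<star> W) * (of_int k - u \<star> v') = (u \<star> W) * (of_int k' - u' \<star> v')"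
   using W(2)[OF u(1)] W(2)[OF u(2)] by (simp add: field_simps)
  hence "\<eta> * (\<delta> (u, u') \<bullet> \<xi>) = (u \<star> W) * (of_int k' - u' \<star> v) - (u' \<star> W) * (of_int k - u \<star> v)"
   by (simp add: v'_def \<delta>_def inner_diff_left inner_diff_right algebra_simps)
  moreover have "\<delta> (u, u') \<bullet> \<xi> \<noteq> 0" using \<xi>P u by (simp add: P_def)
  ultimately have "\<eta> \<in> bad" unfolding bad_def using u
   by (intro UN_I[of "(u, u')"] UN_I[of k] UN_I[of k']) (auto simp: P_def field_simps)
  thus False using \<eta> by simp
 qed
 ultimately show ?thesis by (rule that)
qed

text \<open>Every cycle on the cone bounds in the torus module, where the inequalities are dropped.
  The bounding chain is pulled back into the cone by letting the apex travel along w: at a critical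
  level only one facet u is touched, and the points on it form a module of the same kind with u
  moved from U to E. There exactness is used in degree p + 1, which keeps card E < p.\<close>

theorem conic_koszul_acyclic:
 fixes E U V :: "(int ^ 'n::finite) set"
 assumes fin: "finite V" and g: "\<And>j. j \<in> {1..CARD('n)} ==> g j \<in> spn (conic_points {} V 0)"
  and alg: "algebraic_monomials CARD('n) g (conic_points {} V 0)"
 shows "E \<subseteq> V ==> U \<subseteq> V ==> (\<And>e. e \<in> E ==> pairing e w = 0) ==> (\<And>u. u \<in> U ==> pairing u w > 0) ==>
  (\<And>x::real ^ 'n. (\<forall>e\<in>E. e \<star> x = 0) ==> (\<forall>u\<in>U. u \<star> x \<ge> 0) ==>
    \<forall>u\<in>V. u \<star> x \<ge> 0) ==>
  card E < p ==> koszul_acyclic CARD('n) g (conic_points E U v) p"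
proof (induction "card U" arbitrary: E U v w p rule: less_induct)
 case (less U E v w p)
 define n where "n = CARD('n)"
 define W where "W = real_vec w"
 define D where "D = conic_points {} V 0"
 have finU: "finite U" and finE: "finite E" using less.prems fin finite_subset by blast+
 have D: "d \<in> D \<longleftrightarrow> (\<forall>u\<in>V. u \<star> real_vec d \<ge> 0)" for d by (simp add: D_def conic_points_def)
 have WE: "e \<star> W = 0" if "e \<in> E" for e using less.prems(3)[OF that] by (simp add: W_def real_vec_inner)
 have WU: "u \<star> W > 0" if "u \<in> U" for u using less.prems(4)[OF that] by (simp add: W_def real_vec_inner)
 show ?case
 proof (cases "\<exists>u\<in>U. \<forall>x. (\<forall>e\<in>E. e \<star> x = 0) --> (\<forall>u'\<in>U - {u}. u' \<star> x \<ge> 0) --> u \<star> x \<ge> 0")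
  case True
  then obtain u where u: "u \<in> U" "\<And>x. (\<forall>e\<in>E. e \<star> x = 0) ==> (\<forall>u'\<in>U - {u}. u' \<star> x \<ge> 0) ==> u \<star> x \<ge> 0" by blast
  have "conic_points E U v = conic_points E (U - {u}) v" using u unfolding conic_points_def by blast
  moreover have "koszul_acyclic CARD('n) g (conic_points E (U - {u}) v) p"
  proof (rule less.hyps[where w = w])
   show "card (U - {u}) < card U" using u(1) finU by (meson card_Diff1_less)
   show "\<forall>u\<in>V. u \<star> x \<ge> 0" if "\<forall>e\<in>E. e \<star> x = 0" "\<forall>u'\<in>U - {u}. u' \<star> x \<ge> 0" for x
    using less.prems(5)[of x] u(2)[of x] that by blast
  qed (use less.prems in auto)
  ultimately show ?thesis by simp
 next
  case False
  \<comment> \<open>As u is irredundant, some x violates only u; the combination of x and W on which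
    u vanishes is positive on all other forms. It is a point in the relative interior of the
    facet.\<close>
  have y: "\<exists>y. (\<forall>e\<in>E. e \<star> y = 0) \<and> u \<star> y = 0 \<and> (\<forall>u'\<in>U - {u}. u' \<star> y > 0)" if u: "u \<in> U" for u
  proof -
   obtain x where x: "\<forall>e\<in>E. e \<star> x = 0" "\<forall>u'\<in>U - {u}. u' \<star> x \<ge> 0" "u \<star> x < 0" using False u by (meson not_le)
   have "u' \<star> ((u \<star> W) *\<^sub>R x - (u \<star> x) *\<^sub>R W) > 0" if "u' \<in> U - {u}" for u'
   proof -
    have "(u \<star> W) * (u' \<star> x) \<ge> 0" using x(2) that WU[OF u] by simp
    moreover have "(u \<star> x) * (u' \<star> W) < 0" using x(3) that WU[of u'] mult_neg_pos by blast
    ultimately show ?thesis by (simp add: inner_diff_right)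
   qed
   thus ?thesis using x WE by (intro exI[of _ "(u \<star> W) *\<^sub>R x - (u \<star> x) *\<^sub>R W"]) (auto simp: inner_diff_right)
  qed
  obtain v' where v': "conic_points E U v' = conic_points E U v" "\<And>u u' k k'. u \<in> U ==> u' \<in> U ==> u \<noteq> u' ==>
    (of_int k - u \<star> v') / (u \<star> W) \<noteq> (of_int k' - u' \<star> v') / (u' \<star> W)" using generic_apex[OF finU WE WU y] by metis
  define T where "T = conic_points E {} v'"
  \<comment> \<open>The closed side of the equations E. Multiplication by D does not leave T' and
    does not return from T' - T to T, so truncation to T commutes with the boundary.\<close>
  define T' where "T' = {m. \<forall>e\<in>E. e \<star> (real_vec m - v') \<ge> 0}"
  define G where "G = conic_points E U v'"
  \<comment> \<open>The time at which the facet hyperplane of u, carried by an apex moving from v'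
    along W, passes through m. The cone itself consists of the points of T whose times are all
    nonnegative.\<close>
  define t where "t u m = (u \<star> (real_vec m - v')) / (u \<star> W)" for u m
  have tdist: "t u m \<noteq> t u' m'" if "u \<in> U" "u' \<in> U" "u \<noteq> u'" for u u' m m'
   using v'(2)[OF that, of "pairing u m" "pairing u' m'"] by (simp add: t_def inner_diff_right real_vec_inner)
  have tshift: "t u (d + m) \<ge> t u m" if "u \<in> U" "d \<in> D" for u d m
  proof -
   have "u \<star> real_vec d \<ge> 0" using that D less.prems(2) by auto
   thus ?thesis using WU[OF that(1)]
    by (simp add: t_def real_vec_add inner_diff_right inner_add_right divide_right_mono)
  qed
  have T'shift: "d + m \<in> T'" if "m \<in> T'" "d \<in> D" for m d using that D less.prems(1)
   by (auto simp: T'_def real_vec_add inner_diff_right inner_add_right intro!: add_nonneg_nonneg) (smt (verit) subsetD)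
  have T'shift_out: "d + m \<notin> T" if m: "m \<in> T'" "m \<notin> T" "d \<in> D" for m d
  proof -
   obtain e where e: "e \<in> E" "e \<star> (real_vec m - v') > 0"
    using m(1,2) by (auto simp: T_def T'_def conic_points_def less_le)
   moreover have "e \<star> real_vec d \<ge> 0" using e(1) D m(3) less.prems(1) by blast
   ultimately have "e \<star> (real_vec (d + m) - v') > 0" by (simp add: real_vec_add inner_diff_right inner_add_right)
   thus ?thesis using e(1) unfolding T_def conic_points_def by (simp, metis less_irrefl)
  qed
  have TT': "T \<subseteq> T'" by (auto simp: T_def T'_def conic_points_def)
  have G_iff: "m \<in> G \<longleftrightarrow> m \<in> T \<and> (\<forall>u\<in>U. t u m \<ge> 0)" for m
  proof -
   have "t u m \<ge> 0 \<longleftrightarrow> u \<star> (real_vec m - v') \<ge> 0" if "u \<in> U" for u using WU[OF that] by (simp add: t_def pos_le_divide_eq)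
   thus ?thesis by (auto simp: G_def T_def conic_points_def)
  qed
  have gD: "g j \<in> spn D" if "j \<in> {1..n}" for j using g that by (simp add: D_def n_def)
  have Tac: "koszul_acyclic n g T p" unfolding n_def T_def
   by (rule conic_torus_acyclic[OF fin g alg less.prems(1) finU less.prems(3,4,5,6)]) auto
  define crit where "crit s = {c. s < c \<and> c < 0 \<and> (\<exists>u\<in>U. \<exists>m. c = t u m)}" for s
  have crit: "finite (crit s)" for s
  proof (rule finite_subset)
   show "crit s \<subseteq> (\<Union>u\<in>U. {c. \<exists>k::int. c = (of_int k - u \<star> v') / (u \<star> W) \<and> s < c \<and> c < 0})"
    by (fastforce simp: crit_def t_def inner_diff_right real_vec_inner)
   show "finite (\<Union>u\<in>U. {c. \<exists>k::int. c = (of_int k - u \<star> v') / (u \<star> W) \<and> s < c \<and> c < 0})"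
    using finU WU by (intro finite_UN_I finite_levels) auto
  qed
  have slice: "koszul_acyclic n g {m \<in> T. t u m = c \<and> (\<forall>u'\<in>U - {u}. t u' m \<ge> c)} (Suc p)" if u: "u \<in> U" for u c
  proof -
   have eU: "u' \<star> (real_vec m - (v' + c *\<^sub>R W)) = (t u' m - c) * (u' \<star> W)" if "u' \<in> U" for u' m
    using WU[OF that] by (simp add: t_def inner_diff_right inner_add_right field_simps)
   have e0: "u' \<star> (real_vec m - (v' + c *\<^sub>R W)) = 0 \<longleftrightarrow> t u' m = c"
    and e1: "u' \<star> (real_vec m - (v' + c *\<^sub>R W)) \<ge> 0 \<longleftrightarrow> t u' m \<ge> c" if "u' \<in> U" for u' m
    unfolding eU[OF that] using WU[OF that] by (simp_all add: zero_le_mult_iff)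
   have e2: "e \<star> (real_vec m - (v' + c *\<^sub>R W)) = e \<star> (real_vec m - v')" if "e \<in> E" for e m
    using WE[OF that] by (simp add: inner_diff_right inner_add_right)
   have "{m \<in> T. t u m = c \<and> (\<forall>u'\<in>U - {u}. t u' m \<ge> c)} = conic_points (insert u E) (U - {u}) (v' + c *\<^sub>R W)"
   proof -
    have "(\<forall>e\<in>E. e \<star> (real_vec m - (v' + c *\<^sub>R W)) = 0) \<longleftrightarrow> m \<in> T" for m by (simp add: T_def conic_points_def e2)
    moreover have "(\<forall>u'\<in>U - {u}. u' \<star> (real_vec m - (v' + c *\<^sub>R W)) \<ge> 0) \<longleftrightarrow> (\<forall>u'\<in>U - {u}. t u' m \<ge> c)" for m
     by (intro ball_cong refl e1) simp
    ultimately show ?thesis unfolding conic_points_def ball_simps by (simp add: e0[OF u] conj_ac)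
   qed
   moreover obtain b where b: "\<And>e. e \<in> insert u E ==> pairing e b = 0" "\<And>u'. u' \<in> U - {u} ==> pairing u' b > 0"
   proof -
    obtain z where z: "\<forall>e\<in>E. e \<star> z = 0" "u \<star> z = 0" "\<forall>u'\<in>U - {u}. u' \<star> z > 0" using y[OF u] by blast
    have "finite (insert u E)" "finite (U - {u})" "\<And>e. e \<in> insert u E ==> e \<star> z = 0"
     "\<And>u'. u' \<in> U - {u} ==> u' \<star> z > 0" using z finE finU by auto
    from integral_solution[OF this(1,3,2,4)] show ?thesis using that by metis
   qed
   moreover have "koszul_acyclic CARD('n) g (conic_points (insert u E) (U - {u}) (v' + c *\<^sub>R W)) (Suc p)"
   proof (rule less.hyps[where w = b])
    show "card (U - {u}) < card U" using u finU by (meson card_Diff1_less)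
    show "card (insert u E) < Suc p" using less.prems(6) finE by (simp add: card_insert_if)
    show "\<forall>u\<in>V. u \<star> x \<ge> 0" if "\<forall>e\<in>insert u E. e \<star> x = 0" "\<forall>u'\<in>U - {u}. u' \<star> x \<ge> 0" for x
     using less.prems(5)[of x] that by (metis Diff_iff insertCI order_refl singletonD)
   qed (use less.prems(1,2) u b in auto)
   ultimately show ?thesis by (simp add: n_def)
  qed
  \<comment> \<open>Induction on the number of critical levels between s and 0. The part of y on the
    lowest critical slice is a cycle there, since z has no monomials below level 0. It bounds in the
    slice, and subtracting that boundary, taken in T, moves y strictly above the level.\<close>
  have push: "\<exists>y\<in>kchain n (Suc p) (spn G). \<forall>J\<subseteq>{1..n}. restr T (kd n g y J) = z J"
   if z: "z \<in> kchain n p (spn G)" and y: "y \<in> kchain n (Suc p) (spn {m \<in> T. \<forall>u\<in>U. s < t u m})"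
    "\<And>J. J \<subseteq> {1..n} ==> restr T (kd n g y J) = z J" for z y s using y
  proof (induction "card (crit s)" arbitrary: s y rule: less_induct)
   case (less s y)
   note IH = less.hyps
   show ?case
   proof (cases "crit s = {}")
    case True
    have "t u m \<ge> 0" if "m \<in> T" "u \<in> U" "s < t u m" for u m
    proof (rule ccontr)
     assume "\<not> t u m \<ge> 0"
     hence "t u m \<in> crit s" using that by (auto simp: crit_def)
     thus False using True by simp
    qed
    hence "{m \<in> T. \<forall>u\<in>U. s < t u m} \<subseteq> G" by (auto simp: G_iff)
    hence "y \<in> kchain n (Suc p) (spn G)" using less.prems(1) kchain_mono by blast
    thus ?thesis using less.prems(2) by blast
   next
    case False
    define c where "c = Min (crit s)"
    have c: "c \<in> crit s" "\<And>c'. c' \<in> crit s ==> c \<le> c'" using False crit by (auto simp: c_def)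
    obtain u where u: "u \<in> U" "\<exists>m. c = t u m" using c(1) by (auto simp: crit_def)
    have c0: "s < c" "c < 0" using c(1) by (auto simp: crit_def)
    define T1 where "T1 = {m \<in> T. \<forall>u\<in>U. c \<le> t u m}"
    define T2 where "T2 = {m \<in> T. \<forall>u\<in>U. c < t u m}"
    define Sl where "Sl = {m \<in> T. t u m = c \<and> (\<forall>u'\<in>U - {u}. t u' m \<ge> c)}"
    have T12: "T1 - Sl = T2" and SlT1: "Sl \<subseteq> T1"
    proof -
     show "Sl \<subseteq> T1" by (auto simp: T1_def Sl_def)
     have "t u' m \<noteq> c" if "u' \<in> U" "u' \<noteq> u" for u' m using u tdist[OF that(1) u(1) that(2)] by auto
     thus "T1 - Sl = T2" unfolding T1_def T2_def Sl_def using u(1) by (auto simp: less_le)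
    qed
    have yT1: "y J \<in> spn T1" for J
    proof -
     have "c \<le> t u m" if "u \<in> U" "s < t u m" for u m
      using c(2)[of "t u m"] c0 that by (cases "t u m < 0") (auto simp: crit_def)
     hence "{m \<in> T. \<forall>u\<in>U. s < t u m} \<subseteq> T1" by (auto simp: T1_def)
     hence "y \<in> kchain n (Suc p) (spn T1)" using less.prems(1) kchain_mono by blast
     thus ?thesis by (simp add: kchain_def)
    qed
    define y2 where "y2 J = restr Sl (y J)" for J
    have y2: "y2 \<in> kchain n (Suc p) (spn Sl)"
    proof -
     have "y2 J \<in> spn Sl" "y2 J \<noteq> 0 ==> y J \<noteq> 0" for J by (auto simp: y2_def restr_spn)
     thus ?thesis using less.prems(1) unfolding kchain_def by blast
    qed
    have "restr Sl (kd n g y2 J) = 0" if J: "J \<subseteq> {1..n}" for J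
    proof -
     have "restr Sl (kd n g y2 J) = restr Sl (kd n g y J)"
     proof (rule restr_kd_cong[OF _ gD _ yT1])
      show "restr Sl (y2 J) = restr Sl (y J)" for J by (simp add: y2_def restr_restr)
      show "y2 J \<in> spn T1" for J using kchain_mono[OF y2 SlT1] by (simp add: kchain_def)
      show "d + m \<notin> Sl" if "d \<in> D" "m \<in> T1" "m \<notin> Sl" for d m
      proof -
       have "c < t u m" using that T12 u(1) by (auto simp: T2_def)
       thus ?thesis using tshift[OF u(1) that(1), of m] by (auto simp: Sl_def)
      qed
     qed
     also have "\<dots> = restr Sl (restr T (kd n g y J))"
      using SlT1 by (auto simp: restr_restr T1_def intro!: arg_cong[where f = "\<lambda>S. restr S _"])
     also have "\<dots> = restr Sl (z J)" using less.prems(2)[OF J] by simp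
     also have "\<dots> = 0"
     proof (rule restr_eq_0)
      have "keys (z J) \<subseteq> G" using z by (auto simp: kchain_def spn_def)
      moreover have "m \<notin> Sl" if "m \<in> G" for m
      proof -
       have "t u m \<ge> 0" using that u(1) by (simp add: G_iff)
       thus ?thesis using c0(2) by (auto simp: Sl_def)
      qed
      ultimately show "keys (z J) \<inter> Sl = {}" by blast
     qed
     finally show ?thesis .
    qed
    then obtain x where x: "x \<in> kchain n (Suc (Suc p)) (spn Sl)" "\<And>J. J \<subseteq> {1..n} ==> restr Sl (kd n g x J) = y2 J"
     using slice[OF u(1), of c] y2 unfolding koszul_acyclic_def Sl_def by blast
    define y' where "y' J = (if J \<subseteq> {1..n} then y J - restr T (kd n g x J) else 0)" for J
    have xT: "x J \<in> spn T" for J using kchain_mono[OF x(1), of T] by (auto simp: kchain_def Sl_def)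
    have xT1: "restr T (kd n g x J) \<in> spn T1" for J
    proof -
     have "kd n g x J \<in> spn {m. \<forall>u\<in>U. c \<le> t u m}"
     proof (rule kd_spn[OF gD])
      show "x J \<in> spn Sl" for J using x(1) by (auto simp: kchain_def)
      show "d + m \<in> {m. \<forall>u\<in>U. c \<le> t u m}" if "d \<in> D" "m \<in> Sl" for d m
       using tshift[OF _ that(1), of _ m] that(2) SlT1 by (fastforce simp: T1_def)
     qed
     thus ?thesis by (auto simp: spn_def keys_restr T1_def)
    qed
    have "y' \<in> kchain n (Suc p) (spn {m \<in> T. \<forall>u\<in>U. c < t u m})"
    proof -
     have "y' J \<in> spn T2" for J
     proof (cases "J \<subseteq> {1..n}")
      case True
      have "y' J \<in> spn T1" using True spn_diff[OF yT1 xT1] by (simp add: y'_def)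
      moreover have "restr Sl (y' J) = 0" using True x(2)[OF True] SlT1
       by (simp add: y'_def restr_diff restr_restr y2_def T1_def Int_absorb2 subset_iff)
      hence "keys (y' J) \<inter> Sl = {}" using keys_restr[of Sl "y' J"] by simp
      ultimately show ?thesis using T12 by (auto simp: spn_def)
     qed (simp add: y'_def)
     moreover have "card J = Suc p" if "y' J \<noteq> 0" for J
     proof (rule ccontr)
      assume *: "card J \<noteq> Suc p"
      have J: "J \<subseteq> {1..n}" using that by (auto simp: y'_def split: if_splits)
      have "submod UNIV (UNIV :: 'n laurent set)" by (simp add: submod_def)
      from kd_kchain[OF this, of n g x "Suc p"] have "kd n g x J = 0"
       using x(1) J * by (auto simp: kchain_def split: if_splits)
      thus False using that J * less.prems(1) by (auto simp: y'_def kchain_def)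
     qed
     ultimately show ?thesis by (auto simp: kchain_def T2_def y'_def split: if_splits)
    qed
    moreover have "restr T (kd n g y' J) = z J" if J: "J \<subseteq> {1..n}" for J
    proof -
     have "kd n g y' J = kd n g (\<lambda>J. y J - restr T (kd n g x J)) J" by (rule kd_cong[OF _ J]) (simp add: y'_def)
     hence "restr T (kd n g y' J) = z J - restr T (kd n g (\<lambda>J. restr T (kd n g x J)) J)"
      using less.prems(2)[OF J] by (simp add: kd_diff restr_diff)
     moreover have "restr T (kd n g (\<lambda>J. restr T (kd n g x J)) J) = restr T (kd n g (kd n g x) J)"
     proof (rule restr_kd_cong[OF _ gD])
      show "restr T (restr T (kd n g x J)) = restr T (kd n g x J)" for J by (simp add: restr_restr)
      show "restr T (kd n g x J) \<in> spn T'" for J using spn_mono[OF restr_spn TT'] .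
      show "kd n g x J \<in> spn T'" for J by (rule kd_spn[OF gD]) (use xT T'shift TT' spn_mono in auto)
     qed (use T'shift_out in auto)
     ultimately show ?thesis using kd_kd[OF J, of g x] by simp
    qed
    moreover have "card (crit c) < card (crit s)"
    proof (rule psubset_card_mono[OF crit])
     have "crit c \<subseteq> crit s" "c \<notin> crit c" using c0 by (auto simp: crit_def)
     thus "crit c \<subset> crit s" using c(1) by blast
    qed
    ultimately show ?thesis using IH[of c y'] by blast
   qed
  qed
  show ?thesis unfolding koszul_acyclic_def v'(1)[symmetric] n_def[symmetric] G_def[symmetric]
  proof (intro ballI impI)
   fix z assume z: "z \<in> kchain n p (spn G)" "\<forall>J\<subseteq>{1..n}. restr G (kd n g z J) = 0"
   have GT: "G \<subseteq> T" by (auto simp: G_iff)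
   have zT: "z \<in> kchain n p (spn T)" by (rule kchain_mono[OF z(1) GT])
   have "restr T (kd n g z J) = 0" if J: "J \<subseteq> {1..n}" for J
   proof -
    have "kd n g z J \<in> spn {m. \<forall>u\<in>U. 0 \<le> t u m}"
    proof (rule kd_spn[OF gD])
     show "z J \<in> spn G" for J using z(1) by (auto simp: kchain_def)
     show "d + m \<in> {m. \<forall>u\<in>U. 0 \<le> t u m}" if "d \<in> D" "m \<in> G" for d m
      using tshift[OF _ that(1), of _ m] that(2) by (fastforce simp: G_iff)
    qed
    hence "restr T (kd n g z J) \<in> spn G" by (auto simp: spn_def keys_restr G_iff)
    hence "restr T (kd n g z J) = restr G (restr T (kd n g z J))" by (simp add: restr_id)
    also have "\<dots> = restr G (kd n g z J)" using GT by (simp add: restr_restr Int_absorb2)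
    finally show ?thesis using z(2) J by simp
   qed
   then obtain y where y: "y \<in> kchain n (Suc p) (spn T)" "\<forall>J\<subseteq>{1..n}. restr T (kd n g y J) = z J"
    using Tac zT unfolding koszul_acyclic_def by blast
   define Y where "Y = (\<lambda>(u, m). t u m) ` (U \<times> (\<Union>J\<in>Pow {1..n}. keys (y J)))"
   have fY: "finite Y" unfolding Y_def using finU by auto
   \<comment> \<open>Below every level that occurs in the finitely many supports of y; the 0 keeps
     the minimum defined when y vanishes.\<close>
   define s where "s = Min (insert 0 Y) - 1"
   have "s < t u m" if "u \<in> U" "m \<in> keys (y J)" for u m J
   proof -
    have "y J \<noteq> 0" using that(2) by auto
    hence "J \<subseteq> {1..n}" using y(1) unfolding kchain_def by blast
    hence "t u m \<in> Y" unfolding Y_def using that by force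
    hence "Min (insert 0 Y) \<le> t u m" using fY by simp
    thus ?thesis by (simp add: s_def)
   qed
   hence "y \<in> kchain n (Suc p) (spn {m \<in> T. \<forall>u\<in>U. s < t u m})" using y(1) by (auto simp: kchain_def spn_def)
   then obtain y' where y': "y' \<in> kchain n (Suc p) (spn G)" "\<forall>J\<subseteq>{1..n}. restr T (kd n g y' J) = z J"
    using push[OF z(1)] y(2) by blast
   have "restr G (kd n g y' J) = z J" if J: "J \<subseteq> {1..n}" for J
   proof -
    have "restr G (kd n g y' J) = restr G (restr T (kd n g y' J))" using GT by (simp add: restr_restr Int_absorb2)
    also have "\<dots> = z J" using y'(2) J z(1) by (simp add: restr_id kchain_def)
    finally show ?thesis .
   qed
   thus "\<exists>y\<in>kchain n (Suc p) (spn G). \<forall>J\<subseteq>{1..n}. restr G (kd n g y J) = z J" using y'(1) by blast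
  qed
 qed
qed

section \<open>Cech complexes of polyhedral covers\<close>

text \<open>The alternating sum over the deletions of one entry. Cochains live on all lists,
  repetitions included, and the complex is augmented: the empty list carries the global
  sections.\<close>

fun cech_d :: "('a list => 'v::ab_group_add) => 'a list => 'v" where "cech_d c [] = 0"
| "cech_d c (x # t) = c t - cech_d (\<lambda>s. c (x # s)) t"

lemma cech_d_diff: "cech_d (\<lambda>t. c t - b t) t = cech_d c t - cech_d b t" by (induction t arbitrary: c b) auto

lemma cech_d_zero: "cech_d (\<lambda>t. 0) t = 0" by (induction t) auto

lemma cech_d_cech_d: "cech_d (cech_d c) t = 0" by (induction t arbitrary: c) (auto simp: cech_d_diff)

lemma cech_d_cong: "t \<in> lists A ==> (\<And>s. s \<in> lists A ==> Suc (length s) = length t ==> c s = b s) ==> cech_d c t = cech_d b t"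
proof (induction t arbitrary: c b)
 case (Cons x t)
 hence "cech_d (\<lambda>s. c (x # s)) t = cech_d (\<lambda>s. b (x # s)) t" by (intro Cons.IH) auto
 thus ?case using Cons.prems by simp
qed simp

lemma cech_d_eq_0:
 assumes "t \<in> lists A" "\<And>s. s \<in> lists A ==> Suc (length s) = length t ==> c s = 0"
 shows "cech_d c t = 0"
proof -
 have "cech_d c t = cech_d (\<lambda>s. 0) t" by (rule cech_d_cong) (use assms in auto)
 thus ?thesis by (simp add: cech_d_zero)
qed

lemma cech_d_hom:
 assumes "\<And>x y. F (x - y) = F x - F y"
 shows "F (cech_d c t) = cech_d (\<lambda>s. F (c s)) t"
proof -
 have "F 0 = 0" using assms[of 0 0] by simp
 thus ?thesis by (induction t arbitrary: c) (auto simp: assms)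
qed

text \<open>The intersection over the empty list is the whole space, so \<open>meets W []\<close>
  says that W is nonempty.\<close>

definition meets :: "'a set => 'a set list => bool" where "meets W t \<longleftrightarrow> W \<inter> \<Inter>(set t) \<noteq> {}"

lemma meets_Cons: "meets W (x # t) \<longleftrightarrow> meets (W \<inter> x) t" by (simp add: meets_def Int_assoc)

lemma meets_mono: "meets W t ==> W \<subseteq> W' ==> meets W' t" unfolding meets_def by blast

lemma cech_d_support: "t \<in> lists A ==> (\<And>s. s \<in> lists A ==> c s \<noteq> 0 ==> \<not> meets W s) ==> cech_d c t \<noteq> 0 ==> \<not> meets W t"
proof (induction t arbitrary: c W)
 case (Cons x t)
 show ?case
 proof (cases "c t = 0")
  case True
  hence "cech_d (\<lambda>s. c (x # s)) t \<noteq> 0" using Cons.prems by simp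
  moreover have "\<not> meets (W \<inter> x) s" if "s \<in> lists A" "c (x # s) \<noteq> 0" for s
   using Cons.prems(2)[of "x # s"] Cons.prems(1) that by (simp add: meets_Cons)
  ultimately have "\<not> meets (W \<inter> x) t" using Cons.prems(1) by (intro Cons.IH[of "\<lambda>s. c (x # s)"]) auto
  thus ?thesis by (simp add: meets_Cons)
 next
  case False
  hence "\<not> meets W t" using Cons.prems by auto
  thus ?thesis unfolding meets_Cons using meets_mono[of "W \<inter> x" t W] by blast
 qed
qed simp

text \<open>The tuples that meet W form a subcomplex of the full simplex on A, the nerve of the
  cover induced on W. Exactness of the cochains vanishing on it, the augmented relative cochains,
  expresses that this nerve has no reduced cohomology.\<close>

definition nerve_acyclic :: "'a set set => 'a set => bool" where "nerve_acyclic A W \<longleftrightarrow> (\<forall>c :: 'a set list => complex.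
   (\<forall>t\<in>lists A. c t \<noteq> 0 --> \<not> meets W t) --> (\<forall>t\<in>lists A. cech_d c t = 0) -->
   (\<exists>b. (\<forall>t\<in>lists A. b t \<noteq> 0 --> \<not> meets W t) \<and> (\<forall>t\<in>lists A. cech_d b t = c t)))"

lemma nerve_acyclicD:
 assumes "nerve_acyclic A W" "\<And>t. t \<in> lists A ==> c t \<noteq> 0 ==> \<not> meets W t" "\<And>t. t \<in> lists A ==> cech_d c t = (0 :: complex)"
 obtains b where "\<And>t. t \<in> lists A ==> b t \<noteq> 0 ==> \<not> meets W t" "\<And>t. t \<in> lists A ==> cech_d b t = c t"
 using assms(1)[unfolded nerve_acyclic_def, rule_format, of c] assms(2,3) by (auto simp: lists_eq_set)

text \<open>Evaluation at tuples with \<sigma> prepended is a contracting homotopy. It respects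
  supports because intersecting with \<sigma> does not change W.\<close>

lemma nerve_acyclic_single:
 assumes "\<sigma> \<in> A" "W \<subseteq> \<sigma>"
 shows "nerve_acyclic A W" unfolding nerve_acyclic_def
proof (intro allI impI)
 fix c :: "'a set list => complex"
 assume c: "\<forall>t\<in>lists A. c t \<noteq> 0 --> \<not> meets W t" "\<forall>t\<in>lists A. cech_d c t = 0"
 show "\<exists>b. (\<forall>t\<in>lists A. b t \<noteq> 0 --> \<not> meets W t) \<and> (\<forall>t\<in>lists A. cech_d b t = c t)"
 proof (intro exI[of _ "\<lambda>t. c (\<sigma> # t)"] conjI ballI impI)
  fix t assume t: "t \<in> lists A"
  show "cech_d (\<lambda>t. c (\<sigma> # t)) t = c t" using c(2)[rule_format, of "\<sigma> # t"] assms(1) t by simp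
  show "\<not> meets W t" if "c (\<sigma> # t) \<noteq> 0"
   using c(1)[rule_format, of "\<sigma> # t"] assms t that by (simp add: meets_Cons Int_absorb2)
 qed
qed

text \<open>Mayer-Vietoris. A tuple that meets both halves meets the wall, since a segment from one
  side to the other stays in the convex intersection. So the cochains for W are those common to W1
  and W2, and a cochain e for the wall splits as e1 + e2 with e1 admissible for W1 and e2 for
  W2.\<close>

lemma nerve_acyclic_cut:
 fixes W :: "'a::real_inner set" and a :: 'a
 defines "W1 \<equiv> W \<inter> {x. a \<bullet> x \<ge> 0}" and "W2 \<equiv> W \<inter> {x. a \<bullet> x \<le> 0}" and "W0 \<equiv> W \<inter> {x. a \<bullet> x = 0}"
 assumes conv: "convex W" "\<And>\<sigma>. \<sigma> \<in> A ==> convex \<sigma>"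
  and acyc: "nerve_acyclic A W1" "nerve_acyclic A W2" "nerve_acyclic A W0"
 shows "nerve_acyclic A W" unfolding nerve_acyclic_def
proof (intro allI impI)
 fix c :: "'a set list => complex"
 assume c: "\<forall>t\<in>lists A. c t \<noteq> 0 --> \<not> meets W t" "\<forall>t\<in>lists A. cech_d c t = 0"
 have sub: "W1 \<subseteq> W" "W2 \<subseteq> W" "W0 \<subseteq> W1" "W0 \<subseteq> W2" by (auto simp: W0_def W1_def W2_def)
 have mW: "meets W t \<longleftrightarrow> meets W1 t \<or> meets W2 t" for t
  unfolding meets_def W1_def W2_def using linear[of 0 "a \<bullet> _"] by fastforce
 have m0: "meets W0 t" if t: "t \<in> lists A" "meets W1 t" "meets W2 t" for t
 proof -
  obtain x y where x: "x \<in> W" "a \<bullet> x \<ge> 0" "x \<in> \<Inter>(set t)" and y: "y \<in> W" "a \<bullet> y \<le> 0" "y \<in> \<Inter>(set t)"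
   using t by (auto simp: meets_def W1_def W2_def)
  have cv: "convex (W \<inter> \<Inter>(set t))" using conv t(1) by (intro convex_Int convex_Inter) auto
  show ?thesis
  proof (cases "a \<bullet> x = 0")
   case True
   thus ?thesis using x by (auto simp: meets_def W0_def)
  next
   case False
   define s where "s = (a \<bullet> x) / (a \<bullet> x - a \<bullet> y)"
   have pos: "a \<bullet> x - a \<bullet> y > 0" using x y False by linarith
   hence s: "0 \<le> s" "s \<le> 1" using x y by (auto simp: s_def pos_divide_le_eq)
   have "(1 - s) *\<^sub>R x + s *\<^sub>R y \<in> W \<inter> \<Inter>(set t)" using convexD[OF cv, of x y "1 - s" s] s x y by auto
   moreover have "s * (a \<bullet> x - a \<bullet> y) = a \<bullet> x" using pos by (simp add: s_def)
   hence "a \<bullet> ((1 - s) *\<^sub>R x + s *\<^sub>R y) = 0" by (simp add: inner_add_right algebra_simps)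
   ultimately show ?thesis unfolding meets_def W0_def by blast
  qed
 qed
 obtain b1 where b1: "\<And>t. t \<in> lists A ==> b1 t \<noteq> 0 ==> \<not> meets W1 t" "\<And>t. t \<in> lists A ==> cech_d b1 t = c t"
  by (rule nerve_acyclicD[OF acyc(1), of c]) (use c mW in blast)+
 obtain b2 where b2: "\<And>t. t \<in> lists A ==> b2 t \<noteq> 0 ==> \<not> meets W2 t" "\<And>t. t \<in> lists A ==> cech_d b2 t = c t"
  by (rule nerve_acyclicD[OF acyc(2), of c]) (use c mW in blast)+
 obtain e where e: "\<And>t. t \<in> lists A ==> e t \<noteq> 0 ==> \<not> meets W0 t" "\<And>t. t \<in> lists A ==> cech_d e t = b1 t - b2 t"
 proof (rule nerve_acyclicD[OF acyc(3), of "\<lambda>t. b1 t - b2 t"])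
  show "\<not> meets W0 t" if "t \<in> lists A" "b1 t - b2 t \<noteq> 0" for t
   using b1(1) b2(1) that meets_mono[OF _ sub(3), of t] meets_mono[OF _ sub(4), of t] by fastforce
  show "cech_d (\<lambda>t. b1 t - b2 t) t = 0" if "t \<in> lists A" for t using b1(2) b2(2) that by (simp add: cech_d_diff)
 qed (rule that)
 define e1 where "e1 t = (if meets W1 t then 0 else e t)" for t
 define e2 where "e2 t = (if meets W1 t then e t else 0)" for t
 define b where "b t = b1 t - cech_d e1 t" for t
 have "\<not> meets W t" if t: "t \<in> lists A" "b t \<noteq> 0" for t
 proof -
  have "\<not> meets W1 t"
  proof
   assume m: "meets W1 t"
   have "\<not> meets W1 s" if "e1 s \<noteq> 0" for s using that by (simp add: e1_def split: if_splits)
   hence "b1 t = 0" "cech_d e1 t = 0" using b1(1)[OF t(1)] m cech_d_support[OF t(1), of e1 W1] by blast+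
   thus False using t(2) by (simp add: b_def)
  qed
  moreover have "\<not> meets W2 t"
  proof
   assume m: "meets W2 t"
   have "\<not> meets W2 s" if "s \<in> lists A" "e2 s \<noteq> 0" for s
    using e(1) m0[of s] that by (auto simp: e2_def split: if_splits)
   hence "b2 t = 0" "cech_d e2 t = 0" using b2(1)[OF t(1)] m cech_d_support[OF t(1), of e2 W2] by blast+
   moreover have "cech_d e1 t = cech_d e t - cech_d e2 t"
    unfolding cech_d_diff[symmetric] by (rule cech_d_cong[OF t(1)]) (simp add: e1_def e2_def)
   ultimately show False using t(2) e(2) t(1) by (simp add: b_def)
  qed
  ultimately show ?thesis using mW by blast
 qed
 moreover have "cech_d b t = c t" if "t \<in> lists A" for t
  using b1(2) that unfolding b_def by (simp add: cech_d_diff cech_d_cech_d)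
 ultimately show "\<exists>b. (\<forall>t\<in>lists A. b t \<noteq> 0 --> \<not> meets W t) \<and> (\<forall>t\<in>lists A. cech_d b t = c t)" by blast
qed

text \<open>Cut \<open>W\<close> along all hyperplanes of the cover: a piece that no hyperplane crosses lies in a single member.\<close>

lemma nerve_acyclic_convex:
 fixes H :: "'a::real_inner set => 'a set"
 assumes "finite A" "A \<noteq> {}" and H: "\<And>\<sigma>. \<sigma> \<in> A ==> finite (H \<sigma>)" "\<And>\<sigma>. \<sigma> \<in> A ==> \<sigma> = {x. \<forall>h\<in>H \<sigma>. h \<bullet> x \<ge> 0}"
 shows "convex W ==> W \<subseteq> \<Union>A ==> nerve_acyclic A W"
proof (induction "card {h \<in> \<Union>(H ` A). (\<exists>x\<in>W. h \<bullet> x > 0) \<and> (\<exists>x\<in>W. h \<bullet> x < 0)}" arbitrary: W rule: less_induct)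
 case (less W)
 define X where "X W = {h \<in> \<Union>(H ` A). (\<exists>x\<in>W. h \<bullet> x > 0) \<and> (\<exists>x\<in>W. h \<bullet> x < 0)}" for W
 have finX: "finite (X W)" for W unfolding X_def using assms by auto
 have cv: "convex \<sigma>" if "\<sigma> \<in> A" for \<sigma>
 proof -
  have "\<sigma> = \<Inter>((\<lambda>h. {x. h \<bullet> x \<ge> 0}) ` H \<sigma>)" using H(2)[OF that] by auto
  moreover have "convex (\<Inter>((\<lambda>h. {x. h \<bullet> x \<ge> 0}) ` H \<sigma>))" by (intro convex_Inter) (auto intro: convex_halfspace_ge)
  ultimately show ?thesis by metis
 qed
 show ?case
 proof (cases "X W = {}")
  case True
  have nc: "h \<bullet> x \<ge> 0" if "h \<in> \<Union>(H ` A)" "w \<in> W" "x \<in> W" "h \<bullet> w > 0" for h w x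
  proof (rule ccontr)
   assume "\<not> h \<bullet> x \<ge> 0"
   hence "h \<bullet> x < 0" by simp
   hence "h \<in> X W" using that unfolding X_def by blast
   thus False using True by simp
  qed
  have nc': "h \<bullet> x \<le> 0" if "h \<in> \<Union>(H ` A)" "w \<in> W" "x \<in> W" "h \<bullet> w < 0" for h w x using nc[of h x w] that by linarith
  show ?thesis
  proof (cases "W = {}")
   case True
   thus ?thesis using nerve_acyclic_single assms(2) by blast
  next
   case False
   \<comment> \<open>A point of W at which every form vanishes only if it vanishes on all of W.
     Midpoints work because no form changes sign on W, so averaging creates no new zeros. Any member
     containing such a point contains W.\<close>
   have "\<exists>w\<in>W. \<forall>h\<in>S. (\<exists>x\<in>W. h \<bullet> x \<noteq> 0) --> h \<bullet> w \<noteq> 0" if "finite S" "S \<subseteq> \<Union>(H ` A)" for S using that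
   proof (induction S rule: finite_induct)
    case empty
    thus ?case using False by blast
   next
    case (insert g S)
    then obtain w where w: "w \<in> W" "\<forall>h\<in>S. (\<exists>x\<in>W. h \<bullet> x \<noteq> 0) --> h \<bullet> w \<noteq> 0" by auto
    show ?case
    proof (cases "\<exists>x\<in>W. g \<bullet> x \<noteq> 0")
     case True
     then obtain x where x: "x \<in> W" "g \<bullet> x \<noteq> 0" by blast
     define w' where "w' = (1/2) *\<^sub>R w + (1/2) *\<^sub>R x"
     have "w' \<in> W" unfolding w'_def using convexD[OF less.prems(1) w(1) x(1), of "1/2" "1/2"] by simp
     moreover have "h \<bullet> w' \<noteq> 0" if h: "h \<in> insert g S" and "\<exists>x\<in>W. h \<bullet> x \<noteq> 0" for h
     proof -
      have hH: "h \<in> \<Union>(H ` A)" using h insert.prems by blast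
      have "h \<bullet> w \<noteq> 0 \<or> h \<bullet> x \<noteq> 0" using h w(2) x that by blast
      moreover have "h \<bullet> w' = (h \<bullet> w + h \<bullet> x) / 2" by (simp add: w'_def inner_add_right add_divide_distrib)
      ultimately show ?thesis using nc[OF hH w(1) x(1)] nc[OF hH x(1) w(1)] nc'[OF hH w(1) x(1)] nc'[OF hH x(1) w(1)]
       by (smt (verit) divide_eq_0_iff)
     qed
     ultimately show ?thesis by blast
    next
     case False
     thus ?thesis using w by blast
    qed
   qed
   from this[of "\<Union>(H ` A)"] obtain w where w: "w \<in> W" "\<forall>h\<in>\<Union>(H ` A). (\<exists>x\<in>W. h \<bullet> x \<noteq> 0) --> h \<bullet> w \<noteq> 0"
    using assms(1) H(1) by auto
   obtain \<sigma> where \<sigma>: "\<sigma> \<in> A" "w \<in> \<sigma>" using w(1) less.prems(2) by blast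
   have "W \<subseteq> \<sigma>"
   proof
    fix x assume x: "x \<in> W"
    have "h \<bullet> x \<ge> 0" if h: "h \<in> H \<sigma>" for h
    proof -
     have hH: "h \<in> \<Union>(H ` A)" using h \<sigma>(1) by blast
     have "h \<bullet> w \<ge> 0" using \<sigma> h H(2)[OF \<sigma>(1)] by blast
     then consider "h \<bullet> w > 0" | "h \<bullet> w = 0" by linarith
     thus ?thesis
     proof cases
      case 2
      hence "h \<bullet> x = 0" using w(2) hH x by blast
      thus ?thesis by simp
     qed (rule nc[OF hH w(1) x])
    qed
    thus "x \<in> \<sigma>" using H(2)[OF \<sigma>(1)] by blast
   qed
   thus ?thesis using nerve_acyclic_single \<sigma>(1) by blast
  qed
 next
  case False
  then obtain a where a: "a \<in> X W" by blast
  have IH: "nerve_acyclic A W'" if W': "W' \<subseteq> W" "convex W'" "a \<notin> X W'" for W'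
  proof (rule less.hyps)
   have "X W' \<subset> X W" using W' a unfolding X_def by blast
   thus "card {h \<in> \<Union>(H ` A). (\<exists>x\<in>W'. h \<bullet> x > 0) \<and> (\<exists>x\<in>W'. h \<bullet> x < 0)}
    < card {h \<in> \<Union>(H ` A). (\<exists>x\<in>W. h \<bullet> x > 0) \<and> (\<exists>x\<in>W. h \<bullet> x < 0)}"
    using psubset_card_mono[OF finX] unfolding X_def by simp
  qed (use W' less.prems in auto)
  show ?thesis by (rule nerve_acyclic_cut[OF less.prems(1) cv, where a = a]; (rule IH)?)
    (auto simp: X_def intro!: convex_Int less.prems(1) convex_halfspace_ge convex_halfspace_le convex_hyperplane)
 qed
qed

text \<open>The differential preserves characters, so the equation is solved for each m separately.
  The solutions are reassembled over the finite set F of characters occurring in c and over the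
  length just below l, which keeps the supports finite.\<close>

lemma cech_exact:
 fixes c :: "'a set list => ('g \<Rightarrow>\<^sub>0 complex)" and W :: "'g => 'a set"
 assumes A: "finite A" and acyc: "\<And>m. nerve_acyclic A (W m)"
  and c: "\<And>t. t \<in> lists A ==> c t \<in> spn {m. \<not> meets (W m) t}" "\<And>t. t \<in> lists A ==> length t \<noteq> l ==> c t = 0"
  and cocycle: "\<And>t. t \<in> lists A ==> cech_d c t = 0"
 obtains b where "\<And>t. b t \<in> spn {m. \<not> meets (W m) t}" "\<And>t. b t \<noteq> 0 ==> t \<in> lists A \<and> Suc (length t) = l"
  "\<And>t. t \<in> lists A ==> cech_d b t = c t"
proof -
 define P where "P m b \<longleftrightarrow> (\<forall>t\<in>lists A. b t \<noteq> 0 --> \<not> meets (W m) t) \<and> (\<forall>t\<in>lists A. cech_d b t = lkp (c t) m)" for m b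
 have "\<exists>b. P m b" for m unfolding P_def
 proof (rule acyc[unfolded nerve_acyclic_def, rule_format])
  show "\<not> meets (W m) t" if "t \<in> lists A" "lkp (c t) m \<noteq> 0" for t
   using c(1)[OF that(1)] that(2) by (auto simp: spn_def in_keys_iff)
  show "cech_d (\<lambda>t. lkp (c t) m) t = 0" if "t \<in> lists A" for t
   using cech_d_hom[of "\<lambda>p. lkp p m" c t] cocycle[OF that] by (simp add: lookup_minus)
 qed
 then obtain b where P: "\<And>m. P m (b m)" by metis
 have b: "\<not> meets (W m) t" if "t \<in> lists A" "b m t \<noteq> 0" for m t using P[of m] that unfolding P_def by blast
 have b': "cech_d (b m) t = lkp (c t) m" if "t \<in> lists A" for m t using P[of m] that unfolding P_def by blast
 define F where "F = (\<Union>t\<in>{t \<in> lists A. length t = l}. keys (c t))"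
 have "finite {t \<in> lists A. length t = l}" using finite_lists_length_eq[OF A, of l] by (simp add: lists_eq_set)
 hence F: "finite F" unfolding F_def by auto
 define B where "B t = (if t \<in> lists A \<and> Suc (length t) = l then \<Sum>m\<in>F. sgl m (b m t) else 0)" for t
 have lB: "lkp (B t) m = (if t \<in> lists A \<and> Suc (length t) = l \<and> m \<in> F then b m t else 0)" for t m
  using F by (auto simp: B_def lookup_sum lookup_single when_def)
 have "cech_d B t = c t" if t: "t \<in> lists A" for t
 proof (rule poly_mapping_eqI)
  fix m
  have *: "lkp (cech_d B t) m = cech_d (\<lambda>s. lkp (B s) m) t"
   using cech_d_hom[of "\<lambda>p. lkp p m" B t] by (simp add: lookup_minus)
  show "lkp (cech_d B t) m = lkp (c t) m"
  proof (cases "length t = l \<and> m \<in> F")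
   case True
   hence "cech_d (\<lambda>s. lkp (B s) m) t = cech_d (b m) t" by (intro cech_d_cong[OF t]) (simp add: lB)
   thus ?thesis using * b'[OF t] by simp
  next
   case False
   hence "cech_d (\<lambda>s. lkp (B s) m) t = 0" by (intro cech_d_eq_0[OF t]) (auto simp: lB)
   moreover have "lkp (c t) m = 0"
    using False c(2)[OF t] t unfolding F_def by (cases "length t = l") (auto simp: in_keys_iff)
   ultimately show ?thesis using * by simp
  qed
 qed
 moreover have "B t \<in> spn {m. \<not> meets (W m) t}" for t using b by (auto simp: spn_def in_keys_iff lB split: if_splits)
 moreover have "t \<in> lists A \<and> Suc (length t) = l" if "B t \<noteq> 0" for t using that by (auto simp: B_def split: if_splits)
 ultimately show ?thesis using that by blast
qed

text \<open>The total complex: Koszul differentials in one direction, Cech differentials in the other.  \<open>Gd J t\<close> is the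
 set of monomials that are regular on the intersection of \<open>t\<close>, in the twist belonging to \<open>J\<close>.\<close>

locale cech_koszul =
 fixes A :: "'a set set" and W :: "nat set => 'g::ab_group_add => 'a set" and n :: nat and f :: "nat => ('g \<Rightarrow>\<^sub>0 complex)"
 assumes A: "finite A" "A \<noteq> {}" and acyc: "\<And>J m. nerve_acyclic A (W J m)"
  and f: "\<And>j J t p. j \<in> {1..n} ==> j \<notin> J ==> t \<in> lists A ==> p \<in> spn {m. \<not> meets (W (insert j J) m) t} ==>
    f j * p \<in> spn {m. \<not> meets (W J m) t}"
  and koszul: "\<And>t q z. t \<in> lists A ==> t \<noteq> [] ==> 1 \<le> q ==>
    (\<And>J. z J \<in> spn {m. \<not> meets (W J m) t}) ==> (\<And>J. z J \<noteq> 0 ==> J \<subseteq> {1..n} \<and> card J = q) ==>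
    (\<And>J. J \<subseteq> {1..n} ==> kd n f z J = 0) ==>
    \<exists>y. (\<forall>J. y J \<in> spn {m. \<not> meets (W J m) t}) \<and> (\<forall>J. y J \<noteq> 0 --> J \<subseteq> {1..n} \<and> card J = Suc q) \<and>
     (\<forall>J\<subseteq>{1..n}. kd n f y J = z J)"
begin

abbreviation "Gd J t \<equiv> {m. \<not> meets (W J m) t}"

text \<open>Bidegree with Koszul degree q and Cech tuples of length l; hence l = 0 holds the global
  terms, and l = 1 one term for each chart.\<close>

definition cochains :: "nat => nat => ('a set list => nat set => ('g \<Rightarrow>\<^sub>0 complex)) set" where
 "cochains q l = {c. \<forall>t J. c t J \<in> spn (Gd J t) \<and> (c t J \<noteq> 0 --> t \<in> lists A \<and> length t = l \<and> J \<subseteq> {1..n} \<and> card J = q)}"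

lemma cochainsD:
 assumes "c \<in> cochains q l"
 shows "c t J \<in> spn (Gd J t)" "c t J \<noteq> 0 ==> t \<in> lists A \<and> length t = l \<and> J \<subseteq> {1..n} \<and> card J = q"
 using assms by (auto simp: cochains_def)

lemma ksign_spn: "p \<in> spn S ==> ksign j J * p \<in> spn S" by (rule submod_ksign[OF submod_spn[of "{}"]]) auto

lemma kd_Gd:
 assumes "\<And>J. z J \<in> spn (Gd J t)" "t \<in> lists A"
 shows "kd n f z J \<in> spn (Gd J t)"
proof -
 have "ksign j J * (f j * z (insert j J)) \<in> spn (Gd J t)" if "j \<in> {1..n} - J" for j
  by (rule ksign_spn, rule f) (use assms that in auto)
 thus ?thesis unfolding kd_def mult.assoc by (intro spn_sum) auto
qed

lemma kd_zero_card:
 assumes "\<And>J. z J \<noteq> 0 ==> J \<subseteq> {1..n} \<and> card J = Suc q" "J \<subseteq> {1..n}" "kd n f z J \<noteq> 0"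
 shows "card J = q"
proof -
 have "submod UNIV (UNIV :: ('g \<Rightarrow>\<^sub>0 complex) set)" by (simp add: submod_def)
 from kd_kchain[OF this, of n f z q] assms show ?thesis by (auto simp: kchain_def split: if_splits)
qed

definition delta :: "('a set list => nat set => ('g \<Rightarrow>\<^sub>0 complex)) => 'a set list => nat set => ('g \<Rightarrow>\<^sub>0 complex)" where
 "delta c t J = (if t \<in> lists A then cech_d (\<lambda>s. c s J) t else 0)"

lemma delta_delta: "t \<in> lists A ==> cech_d (\<lambda>s. delta c s J) t = 0"
 using cech_d_cong[of t A "\<lambda>s. delta c s J" "cech_d (\<lambda>s. c s J)"] by (simp add: delta_def cech_d_cech_d)

lemma cech_cochains:
 assumes "c \<in> cochains q l"
 shows "delta c \<in> cochains q (Suc l)"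
proof -
 have "cech_d (\<lambda>s. c s J) t \<in> spn (Gd J t)" if t: "t \<in> lists A" for t J
 proof -
  have "\<not> meets (W J m) t" if m: "lkp (cech_d (\<lambda>s. c s J) t) m \<noteq> 0" for m
  proof (rule cech_d_support[OF t, of "\<lambda>s. lkp (c s J) m"])
   show "cech_d (\<lambda>s. lkp (c s J) m) t \<noteq> 0"
    using m cech_d_hom[of "\<lambda>p. lkp p m" "\<lambda>s. c s J" t] by (simp add: lookup_minus)
   show "\<not> meets (W J m) s" if "lkp (c s J) m \<noteq> 0" for s
    using that cochainsD(1)[OF assms, of s J] by (auto simp: spn_def in_keys_iff)
  qed
  thus ?thesis by (auto simp: spn_def in_keys_iff)
 qed
 moreover have "length t = Suc l \<and> J \<subseteq> {1..n} \<and> card J = q" if "t \<in> lists A" "cech_d (\<lambda>s. c s J) t \<noteq> 0" for t J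
 proof (rule ccontr)
  assume *: "\<not> ?thesis"
  have "c s J = 0" if "Suc (length s) = length t" for s using cochainsD(2)[OF assms, of s J] * that by fastforce
  thus False using that(2) cech_d_eq_0[OF that(1), of "\<lambda>s. c s J"] by blast
 qed
 ultimately show ?thesis by (auto simp: cochains_def delta_def)
qed

lemma cech_kd: "cech_d (\<lambda>s. kd n f (c s) J) t = kd n f (\<lambda>J. cech_d (\<lambda>s. c s J) t) J"
 by (induction t arbitrary: c) (auto simp: kd_zero kd_diff)

lemma cech_solve:
 assumes c: "c \<in> cochains q (Suc l)" and cocycle: "\<And>t J. t \<in> lists A ==> cech_d (\<lambda>s. c s J) t = 0"
 obtains v where "v \<in> cochains q l" "\<And>t J. t \<in> lists A ==> cech_d (\<lambda>s. v s J) t = c t J"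
proof -
 define P where "P J b \<longleftrightarrow> (\<forall>t. b t \<in> spn (Gd J t)) \<and>
  (\<forall>t. b t \<noteq> 0 --> t \<in> lists A \<and> length t = l \<and> J \<subseteq> {1..n} \<and> card J = q) \<and> (\<forall>t\<in>lists A. cech_d b t = c t J)" for J b
 have "\<exists>b. P J b" for J
 proof (cases "J \<subseteq> {1..n} \<and> card J = q")
  case True
  obtain b where "\<And>t. b t \<in> spn (Gd J t)" "\<And>t. b t \<noteq> 0 ==> t \<in> lists A \<and> Suc (length t) = Suc l"
   "\<And>t. t \<in> lists A ==> cech_d b t = c t J"
  proof (rule cech_exact[OF A(1) acyc, where c = "\<lambda>t. c t J" and l = "Suc l"])
   show "c t J = 0" if "length t \<noteq> Suc l" for t using cochainsD(2)[OF c] that by blast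
   show "c t J \<in> spn (Gd J t)" for t by (rule cochainsD(1)[OF c])
   show "cech_d (\<lambda>t. c t J) t = 0" if "t \<in> lists A" for t by (rule cocycle[OF that])
  qed (rule that)
  thus ?thesis using True unfolding P_def by blast
 next
  case False
  hence "c t J = 0" for t using cochainsD(2)[OF c] by blast
  thus ?thesis unfolding P_def by (intro exI[of _ "\<lambda>t. 0"]) (simp add: cech_d_zero)
 qed
 then obtain b where P: "\<And>J. P J (b J)" by metis
 have "(\<lambda>t J. b J t) \<in> cochains q l" unfolding cochains_def using P unfolding P_def by blast
 moreover have "cech_d (\<lambda>s. b J s) t = c t J" if "t \<in> lists A" for t J using P[of J] that unfolding P_def by blast
 ultimately show ?thesis using that[of "\<lambda>t J. b J t"] by simp
qed

text \<open>Let e be the Cech differential of the given y'. It is a Koszul cycle because c is a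
  cocycle, so it bounds locally, and by induction, descending in the Koszul degree, it bounds a
  cocycle w. Writing w as the Cech differential of v, the correction of y' by the Koszul boundary of
  v makes it closed without changing its own boundary. The induction ends at q = n, where no index
  set of size q + 1 is left.\<close>

lemma lift_cocycle:
 assumes "l \<ge> 1" "c \<in> cochains q l" "\<And>t J. t \<in> lists A ==> cech_d (\<lambda>s. c s J) t = 0"
  and "y' \<in> cochains (Suc q) l" "\<And>t J. t \<in> lists A ==> J \<subseteq> {1..n} ==> kd n f (y' t) J = c t J"
 shows "\<exists>y\<in>cochains (Suc q) l. (\<forall>t\<in>lists A. \<forall>J\<subseteq>{1..n}. kd n f (y t) J = c t J) \<and>
   (\<forall>t\<in>lists A. \<forall>J. cech_d (\<lambda>s. y s J) t = 0)" using assms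
proof (induction "n - q" arbitrary: q l c y' rule: less_induct)
 case less
 note c = less.prems(2,3) and y' = less.prems(4,5)
 show ?case
 proof (cases "q < n")
  case False
  have "y' t J = 0" for t J
  proof (rule ccontr)
   assume "y' t J \<noteq> 0"
   hence "J \<subseteq> {1..n}" "card J = Suc q" using cochainsD(2)[OF y'(1)] by blast+
   thus False using card_mono[of "{1..n}" J] False by simp
  qed
  thus ?thesis using y' by (intro bexI[of _ y']) (auto simp: cech_d_zero)
 next
  case True
  define e where "e = delta y'"
  have e: "e \<in> cochains (Suc q) (Suc l)" and ecoc: "\<And>t J. t \<in> lists A ==> cech_d (\<lambda>s. e s J) t = 0"
   unfolding e_def by (rule cech_cochains[OF y'(1)], rule delta_delta)
  have kde: "kd n f (e t) J = 0" if t: "t \<in> lists A" "J \<subseteq> {1..n}" for t J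
  proof -
   have "kd n f (e t) J = cech_d (\<lambda>s. kd n f (y' s) J) t" using t by (simp add: e_def delta_def[abs_def] cech_kd)
   also have "\<dots> = cech_d (\<lambda>s. c s J) t" by (rule cech_d_cong[OF t(1)]) (use y'(2) t in auto)
   finally show ?thesis using c(2)[OF t(1)] by simp
  qed
  define P where "P t y \<longleftrightarrow> (\<forall>J. y J \<in> spn (Gd J t)) \<and>
   (\<forall>J. y J \<noteq> 0 --> t \<in> lists A \<and> length t = Suc l \<and> J \<subseteq> {1..n} \<and> card J = Suc (Suc q)) \<and>
   (\<forall>J\<subseteq>{1..n}. t \<in> lists A --> kd n f y J = e t J)" for t y
  have "\<exists>y. P t y" for t
  proof (cases "t \<in> lists A \<and> length t = Suc l")
   case True
   have "\<exists>y. (\<forall>J. y J \<in> spn (Gd J t)) \<and> (\<forall>J. y J \<noteq> 0 --> J \<subseteq> {1..n} \<and> card J = Suc (Suc q)) \<and>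
     (\<forall>J\<subseteq>{1..n}. kd n f y J = e t J)"
   proof (rule koszul)
    show "t \<in> lists A" "t \<noteq> []" "1 \<le> Suc q" using True by auto
    show "e t J \<in> spn (Gd J t)" for J by (rule cochainsD(1)[OF e])
    show "J \<subseteq> {1..n} \<and> card J = Suc q" if "e t J \<noteq> 0" for J using cochainsD(2)[OF e that] by blast
    show "kd n f (e t) J = 0" if "J \<subseteq> {1..n}" for J using kde True that by blast
   qed
   then obtain y where y: "\<forall>J. y J \<in> spn (Gd J t)" "\<forall>J. y J \<noteq> 0 --> J \<subseteq> {1..n} \<and> card J = Suc (Suc q)"
    "\<forall>J\<subseteq>{1..n}. kd n f y J = e t J" by (elim exE conjE)
   hence "P t y" unfolding P_def using True by simp
   thus ?thesis by blast
  next
   case False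
   hence "e t J = 0" for J using cochainsD(2)[OF e] by blast
   thus ?thesis unfolding P_def by (intro exI[of _ "\<lambda>J. 0"]) (simp add: kd_zero)
  qed
  then obtain w' where P: "\<And>t. P t (w' t)" by metis
  have w': "w' \<in> cochains (Suc (Suc q)) (Suc l)"
  proof (unfold cochains_def, intro CollectI allI conjI)
   fix t J
   show "w' t J \<in> spn (Gd J t)" by (rule P[unfolded P_def, THEN conjunct1, THEN spec])
   show "w' t J \<noteq> 0 --> t \<in> lists A \<and> length t = Suc l \<and> J \<subseteq> {1..n} \<and> card J = Suc (Suc q)"
    by (rule P[unfolded P_def, THEN conjunct2, THEN conjunct1, THEN spec])
  qed
  have kdw': "kd n f (w' t) J = e t J" if "t \<in> lists A" "J \<subseteq> {1..n}" for t J
   using P[of t, unfolded P_def, THEN conjunct2, THEN conjunct2, THEN spec, of J] that by simp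
  have "\<exists>w\<in>cochains (Suc (Suc q)) (Suc l). (\<forall>t\<in>lists A. \<forall>J\<subseteq>{1..n}. kd n f (w t) J = e t J) \<and>
    (\<forall>t\<in>lists A. \<forall>J. cech_d (\<lambda>s. w s J) t = 0)"
   by (rule less.hyps[OF _ _ e ecoc w' kdw']) (use True less.prems(1) in auto)
  then obtain w where w0: "w \<in> cochains (Suc (Suc q)) (Suc l)"
   and w1: "\<forall>t\<in>lists A. \<forall>J\<subseteq>{1..n}. kd n f (w t) J = e t J"
   and w2: "\<forall>t\<in>lists A. \<forall>J. cech_d (\<lambda>s. w s J) t = 0" by (elim bexE conjE)
  note w = w0 w1[THEN bspec, THEN spec, THEN mp] w2[THEN bspec, THEN spec]
  obtain v where v: "v \<in> cochains (Suc (Suc q)) l" "\<And>t J. t \<in> lists A ==> cech_d (\<lambda>s. v s J) t = w t J"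
   using cech_solve[OF w(1,3)] by blast
  define y where "y t J = (if t \<in> lists A \<and> J \<subseteq> {1..n} then y' t J - kd n f (v t) J else 0)" for t J
  have y: "y \<in> cochains (Suc q) l"
  proof -
   have "y t J \<in> spn (Gd J t)" for t J using kd_Gd[of "v t" t J] cochainsD(1)[OF v(1)] cochainsD(1)[OF y'(1)]
    by (auto simp: y_def intro!: spn_diff)
   moreover have "length t = l \<and> card J = Suc q" if "y' t J - kd n f (v t) J \<noteq> 0" "t \<in> lists A" "J \<subseteq> {1..n}" for t J
   proof (cases "y' t J = 0")
    case True
    hence k: "kd n f (v t) J \<noteq> 0" using that(1) by simp
    hence "card J = Suc q" by (intro kd_zero_card[OF _ that(3) k]) (use cochainsD(2)[OF v(1)] in blast)
    moreover have "length t = l"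
    proof (rule ccontr)
     assume "length t \<noteq> l"
     hence "v t = (\<lambda>J. 0)" using cochainsD(2)[OF v(1)] by blast
     thus False using k by (simp add: kd_zero)
    qed
    ultimately show ?thesis by simp
   qed (use cochainsD(2)[OF y'(1)] in blast)
   ultimately show ?thesis by (auto simp: cochains_def y_def split: if_splits)
  qed
  have kdy: "kd n f (y t) J = c t J" if "t \<in> lists A" "J \<subseteq> {1..n}" for t J
  proof -
   have "kd n f (y t) J = kd n f (\<lambda>J. y' t J - kd n f (v t) J) J"
    by (rule kd_cong[OF _ that(2)]) (simp add: y_def that(1))
   also have "\<dots> = c t J" using y'(2)[OF that] kd_kd[OF that(2)] by (simp add: kd_diff)
   finally show ?thesis .
  qed
  have cdy: "cech_d (\<lambda>s. y s J) t = 0" if t: "t \<in> lists A" for t J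
  proof (cases "J \<subseteq> {1..n}")
   case True
   have "cech_d (\<lambda>s. y s J) t = cech_d (\<lambda>s. y' s J - kd n f (v s) J) t"
    by (rule cech_d_cong[OF t]) (use True in \<open>simp add: y_def\<close>)
   also have "\<dots> = e t J - kd n f (\<lambda>J. w t J) J" using t v(2)[OF t] by (simp add: cech_d_diff cech_kd e_def delta_def)
   also have "\<dots> = 0" using w(2)[OF t True] by simp
   finally show ?thesis .
  next
   case False
   thus ?thesis by (intro cech_d_eq_0[OF t]) (simp add: y_def)
  qed
  show ?thesis using y kdy cdy by (intro bexI[of _ y]) simp_all
 qed
qed

text \<open>The image of the last Koszul differential over the intersection of t: the sections in
  the twist of the empty index set that lie in the ideal there.\<close>

definition image_ideal :: "'a set list => ('g \<Rightarrow>\<^sub>0 complex) set" where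
 "image_ideal t = {\<Sum>j\<in>{1..n}. f j * y j | y. \<forall>j\<in>{1..n}. y j \<in> spn (Gd {j} t)}"

lemma kd_empty: "kd n f z {} = (\<Sum>j\<in>{1..n}. f j * z {j})" by (simp add: kd_def ksign_def)

lemma image_ideal_iff: "x \<in> image_ideal t \<longleftrightarrow>
  (\<exists>z. (\<forall>J. z J \<in> spn (Gd J t)) \<and> (\<forall>J. z J \<noteq> 0 --> J \<subseteq> {1..n} \<and> card J = 1) \<and> kd n f z {} = x)"
proof
 assume "x \<in> image_ideal t"
 then obtain y where y: "x = (\<Sum>j\<in>{1..n}. f j * y j)" "\<forall>j\<in>{1..n}. y j \<in> spn (Gd {j} t)" by (auto simp: image_ideal_def)
 define z where "z J = (if \<exists>j\<in>{1..n}. J = {j} then y (the_elem J) else 0)" for J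
 have "z J \<in> spn (Gd J t)" for J using y(2) by (auto simp: z_def)
 moreover have "J \<subseteq> {1..n} \<and> card J = 1" if "z J \<noteq> 0" for J using that by (auto simp: z_def split: if_splits)
 moreover have "kd n f z {} = x" unfolding kd_empty y(1) by (intro sum.cong) (auto simp: z_def)
 ultimately show "\<exists>z. (\<forall>J. z J \<in> spn (Gd J t)) \<and> (\<forall>J. z J \<noteq> 0 --> J \<subseteq> {1..n} \<and> card J = 1) \<and> kd n f z {} = x" by blast
qed (auto simp: image_ideal_def kd_empty)

lemma kd_image_ideal:
 assumes "y \<in> cochains 1 l"
 shows "kd n f (y t) {} \<in> image_ideal t" unfolding image_ideal_iff using cochainsD[OF assms] by blast

text \<open>Local membership gives a chain of Koszul degree 1, which \<open>lift_cocycle\<close>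
  makes closed and \<open>cech_solve\<close> makes exact. So c is the Koszul boundary of a Cech
  coboundary, and the tuple length has dropped by one.\<close>

lemma boundary_of_local:
 assumes c: "c \<in> cochains 0 (Suc l)" "\<And>t J. t \<in> lists A ==> cech_d (\<lambda>s. c s J) t = 0"
  and loc: "\<And>t. t \<in> lists A ==> length t = Suc l ==> c t {} \<in> image_ideal t"
 obtains v where "v \<in> cochains 1 l" "\<And>t. t \<in> lists A ==> kd n f (\<lambda>J. cech_d (\<lambda>s. v s J) t) {} = c t {}"
proof -
 define P where "P t y \<longleftrightarrow> (\<forall>J. y J \<in> spn (Gd J t)) \<and>
   (\<forall>J. y J \<noteq> 0 --> t \<in> lists A \<and> length t = Suc l \<and> J \<subseteq> {1..n} \<and> card J = 1) \<and> kd n f y {} = c t {}" for t y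
 have "\<exists>y. P t y" for t
 proof (cases "t \<in> lists A \<and> length t = Suc l")
  case True
  thus ?thesis using loc[of t] unfolding P_def image_ideal_iff by auto
 next
  case False
  hence "c t {} = 0" using cochainsD(2)[OF c(1)] by blast
  thus ?thesis unfolding P_def by (intro exI[of _ "\<lambda>J. 0"]) (auto simp: kd_zero)
 qed
 then obtain y' where P: "\<And>t. P t (y' t)" by metis
 have y': "y' \<in> cochains (Suc 0) (Suc l)" unfolding cochains_def using P unfolding P_def by auto
 have "kd n f (y' t) J = c t J" if "t \<in> lists A" "J \<subseteq> {1..n}" for t J
 proof (cases "J = {}")
  case False
  hence "card J \<noteq> 0" using that finite_subset by fastforce
  hence "kd n f (y' t) J = 0" "c t J = 0"
   using kd_zero_card[of "y' t" 0 J] cochainsD(2)[OF y', of t] cochainsD(2)[OF c(1), of t J] that by auto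
  thus ?thesis by simp
 qed (use P in \<open>simp add: P_def\<close>)
 then obtain y where y: "y \<in> cochains (Suc 0) (Suc l)" "\<forall>t\<in>lists A. \<forall>J\<subseteq>{1..n}. kd n f (y t) J = c t J"
  "\<forall>t\<in>lists A. \<forall>J. cech_d (\<lambda>s. y s J) t = 0" using lift_cocycle[OF _ c y'] by auto
 obtain v where v: "v \<in> cochains (Suc 0) l" "\<And>t J. t \<in> lists A ==> cech_d (\<lambda>s. v s J) t = y t J"
  using cech_solve[of y "Suc 0" l] y by auto
 show ?thesis by (rule that[of v]) (use v y(2) in auto)
qed

text \<open>A global section is the constant cocycle on tuples of length one. The chain obtained
  from it has length zero, so it is a global presentation of x by the generators.\<close>

theorem image_ideal_global:
 assumes x: "x \<in> spn (Gd {} [])" and loc: "\<And>\<sigma>. \<sigma> \<in> A ==> x \<in> image_ideal [\<sigma>]"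
 shows "x \<in> image_ideal []"
proof -
 define c where "c t J = (if t \<in> lists A \<and> length t = 1 \<and> J = {} then x else 0)" for t and J :: "nat set"
 have sub: "spn (Gd {} []) \<subseteq> spn (Gd {} t)" for t by (auto simp: spn_def meets_def)
 have c: "c \<in> cochains 0 (Suc 0)" using x sub by (auto simp: cochains_def c_def)
 have coc: "cech_d (\<lambda>s. c s J) t = 0" if t: "t \<in> lists A" for t J
 proof (cases "length t = 2")
  case True
  then obtain a b where "t = [a, b]" by (auto simp: numeral_2_eq_2 length_Suc_conv)
  thus ?thesis using t by (simp add: c_def)
 qed (intro cech_d_eq_0[OF t], auto simp: c_def)
 obtain v where v: "v \<in> cochains 1 0" "\<And>t. t \<in> lists A ==> kd n f (\<lambda>J. cech_d (\<lambda>s. v s J) t) {} = c t {}"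
 proof (rule boundary_of_local[OF c coc])
  show "c t {} \<in> image_ideal t" if "t \<in> lists A" "length t = Suc 0" for t
   using that loc by (auto simp: c_def length_Suc_conv)
 qed (assumption, rule that)
 obtain \<sigma> where \<sigma>: "\<sigma> \<in> A" using A(2) by blast
 hence "kd n f (v []) {} = x" using v(2)[of "[\<sigma>]"] by (simp add: c_def)
 thus ?thesis using kd_image_ideal[of v 0 "[]"] v(1) by simp
qed

text \<open>The differences of the x \<sigma> form a cocycle lying locally in the ideal, hence the
  Koszul boundary of a coboundary of some v. Correcting x \<sigma> by the boundary of v over
  \<sigma> makes the sections agree exactly, so they come from one global section.\<close>

theorem image_ideal_glue:
 assumes x: "\<And>\<sigma>. \<sigma> \<in> A ==> x \<sigma> \<in> spn (Gd {} [\<sigma>])"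
  and loc: "\<And>\<sigma> \<tau>. \<sigma> \<in> A ==> \<tau> \<in> A ==> x \<tau> - x \<sigma> \<in> image_ideal [\<sigma>, \<tau>]"
 obtains X where "X \<in> spn (Gd {} [])" "\<And>\<sigma>. \<sigma> \<in> A ==> X - x \<sigma> \<in> image_ideal [\<sigma>]"
proof -
 define g where "g t J = (if t \<in> lists A \<and> length t = Suc 0 \<and> J = {} then x (hd t) else 0)" for t and J :: "nat set"
 have g: "g \<in> cochains 0 (Suc 0)" using x by (fastforce simp: cochains_def g_def length_Suc_conv)
 have dg: "delta g \<in> cochains 0 (Suc (Suc 0))" using cech_cochains[OF g] by simp
 obtain v where v: "v \<in> cochains 1 (Suc 0)" "\<And>t. t \<in> lists A ==> kd n f (\<lambda>J. cech_d (\<lambda>s. v s J) t) {} = delta g t {}"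
 proof (rule boundary_of_local[OF dg delta_delta])
  show "delta g t {} \<in> image_ideal t" if "t \<in> lists A" "length t = Suc (Suc 0)" for t
   using that loc by (auto simp: delta_def g_def length_Suc_conv)
 qed (assumption, rule that)
 define h where "h t J = (if t \<in> lists A \<and> J = {} then g t J - kd n f (v t) J else 0)" for t J
 have hc: "h \<in> cochains 0 (Suc 0)"
 proof -
  have "h t J \<in> spn (Gd J t)" for t J
   using kd_Gd[of "v t" t J] cochainsD(1)[OF v(1)] cochainsD(1)[OF g] by (auto simp: h_def intro!: spn_diff)
  moreover have "length t = Suc 0" if "h t J \<noteq> 0" for t J
  proof (rule ccontr)
   assume "length t \<noteq> Suc 0"
   hence "v t = (\<lambda>J. 0)" "g t J = 0" using cochainsD(2)[OF v(1)] cochainsD(2)[OF g] by blast+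
   thus False using that by (simp add: h_def kd_zero split: if_splits)
  qed
  ultimately show ?thesis by (auto simp: cochains_def h_def split: if_splits)
 qed
 have hcoc: "cech_d (\<lambda>s. h s J) t = 0" if t: "t \<in> lists A" for t J
 proof (cases "J = {}")
  case True
  have "cech_d (\<lambda>s. h s J) t = cech_d (\<lambda>s. g s J - kd n f (v s) J) t" by (rule cech_d_cong[OF t]) (simp add: h_def True)
  also have "\<dots> = 0" using t v(2)[OF t] by (simp add: cech_d_diff cech_kd delta_def True)
  finally show ?thesis .
 next
  case False
  thus ?thesis by (intro cech_d_eq_0[OF t]) (simp add: h_def)
 qed
 obtain b where b: "b \<in> cochains 0 0" "\<And>t J. t \<in> lists A ==> cech_d (\<lambda>s. b s J) t = h t J"
  by (rule cech_solve[OF hc]) (rule hcoc, assumption, rule that)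
 have "b [] {} \<in> spn (Gd {} [])" using cochainsD(1)[OF b(1)] .
 moreover have "b [] {} - x \<sigma> \<in> image_ideal [\<sigma>]" if "\<sigma> \<in> A" for \<sigma>
 proof -
  have "b [] {} = x \<sigma> - kd n f (v [\<sigma>]) {}" using b(2)[of "[\<sigma>]" "{}"] that by (simp add: h_def g_def)
  hence "b [] {} - x \<sigma> = kd n f (\<lambda>J. - v [\<sigma>] J) {}" using kd_diff[of n f "\<lambda>J. 0" "v [\<sigma>]" "{}"] by (simp add: kd_zero)
  moreover have "- v [\<sigma>] J \<in> spn (Gd J [\<sigma>])" for J
   using spn_diff[of 0 "Gd J [\<sigma>]" "v [\<sigma>] J"] cochainsD(1)[OF v(1)] by simp
  ultimately show ?thesis unfolding image_ideal_iff using cochainsD(2)[OF v(1)]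
   by (intro exI[of _ "\<lambda>J. - v [\<sigma>] J"]) auto
 qed
 ultimately show ?thesis using that by blast
qed

end

section \<open>Complete rational fans\<close>

lemma finite_cone_hull:
 fixes S :: "'a::real_vector set"
 assumes "finite S"
 shows "convex_cone hull S = {\<Sum>x\<in>S. c x *\<^sub>R x | c. \<forall>x. c x \<ge> 0}" (is "_ = ?R")
proof
 have "S \<subseteq> ?R"
 proof
  fix x assume "x \<in> S"
  thus "x \<in> ?R" using assms
   by (intro CollectI exI[of _ "\<lambda>y. if y = x then 1 else 0"]) (simp add: if_distrib[of "\<lambda>c. c *\<^sub>R _"] cong: if_cong)
 qed
 moreover have "convex_cone ?R" unfolding convex_cone_iff
 proof (intro conjI ballI allI impI)
  show "0 \<in> ?R" by (intro CollectI exI[of _ "\<lambda>y. 0"]) simp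
  fix x y assume "x \<in> ?R" "y \<in> ?R"
  then obtain c d where "x = (\<Sum>x\<in>S. c x *\<^sub>R x)" "y = (\<Sum>x\<in>S. d x *\<^sub>R x)" "\<forall>x. c x \<ge> 0" "\<forall>x. d x \<ge> 0" by auto
  thus "x + y \<in> ?R" by (intro CollectI exI[of _ "\<lambda>x. c x + d x"]) (simp add: scaleR_add_left sum.distrib)
 next
  fix x and k :: real assume "x \<in> ?R" "k \<ge> 0"
  then obtain c where "x = (\<Sum>x\<in>S. c x *\<^sub>R x)" "\<forall>x. c x \<ge> 0" by auto
  thus "k *\<^sub>R x \<in> ?R" using \<open>k \<ge> 0\<close> by (intro CollectI exI[of _ "\<lambda>x. k * c x"]) (simp add: scaleR_sum_right)
 qed
 ultimately show "convex_cone hull S \<subseteq> ?R" by (intro hull_minimal)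
 show "?R \<subseteq> convex_cone hull S"
 proof clarify
  fix c :: "'a => real" assume c: "\<forall>x. c x \<ge> 0"
  have "(\<Sum>x\<in>T. c x *\<^sub>R x) \<in> convex_cone hull S" if "finite T" "T \<subseteq> S" for T using that
  proof (induction T rule: finite_induct)
   case (insert x T)
   hence "c x *\<^sub>R x \<in> convex_cone hull S" using c by (intro convex_cone_hull_mul hull_inc) auto
   thus ?case using insert by (simp add: convex_cone_hull_add)
  qed (simp add: convex_cone_hull_contains_0)
  thus "(\<Sum>x\<in>S. c x *\<^sub>R x) \<in> convex_cone hull S" using assms by blast
 qed
qed

lemma strongly_convexD:
 assumes "strongly_convex \<sigma>" "x \<in> \<sigma>" "- x \<in> \<sigma>"
 shows "x = 0"
proof -
 have "x \<in> \<sigma> \<inter> uminus ` \<sigma>" using assms(2,3) by (auto intro: image_eqI[of _ _ "- x"])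
 thus ?thesis using assms(1) unfolding strongly_convex_def by blast
qed

text \<open>The primitive generator is the shortest nonzero lattice point of the ray. Writing any
  other as t times it and removing the integral part of t leaves a shorter lattice point of the ray,
  hence 0.\<close>

lemma ray_lattice_points:
 fixes \<tau> :: "(real ^ 'n::finite) set"
 assumes "rational_polyhedral_cone \<tau>" "strongly_convex \<tau>" "aff_dim \<tau> = 1"
 obtains u where "u \<noteq> 0" "\<tau> = {t *\<^sub>R real_vec u | t. t \<ge> 0}" "{v. real_vec v \<in> \<tau>} = range (\<lambda>c. int c *s u)"
proof -
 obtain V where V: "finite V" "\<tau> = convex_cone hull (real_vec ` V)"
  using assms(1) by (auto simp: rational_polyhedral_cone_def)
 have cc: "convex_cone \<tau>" using V(2) convex_cone_convex_cone_hull by auto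
 hence cone: "0 \<in> \<tau>" "\<And>x y. x \<in> \<tau> ==> y \<in> \<tau> ==> x + y \<in> \<tau>" "\<And>c x. c \<ge> 0 ==> x \<in> \<tau> ==> c *\<^sub>R x \<in> \<tau>"
  by (auto simp: convex_cone_iff)
 have "\<exists>v\<in>V. v \<noteq> 0"
 proof (rule ccontr)
  assume "\<not> (\<exists>v\<in>V. v \<noteq> 0)"
  hence "real_vec ` V \<subseteq> {0}" by auto
  hence "\<tau> \<subseteq> {0}" unfolding V(2) by (intro hull_minimal) simp_all
  hence "aff_dim \<tau> \<le> aff_dim {0 :: real ^ 'n}" by (rule aff_dim_subset)
  thus False using assms(3) by simp
 qed
 then obtain v0 where v0: "v0 \<noteq> 0" "real_vec v0 \<in> \<tau>" unfolding V(2) by (auto intro: hull_inc)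
 have dim: "dim \<tau> = 1" using aff_dim_zero[of \<tau>] cone(1) assms(3) by (simp add: hull_inc)
 have sp: "\<tau> \<subseteq> span {v}" if "v \<in> \<tau>" "v \<noteq> 0" for v by (rule card_ge_dim_independent) (use that dim in auto)
 have line: "\<exists>t\<ge>0. x = t *\<^sub>R v" if "v \<in> \<tau>" "v \<noteq> 0" "x \<in> \<tau>" for v x
 proof -
  have "x \<in> span {v}" using sp[OF that(1,2)] that(3) by blast
  then obtain t where t: "x = t *\<^sub>R v" by (auto simp: span_singleton)
  have "t \<ge> 0"
  proof (rule ccontr)
   assume "\<not> t \<ge> 0"
   hence "(- 1 / t) *\<^sub>R x \<in> \<tau>" "(- 1 / t) *\<^sub>R x = - v" using cone(3)[OF _ that(3), of "- 1 / t"] t by auto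
   thus False using strongly_convexD[OF assms(2) that(1)] that(2) by simp
  qed
  thus ?thesis using t by blast
 qed
 define P where "P v \<longleftrightarrow> v \<noteq> 0 \<and> real_vec v \<in> \<tau>" for v
 have "\<exists>u. P u \<and> (\<forall>v. P v --> nat (pairing u u) \<le> nat (pairing v v))"
  by (rule ex_has_least_nat[of P v0]) (use v0 in \<open>simp add: P_def\<close>)
 then obtain u where u: "P u" "\<And>v. P v ==> nat (pairing u u) \<le> nat (pairing v v)" by blast
 have u0: "u \<noteq> 0" "real_vec u \<in> \<tau>" "real_vec u \<noteq> 0" using u(1) real_vec_eq[of u 0] by (auto simp: P_def)
 have "\<tau> = {t *\<^sub>R real_vec u | t. t \<ge> 0}" using line[OF u0(2,3)] cone(3)[OF _ u0(2)] by blast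
 moreover have "{v. real_vec v \<in> \<tau>} = range (\<lambda>c. int c *s u)"
 proof
  show "range (\<lambda>c. int c *s u) \<subseteq> {v. real_vec v \<in> \<tau>}" using cone(3)[OF _ u0(2)] by (auto simp: real_vec_scale)
  show "{v. real_vec v \<in> \<tau>} \<subseteq> range (\<lambda>c. int c *s u)"
  proof clarify
   fix w assume w: "real_vec w \<in> \<tau>"
   obtain t where t: "t \<ge> 0" "real_vec w = t *\<^sub>R real_vec u" using line[OF u0(2,3) w] by blast
   define r where "r = w - \<lfloor>t\<rfloor> *s u"
   have r: "real_vec r = (t - \<lfloor>t\<rfloor>) *\<^sub>R real_vec u" by (simp add: r_def real_vec_diff real_vec_scale t(2) algebra_simps)
   have frac: "0 \<le> t - \<lfloor>t\<rfloor>" "t - \<lfloor>t\<rfloor> < 1" by linarith+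
   have "r = 0"
   proof (rule ccontr)
    assume "r \<noteq> 0"
    moreover have "real_vec r \<in> \<tau>" unfolding r using cone(3) u0(2) frac by simp
    ultimately have "nat (pairing u u) \<le> nat (pairing r r)" using u(2) by (simp add: P_def)
    hence "pairing u u \<le> pairing r r" using pairing_self_pos[OF \<open>r \<noteq> 0\<close>] by linarith
    moreover have "real_of_int (pairing r r) = (t - \<lfloor>t\<rfloor>)\<^sup>2 * pairing u u"
     by (simp add: real_vec_inner[symmetric] r power2_eq_square)
    moreover have "(t - \<lfloor>t\<rfloor>)\<^sup>2 < 1" using frac by (simp add: power_less_one_iff abs_square_less_1)
    hence "(t - \<lfloor>t\<rfloor>)\<^sup>2 * pairing u u < 1 * real_of_int (pairing u u)"
     using pairing_self_pos[OF u0(1)] by (intro mult_strict_right_mono) simp_all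
    ultimately show False by simp
   qed
   hence "w = int (nat \<lfloor>t\<rfloor>) *s u" using t(1) by (simp add: r_def)
   thus "w \<in> range (\<lambda>c. int c *s u)" by blast
  qed
 qed
 ultimately show ?thesis using that u0(1) by blast
qed

lemma ray_generator:
 fixes \<tau> :: "(real ^ 'n::finite) set"
 assumes "rational_polyhedral_cone \<tau>" "strongly_convex \<tau>" "aff_dim \<tau> = 1"
 shows "ray_generator \<tau> \<noteq> 0" "\<tau> = {t *\<^sub>R real_vec (ray_generator \<tau>) | t. t \<ge> 0}"
proof -
 obtain u where u: "u \<noteq> 0" "\<tau> = {t *\<^sub>R real_vec u | t. t \<ge> 0}" "{v. real_vec v \<in> \<tau>} = range (\<lambda>c. int c *s u)"
  using ray_lattice_points[OF assms] by blast
 have "ray_generator \<tau> = u" unfolding ray_generator_def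
 proof (rule the_equality)
  fix u' assume "{v. real_vec v \<in> \<tau>} = range (\<lambda>c. int c *s u')"
  hence r: "range (\<lambda>c. int c *s u) = range (\<lambda>c. int c *s u')" using u(3) by simp
  have "u \<in> range (\<lambda>c. int c *s u)" "u' \<in> range (\<lambda>c. int c *s u')" by (rule range_eqI[of _ _ 1]; simp)+
  hence "u \<in> range (\<lambda>c. int c *s u')" "u' \<in> range (\<lambda>c. int c *s u)" using r by blast+
  then obtain c d where "u = int c *s u'" "u' = int d *s u" by (elim rangeE)
  hence *: "u = (int c * int d) *s u" by (simp add: vector_smult_assoc)
  obtain j where "u $ j \<noteq> 0" using u(1) by (auto simp: vec_eq_iff)
  moreover have "u $ j = (int c * int d) * u $ j" by (subst * ) (rule vector_smult_component)
  ultimately have "int c * int d = 1" by simp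
  hence "d = 1" by (simp flip: of_nat_mult)
  thus "u' = u" using \<open>u' = int d *s u\<close> by simp
 qed (rule u(3))
 thus "ray_generator \<tau> \<noteq> 0" "\<tau> = {t *\<^sub>R real_vec (ray_generator \<tau>) | t. t \<ge> 0}" using u by simp_all
qed

section \<open>Cones, faces and characters of a complete rational fan\<close>

locale toric_fan =
 fixes \<Sigma> :: "(real ^ 'n::finite) set set" and \<rho> :: "'k::finite => (real ^ 'n) set"
 assumes fan: "complete_rational_fan \<Sigma>" and rays: "ray_enumeration \<Sigma> \<rho>"
begin

definition u :: "'k => int ^ 'n" where "u i = ray_generator (\<rho> i)"

lemma fin: "finite \<Sigma>" and union: "\<Union>\<Sigma> = UNIV"
 and cone: "\<sigma> \<in> \<Sigma> ==> rational_polyhedral_cone \<sigma>" "\<sigma> \<in> \<Sigma> ==> strongly_convex \<sigma>"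
 and faces: "\<sigma> \<in> \<Sigma> ==> \<tau> face_of \<sigma> ==> \<tau> \<noteq> {} ==> \<tau> \<in> \<Sigma>"
 and inter_face: "\<sigma> \<in> \<Sigma> ==> \<tau> \<in> \<Sigma> ==> (\<sigma> \<inter> \<tau>) face_of \<sigma>" "\<sigma> \<in> \<Sigma> ==> \<tau> \<in> \<Sigma> ==> (\<sigma> \<inter> \<tau>) face_of \<tau>"
 using fan unfolding complete_rational_fan_def rational_fan_def by auto

lemma convex_cone_fan: "\<sigma> \<in> \<Sigma> ==> convex_cone \<sigma>"
 using cone(1) convex_cone_convex_cone_hull unfolding rational_polyhedral_cone_def by metis

lemma cone_zero: "\<sigma> \<in> \<Sigma> ==> 0 \<in> \<sigma>"
 and cone_add: "\<sigma> \<in> \<Sigma> ==> x \<in> \<sigma> ==> y \<in> \<sigma> ==> x + y \<in> \<sigma>"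
 and cone_scale: "\<sigma> \<in> \<Sigma> ==> c \<ge> 0 ==> x \<in> \<sigma> ==> c *\<^sub>R x \<in> \<sigma>" using convex_cone_fan unfolding convex_cone_iff by auto

lemma polyhedron_fan: "\<sigma> \<in> \<Sigma> ==> polyhedron \<sigma>"
 using cone(1) polyhedron_convex_cone_hull unfolding rational_polyhedral_cone_def by (metis finite_imageI)

lemma ray: "\<rho> i \<in> \<Sigma>" "u i \<noteq> 0" "\<rho> i = {t *\<^sub>R real_vec (u i) | t. t \<ge> 0}"
proof -
 have "\<rho> i \<in> {\<tau>\<in>\<Sigma>. aff_dim \<tau> = 1}" using rays by (auto simp: ray_enumeration_def bij_betw_def)
 thus "\<rho> i \<in> \<Sigma>" "u i \<noteq> 0" "\<rho> i = {t *\<^sub>R real_vec (u i) | t. t \<ge> 0}"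
  unfolding u_def using ray_generator[of "\<rho> i"] cone by auto
qed

lemma in_ray: "x \<in> \<rho> i \<longleftrightarrow> (\<exists>t\<ge>0. x = t *\<^sub>R real_vec (u i))" by (subst ray(3)) blast

lemma ray_subset_iff: "\<sigma> \<in> \<Sigma> ==> \<rho> i \<subseteq> \<sigma> \<longleftrightarrow> real_vec (u i) \<in> \<sigma>"
proof
 assume "\<rho> i \<subseteq> \<sigma>"
 moreover have "1 *\<^sub>R real_vec (u i) \<in> \<rho> i" by (subst ray(3)) (rule CollectI, rule exI[of _ 1], simp)
 hence "real_vec (u i) \<in> \<rho> i" by simp
 ultimately show "real_vec (u i) \<in> \<sigma>" by blast
next
 assume "\<sigma> \<in> \<Sigma>" "real_vec (u i) \<in> \<sigma>"
 show "\<rho> i \<subseteq> \<sigma>"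
 proof
  fix x assume "x \<in> \<rho> i"
  then obtain t where "t \<ge> 0" "x = t *\<^sub>R real_vec (u i)" using in_ray by blast
  thus "x \<in> \<sigma>" using cone_scale \<open>\<sigma> \<in> \<Sigma>\<close> \<open>real_vec (u i) \<in> \<sigma>\<close> by simp
 qed
qed

lemma inter_fan: "\<sigma> \<in> \<Sigma> ==> \<tau> \<in> \<Sigma> ==> \<sigma> \<inter> \<tau> \<in> \<Sigma>" using faces[OF _ inter_face(1)] cone_zero by blast

lemma Inter_fan: "t \<in> lists \<Sigma> ==> t \<noteq> [] ==> \<Inter>(set t) \<in> \<Sigma>" by (induction t rule: induct_list012) (auto simp: inter_fan)

lemma zero_fan: "{0} \<in> \<Sigma>"
proof -
 obtain \<sigma> where s: "\<sigma> \<in> \<Sigma>" using union by blast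
 have "{0} face_of \<sigma>" unfolding face_of_def
 proof (intro conjI ballI impI)
  show "{0} \<subseteq> \<sigma>" using cone_zero[OF s] by simp
  fix a b x assume ab: "a \<in> \<sigma>" "b \<in> \<sigma>" "x \<in> {0}" "x \<in> open_segment a b"
  then obtain t where t: "0 < t" "t < 1" "(1 - t) *\<^sub>R a + t *\<^sub>R b = 0" by (auto simp: in_segment)
  have "(1 - t) *\<^sub>R a \<in> \<sigma>" "- ((1 - t) *\<^sub>R a) = t *\<^sub>R b" "t *\<^sub>R b \<in> \<sigma>"
   using t ab cone_scale[OF s] by (auto simp: minus_unique)
  hence "(1 - t) *\<^sub>R a = 0" using strongly_convexD[OF cone(2)[OF s]] by metis
  thus "a \<in> {0}" "b \<in> {0}" using t by auto
 qed auto
 thus ?thesis using faces[OF s] by blast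
qed

text \<open>An irredundant generator of a pointed cone spans a one-dimensional face.\<close>

lemma cone_generated:
 assumes s: "\<sigma> \<in> \<Sigma>"
 shows "\<sigma> = convex_cone hull ((\<lambda>i. real_vec (u i)) ` {i. \<rho> i \<subseteq> \<sigma>})"
proof
 show "convex_cone hull ((\<lambda>i. real_vec (u i)) ` {i. \<rho> i \<subseteq> \<sigma>}) \<subseteq> \<sigma>"
  by (rule hull_minimal) (use ray_subset_iff[OF s] convex_cone_fan[OF s] in auto)
 define P where "P V \<longleftrightarrow> finite V \<and> \<sigma> = convex_cone hull V" for V :: "(real ^ 'n) set"
 obtain V0 where "P V0" using cone(1)[OF s] by (auto simp: rational_polyhedral_cone_def P_def)
 \<comment> \<open>A generating set of least size, so that no generator lies in the cone spanned by
   the others.\<close>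
 then obtain V where V: "P V" "\<And>V'. P V' ==> card V \<le> card V'" using ex_has_least_nat[of P V0 card] by blast
 have finV: "finite V" and sV: "\<sigma> = convex_cone hull V" using V(1) by (auto simp: P_def)
 have "v \<in> convex_cone hull ((\<lambda>i. real_vec (u i)) ` {i. \<rho> i \<subseteq> \<sigma>})" if v: "v \<in> V" for v
 proof -
  define H where "H = convex_cone hull (V - {v})"
  have H: "convex_cone H" "H \<subseteq> \<sigma>"
   unfolding H_def sV using convex_cone_convex_cone_hull by (auto intro: hull_mono[THEN subsetD])
  have vs: "v \<in> \<sigma>" unfolding sV using v by (rule hull_inc)
  have vH: "v \<notin> H"
  proof
   assume "v \<in> H"
   hence "V \<subseteq> H" using hull_inc[of _ "V - {v}"] unfolding H_def by blast
   hence "\<sigma> \<subseteq> H" unfolding sV using H(1) by (intro hull_minimal)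
   hence "P (V - {v})" using H(2) finV by (auto simp: P_def H_def)
   hence "card V \<le> card (V - {v})" by (rule V(2))
   thus False using card_Diff1_less[OF finV v] by linarith
  qed
  have v0: "v \<noteq> 0" using vH H(1) by (auto simp: convex_cone_iff)
  have dec: "\<exists>c\<ge>0. \<exists>h\<in>H. x = c *\<^sub>R v + h" if "x \<in> \<sigma>" for x
  proof -
   have "x \<in> {\<Sum>x\<in>V. c x *\<^sub>R x | c. \<forall>x. c x \<ge> 0}" using that finite_cone_hull[OF finV] sV by blast
   then obtain c where c: "x = (\<Sum>y\<in>V. c y *\<^sub>R y)" "\<forall>y. c y \<ge> 0" by blast
   have "x = c v *\<^sub>R v + (\<Sum>y\<in>V - {v}. c y *\<^sub>R y)" using c(1) sum.remove[OF finV v] by simp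
   moreover have "(\<Sum>y\<in>V - {v}. c y *\<^sub>R y) \<in> H"
    unfolding H_def finite_cone_hull[OF finite_Diff[OF finV]] using c(2) by blast
   ultimately show ?thesis using c(2) by blast
  qed
  define R where "R = {t *\<^sub>R v | t. t \<ge> 0}"
  have R: "R = convex_cone hull {v}" unfolding R_def finite_cone_hull[OF finite.insertI[OF finite.emptyI]] by auto
  have "R face_of \<sigma>" unfolding face_of_def
  proof (intro conjI ballI impI)
   show "R \<subseteq> \<sigma>" using cone_scale[OF s] vs by (auto simp: R_def)
   show "convex R" unfolding R by (rule convex_convex_cone_hull)
   fix a b x assume ab: "a \<in> \<sigma>" "b \<in> \<sigma>" "x \<in> R" "x \<in> open_segment a b"
   obtain \<alpha> a' where a: "\<alpha> \<ge> 0" "a' \<in> H" "a = \<alpha> *\<^sub>R v + a'" using dec[OF ab(1)] by blast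
   obtain \<beta> b' where b: "\<beta> \<ge> 0" "b' \<in> H" "b = \<beta> *\<^sub>R v + b'" using dec[OF ab(2)] by blast
   obtain t where t: "0 < t" "t < 1" "x = (1 - t) *\<^sub>R a + t *\<^sub>R b" using ab(4) by (auto simp: in_segment)
   obtain r where r: "r \<ge> 0" "x = r *\<^sub>R v" using ab(3) by (auto simp: R_def)
   define c where "c = (1 - t) *\<^sub>R a' + t *\<^sub>R b'"
   have aH: "(1 - t) *\<^sub>R a' \<in> H" "t *\<^sub>R b' \<in> H" using a(2) b(2) t H(1) by (auto simp: convex_cone_iff)
   hence cH: "c \<in> H" unfolding c_def using H(1) by (simp add: convex_cone_iff)
   define k where "k = r - ((1 - t) * \<alpha> + t * \<beta>)"
   have ck: "c = k *\<^sub>R v" using t(3) r(2) unfolding a(3) b(3) c_def k_def by (simp add: algebra_simps)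
   have "k = 0"
   proof (rule ccontr)
    assume "k \<noteq> 0"
    show False
    proof (cases "k > 0")
     case True
     hence "v = (1 / k) *\<^sub>R c" using ck by simp
     thus False using vH cH H(1) True by (simp add: convex_cone_iff)
    next
     case False
     hence "- v = (1 / - k) *\<^sub>R c" using ck \<open>k \<noteq> 0\<close> by simp
     hence "- v \<in> \<sigma>" using cH H False cone_scale[OF s, of "1 / - k" c] by auto
     thus False using strongly_convexD[OF cone(2)[OF s] vs] v0 by simp
    qed
   qed
   hence "- ((1 - t) *\<^sub>R a') = t *\<^sub>R b'" using ck unfolding c_def by (simp add: minus_unique)
   hence "(1 - t) *\<^sub>R a' = 0" using strongly_convexD[OF cone(2)[OF s], of "(1 - t) *\<^sub>R a'"] aH H(2) by auto
   hence "a' = 0" "b' = 0" using t \<open>- ((1 - t) *\<^sub>R a') = t *\<^sub>R b'\<close> by auto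
   thus "a \<in> R" "b \<in> R" using a b by (auto simp: R_def)
  qed
  moreover have "v \<in> R" unfolding R by (simp add: hull_inc)
  ultimately have RS: "R \<in> \<Sigma>" using faces[OF s] by blast
  have "aff_dim R = int (dim R)" by (rule aff_dim_zero) (simp add: hull_inc cone_zero[OF RS])
  also have "dim R = dim {v}"
  proof -
   have "R \<subseteq> span {v}" by (auto simp: R_def span_singleton)
   hence "span R = span {v}" unfolding span_eq using \<open>v \<in> R\<close> by (auto intro: span_base)
   thus ?thesis by (metis dim_span)
  qed
  also have "dim {v} = 1" using v0 by (simp add: dim_eq_card_independent)
  finally have "R \<in> {\<tau>\<in>\<Sigma>. aff_dim \<tau> = 1}" using RS by simp
  hence "R \<in> range \<rho>" using rays unfolding ray_enumeration_def bij_betw_def by simp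
  then obtain i where i: "\<rho> i = R" by blast
  have "v \<in> \<rho> i" using i \<open>v \<in> R\<close> by simp
  then obtain t where "v = t *\<^sub>R real_vec (u i)" "t \<ge> 0" using in_ray by blast
  moreover have "\<rho> i \<subseteq> \<sigma>" using i \<open>R face_of \<sigma>\<close> face_of_imp_subset by blast
  ultimately show ?thesis
   using convex_cone_hull_mul[OF hull_inc[of "real_vec (u i)" "(\<lambda>i. real_vec (u i)) ` {i. \<rho> i \<subseteq> \<sigma>}"]] by auto
 qed
 thus "\<sigma> \<subseteq> convex_cone hull ((\<lambda>i. real_vec (u i)) ` {i. \<rho> i \<subseteq> \<sigma>})"
  by (subst sV) (intro hull_minimal subsetI convex_cone_convex_cone_hull)
qed

lemma cone_inner_nonneg:
 assumes "\<sigma> \<in> \<Sigma>" "\<And>i. \<rho> i \<subseteq> \<sigma> ==> w \<bullet> real_vec (u i) \<ge> 0" "x \<in> \<sigma>"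
 shows "w \<bullet> x \<ge> 0"
proof -
 have "convex_cone hull ((\<lambda>i. real_vec (u i)) ` {i. \<rho> i \<subseteq> \<sigma>}) \<subseteq> {x. w \<bullet> x \<ge> 0}"
  by (rule hull_minimal) (use assms(2) convex_cone_halfspace_ge in auto)
 thus ?thesis using assms(3) cone_generated[OF assms(1)] by blast
qed

lemma dual_semigroup_iff:
 assumes "\<sigma> \<in> \<Sigma>"
 shows "m \<in> dual_semigroup \<sigma> \<longleftrightarrow> (\<forall>i. \<rho> i \<subseteq> \<sigma> --> pairing m (u i) \<ge> 0)"
proof
 assume "m \<in> dual_semigroup \<sigma>"
 thus "\<forall>i. \<rho> i \<subseteq> \<sigma> --> pairing m (u i) \<ge> 0"
  using ray_subset_iff[OF assms] by (auto simp: dual_semigroup_def real_vec_inner)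
next
 assume "\<forall>i. \<rho> i \<subseteq> \<sigma> --> pairing m (u i) \<ge> 0"
 thus "m \<in> dual_semigroup \<sigma>"
  unfolding dual_semigroup_def using cone_inner_nonneg[OF assms, of "real_vec m"] by (auto simp: real_vec_inner)
qed

text \<open>By completeness some cone contains -m. Since m is zero on its generators, the square
  length of m is at most 0.\<close>

lemma character_inj:
 assumes "\<And>i. pairing m (u i) = 0"
 shows "m = 0"
proof -
 obtain \<sigma> where s: "\<sigma> \<in> \<Sigma>" "- real_vec m \<in> \<sigma>" using union by blast
 have "m \<star> - real_vec m \<ge> 0" by (rule cone_inner_nonneg[OF s(1) _ s(2)]) (simp add: real_vec_inner assms)
 hence "real_vec m = 0" using inner_gt_zero_iff[of "real_vec m"] by fastforce
 thus ?thesis using real_vec_eq[of m 0] by simp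
qed

text \<open>Faces of a polyhedron are exposed, which gives a real supporting functional;
  \<open>integral_solution\<close> replaces it by an integral one. Inverting this character is the
  passage from the chart of \<tau> to that of the face.\<close>

lemma face_character:
 assumes "\<tau> \<in> \<Sigma>" "\<eta> \<in> \<Sigma>" "\<eta> face_of \<tau>"
 obtains w where "\<And>i. \<rho> i \<subseteq> \<tau> ==> pairing w (u i) \<ge> 0" "\<And>i. \<rho> i \<subseteq> \<tau> ==> pairing w (u i) = 0 \<longleftrightarrow> \<rho> i \<subseteq> \<eta>"
proof -
 have "\<eta> exposed_face_of \<tau>" using exposed_face_of_polyhedron[OF polyhedron_fan] assms by blast
 then obtain a b where ab: "\<tau> \<subseteq> {x. a \<bullet> x \<le> b}" "\<eta> = \<tau> \<inter> {x. a \<bullet> x = b}" unfolding exposed_face_of_def by blast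
 have "b = 0" using ab(2) cone_zero[OF assms(2)] by auto
 have sub: "\<eta> \<subseteq> \<tau>" using assms(3) face_of_imp_subset by blast
 define E where "E = u ` {i. \<rho> i \<subseteq> \<eta>}"
 define U where "U = u ` {i. \<rho> i \<subseteq> \<tau> \<and> \<not> \<rho> i \<subseteq> \<eta>}"
 have "e \<star> (- a) = 0" if "e \<in> E" for e
  using that ab(2) \<open>b = 0\<close> ray_subset_iff[OF assms(2)] by (auto simp: E_def inner_commute)
 moreover have "e \<star> (- a) > 0" if "e \<in> U" for e
 proof -
  obtain i where i: "e = u i" "\<rho> i \<subseteq> \<tau>" "\<not> \<rho> i \<subseteq> \<eta>" using \<open>e \<in> U\<close> by (auto simp: U_def)
  hence "real_vec e \<in> \<tau>" "real_vec e \<notin> \<eta>" using ray_subset_iff assms by auto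
  hence "a \<bullet> real_vec e \<le> 0" "a \<bullet> real_vec e \<noteq> 0" using ab \<open>b = 0\<close> by auto
  thus ?thesis by (simp add: inner_commute)
 qed
 moreover have "finite E" "finite U" by (simp_all add: E_def U_def)
 ultimately obtain w where w: "\<And>e. e \<in> E ==> pairing e w = 0" "\<And>e. e \<in> U ==> pairing e w > 0"
  using integral_solution[of E "- a" U] by metis
 have "pairing w (u i) = 0" if "\<rho> i \<subseteq> \<eta>" for i using w(1)[of "u i"] that by (auto simp: E_def pairing_commute)
 moreover have "pairing w (u i) > 0" if "\<rho> i \<subseteq> \<tau>" "\<not> \<rho> i \<subseteq> \<eta>" for i
  using w(2)[of "u i"] that by (auto simp: U_def pairing_commute)
 ultimately have *: "pairing w (u i) \<ge> 0 \<and> (pairing w (u i) = 0 \<longleftrightarrow> \<rho> i \<subseteq> \<eta>)" if "\<rho> i \<subseteq> \<tau>" for i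
  using that by (metis less_le order_refl)
 show ?thesis by (rule that[of w]) (simp_all add: *)
qed

text \<open>A half-space containing the cone contains the origin, and rescaling points of the cone
  shows that its linear form is already nonpositive on the cone. So the affine inequalities of the
  polyhedron can be made homogeneous.\<close>

lemma halfspaces:
 assumes "\<sigma> \<in> \<Sigma>"
 shows "\<exists>H. finite H \<and> \<sigma> = {x. \<forall>h\<in>H. h \<bullet> x \<ge> 0}"
proof -
 obtain F where F: "finite F" "\<sigma> = \<Inter>F" "\<And>h. h \<in> F ==> \<exists>a b. a \<noteq> 0 \<and> h = {x. a \<bullet> x \<le> b}"
  using polyhedron_fan[OF assms] unfolding polyhedron_def by metis
 then obtain a b where ab: "\<And>h. h \<in> F ==> h = {x. a h \<bullet> x \<le> b h}" by metis
 have b: "b h \<ge> 0" if "h \<in> F" for h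
 proof -
  have "0 \<in> h" using cone_zero[OF assms] F(2) that by blast
  hence "0 \<in> {x. a h \<bullet> x \<le> b h}" using ab[OF that] by blast
  thus ?thesis by simp
 qed
 have neg: "a h \<bullet> x \<le> 0" if "h \<in> F" "x \<in> \<sigma>" for h x
 proof (rule ccontr)
  assume *: "\<not> a h \<bullet> x \<le> 0"
  define c where "c = (b h + 1) / (a h \<bullet> x)"
  have "c *\<^sub>R x \<in> \<sigma>" using * b[OF that(1)] cone_scale[OF assms] that(2) by (simp add: c_def)
  hence "c *\<^sub>R x \<in> h" using F(2) that(1) by blast
  hence "c *\<^sub>R x \<in> {x. a h \<bullet> x \<le> b h}" using ab[OF that(1)] by blast
  hence "c * (a h \<bullet> x) \<le> b h" by simp
  thus False using * by (simp add: c_def)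
 qed
 have "\<sigma> = {x. \<forall>h\<in>(\<lambda>h. - a h) ` F. h \<bullet> x \<ge> 0}"
 proof
  show "{x. \<forall>h\<in>(\<lambda>h. - a h) ` F. h \<bullet> x \<ge> 0} \<subseteq> \<sigma>" using ab b F(2) by (fastforce intro: order_trans)
 qed (use neg in auto)
 thus ?thesis using F(1) by blast
qed

lemma fan_nerve_acyclic:
 assumes "convex W"
 shows "nerve_acyclic \<Sigma> W"
proof -
 define Q where "Q \<sigma> H \<longleftrightarrow> finite H \<and> \<sigma> = {x. \<forall>h\<in>H. h \<bullet> x \<ge> 0}" for \<sigma> and H :: "(real ^ 'n) set"
 have "\<exists>H. Q \<sigma> H" if "\<sigma> \<in> \<Sigma>" for \<sigma> using halfspaces[OF that] by (simp add: Q_def)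
 then obtain H where Q: "\<And>\<sigma>. \<sigma> \<in> \<Sigma> ==> Q \<sigma> (H \<sigma>)" by metis
 show ?thesis
  by (rule nerve_acyclic_convex[of \<Sigma> H, OF fin _ Q[unfolded Q_def, THEN conjunct1] Q[unfolded Q_def, THEN conjunct2] assms])
   (use union in auto)
qed

end

section \<open>Evaluation and monomial substitution\<close>

text \<open>The values \<kappa> of the monomials are arbitrary, and multiplicativity is asked for
  only on the supports at hand: at a point with vanishing coordinates, \<open>mono\<close> is
  multiplicative only between regular characters.\<close>

definition ev :: "('g => complex) => ('g \<Rightarrow>\<^sub>0 complex) => complex" where "ev \<kappa> p = (\<Sum>m\<in>keys p. lkp p m * \<kappa> m)"

definition mmap :: "('g => 'h) => ('g \<Rightarrow>\<^sub>0 complex) => ('h \<Rightarrow>\<^sub>0 complex)" where "mmap \<phi> p = (\<Sum>m\<in>keys p. sgl (\<phi> m) (lkp p m))"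

lemma ev_superset: "finite K ==> keys p \<subseteq> K ==> ev \<kappa> p = (\<Sum>m\<in>K. lkp p m * \<kappa> m)"
 unfolding ev_def by (rule sum.mono_neutral_left) (auto simp: in_keys_iff)

lemma mmap_superset: "finite K ==> keys p \<subseteq> K ==> mmap \<phi> p = (\<Sum>m\<in>K. sgl (\<phi> m) (lkp p m))"
 unfolding mmap_def by (rule sum.mono_neutral_left) (auto simp: in_keys_iff)

lemma ev_add: "ev \<kappa> (p + q) = ev \<kappa> p + ev \<kappa> q" using keys_add[of p q]
 by (simp add: ev_superset[of "keys p \<union> keys q"] lookup_add distrib_right sum.distrib)

lemma mmap_add: "mmap \<phi> (p + q) = mmap \<phi> p + mmap \<phi> q" using keys_add[of p q]
 by (simp add: mmap_superset[of "keys p \<union> keys q"] lookup_add single_add sum.distrib)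

lemma ev_single [simp]: "ev \<kappa> (sgl m c) = c * \<kappa> m" by (cases "c = 0") (simp_all add: ev_def)

lemma mmap_single [simp]: "mmap \<phi> (sgl m c) = sgl (\<phi> m) c" by (cases "c = 0") (simp_all add: mmap_def)

lemma ev_zero [simp]: "ev \<kappa> 0 = 0" and mmap_zero [simp]: "mmap \<phi> 0 = 0" by (simp_all add: ev_def mmap_def)

lemma ev_sum: "ev \<kappa> (sum f A) = (\<Sum>i\<in>A. ev \<kappa> (f i))"
 and mmap_sum: "mmap \<phi> (sum f A) = (\<Sum>i\<in>A. mmap \<phi> (f i))"
 by (induction A rule: infinite_finite_induct) (auto simp: ev_add mmap_add)

lemma monomial_sum: "p = (\<Sum>m\<in>keys p. sgl m (lkp p m))"
 by (rule poly_mapping_eqI) (auto simp: lookup_sum lookup_single when_def in_keys_iff)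

lemma mult_monomial_sum:
 fixes p q :: "'g::comm_monoid_add \<Rightarrow>\<^sub>0 complex"
 shows "p * q = (\<Sum>a\<in>keys p. \<Sum>b\<in>keys q. sgl (a + b) (lkp p a * lkp q b))"
proof -
 have "p * q = (\<Sum>a\<in>keys p. sgl a (lkp p a)) * (\<Sum>b\<in>keys q. sgl b (lkp q b))"
  using monomial_sum[of p] monomial_sum[of q] by simp
 thus ?thesis by (simp add: sum_product mult_single)
qed

lemma ev_mult:
 fixes p q :: "'g::comm_monoid_add \<Rightarrow>\<^sub>0 complex"
 assumes "\<And>a b. a \<in> keys p ==> b \<in> keys q ==> \<kappa>'' (a + b) = \<kappa> a * \<kappa>' b"
 shows "ev \<kappa>'' (p * q) = ev \<kappa> p * ev \<kappa>' q" unfolding mult_monomial_sum[of p q] ev_sum ev_single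
 by (simp add: ev_def sum_product assms mult_ac)

lemma mmap_mult:
 fixes p q :: "'g::comm_monoid_add \<Rightarrow>\<^sub>0 complex" and \<phi> :: "'g => 'h::comm_monoid_add"
 assumes "\<And>a b. a \<in> keys p ==> b \<in> keys q ==> \<phi>'' (a + b) = \<phi> a + \<phi>' b"
 shows "mmap \<phi>'' (p * q) = mmap \<phi> p * mmap \<phi>' q" unfolding mult_monomial_sum[of p q] mmap_sum mmap_single
 by (simp add: mmap_def sum_product assms mult_single)

lemma ev_mmap: "ev \<kappa> (mmap \<phi> p) = ev (\<lambda>m. \<kappa> (\<phi> m)) p" unfolding mmap_def ev_sum ev_single by (simp add: ev_def)

lemma keys_mmap: "keys (mmap \<phi> p) \<subseteq> \<phi> ` keys p"
 unfolding mmap_def using keys_sum[of "\<lambda>m. sgl (\<phi> m) (lkp p m)" "keys p"] by (auto split: if_splits)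

lemma lookup_mmap:
 assumes "inj_on \<phi> (insert m (keys p))"
 shows "lkp (mmap \<phi> p) (\<phi> m) = lkp p m"
proof -
 have "lkp (mmap \<phi> p) (\<phi> m) = (\<Sum>k\<in>keys p. if k = m then lkp p k else 0)"
  unfolding mmap_def lookup_sum by (intro sum.cong refl) (use assms in \<open>auto simp: lookup_single when_def inj_on_def\<close>)
 thus ?thesis by (simp add: in_keys_iff)
qed

lemma mmap_mmap: "mmap \<psi> (mmap \<phi> p) = mmap (\<lambda>m. \<psi> (\<phi> m)) p"
 unfolding mmap_def[of \<phi>] mmap_sum mmap_single by (simp add: mmap_def)

lemma mmap_cong: "(\<And>m. m \<in> keys p ==> \<phi> m = \<psi> m) ==> mmap \<phi> p = mmap \<psi> p" unfolding mmap_def by (intro sum.cong) auto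

lemma ev_cong: "(\<And>m. m \<in> keys p ==> \<kappa> m = \<psi> m) ==> ev \<kappa> p = ev \<psi> p" unfolding ev_def by (intro sum.cong) auto

lemma mmap_ident: "mmap (\<lambda>m. m) p = p" unfolding mmap_def using monomial_sum[of p] by simp

section \<open>Extension of characters\<close>

lemma int_multiple_of_least:
 fixes P :: "int => bool"
 assumes diff: "\<And>a b. P a ==> P b ==> P (a - b)" and d: "d > 0" "P d" and least: "\<And>e. 0 < e ==> e < d ==> \<not> P e"
  and k: "P k"
 shows "d dvd k"
proof -
 have z: "P 0" using diff[OF k k] by simp
 have neg: "P (- a)" if "P a" for a using diff[OF z that] by simp
 have mulp: "P (int j * d)" for j
 proof (induction j)
  case (Suc j)
  thus ?case using diff[OF Suc neg[OF d(2)]] by (simp add: algebra_simps)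
 qed (simp add: z)
 have mul: "P (j * d)" for j using mulp[of "nat j"] neg[OF mulp[of "nat (- j)"]] by (cases "j \<ge> 0") auto
 have "P (k - (k div d) * d)" by (rule diff[OF k mul])
 hence "P (k mod d)" by (simp add: minus_div_mult_eq_mod)
 hence "k mod d = 0" using least[of "k mod d"] pos_mod_bound[OF d(1), of k] pos_mod_sign[OF d(1), of k] by linarith
 thus ?thesis by auto
qed

definition char_on :: "'g::ab_group_add set => ('g => complex) => bool" where
 "char_on G \<psi> \<longleftrightarrow> 0 \<in> G \<and> (\<forall>a\<in>G. \<forall>b\<in>G. a - b \<in> G) \<and> (\<forall>a\<in>G. \<psi> a \<noteq> 0) \<and> (\<forall>a\<in>G. \<forall>b\<in>G. \<psi> (a + b) = \<psi> a * \<psi> b)"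

lemma char_onD:
 assumes "char_on G \<psi>"
 shows "0 \<in> G" "\<And>a b. a \<in> G ==> b \<in> G ==> a - b \<in> G" "\<And>a. a \<in> G ==> \<psi> a \<noteq> 0"
  "\<And>a b. a \<in> G ==> b \<in> G ==> \<psi> (a + b) = \<psi> a * \<psi> b" "\<And>a. a \<in> G ==> - a \<in> G" "\<And>a b. a \<in> G ==> b \<in> G ==> a + b \<in> G" "\<psi> 0 = 1"
proof -
 show 0: "0 \<in> G" and d: "\<And>a b. a \<in> G ==> b \<in> G ==> a - b \<in> G" and nz: "\<And>a. a \<in> G ==> \<psi> a \<noteq> 0"
  and m: "\<And>a b. a \<in> G ==> b \<in> G ==> \<psi> (a + b) = \<psi> a * \<psi> b" using assms by (auto simp: char_on_def)
 show n: "\<And>a. a \<in> G ==> - a \<in> G" using d[OF 0] by simp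
 show "\<And>a b. a \<in> G ==> b \<in> G ==> a + b \<in> G" using d n by (metis diff_minus_eq_add)
 show "\<psi> 0 = 1" using m[OF 0 0] nz[OF 0] by simp
qed

lemma char_on_power:
 fixes G :: "(int ^ 'n) set"
 assumes "char_on G \<psi>" "a \<in> G"
 shows "k *s a \<in> G" "\<psi> (k *s a) = \<psi> a powi k"
proof -
 note c = char_onD[OF assms(1)]
 have n: "int j *s a \<in> G \<and> \<psi> (int j *s a) = \<psi> a ^ j" for j
 proof (induction j)
  case (Suc j)
  have "int (Suc j) *s a = a + int j *s a" by (simp add: vector_sadd_rdistrib)
  thus ?case using Suc c(4,6)[OF assms(2)] by simp
 qed (simp add: c)
 have neg: "\<psi> (- b) = inverse (\<psi> b)" if "b \<in> G" for b
  using c(4)[OF that c(5)[OF that]] c(7) c(3)[OF that] by (simp add: field_simps)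
 show "k *s a \<in> G" "\<psi> (k *s a) = \<psi> a powi k"
 proof (atomize (full), cases "k \<ge> 0")
  case True
  thus "k *s a \<in> G \<and> \<psi> (k *s a) = \<psi> a powi k" using n[of "nat k"] by (simp add: power_int_def)
 next
  case False
  define j where "j = nat (- k)"
  have k: "k = - int j" using False by (simp add: j_def)
  have "k *s a = - (int j *s a)" by (simp add: k vec_eq_iff)
  thus "k *s a \<in> G \<and> \<psi> (k *s a) = \<psi> a powi k" using n[of j] neg c(5) by (simp add: k power_int_minus)
 qed
qed

text \<open>The nonzero complex numbers are divisible. If some positive multiple of a lies in G, the
  least one, d a, determines all, and z is a d-th root of its value; otherwise z = 1. The new value
  at g + k a is \<psi> g times z to the k.\<close>

lemma char_extend_one:
 fixes G :: "(int ^ 'n) set"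
 assumes "char_on G \<psi>"
 shows "\<exists>\<psi>'. char_on {g + k *s a | g k. g \<in> G} \<psi>' \<and> (\<forall>g\<in>G. \<psi>' g = \<psi> g)"
proof -
 note c = char_onD[OF assms]
 have "\<exists>z. z \<noteq> 0 \<and> (\<forall>k. k *s a \<in> G --> \<psi> (k *s a) = z powi k)"
 proof (cases "\<exists>k::nat. k > 0 \<and> int k *s a \<in> G")
  case False
  have k0: "k = 0" if "k *s a \<in> G" for k
  proof (rule ccontr)
   assume "k \<noteq> 0"
   have "(- k) *s a = - (k *s a)" by (simp add: vec_eq_iff)
   hence "int (nat \<bar>k\<bar>) *s a \<in> G" using that c(5)[OF that] by (cases "k \<ge> 0") simp_all
   thus False using False \<open>k \<noteq> 0\<close> by (metis nat_0_iff abs_le_zero_iff neq0_conv)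
  qed
  have "\<psi> (k *s a) = 1 powi k" if "k *s a \<in> G" for k using k0[OF that] c(7) by simp
  thus ?thesis by (intro exI[of _ 1]) simp
 next
  case True
  define d where "d = (LEAST k. k > 0 \<and> int k *s a \<in> G)"
  have d: "d > 0" "int d *s a \<in> G" using LeastI_ex[OF True] by (auto simp: d_def)
  have least: "\<not> int k *s a \<in> G" if "0 < k" "k < d" for k using not_less_Least that unfolding d_def by blast
  define z where "z = exp (Ln (\<psi> (int d *s a)) / of_nat d)"
  have z: "z ^ d = \<psi> (int d *s a)" "z \<noteq> 0" using c(3)[OF d(2)] d(1) by (simp_all add: z_def flip: exp_of_nat_mult)
  have "\<psi> (k *s a) = z powi k" if k: "k *s a \<in> G" for k
  proof -
   have "int d dvd k"
   proof (rule int_multiple_of_least[of "\<lambda>k. k *s a \<in> G"])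
    show "(x - y) *s a \<in> G" if "x *s a \<in> G" "y *s a \<in> G" for x y using c(2)[OF that] by (simp add: vector_sub_rdistrib)
    show "\<not> e *s a \<in> G" if "0 < e" "e < int d" for e using least[of "nat e"] that by simp
   qed (use d k in auto)
   then obtain q where q: "k = int d * q" by blast
   have "\<psi> (k *s a) = \<psi> (int d *s a) powi q"
    using char_on_power(2)[OF assms d(2), of q] by (simp add: q vector_smult_assoc mult.commute)
   thus ?thesis by (simp add: q z(1)[symmetric] power_int_mult flip: power_int_of_nat)
  qed
  thus ?thesis using z(2) by blast
 qed
 then obtain z where z: "z \<noteq> 0" "\<And>k. k *s a \<in> G ==> \<psi> (k *s a) = z powi k" by blast
 have wd: "\<psi> g * z powi k = \<psi> g' * z powi k'" if "g \<in> G" "g' \<in> G" "g + k *s a = g' + k' *s a" for g g' k k'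
 proof -
  have e: "(k - k') *s a = g' - g" using that(3) by (simp add: vector_sub_rdistrib algebra_simps)
  hence "\<psi> (g' - g) = z powi (k - k')" using z(2)[of "k - k'"] c(2)[OF that(2,1)] by simp
  moreover have "\<psi> g' = \<psi> g * \<psi> (g' - g)" using c(4)[OF that(1) c(2)[OF that(2,1)]] by simp
  ultimately have "\<psi> g' * z powi k' = \<psi> g * (z powi (k - k') * z powi k')" by simp
  also have "z powi (k - k') * z powi k' = z powi k" using z(1) by (simp flip: power_int_add)
  finally show ?thesis by simp
 qed
 define Q where "Q v y \<longleftrightarrow> (\<exists>g\<in>G. \<exists>k. v = g + k *s a \<and> y = \<psi> g * z powi k)" for v y
 define \<psi>' where "\<psi>' v = (THE y. Q v y)" for v
 have val: "\<psi>' (g + k *s a) = \<psi> g * z powi k" if "g \<in> G" for g k unfolding \<psi>'_def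
 proof (rule the_equality)
  show "Q (g + k *s a) (\<psi> g * z powi k)" using that unfolding Q_def by blast
  fix y assume "Q (g + k *s a) y"
  then obtain g' k' where "g' \<in> G" "g + k *s a = g' + k' *s a" "y = \<psi> g' * z powi k'" unfolding Q_def by blast
  thus "y = \<psi> g * z powi k" using wd[OF that] by simp
 qed
 have "char_on {g + k *s a | g k. g \<in> G} \<psi>'" unfolding char_on_def
 proof (intro conjI ballI)
  show "0 \<in> {g + k *s a | g k. g \<in> G}" using c(1) by (intro CollectI exI[of _ 0]) simp
  fix x y assume "x \<in> {g + k *s a | g k. g \<in> G}" "y \<in> {g + k *s a | g k. g \<in> G}"
  then obtain g k g' k' where x: "x = g + k *s a" "g \<in> G" and y: "y = g' + k' *s a" "g' \<in> G" by auto
  have "x - y = (g - g') + (k - k') *s a" by (simp add: x y vector_sub_rdistrib)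
  thus "x - y \<in> {g + k *s a | g k. g \<in> G}" using c(2)[OF x(2) y(2)] by blast
  have "x + y = (g + g') + (k + k') *s a" by (simp add: x y vector_sadd_rdistrib)
  hence "\<psi>' (x + y) = \<psi> (g + g') * z powi (k + k')" using val[OF c(6)[OF x(2) y(2)], of "k + k'"] by simp
  also have "\<dots> = (\<psi> g * z powi k) * (\<psi> g' * z powi k')" using c(4)[OF x(2) y(2)] z(1) by (simp add: power_int_add)
  finally show "\<psi>' (x + y) = \<psi>' x * \<psi>' y" using val[OF x(2), of k] val[OF y(2), of k'] by (simp add: x(1) y(1))
 next
  fix x assume "x \<in> {g + k *s a | g k. g \<in> G}"
  then obtain g k where "g \<in> G" "x = g + k *s a" by blast
  thus "\<psi>' x \<noteq> 0" using val[of g k] c(3)[of g] z(1) by simp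
 qed
 moreover have "\<psi>' g = \<psi> g" if "g \<in> G" for g using val[OF that, of 0] by simp
 ultimately show ?thesis by blast
qed

text \<open>After adjoining the coordinate vectors one by one, the character is defined on the whole
  lattice, where it is evaluation at a point t of the torus.\<close>

lemma char_extend:
 fixes G :: "(int ^ 'n::finite) set"
 assumes "char_on G \<psi>"
 obtains t :: "complex ^ 'n" where "\<And>j. t $ j \<noteq> 0" "\<And>m. m \<in> G ==> \<psi> m = (\<Prod>j\<in>UNIV. t $ j powi m $ j)"
proof -
 have ext: "\<exists>G' \<psi>'. char_on G' \<psi>' \<and> G \<subseteq> G' \<and> (\<forall>j\<in>J. axis j 1 \<in> G') \<and> (\<forall>g\<in>G. \<psi>' g = \<psi> g)" if "finite J" for J :: "'n set"
  using that
 proof (induction J rule: finite_induct)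
  case empty
  thus ?case using assms by auto
 next
  case (insert i J)
  then obtain G' \<psi>' where G': "char_on G' \<psi>'" "G \<subseteq> G'" "\<forall>j\<in>J. axis j 1 \<in> G'" "\<forall>g\<in>G. \<psi>' g = \<psi> g" by blast
  obtain \<psi>'' where e: "char_on {g + k *s axis i 1 | g k. g \<in> G'} \<psi>''" "\<And>g. g \<in> G' ==> \<psi>'' g = \<psi>' g"
   using char_extend_one[OF G'(1), of "axis i 1"] by blast
  have sub: "G' \<subseteq> {g + k *s axis i 1 | g k. g \<in> G'}"
  proof
   fix x assume "x \<in> G'"
   thus "x \<in> {g + k *s axis i 1 | g k. g \<in> G'}" by (intro CollectI exI[of _ x] exI[of _ 0]) simp
  qed
  moreover have "axis i 1 \<in> {g + k *s axis i 1 | g k. g \<in> G'}"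
   using char_onD(1)[OF G'(1)] by (intro CollectI exI[of _ 0] exI[of _ 1]) simp
  moreover have "\<forall>g\<in>G. \<psi>'' g = \<psi> g" using e(2) G'(2,4) by auto
  ultimately show ?case using e(1) G'(2,3) by (intro exI[of _ "{g + k *s axis i 1 | g k. g \<in> G'}"] exI[of _ \<psi>'']) blast
 qed
 obtain G' \<psi>' where G': "char_on G' \<psi>'" "G \<subseteq> G'" "\<forall>j. axis j 1 \<in> G'" "\<forall>g\<in>G. \<psi>' g = \<psi> g" using ext[of UNIV] by auto
 note c = char_onD[OF G'(1)]
 have prod: "\<psi>' (\<Sum>j\<in>J. m $ j *s axis j 1) = (\<Prod>j\<in>J. \<psi>' (axis j 1) powi m $ j) \<and> (\<Sum>j\<in>J. m $ j *s axis j 1) \<in> G'"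
  if "finite J" for J and m :: "int ^ 'n" using that
 proof (induction J rule: finite_induct)
  case (insert i J)
  have i: "m $ i *s axis i 1 \<in> G'" "\<psi>' (m $ i *s axis i 1) = \<psi>' (axis i 1) powi m $ i"
   using char_on_power[OF G'(1)] G'(3) by auto
  thus ?case using insert c(4)[OF i(1), of "\<Sum>j\<in>J. m $ j *s axis j 1"] c(6)[OF i(1), of "\<Sum>j\<in>J. m $ j *s axis j 1"]
   by simp
 qed (simp add: c)
 have "(\<Sum>j\<in>UNIV. m $ j *s axis j 1) = m" for m :: "int ^ 'n" by (simp add: vec_eq_iff axis_def if_distrib cong: if_cong)
 hence "\<psi> m = (\<Prod>j\<in>UNIV. \<psi>' (axis j 1) powi m $ j)" if "m \<in> G" for m using prod[of UNIV m] G'(4) that by simp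
 thus ?thesis using that[of "\<chi> j. \<psi>' (axis j 1)"] c(3) G'(3) by simp
qed

section \<open>Points of the toric variety in Cox coordinates\<close>

lemma cox_eval_ev: "cox_eval x f = ev (\<lambda>e. \<Prod>i\<in>UNIV. (x $ i) ^ lkp e i) f" by (simp add: cox_eval_def ev_def)

lemma cox_eval_add: "cox_eval x (f + g) = cox_eval x f + cox_eval x g"
 and cox_eval_mult: "cox_eval x (f * g) = cox_eval x f * cox_eval x g"
 and cox_eval_zero [simp]: "cox_eval x 0 = 0"
 and cox_eval_sum: "cox_eval x (sum h A) = (\<Sum>i\<in>A. cox_eval x (h i))"
 and cox_eval_single: "cox_eval x (sgl e c) = c * (\<Prod>i\<in>UNIV. (x $ i) ^ lkp e i)"
 unfolding cox_eval_ev by (simp_all add: ev_add ev_sum ev_mult lookup_add power_add prod.distrib)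

lemma cox_eval_one [simp]: "cox_eval x 1 = 1" using cox_eval_single[of x 0 1] by simp

lemma cox_eval_prod: "cox_eval x (prod h A) = (\<Prod>i\<in>A. cox_eval x (h i))"
 by (induction A rule: infinite_finite_induct) (auto simp: cox_eval_mult)

lemma cox_eval_variable: "cox_eval x (variable i) = x $ i"
proof -
 have "(\<Prod>j\<in>UNIV. x $ j ^ lkp (sgl i (1::nat)) j) = (\<Prod>j\<in>UNIV. if j = i then x $ i else 1)"
  by (intro prod.cong) (auto simp: lookup_single when_def)
 thus ?thesis by (simp add: variable_def cox_eval_single)
qed

lemma cring_cox: "cring cox_ring"
proof (rule cringI)
 show "abelian_group cox_ring" by (rule abelian_groupI) (auto simp: cox_ring_def intro: exI[of _ "- _"] add.commute)
 show "comm_monoid cox_ring" by (rule comm_monoidI) (auto simp: cox_ring_def mult_ac)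
qed (auto simp: cox_ring_def algebra_simps)

lemma cox_ring_simps [simp]:
 "carrier cox_ring = UNIV" "x \<otimes>\<^bsub>cox_ring\<^esub> y = x * y" "x \<oplus>\<^bsub>cox_ring\<^esub> y = x + y" "\<one>\<^bsub>cox_ring\<^esub> = 1" "\<zero>\<^bsub>cox_ring\<^esub> = 0"
 by (simp_all add: cox_ring_def)

lemma cox_ideal_iff: "ideal I cox_ring \<longleftrightarrow> submod UNIV I"
proof
 assume "ideal I cox_ring"
 then interpret ideal I cox_ring .
 have neg: "- y \<in> I" if "y \<in> I" for y using I_l_closed[OF that, of "- 1"] by simp
 have "x - y \<in> I" if "x \<in> I" "y \<in> I" for x y
  using additive_subgroup.a_closed[OF is_additive_subgroup that(1) neg[OF that(2)]] by simp
 thus "submod UNIV I" using I_l_closed additive_subgroup.zero_closed[OF is_additive_subgroup] by (auto simp: submod_def)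
next
 assume s: "submod UNIV I"
 have "subgroup I (add_monoid cox_ring)"
 proof (rule group.subgroupI)
  show "group (add_monoid cox_ring)"
   using cring.axioms(1)[OF cring_cox] ring.is_abelian_group abelian_group.a_group by blast
  show "I \<noteq> {}" using submod_zero[OF s] by blast
  fix a assume a: "a \<in> I"
  have "inv\<^bsub>add_monoid cox_ring\<^esub> a = - a"
   using abelian_group.minus_equality[OF ring.is_abelian_group[OF cring.axioms(1)[OF cring_cox]], of "- a" a]
   by (simp add: a_inv_def)
  thus "inv\<^bsub>add_monoid cox_ring\<^esub> a \<in> I" using submod_minus[OF s a] by simp
 qed (use submod_add[OF s] in auto)
 moreover have "x * a \<in> I" "a * x \<in> I" if "a \<in> I" for a x
  using submod_mult[OF s UNIV_I that, of x] by (simp_all add: mult.commute)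
 ultimately show "ideal I cox_ring" by (intro idealI cring.axioms(1)[OF cring_cox]) auto
qed

lemma power_int_add_nonneg: "x \<noteq> 0 \<or> (0 \<le> m \<and> 0 \<le> n) ==> (x::complex) powi (m + n) = x powi m * x powi n"
 by (cases "x = 0") (auto simp: power_int_add power_int_0_left_if)

context toric_fan
begin

lemma character_divisor_nth [simp]: "character_divisor \<rho> m $ i = pairing m (u i)"
 by (simp add: character_divisor_def u_def)

text \<open>The value at \<open>x\<close> of the Laurent monomial corresponding to \<open>m\<close> in the twist by \<open>a\<close>.\<close>

definition mono :: "complex ^ 'k => int ^ 'k => int ^ 'n => complex" where
 "mono x a m = (\<Prod>i\<in>UNIV. (x $ i) powi (pairing m (u i) + a $ i))"

definition nv :: "complex ^ 'k => (real ^ 'n) set => bool" where "nv x \<sigma> \<longleftrightarrow> (\<forall>i. \<not> \<rho> i \<subseteq> \<sigma> --> x $ i \<noteq> 0)"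

definition cpt :: "complex ^ 'k => (real ^ 'n) set => int ^ 'n => complex" where
 "cpt x \<sigma> = restrict (mono x 0) (dual_semigroup \<sigma>)"

text \<open>The image of x under the Cox map, written out as the set of its representatives on all
  charts that contain it. Here \<open>nv x \<sigma>\<close> says that x lies over the chart of
  \<sigma>.\<close>

definition cclass :: "complex ^ 'k => 'n toric_point" where "cclass x = {(\<sigma>, cpt x \<sigma>) | \<sigma>. \<sigma> \<in> \<Sigma> \<and> nv x \<sigma>}"

text \<open>The characters that are regular on the chart of \<sigma> as sections of the divisor with
  coefficients a. With \<open>UNIV\<close> in place of a cone no ray is exempt, and these are the
  global sections.\<close>

definition Rg :: "int ^ 'k => (real ^ 'n) set => (int ^ 'n) set" where
 "Rg a \<sigma> = {m. \<forall>i. \<rho> i \<subseteq> \<sigma> --> pairing m (u i) + a $ i \<ge> 0}"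

lemma Rg_add: "m \<in> Rg a \<sigma> ==> m' \<in> Rg b \<sigma> ==> m + m' \<in> Rg (a + b) \<sigma>" by (fastforce simp: Rg_def pairing_add)

lemma Rg_mono: "\<tau> \<subseteq> \<sigma> ==> Rg a \<sigma> \<subseteq> Rg a \<tau>" by (auto simp: Rg_def)

lemma dual_Rg: "\<sigma> \<in> \<Sigma> ==> dual_semigroup \<sigma> = Rg 0 \<sigma>" using dual_semigroup_iff by (auto simp: Rg_def)

lemma spn_Rg_mult: "p \<in> spn (Rg a \<sigma>) ==> q \<in> spn (Rg b \<sigma>) ==> p * q \<in> spn (Rg (a + b) \<sigma>)" using spn_mult Rg_add by blast

lemma mono_add:
 assumes "nv x \<sigma>" "m \<in> Rg a \<sigma>" "m' \<in> Rg b \<sigma>"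
 shows "mono x (a + b) (m + m') = mono x a m * mono x b m'"
proof -
 have "(x $ i) powi (pairing (m + m') (u i) + (a + b) $ i)
  = (x $ i) powi (pairing m (u i) + a $ i) * (x $ i) powi (pairing m' (u i) + b $ i)" for i
 proof -
  have "x $ i \<noteq> 0 \<or> (0 \<le> pairing m (u i) + a $ i \<and> 0 \<le> pairing m' (u i) + b $ i)"
   using assms by (cases "\<rho> i \<subseteq> \<sigma>") (auto simp: nv_def Rg_def)
  from power_int_add_nonneg[OF this] show ?thesis by (simp add: pairing_add algebra_simps)
 qed
 thus ?thesis by (simp add: mono_def prod.distrib)
qed

lemma mono_zero [simp]: "mono x 0 0 = 1" by (simp add: mono_def)

lemma cpt_affine: "\<sigma> \<in> \<Sigma> ==> nv x \<sigma> ==> cpt x \<sigma> \<in> affine_points \<sigma>" unfolding affine_points_def cpt_def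
 using mono_add[of x \<sigma> _ 0 _ 0] Rg_add[of _ 0 \<sigma> _ 0] by (auto simp: dual_Rg Rg_def)

lemma nv_Int: "nv x (\<sigma> \<inter> \<tau>) \<longleftrightarrow> nv x \<sigma> \<and> nv x \<tau>" by (auto simp: nv_def)

text \<open>Let \<epsilon> on the overlap restrict to the point of x on \<sigma>. The character w
  that cuts the overlap out of \<sigma> is invertible there, so x has no zero coordinate outside the
  overlap. Any character of the overlap becomes regular on \<sigma> after adding a multiple of w,
  which forces \<epsilon> to be evaluation at x.\<close>

lemma gluing_cpt:
 assumes s: "\<sigma> \<in> \<Sigma>" "nv x \<sigma>"
 shows "gluing \<Sigma> `` {(\<sigma>, cpt x \<sigma>)} = cclass x"
proof
 have restr: "restrict (cpt x (\<sigma> \<inter> \<tau>)) (dual_semigroup \<sigma>) = cpt x \<sigma>" if "\<sigma> \<in> \<Sigma>" "\<tau> \<in> \<Sigma>" for \<sigma> \<tau>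
  using Rg_mono[of "\<sigma> \<inter> \<tau>" \<sigma> 0] that by (auto simp: cpt_def dual_Rg inter_fan fun_eq_iff subset_iff)
 show "cclass x \<subseteq> gluing \<Sigma> `` {(\<sigma>, cpt x \<sigma>)}"
 proof
  fix z assume "z \<in> cclass x"
  then obtain \<tau> where t: "z = (\<tau>, cpt x \<tau>)" "\<tau> \<in> \<Sigma>" "nv x \<tau>" by (auto simp: cclass_def)
  have "cpt x (\<sigma> \<inter> \<tau>) \<in> affine_points (\<sigma> \<inter> \<tau>)" using cpt_affine[OF inter_fan[OF s(1) t(2)]] nv_Int s(2) t(3) by blast
  hence "((\<sigma>, cpt x \<sigma>), (\<tau>, cpt x \<tau>)) \<in> gluing \<Sigma>"
   unfolding gluing_def using s(1) t(2) restr[OF s(1) t(2)] restr[OF t(2) s(1)]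
   by (auto simp: Int_commute intro!: bexI[of _ "cpt x (\<sigma> \<inter> \<tau>)"])
  thus "z \<in> gluing \<Sigma> `` {(\<sigma>, cpt x \<sigma>)}" by (simp add: t(1) Image_singleton_iff)
 qed
 show "gluing \<Sigma> `` {(\<sigma>, cpt x \<sigma>)} \<subseteq> cclass x"
 proof
  fix z assume "z \<in> gluing \<Sigma> `` {(\<sigma>, cpt x \<sigma>)}"
  then obtain \<tau> \<delta> \<epsilon> where z: "z = (\<tau>, \<delta>)" "\<tau> \<in> \<Sigma>" "\<epsilon> \<in> affine_points (\<sigma> \<inter> \<tau>)"
   "cpt x \<sigma> = restrict \<epsilon> (dual_semigroup \<sigma>)" "\<delta> = restrict \<epsilon> (dual_semigroup \<tau>)" by (cases z) (auto simp: gluing_def)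
  note st = inter_fan[OF s(1) z(2)]
  obtain w where w: "\<And>i. \<rho> i \<subseteq> \<sigma> ==> pairing w (u i) \<ge> 0" "\<And>i. \<rho> i \<subseteq> \<sigma> ==> pairing w (u i) = 0 \<longleftrightarrow> \<rho> i \<subseteq> \<sigma> \<inter> \<tau>"
   by (rule face_character[OF s(1) st inter_face(1)[OF s(1) z(2)]]) (rule that)
  have "pairing w (u i) = 0" if "\<rho> i \<subseteq> \<sigma> \<inter> \<tau>" for i using w(2)[of i] that by blast
  hence wd: "w \<in> Rg 0 \<sigma>" "w \<in> Rg 0 (\<sigma> \<inter> \<tau>)" "- w \<in> Rg 0 (\<sigma> \<inter> \<tau>)" using w(1) by (auto simp: Rg_def pairing_minus)
  have \<epsilon>: "\<epsilon> 0 = 1" "\<And>m m'. m \<in> Rg 0 (\<sigma> \<inter> \<tau>) ==> m' \<in> Rg 0 (\<sigma> \<inter> \<tau>) ==> \<epsilon> (m + m') = \<epsilon> m * \<epsilon> m'"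
   "\<epsilon> \<in> extensional (Rg 0 (\<sigma> \<inter> \<tau>))" using z(3) st by (auto simp: affine_points_def dual_Rg)
  have \<epsilon>\<sigma>: "\<epsilon> m = mono x 0 m" if "m \<in> Rg 0 \<sigma>" for m
   using fun_cong[OF z(4), of m] that s(1) by (simp add: cpt_def dual_Rg)
  have "\<epsilon> w * \<epsilon> (- w) = 1" using \<epsilon>(2)[OF wd(2,3)] \<epsilon>(1) by simp
  hence wnz: "mono x 0 w \<noteq> 0" using \<epsilon>\<sigma>[OF wd(1)] by auto
  have "x $ i \<noteq> 0" if "\<not> \<rho> i \<subseteq> \<sigma> \<inter> \<tau>" for i
  proof (cases "\<rho> i \<subseteq> \<sigma>")
   case True
   hence "pairing w (u i) \<noteq> 0" using w(2) that by blast
   moreover have "x $ i powi (pairing w (u i)) \<noteq> 0" using wnz by (simp add: mono_def)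
   ultimately show ?thesis by auto
  qed (use s(2) in \<open>simp add: nv_def\<close>)
  hence nvI: "nv x (\<sigma> \<inter> \<tau>)" by (simp add: nv_def)
  have "\<epsilon> m = mono x 0 m" if m: "m \<in> Rg 0 (\<sigma> \<inter> \<tau>)" for m
  proof -
   define k where "k = (\<Sum>i\<in>UNIV. \<bar>pairing m (u i)\<bar>)"
   have k: "k \<ge> 0" "\<And>i. \<bar>pairing m (u i)\<bar> \<le> k"
    unfolding k_def using member_le_sum[of _ UNIV "\<lambda>i. \<bar>pairing m (u i)\<bar>"] by (auto intro: sum_nonneg)
   have kw: "k *s w \<in> Rg 0 \<sigma>" "k *s w \<in> Rg 0 (\<sigma> \<inter> \<tau>)" using wd k(1) by (auto simp: Rg_def pairing_scale)
   have "0 \<le> pairing m (u i) + k * pairing w (u i)" if "\<rho> i \<subseteq> \<sigma>" for i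
   proof (cases "pairing w (u i) = 0")
    case True
    thus ?thesis using w(2)[OF that] m by (auto simp: Rg_def)
   next
    case False
    hence "k * 1 \<le> k * pairing w (u i)" using w(1)[OF that] k(1) by (intro mult_left_mono) auto
    thus ?thesis using k(2)[of i] by linarith
   qed
   hence mkw: "m + k *s w \<in> Rg 0 \<sigma>" by (auto simp: Rg_def pairing_add pairing_scale)
   have "mono x 0 (k *s w) \<noteq> 0" using wnz by (auto simp: mono_def pairing_scale power_int_mult power_int_eq_0_iff)
   moreover have "\<epsilon> m * mono x 0 (k *s w) = mono x 0 m * mono x 0 (k *s w)"
    using \<epsilon>(2)[OF m kw(2)] \<epsilon>\<sigma>[OF mkw] \<epsilon>\<sigma>[OF kw(1)] mono_add[OF nvI m kw(2)] by simp
   ultimately show ?thesis by simp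
  qed
  hence "\<delta> = cpt x \<tau>" using Rg_mono[of "\<sigma> \<inter> \<tau>" \<tau> 0] z(2,5) by (auto simp: cpt_def dual_Rg fun_eq_iff)
  thus "z \<in> cclass x" using z(1,2) nvI nv_Int by (auto simp: cclass_def)
 qed
qed

lemma cone_monomial_nv: "cox_eval x (cone_monomial \<rho> \<sigma>) \<noteq> 0 \<longleftrightarrow> nv x \<sigma>"
 by (auto simp: cone_monomial_def cox_eval_prod cox_eval_variable nv_def)

lemma irrelevant_locus_iff: "x \<notin> irrelevant_locus \<Sigma> \<rho> \<longleftrightarrow> (\<exists>\<sigma>\<in>\<Sigma>. nv x \<sigma>)"
proof
 assume x: "x \<notin> irrelevant_locus \<Sigma> \<rho>"
 show "\<exists>\<sigma>\<in>\<Sigma>. nv x \<sigma>"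
 proof (rule ccontr)
  assume n: "\<not> (\<exists>\<sigma>\<in>\<Sigma>. nv x \<sigma>)"
  have "ideal {f. cox_eval x f = 0} cox_ring"
  proof -
   have "cox_eval x (f - g) = cox_eval x f - cox_eval x g" for f g using cox_eval_add[of x "f - g" g] by simp
   thus ?thesis unfolding cox_ideal_iff by (simp add: submod_def cox_eval_mult)
  qed
  moreover have "cone_monomial \<rho> ` \<Sigma> \<subseteq> {f. cox_eval x f = 0}" using n cone_monomial_nv by blast
  ultimately have "irrelevant_ideal \<Sigma> \<rho> \<subseteq> {f. cox_eval x f = 0}"
   unfolding irrelevant_ideal_def by (intro ring.genideal_minimal[OF cring.axioms(1)[OF cring_cox]])
  thus False using x by (auto simp: irrelevant_locus_def)
 qed
next
 assume "\<exists>\<sigma>\<in>\<Sigma>. nv x \<sigma>"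
 then obtain \<sigma> where s: "\<sigma> \<in> \<Sigma>" "cox_eval x (cone_monomial \<rho> \<sigma>) \<noteq> 0" using cone_monomial_nv by blast
 have "cone_monomial \<rho> \<sigma> \<in> irrelevant_ideal \<Sigma> \<rho>" unfolding irrelevant_ideal_def
  using ring.genideal_self[OF cring.axioms(1)[OF cring_cox], of "cone_monomial \<rho> ` \<Sigma>"] s(1) by auto
 thus "x \<notin> irrelevant_locus \<Sigma> \<rho>" using s(2) by (auto simp: irrelevant_locus_def)
qed

lemma cox_map_cclass: "x \<notin> irrelevant_locus \<Sigma> \<rho> ==> cox_map \<Sigma> \<rho> x = cclass x"
proof -
 assume "x \<notin> irrelevant_locus \<Sigma> \<rho>"
 hence ne: "{\<sigma>\<in>\<Sigma>. cox_eval x (cone_monomial \<rho> \<sigma>) \<noteq> 0} \<noteq> {}"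
  unfolding irrelevant_locus_iff using cone_monomial_nv by blast
 have "(\<lambda>m. \<Prod>i\<in>UNIV. (x $ i) powi (character_divisor \<rho> m $ i)) = mono x 0" by (simp add: mono_def fun_eq_iff)
 hence "cox_map \<Sigma> \<rho> x = (\<Union>\<sigma>\<in>{\<sigma>\<in>\<Sigma>. cox_eval x (cone_monomial \<rho> \<sigma>) \<noteq> 0}. gluing \<Sigma> `` {(\<sigma>, cpt x \<sigma>)})"
  by (simp add: cox_map_def cpt_def)
 also have "\<dots> = (\<Union>\<sigma>\<in>{\<sigma>\<in>\<Sigma>. cox_eval x (cone_monomial \<rho> \<sigma>) \<noteq> 0}. cclass x)"
  by (intro SUP_cong refl) (use gluing_cpt cone_monomial_nv in auto)
 also have "\<dots> = cclass x" unfolding UN_constant using ne by (simp only: if_False)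
 finally show ?thesis .
qed

lemma cox_fibre_iff: "x \<in> cox_fibre \<Sigma> \<rho> \<zeta> \<longleftrightarrow> (\<exists>\<sigma>\<in>\<Sigma>. nv x \<sigma>) \<and> \<zeta> = cclass x"
 using cox_map_cclass irrelevant_locus_iff by (auto simp: cox_fibre_def)

section \<open>Surjectivity of the Cox quotient map on charts\<close>

lemma real_span: "\<exists>c. x = (\<Sum>i\<in>UNIV. c i *\<^sub>R real_vec (u i))"
proof -
 obtain \<sigma> where s: "\<sigma> \<in> \<Sigma>" "x \<in> \<sigma>" using union by blast
 have "convex_cone hull ((\<lambda>i. real_vec (u i)) ` {i. \<rho> i \<subseteq> \<sigma>}) \<subseteq> span (range (\<lambda>i. real_vec (u i)))"
  by (rule hull_minimal) (auto intro: span_base subspace_imp_convex_cone)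
 hence "x \<in> span (range (\<lambda>i. real_vec (u i)))" using cone_generated[OF s(1)] s(2) by blast
 thus ?thesis
 proof (induction rule: span_induct_alt)
  case base
  thus ?case by (intro exI[of _ "\<lambda>i. 0"]) simp
 next
  case (step c b y)
  then obtain i d where b: "b = real_vec (u i)" and y: "y = (\<Sum>i\<in>UNIV. d i *\<^sub>R real_vec (u i))" by auto
  have "c *\<^sub>R b + y = (\<Sum>j\<in>UNIV. (d j + (if j = i then c else 0)) *\<^sub>R real_vec (u j))"
   by (simp add: b y scaleR_add_left sum.distrib if_distrib[of "\<lambda>c. c *\<^sub>R _"] cong: if_cong)
  thus ?case by (intro exI[of _ "\<lambda>j. d j + (if j = i then c else 0)"])
 qed
qed

text \<open>The ray generators span, so each coordinate axis is a real combination of them. The same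
  combination of logarithms of t, exponentiated, solves the monomial equations.\<close>

lemma torus_lift:
 fixes t :: "complex ^ 'n"
 assumes "\<And>j. t $ j \<noteq> 0"
 obtains x :: "complex ^ 'k" where "\<And>i. x $ i \<noteq> 0" "\<And>m. (\<Prod>i\<in>UNIV. x $ i powi pairing m (u i)) = (\<Prod>j\<in>UNIV. t $ j powi m $ j)"
proof -
 have "\<forall>j. \<exists>c. axis j 1 = (\<Sum>i\<in>UNIV. c i *\<^sub>R real_vec (u i))" by (intro allI real_span)
 from choice[OF this] obtain c where c: "\<And>j. axis j 1 = (\<Sum>i\<in>UNIV. c j i *\<^sub>R real_vec (u i))" by auto
 have cu: "(\<Sum>i\<in>UNIV. c j i * of_int (u i $ l)) = (if l = j then 1 else 0)" for j l
  using arg_cong[OF c[of j], of "\<lambda>v. v $ l"] by (auto simp: axis_def real_vec_def sum_component)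
 define y where "y i = (\<Sum>j\<in>UNIV. Ln (t $ j) * of_real (c j i))" for i
 define x :: "complex ^ 'k" where "x = (\<chi> i. exp (y i))"
 have yu: "(\<Sum>i\<in>UNIV. of_int (u i $ l) * y i) = Ln (t $ l)" for l
 proof -
  have "(\<Sum>i\<in>UNIV. of_int (u i $ l) * y i) = (\<Sum>j\<in>UNIV. Ln (t $ j) * (\<Sum>i\<in>UNIV. of_real (c j i * of_int (u i $ l))))"
   unfolding y_def sum_distrib_left by (subst sum.swap) (simp add: mult_ac)
  also have "\<dots> = (\<Sum>j\<in>UNIV. Ln (t $ j) * of_real (if l = j then 1 else 0))" by (simp only: of_real_sum[symmetric] cu)
  also have "\<dots> = (\<Sum>j\<in>UNIV. if j = l then Ln (t $ l) else 0)" by (intro sum.cong) auto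
  finally show ?thesis by simp
 qed
 have "(\<Prod>i\<in>UNIV. x $ i powi pairing m (u i)) = (\<Prod>j\<in>UNIV. t $ j powi m $ j)" for m
 proof -
  have "(\<Prod>i\<in>UNIV. x $ i powi pairing m (u i)) = exp (\<Sum>i\<in>UNIV. of_int (pairing m (u i)) * y i)"
   by (simp add: x_def exp_power_int exp_sum)
  also have "(\<Sum>i\<in>UNIV. of_int (pairing m (u i)) * y i) = (\<Sum>l\<in>UNIV. of_int (m $ l) * (\<Sum>i\<in>UNIV. of_int (u i $ l) * y i))"
   unfolding pairing_def of_int_sum sum_distrib_right sum_distrib_left by (subst sum.swap) (simp add: mult_ac)
  also have "exp \<dots> = (\<Prod>l\<in>UNIV. t $ l powi m $ l)" by (simp add: yu exp_sum exp_power_int[symmetric] assms)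
  finally show ?thesis .
 qed
 thus ?thesis using that[of x] by (simp add: x_def)
qed

text \<open>The point \<open>x\<close> lies in the closed orbit of its fibre: it has as many vanishing coordinates as possible.\<close>

lemma affine_point_lift:
 assumes s: "\<sigma> \<in> \<Sigma>" and g: "\<gamma> \<in> affine_points \<sigma>"
 obtains x w where "nv x \<sigma>" "\<gamma> = cpt x \<sigma>" "w \<in> Rg 0 \<sigma>" "mono x 0 w \<noteq> 0" "\<And>i. \<rho> i \<subseteq> \<sigma> ==> x $ i = 0 \<longleftrightarrow> pairing w (u i) = 0"
proof -
 have \<gamma>: "\<gamma> 0 = 1" "\<And>m m'. m \<in> Rg 0 \<sigma> ==> m' \<in> Rg 0 \<sigma> ==> \<gamma> (m + m') = \<gamma> m * \<gamma> m'" "\<gamma> \<in> extensional (Rg 0 \<sigma>)"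
  using g s by (auto simp: affine_points_def dual_Rg)
 have Rg0: "0 \<in> Rg 0 \<sigma>" by (simp add: Rg_def)
 have Rga: "m + m' \<in> Rg 0 \<sigma>" if "m \<in> Rg 0 \<sigma>" "m' \<in> Rg 0 \<sigma>" for m m' using Rg_add[OF that] by simp
 \<comment> \<open>F is the face of the semigroup on which \<gamma> does not vanish, and H consists
   of the rays of \<sigma> orthogonal to it. The sum w of the witnesses lies in the relative
   interior of F: it is positive on the other rays of \<sigma>.\<close>
 define F where "F = {m \<in> Rg 0 \<sigma>. \<gamma> m \<noteq> 0}"
 define H where "H = {i. \<rho> i \<subseteq> \<sigma> \<and> (\<forall>m\<in>F. pairing m (u i) = 0)}"
 have Fsum: "sum f A \<in> F" if "\<And>i. i \<in> A ==> f i \<in> F" for f and A :: "'k set"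
  using that by (induction A rule: infinite_finite_induct) (auto simp: F_def \<gamma> Rg0 Rga)
 have "\<exists>m\<in>F. \<rho> i \<subseteq> \<sigma> --> i \<notin> H --> pairing m (u i) > 0" for i
 proof (cases "\<rho> i \<subseteq> \<sigma> \<and> i \<notin> H")
  case True
  then obtain m where "m \<in> F" "pairing m (u i) \<noteq> 0" by (auto simp: H_def)
  moreover from this have "pairing m (u i) \<ge> 0" using True by (auto simp: F_def Rg_def)
  ultimately show ?thesis by (intro bexI[of _ m]) auto
 next
  case False
  thus ?thesis using Fsum[of "{}" "\<lambda>i. 0"] by auto
 qed
 then obtain f where f: "\<And>i. f i \<in> F" "\<And>i. \<rho> i \<subseteq> \<sigma> ==> i \<notin> H ==> pairing (f i) (u i) > 0" by metis
 define w where "w = (\<Sum>i\<in>UNIV. f i)"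
 have wF: "w \<in> F" unfolding w_def by (rule Fsum) (rule f(1))
 have wR: "w \<in> Rg 0 \<sigma>" and wnz: "\<gamma> w \<noteq> 0" using wF by (auto simp: F_def)
 have wH: "pairing w (u i) = 0 \<longleftrightarrow> i \<in> H" if "\<rho> i \<subseteq> \<sigma>" for i
 proof
  assume "pairing w (u i) = 0"
  moreover have "pairing w (u i) > 0" if "i \<notin> H"
  proof -
   have "pairing (f i) (u i) \<le> pairing w (u i)"
    unfolding w_def pairing_sum using f(1) \<open>\<rho> i \<subseteq> \<sigma>\<close> by (intro member_le_sum) (auto simp: F_def Rg_def)
   thus ?thesis using f(2)[OF \<open>\<rho> i \<subseteq> \<sigma>\<close> that] by linarith
  qed
  ultimately show "i \<in> H" by fastforce
 qed (use wF in \<open>auto simp: H_def\<close>)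
 have kw: "int k *s w \<in> Rg 0 \<sigma> \<and> \<gamma> (int k *s w) = \<gamma> w ^ k" for k
 proof (induction k)
  case (Suc k)
  have "int (Suc k) *s w = w + int k *s w" by (simp add: vector_sadd_rdistrib)
  thus ?case using Suc Rga[OF wR] \<gamma>(2)[OF wR] by simp
 qed (simp add: Rg0 \<gamma>)
 define K where "K m = nat (\<Sum>i\<in>UNIV. \<bar>pairing m (u i)\<bar>)" for m
 define G where "G = {m. \<forall>i\<in>H. pairing m (u i) = 0}"
 have mK: "m + int k *s w \<in> Rg 0 \<sigma>" if "m \<in> G" "K m \<le> k" for m k
 proof -
  have "0 \<le> pairing m (u i) + int k * pairing w (u i)" if i: "\<rho> i \<subseteq> \<sigma>" for i
  proof (cases "i \<in> H")
   case True
   thus ?thesis using \<open>m \<in> G\<close> wH[OF i] by (simp add: G_def)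
  next
   case False
   hence "pairing w (u i) \<ge> 1" using wH[OF i] wR i by (force simp: Rg_def)
   hence "int k * 1 \<le> int k * pairing w (u i)" by (intro mult_left_mono) auto
   moreover have "\<bar>pairing m (u i)\<bar> \<le> (\<Sum>i\<in>UNIV. \<bar>pairing m (u i)\<bar>)" by (intro member_le_sum) auto
   hence "\<bar>pairing m (u i)\<bar> \<le> int k" using \<open>K m \<le> k\<close> unfolding K_def by linarith
   ultimately show ?thesis by linarith
  qed
  thus ?thesis by (auto simp: Rg_def pairing_add pairing_scale)
 qed
 have wd: "\<gamma> (m + int k *s w) * \<gamma> w ^ k' = \<gamma> (m + int k' *s w) * \<gamma> w ^ k"
  if "m + int k *s w \<in> Rg 0 \<sigma>" "m + int k' *s w \<in> Rg 0 \<sigma>" for m k k'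
 proof -
  have "(m + int k *s w) + int k' *s w = (m + int k' *s w) + int k *s w" by simp
  thus ?thesis using \<gamma>(2)[OF that(1), of "int k' *s w"] \<gamma>(2)[OF that(2), of "int k *s w"] kw by metis
 qed
 \<comment> \<open>Adding enough copies of w makes any character orthogonal to H regular, so
   \<gamma> extends from F to the group G of all such characters by dividing out the value at
   w.\<close>
 define \<psi> where "\<psi> m = \<gamma> (m + int (K m) *s w) / \<gamma> w ^ K m" for m
 have \<psi>: "\<psi> m = \<gamma> (m + int k *s w) / \<gamma> w ^ k" if "m \<in> G" "m + int k *s w \<in> Rg 0 \<sigma>" for m k
  using wd[OF that(2) mK[OF that(1) order_refl]] wnz by (simp add: \<psi>_def field_simps)
 have Gneg: "- m \<in> G" and Gadd: "m + m' \<in> G" if "m \<in> G" "m' \<in> G" for m m'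
  using that by (auto simp: G_def pairing_minus pairing_add)
 have \<psi>add: "\<psi> (m + m') = \<psi> m * \<psi> m'" if "m \<in> G" "m' \<in> G" for m m'
 proof -
  have e: "m + m' + int (K m + K m') *s w = (m + int (K m) *s w) + (m' + int (K m') *s w)"
   by (simp add: vector_sadd_rdistrib)
  have "m + m' + int (K m + K m') *s w \<in> Rg 0 \<sigma>" unfolding e by (intro Rga mK that order_refl)
  hence "\<psi> (m + m') = \<gamma> (m + m' + int (K m + K m') *s w) / \<gamma> w ^ (K m + K m')" by (rule \<psi>[OF Gadd[OF that]])
  also have "\<dots> = \<psi> m * \<psi> m'" unfolding e using \<gamma>(2)[OF mK[OF that(1) order_refl] mK[OF that(2) order_refl]]
   by (simp add: \<psi>_def power_add)
  finally show ?thesis .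
 qed
 have "0 \<in> G" by (simp add: G_def)
 have "\<psi> 0 = 1" using \<psi>[OF \<open>0 \<in> G\<close>, of 0] Rg0 \<gamma>(1) by simp
 have "char_on G \<psi>" unfolding char_on_def
 proof (intro conjI ballI)
  show "0 \<in> G" by fact
  show "a - b \<in> G" if "a \<in> G" "b \<in> G" for a b using Gadd[OF that(1) Gneg[OF that(2,2)]] by simp
  show "\<psi> a \<noteq> 0" if "a \<in> G" for a using \<psi>add[OF that Gneg[OF that that]] \<open>\<psi> 0 = 1\<close> by auto
  show "\<psi> (a + b) = \<psi> a * \<psi> b" if "a \<in> G" "b \<in> G" for a b by (rule \<psi>add[OF that])
 qed
 then obtain t where t: "\<And>j. t $ j \<noteq> 0" "\<And>m. m \<in> G ==> \<psi> m = (\<Prod>j\<in>UNIV. t $ j powi m $ j)" using char_extend by blast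
 obtain x0 :: "complex ^ 'k" where x0: "\<And>i. x0 $ i \<noteq> 0"
  "\<And>m. (\<Prod>i\<in>UNIV. x0 $ i powi pairing m (u i)) = (\<Prod>j\<in>UNIV. t $ j powi m $ j)" using torus_lift[OF t(1)] by blast
 \<comment> \<open>Zero exactly at H. Characters of G do not involve these coordinates, and a
   regular character outside G has a positive exponent at one of them, in accordance with \<gamma> =
   0 there.\<close>
 define x where "x = (\<chi> i. if i \<in> H then 0 else x0 $ i)"
 have x: "x $ i = 0 \<longleftrightarrow> i \<in> H" for i using x0(1) by (simp add: x_def)
 have xG: "mono x 0 m = \<psi> m" if "m \<in> G" for m
 proof -
  have "mono x 0 m = (\<Prod>i\<in>UNIV. x0 $ i powi pairing m (u i))"
   unfolding mono_def by (intro prod.cong) (use that in \<open>auto simp: x_def G_def\<close>)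
  thus ?thesis using t(2)[OF that] x0(2) by simp
 qed
 have "\<gamma> m = mono x 0 m" if m: "m \<in> Rg 0 \<sigma>" for m
 proof (cases "m \<in> G")
  case True
  thus ?thesis using xG \<psi>[OF True, of 0] m by simp
 next
  case False
  then obtain i where i: "i \<in> H" "pairing m (u i) \<noteq> 0" by (auto simp: G_def)
  hence "\<gamma> m = 0" using m by (auto simp: H_def F_def)
  moreover have "mono x 0 m = 0" unfolding mono_def using x[of i] i by (intro prod_zero) (auto intro!: bexI[of _ i])
  ultimately show ?thesis by simp
 qed
 hence "\<gamma> = cpt x \<sigma>" using \<gamma>(3) s by (auto simp: cpt_def dual_Rg fun_eq_iff extensional_def)
 moreover have "nv x \<sigma>" using x by (auto simp: nv_def H_def)
 moreover have "w \<in> G" using wF by (auto simp: G_def H_def)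
 hence "mono x 0 w \<noteq> 0" using xG \<open>char_on G \<psi>\<close> char_onD(3) by metis
 ultimately show ?thesis using that[of x w] wR wH x by blast
qed

end

section \<open>Degrees and homogenization\<close>

text \<open>Negative entries are truncated to 0, so this is faithful on effective divisors only;
  hence the recurring assumption that a polynomial lies in \<open>Ng a UNIV\<close>.\<close>

definition expo :: "int ^ 'k => ('k::finite \<Rightarrow>\<^sub>0 nat)" where "expo v = Poly_Mapping.Abs_poly_mapping (\<lambda>i. nat (v $ i))"

lemma lookup_expo [simp]: "lkp (expo v) i = nat (v $ i)" by (simp add: expo_def)

lemma expo_add: "(\<And>i. v $ i \<ge> 0) ==> (\<And>i. w $ i \<ge> 0) ==> expo (v + w) = expo v + expo w"
 by (intro poly_mapping_eqI) (simp add: lookup_add nat_add_distrib)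

lemma expo_inverse: "(\<chi> i. int (lkp (expo v) i)) = v \<longleftrightarrow> (\<forall>i. v $ i \<ge> 0)" by (auto simp: vec_eq_iff max_def)

lemma expo_int: "expo (\<chi> i. int (lkp e i)) = e" by (intro poly_mapping_eqI) simp

context toric_fan
begin

abbreviation "dv \<equiv> character_divisor \<rho>"
abbreviation "cl \<equiv> divisor_class \<rho>"

lemma dv_add: "dv (m + m') = dv m + dv m'"
 and dv_diff: "dv (m - m') = dv m - dv m'"
 and dv_zero [simp]: "dv 0 = 0" by (simp_all add: vec_eq_iff pairing_add pairing_diff)

lemma dv_inj: "dv m = dv m' \<longleftrightarrow> m = m'"
proof
 assume "dv m = dv m'"
 hence "pairing (m - m') (u i) = 0" for i by (metis character_divisor_nth pairing_diff right_minus_eq)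
 thus "m = m'" using character_inj[of "m - m'"] by simp
qed simp

lemma comm_group_torus: "comm_group (torus_divisors :: (int ^ 'k) monoid)"
 by (rule comm_groupI) (auto simp: torus_divisors_def intro: exI[of _ "- _"])

lemma subgroup_dv: "subgroup (range dv) torus_divisors"
proof (rule group.subgroupI[OF comm_group.axioms(2)[OF comm_group_torus]])
 fix a assume "a \<in> range dv"
 then obtain m where m: "a = dv m" by blast
 have "inv\<^bsub>torus_divisors\<^esub> a = - a"
  by (rule group.inv_equality[OF comm_group.axioms(2)[OF comm_group_torus]]) (auto simp: torus_divisors_def)
 also have "- a = dv (- m)" using dv_diff[of 0 m] m by simp
 finally show "inv\<^bsub>torus_divisors\<^esub> a \<in> range dv" by simp
qed (auto simp: torus_divisors_def dv_add[symmetric])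

lemma cl_iff: "b \<in> cl a \<longleftrightarrow> (\<exists>m. b = a + dv m)"
 by (auto simp: divisor_class_def r_coset_def torus_divisors_def add.commute)

lemma cl_eq_iff: "cl a = cl b \<longleftrightarrow> (\<exists>m. b = a + dv m)"
proof
 assume "cl a = cl b"
 moreover have "b \<in> cl b" unfolding cl_iff by (intro exI[of _ 0]) simp
 ultimately show "\<exists>m. b = a + dv m" using cl_iff by blast
next
 assume "\<exists>m. b = a + dv m"
 then obtain m where m: "b = a + dv m" by blast
 have "c = a + dv k \<longleftrightarrow> c = b + dv (k - m)" for c k by (simp add: m dv_diff)
 hence "(\<exists>k. c = a + dv k) \<longleftrightarrow> (\<exists>k. c = b + dv k)" for c by (metis add_diff_cancel_right')
 thus "cl a = cl b" using cl_iff by blast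
qed

lemma normal_dv: "range dv \<lhd> torus_divisors" by (rule comm_group.subgroup_imp_normal[OF comm_group_torus subgroup_dv])

lemma comm_group_class: "comm_group (class_group \<rho>)" unfolding class_group_def
 by (rule comm_group.abelian_FactGroup[OF comm_group_torus subgroup_dv])

lemma class_carrier: "carrier (class_group \<rho>) = range cl"
 by (auto simp: class_group_def FactGroup_def RCOSETS_def divisor_class_def torus_divisors_def)

lemma class_mult: "cl a \<otimes>\<^bsub>class_group \<rho>\<^esub> cl b = cl (a + b)"
 using normal.rcos_sum[OF normal_dv, of a b] by (simp add: class_group_def divisor_class_def torus_divisors_def)

lemma class_one: "\<one>\<^bsub>class_group \<rho>\<^esub> = cl 0" using cl_iff[of _ 0] by (auto simp: class_group_def)

lemma class_pow: "cl a [^]\<^bsub>class_group \<rho>\<^esub> (l::nat) = cl (int l *s a)"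
proof (induction l)
 case (Suc l)
 have "int (Suc l) *s a = int l *s a + a" by (simp add: vector_sadd_rdistrib)
 thus ?case using Suc class_mult by (simp add: add.commute)
qed (simp add: class_one)

lemma class_finprod: "finite A ==> finprod (class_group \<rho>) (\<lambda>j. cl (a j)) A = cl (\<Sum>j\<in>A. a j)"
proof (induction A rule: finite_induct)
 case empty
 thus ?case using comm_group.axioms(1)[OF comm_group_class] by (simp add: comm_monoid.finprod_empty class_one)
next
 case (insert x A)
 thus ?case using comm_monoid.finprod_insert[OF comm_group.axioms(1)[OF comm_group_class], of A x "\<lambda>j. cl (a j)"]
  by (simp add: class_carrier class_mult)
qed

lemma monomial_degree_add: "monomial_degree \<rho> e = cl a ==> monomial_degree \<rho> (e' + e) = cl (b + a) \<longleftrightarrow> monomial_degree \<rho> e' = cl b"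
proof -
 assume "monomial_degree \<rho> e = cl a"
 then obtain m where m: "a = (\<chi> i. int (lkp e i)) + dv m" unfolding monomial_degree_def cl_eq_iff by blast
 have s: "(\<chi> i. int (lkp (e' + e) i)) = (\<chi> i. int (lkp e' i)) + (\<chi> i. int (lkp e i))"
  by (simp add: vec_eq_iff lookup_add)
 have "b + a = (\<chi> i. int (lkp (e' + e) i)) + dv k \<longleftrightarrow> b = (\<chi> i. int (lkp e' i)) + dv (k - m)" for k
  unfolding s m by (auto simp: dv_diff algebra_simps)
 thus ?thesis unfolding monomial_degree_def cl_eq_iff by (metis add_diff_cancel_right')
qed

text \<open>Fixing a representative a of the class identifies the graded piece with the Laurent
  polynomials supported on the global sections of the divisor a; another representative shifts the
  supports by a character.\<close>

definition homog :: "int ^ 'k => 'n laurent => 'k cox" where "homog a = mmap (\<lambda>m. expo (dv m + a))"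

abbreviation "Ng a \<sigma> \<equiv> spn (Rg a \<sigma>)"

lemma Rg_UNIV: "m \<in> Rg a UNIV \<longleftrightarrow> (\<forall>i. (dv m + a) $ i \<ge> 0)" by (simp add: Rg_def)

lemma homog_inj_on: "inj_on (\<lambda>m. expo (dv m + a)) (Rg a UNIV)"
proof (rule inj_onI)
 fix m m' assume m: "m \<in> Rg a UNIV" "m' \<in> Rg a UNIV" "expo (dv m + a) = expo (dv m' + a)"
 hence "dv m + a = dv m' + a" using expo_inverse Rg_UNIV by metis
 thus "m = m'" using dv_inj by simp
qed

lemma homog_zero [simp]: "homog a 0 = 0"
 and homog_add: "homog a (p + q) = homog a p + homog a q"
 and homog_sum: "homog a (sum f A) = (\<Sum>i\<in>A. homog a (f i))" by (simp_all add: homog_def mmap_add mmap_sum)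

lemma homog_diff: "homog a (p - q) = homog a p - homog a q" using homog_add[of a "p - q" q] by simp

lemma homog_mult: "p \<in> Ng a UNIV ==> q \<in> Ng b UNIV ==> homog (a + b) (p * q) = homog a p * homog b q" unfolding homog_def
proof (rule mmap_mult)
 fix m m' assume "p \<in> Ng a UNIV" "q \<in> Ng b UNIV" "m \<in> keys p" "m' \<in> keys q"
 hence "m \<in> Rg a UNIV" "m' \<in> Rg b UNIV" by (auto simp: spn_def)
 hence "expo ((dv m + a) + (dv m' + b)) = expo (dv m + a) + expo (dv m' + b)" using Rg_UNIV by (intro expo_add) auto
 thus "expo (dv (m + m') + (a + b)) = expo (dv m + a) + expo (dv m' + b)" by (simp add: dv_add algebra_simps)
qed

lemma homog_eq_0: "p \<in> Ng a UNIV ==> homog a p = 0 \<longleftrightarrow> p = 0"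
proof
 assume p: "p \<in> Ng a UNIV" "homog a p = 0"
 show "p = 0"
 proof (rule ccontr)
  assume "p \<noteq> 0"
  then obtain m where m: "m \<in> keys p" using keys_eq_empty by blast
  have "lkp (homog a p) (expo (dv m + a)) = lkp p m" unfolding homog_def
   by (rule lookup_mmap) (rule inj_on_subset[OF homog_inj_on], use p(1) m in \<open>auto simp: spn_def\<close>)
  thus False using p(2) m by (simp add: in_keys_iff)
 qed
qed simp

lemma homog_inj: "p \<in> Ng a UNIV ==> q \<in> Ng a UNIV ==> homog a p = homog a q ==> p = q"
 using homog_eq_0[OF spn_diff, of p a q] by (simp add: homog_diff)

lemma homog_graded: "p \<in> Ng a UNIV ==> homog a p \<in> graded_piece \<rho> (cl a)"
proof -
 assume p: "p \<in> Ng a UNIV"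
 have "monomial_degree \<rho> (expo (dv m + a)) = cl a" if "m \<in> Rg a UNIV" for m
 proof -
  have "(\<chi> i. int (lkp (expo (dv m + a)) i)) = dv m + a" using that Rg_UNIV expo_inverse by blast
  hence "monomial_degree \<rho> (expo (dv m + a)) = cl (dv m + a)" unfolding monomial_degree_def by simp
  also have "\<dots> = cl a" using cl_eq_iff[of a "dv m + a"] add.commute by metis
  finally show ?thesis .
 qed
 thus ?thesis using p keys_mmap[of "\<lambda>m. expo (dv m + a)" p] unfolding graded_piece_def homog_def spn_def by blast
qed

lemma dehomog:
 assumes "f \<in> graded_piece \<rho> (cl a)"
 obtains p where "p \<in> Ng a UNIV" "homog a p = f"
proof -
 have "\<exists>m. (\<chi> i. int (lkp e i)) = dv m + a" if "e \<in> keys f" for e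
 proof -
  have "cl a = cl (\<chi> i. int (lkp e i))" using assms that by (simp add: graded_piece_def monomial_degree_def)
  thus ?thesis unfolding cl_eq_iff by (metis add.commute)
 qed
 then obtain \<mu> where \<mu>: "\<And>e. e \<in> keys f ==> (\<chi> i. int (lkp e i)) = dv (\<mu> e) + a" by metis
 have "mmap \<mu> f \<in> Ng a UNIV"
 proof -
  have "\<mu> e \<in> Rg a UNIV" if "e \<in> keys f" for e unfolding Rg_UNIV \<mu>[OF that, symmetric] by simp
  thus ?thesis using keys_mmap[of \<mu> f] by (auto simp: spn_def)
 qed
 moreover have "homog a (mmap \<mu> f) = mmap (\<lambda>e. e) f"
  unfolding homog_def mmap_mmap by (rule mmap_cong) (simp add: \<mu>[symmetric] expo_int)
 ultimately show ?thesis using that mmap_ident by metis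
qed

lemma cox_eval_homog:
 assumes "p \<in> Ng a UNIV"
 shows "cox_eval x (homog a p) = ev (mono x a) p" unfolding cox_eval_ev homog_def ev_mmap
proof (rule ev_cong)
 fix m assume "m \<in> keys p"
 hence "m \<in> Rg a UNIV" using assms by (auto simp: spn_def)
 hence "pairing m (u i) + a $ i \<ge> 0" for i by (simp add: Rg_def)
 thus "(\<Prod>i\<in>UNIV. x $ i ^ lkp (expo (dv m + a)) i) = mono x a m"
  unfolding mono_def by (intro prod.cong refl) (simp add: power_int_def)
qed

section \<open>Clearing denominators with powers of cone monomials\<close>

definition hat :: "(real ^ 'n) set => int ^ 'k" where "hat \<sigma> = (\<chi> i. if \<rho> i \<subseteq> \<sigma> then 0 else 1)"

lemma cone_monomial_single: "cone_monomial \<rho> \<sigma> = sgl (expo (hat \<sigma>)) 1"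
proof -
 have "(\<Prod>i\<in>A. variable i) = (sgl (\<Sum>i\<in>A. sgl i 1) 1 :: 'k cox)" for A :: "'k set"
  by (induction A rule: infinite_finite_induct) (auto simp: variable_def mult_single)
 moreover have "(\<Sum>i | \<not> \<rho> i \<subseteq> \<sigma>. sgl i 1) = expo (hat \<sigma>)"
  by (rule poly_mapping_eqI) (auto simp: lookup_sum lookup_single when_def hat_def)
 ultimately show ?thesis by (simp add: cone_monomial_def)
qed

lemma one_Rg_hat: "1 \<in> Ng (int l *s hat \<sigma>) UNIV" by (simp add: spn_def Rg_def hat_def)

lemma cone_monomial_power: "cone_monomial \<rho> \<sigma> ^ l = homog (int l *s hat \<sigma>) 1"
proof (induction l)
 case 0
 have "expo (0 :: int ^ 'k) = 0" by (rule poly_mapping_eqI) simp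
 thus ?case using mmap_single[of "\<lambda>m. expo (dv m + 0)" 0 1] by (simp add: homog_def)
next
 case (Suc l)
 have "homog (hat \<sigma>) 1 = cone_monomial \<rho> \<sigma>"
  using mmap_single[of "\<lambda>m. expo (dv m + hat \<sigma>)" 0 1] by (simp add: homog_def cone_monomial_single)
 moreover have "int (Suc l) *s hat \<sigma> = hat \<sigma> + int l *s hat \<sigma>" by (simp add: vector_sadd_rdistrib)
 ultimately show ?case using homog_mult[of 1 "hat \<sigma>" 1 "int l *s hat \<sigma>"] one_Rg_hat[of 1 \<sigma>] one_Rg_hat[of l \<sigma>] Suc
  by simp
qed

text \<open>The divisor \<open>hat \<sigma>\<close> is positive exactly at the rays outside
  \<sigma>, the only places where p may have negative exponents. L is a crude bound for all
  exponents occurring in p.\<close>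

lemma Ng_globalize:
 assumes "p \<in> Ng a \<sigma>"
 shows "\<exists>L. \<forall>l\<ge>L. p \<in> Ng (a + int l *s hat \<sigma>) UNIV"
proof -
 define L where "L = nat (\<Sum>m\<in>keys p. \<Sum>i\<in>UNIV. \<bar>pairing m (u i) + a $ i\<bar>)"
 have "m \<in> Rg (a + int l *s hat \<sigma>) UNIV" if m: "m \<in> keys p" and l: "l \<ge> L" for m l
 proof -
  have "0 \<le> pairing m (u i) + (a + int l *s hat \<sigma>) $ i" for i
  proof (cases "\<rho> i \<subseteq> \<sigma>")
   case True
   thus ?thesis using assms m by (auto simp: spn_def Rg_def hat_def)
  next
   case False
   have "\<bar>pairing m (u i) + a $ i\<bar> \<le> (\<Sum>i\<in>UNIV. \<bar>pairing m (u i) + a $ i\<bar>)" by (intro member_le_sum) auto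
   also have "\<dots> \<le> (\<Sum>m\<in>keys p. \<Sum>i\<in>UNIV. \<bar>pairing m (u i) + a $ i\<bar>)"
    by (intro member_le_sum[of m _ "\<lambda>m. \<Sum>i\<in>UNIV. \<bar>pairing m (u i) + a $ i\<bar>"] m) (auto intro: sum_nonneg)
   finally have "\<bar>pairing m (u i) + a $ i\<bar> \<le> int l" using l unfolding L_def by linarith
   thus ?thesis using False by (simp add: hat_def)
  qed
  thus ?thesis by (simp add: Rg_def)
 qed
 thus ?thesis by (intro exI[of _ L]) (auto simp: spn_def)
qed

lemma Ng_hat: "Ng (a + int l *s hat \<sigma>) UNIV \<subseteq> Ng a \<sigma>"
proof -
 have "Rg (a + int l *s hat \<sigma>) UNIV \<subseteq> Rg a \<sigma>"
 proof
  fix m assume "m \<in> Rg (a + int l *s hat \<sigma>) UNIV"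
  hence "0 \<le> pairing m (u i) + (a + int l *s hat \<sigma>) $ i" for i by (simp add: Rg_def)
  hence "0 \<le> pairing m (u i) + a $ i" if "\<rho> i \<subseteq> \<sigma>" for i
  proof -
   have "hat \<sigma> $ i = 0" using that by (simp add: hat_def)
   thus ?thesis using \<open>\<And>i. 0 \<le> pairing m (u i) + (a + int l *s hat \<sigma>) $ i\<close>[of i] by simp
  qed
  thus "m \<in> Rg a \<sigma>" by (simp add: Rg_def)
 qed
 thus ?thesis by (auto simp: spn_def)
qed

section \<open>Support functions of nef classes\<close>

text \<open>The character \<mu> \<sigma> is a global section of l times the divisor without zeros on
  the chart of \<sigma>. Up to sign and the factor l this is the local data of a convex support
  function; l > 1 covers divisors that are only Q-Cartier.\<close>

definition nef_support :: "int ^ 'k => int => ((real ^ 'n) set => int ^ 'n) => bool" where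
 "nef_support a l \<mu> \<longleftrightarrow> l > 0 \<and> (\<forall>\<sigma>\<in>\<Sigma>. \<forall>i. pairing (\<mu> \<sigma>) (u i) + l * a $ i \<ge> 0 \<and>
   (\<rho> i \<subseteq> \<sigma> --> pairing (\<mu> \<sigma>) (u i) + l * a $ i = 0))"

lemma cclass_toric:
 assumes "\<sigma> \<in> \<Sigma>" "nv x \<sigma>"
 shows "cclass x \<in> toric_variety \<Sigma>" unfolding toric_variety_def quotient_def
 using gluing_cpt[OF assms] cpt_affine[OF assms] assms(1) by (auto intro!: bexI[of _ "(\<sigma>, cpt x \<sigma>)"])

text \<open>Tested at the distinguished point of the orbit of \<sigma>, with Cox coordinates 0 on
  the rays of \<sigma> and 1 elsewhere. A section that is nonzero there contains a monomial of
  exponent 0 on all rays of \<sigma>.\<close>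

lemma basepoint_free_support:
 assumes "basepoint_free \<Sigma> \<rho> (cl a)"
 shows "\<exists>\<mu>. nef_support a 1 \<mu>"
proof -
 define Q where "Q \<sigma> m \<longleftrightarrow> (\<forall>i. pairing m (u i) + a $ i \<ge> 0 \<and> (\<rho> i \<subseteq> \<sigma> --> pairing m (u i) + a $ i = 0))" for \<sigma> m
 have "\<exists>m. Q \<sigma> m" if s: "\<sigma> \<in> \<Sigma>" for \<sigma>
 proof -
  define x :: "complex ^ 'k" where "x = (\<chi> i. if \<rho> i \<subseteq> \<sigma> then 0 else 1)"
  have x: "nv x \<sigma>" by (simp add: nv_def x_def)
  obtain f where f: "f \<in> graded_piece \<rho> (cl a)" "cclass x \<notin> hypersurface \<Sigma> \<rho> f"
   using assms cclass_toric[OF s x] unfolding basepoint_free_def basepoint_def by blast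
  have "x \<in> cox_fibre \<Sigma> \<rho> (cclass x)" using cox_fibre_iff s x by blast
  hence "cox_eval x f \<noteq> 0" using f(2) cclass_toric[OF s x] unfolding hypersurface_def by blast
  obtain p where p: "p \<in> Ng a UNIV" "homog a p = f" using dehomog[OF f(1)] by blast
  have "ev (mono x a) p \<noteq> 0" using cox_eval_homog[OF p(1), of x] p(2) \<open>cox_eval x f \<noteq> 0\<close> by simp
  then obtain m where m: "m \<in> keys p" "mono x a m \<noteq> 0" unfolding ev_def by (metis (no_types, lifting) mult_zero_right sum.neutral)
  have "m \<in> Rg a UNIV" using p(1) m(1) by (auto simp: spn_def)
  moreover have "pairing m (u i) + a $ i = 0" if "\<rho> i \<subseteq> \<sigma>" for i
  proof -
   have "x $ i powi (pairing m (u i) + a $ i) \<noteq> 0" using m(2) by (simp add: mono_def)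
   thus ?thesis using that by (auto simp: x_def power_int_0_left_if split: if_splits)
  qed
  ultimately show ?thesis by (auto simp: Rg_def Q_def)
 qed
 then obtain \<mu> where "\<And>\<sigma>. \<sigma> \<in> \<Sigma> ==> Q \<sigma> (\<mu> \<sigma>)" by metis
 hence "nef_support a 1 \<mu>" unfolding nef_support_def Q_def by simp
 thus ?thesis by blast
qed

text \<open>The monomials regular on a cone are those for which the cone avoids a convex set: this is where nefness,
 i.e. convexity of the support function, enters.\<close>

definition bad_set :: "int => ((real ^ 'n) set => int ^ 'n) => int ^ 'n => (real ^ 'n) set" where
 "bad_set l \<mu> m = {x. \<forall>\<sigma>\<in>\<Sigma>. (l *s m - \<mu> \<sigma>) \<star> x < 0}"

lemma convex_bad_set: "convex (bad_set l \<mu> m)"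
proof -
 have "bad_set l \<mu> m = (\<Inter>\<sigma>\<in>\<Sigma>. {x. (l *s m - \<mu> \<sigma>) \<star> x < 0})" by (auto simp: bad_set_def)
 thus ?thesis by (simp add: convex_INT convex_halfspace_lt)
qed

text \<open>If m is regular on the intersection, its functional relative to a cone \<tau> inside is
  nonnegative on the generators of \<tau>, hence on \<tau>. If m fails at a ray, the support
  inequalities put that ray generator itself into the bad set. For the empty list, completeness
  supplies a cone containing a given point.\<close>

lemma Rg_iff_meets:
 assumes a: "nef_support a l \<mu>" and t: "t \<in> lists \<Sigma>"
 shows "m \<in> Rg a (\<Inter>(set t)) \<longleftrightarrow> \<not> meets (bad_set l \<mu> m) t"
proof
 assume m: "m \<in> Rg a (\<Inter>(set t))"
 show "\<not> meets (bad_set l \<mu> m) t"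
 proof
  assume "meets (bad_set l \<mu> m) t"
  then obtain x where x: "x \<in> bad_set l \<mu> m" "x \<in> \<Inter>(set t)" by (auto simp: meets_def)
  obtain \<tau> where \<tau>: "\<tau> \<in> \<Sigma>" "x \<in> \<tau>" "\<tau> \<subseteq> \<Inter>(set t)"
  proof (cases "t = []")
   case True
   thus ?thesis using union that by auto
  next
   case False
   thus ?thesis using Inter_fan[OF t] x(2) that by blast
  qed
  have "(l *s m - \<mu> \<tau>) \<star> x \<ge> 0"
  proof (rule cone_inner_nonneg[OF \<tau>(1) _ \<tau>(2)])
   fix i assume i: "\<rho> i \<subseteq> \<tau>"
   have "pairing m (u i) + a $ i \<ge> 0" using m i \<tau>(3) by (auto simp: Rg_def)
   hence "l * (pairing m (u i) + a $ i) \<ge> 0" using a by (simp add: nef_support_def)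
   moreover have "pairing (\<mu> \<tau>) (u i) + l * a $ i = 0" using a i \<tau>(1) by (simp add: nef_support_def)
   ultimately have "pairing (l *s m - \<mu> \<tau>) (u i) \<ge> 0" by (simp add: pairing_diff pairing_scale algebra_simps)
   thus "(l *s m - \<mu> \<tau>) \<star> real_vec (u i) \<ge> 0" by (simp add: real_vec_inner)
  qed
  thus False using x(1) \<tau>(1) by (auto simp: bad_set_def)
 qed
next
 assume nm: "\<not> meets (bad_set l \<mu> m) t"
 have "pairing m (u i) + a $ i \<ge> 0" if i: "\<rho> i \<subseteq> \<Inter>(set t)" for i
 proof (rule ccontr)
  assume "\<not> pairing m (u i) + a $ i \<ge> 0"
  hence neg: "l * (pairing m (u i) + a $ i) < 0" using a by (simp add: nef_support_def mult_pos_neg)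
  have "(l *s m - \<mu> \<sigma>) \<star> real_vec (u i) < 0" if "\<sigma> \<in> \<Sigma>" for \<sigma>
  proof -
   have "pairing (\<mu> \<sigma>) (u i) + l * a $ i \<ge> 0" using a that by (simp add: nef_support_def)
   hence "pairing (l *s m - \<mu> \<sigma>) (u i) < 0" using neg by (simp add: pairing_diff pairing_scale algebra_simps)
   thus ?thesis by (simp add: real_vec_inner)
  qed
  hence "real_vec (u i) \<in> bad_set l \<mu> m" by (simp add: bad_set_def)
  moreover have "real_vec (u i) \<in> \<rho> i" using ray_subset_iff[OF ray(1)] by blast
  ultimately show False using nm i by (auto simp: meets_def)
 qed
 thus "m \<in> Rg a (\<Inter>(set t))" by (simp add: Rg_def)
qed

end

text \<open>A system of \<open>n\<close> equations: \<open>F j\<close> is the dehomogenization of the \<open>j\<close>-th generator, a section of the divisor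
 with coefficients \<open>a j\<close>.\<close>

locale toric_system = toric_fan \<Sigma> \<rho> for \<Sigma> :: "(real ^ 'n::finite) set set" and \<rho> :: "'k::finite => (real ^ 'n) set" +
 fixes a :: "nat => int ^ 'k" and F :: "nat => 'n laurent" and \<mu> :: "nat => (real ^ 'n) set => int ^ 'n"
 assumes F: "\<And>j. j \<in> {1..CARD('n)} ==> F j \<in> spn (Rg (a j) UNIV)"
  and \<mu>: "\<And>j. j \<in> {1..CARD('n)} ==> nef_support (a j) 1 (\<mu> j)"
begin

definition I :: "'k cox set" where "I = Idl\<^bsub>cox_ring\<^esub> ((\<lambda>j. homog (a j) (F j)) ` {1..CARD('n)})"

text \<open>The part of twist b of the ideal on the chart of \<sigma>, with coefficients regular in
  the complementary twists. With \<open>UNIV\<close> it is the graded piece of \<open>I\<close> in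
  dehomogenized form.\<close>

definition Im :: "int ^ 'k => (real ^ 'n) set => 'n laurent set" where
 "Im b \<sigma> = {\<Sum>j\<in>{1..CARD('n)}. F j * q j | q. \<forall>j\<in>{1..CARD('n)}. q j \<in> Ng (b - a j) \<sigma>}"

lemma F_local: "j \<in> {1..CARD('n)} ==> F j \<in> Ng (a j) \<sigma>" using F spn_mono Rg_mono[of \<sigma> UNIV] by blast

lemma Im_sub: "Im b \<sigma> \<subseteq> Ng b \<sigma>"
proof
 fix x assume "x \<in> Im b \<sigma>"
 then obtain q where q: "x = (\<Sum>j\<in>{1..CARD('n)}. F j * q j)" "\<forall>j\<in>{1..CARD('n)}. q j \<in> Ng (b - a j) \<sigma>" by (auto simp: Im_def)
 have "F j * q j \<in> Ng b \<sigma>" if "j \<in> {1..CARD('n)}" for j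
  using spn_Rg_mult[OF F_local[OF that], where q = "q j" and b = "b - a j"] q(2) that by simp
 thus "x \<in> Ng b \<sigma>" unfolding q(1) by (intro spn_sum)
qed

lemma Im_mult: "x \<in> Im b \<sigma> ==> y \<in> Ng c \<sigma> ==> y * x \<in> Im (c + b) \<sigma>"
proof -
 assume "x \<in> Im b \<sigma>" and y: "y \<in> Ng c \<sigma>"
 then obtain q where q: "x = (\<Sum>j\<in>{1..CARD('n)}. F j * q j)" "\<forall>j\<in>{1..CARD('n)}. q j \<in> Ng (b - a j) \<sigma>" by (auto simp: Im_def)
 have "y * x = (\<Sum>j\<in>{1..CARD('n)}. F j * (y * q j))" by (simp add: q(1) sum_distrib_left mult_ac)
 moreover have "y * q j \<in> Ng (c + b - a j) \<sigma>" if "j \<in> {1..CARD('n)}" for j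
  using spn_Rg_mult[OF y, where q = "q j" and b = "b - a j"] q(2) that by (simp add: algebra_simps)
 ultimately show ?thesis unfolding Im_def by (intro CollectI exI[of _ "\<lambda>j. y * q j"]) simp
qed

lemma submod_Im: "submod (Ng 0 \<sigma>) (Im b \<sigma>)" unfolding submod_def
proof (intro conjI ballI)
 show "0 \<in> Im b \<sigma>" unfolding Im_def by (intro CollectI exI[of _ "\<lambda>j. 0"]) simp
 show "x - y \<in> Im b \<sigma>" if xy: "x \<in> Im b \<sigma>" "y \<in> Im b \<sigma>" for x y
 proof -
  obtain q r where "x = (\<Sum>j\<in>{1..CARD('n)}. F j * q j)" "\<forall>j\<in>{1..CARD('n)}. q j \<in> Ng (b - a j) \<sigma>"
   "y = (\<Sum>j\<in>{1..CARD('n)}. F j * r j)" "\<forall>j\<in>{1..CARD('n)}. r j \<in> Ng (b - a j) \<sigma>" using xy by (auto simp: Im_def)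
  thus ?thesis unfolding Im_def
   by (intro CollectI exI[of _ "\<lambda>j. q j - r j"]) (simp add: right_diff_distrib sum_subtractf spn_diff)
 qed
 show "r * x \<in> Im b \<sigma>" if "r \<in> Ng 0 \<sigma>" "x \<in> Im b \<sigma>" for r x using Im_mult[OF that(2,1)] by simp
qed

lemma Im_mono: "\<tau> \<subseteq> \<sigma> ==> Im b \<sigma> \<subseteq> Im b \<tau>" unfolding Im_def using spn_mono[OF _ Rg_mono] by blast

lemma I_iff: "f \<in> I \<longleftrightarrow> (\<exists>s. f = (\<Sum>j\<in>{1..CARD('n)}. s j * homog (a j) (F j)))"
proof
 let ?S = "{f. \<exists>s. f = (\<Sum>j\<in>{1..CARD('n)}. s j * homog (a j) (F j))}"
 assume "f \<in> I"
 moreover have "ideal ?S cox_ring" unfolding cox_ideal_iff submod_def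
 proof (intro conjI ballI)
  show "0 \<in> ?S" by (intro CollectI exI[of _ "\<lambda>j. 0"]) simp
  fix x y assume "x \<in> ?S" "y \<in> ?S"
  then obtain s t where "x = (\<Sum>j\<in>{1..CARD('n)}. s j * homog (a j) (F j))" "y = (\<Sum>j\<in>{1..CARD('n)}. t j * homog (a j) (F j))" by blast
  thus "x - y \<in> ?S" by (intro CollectI exI[of _ "\<lambda>j. s j - t j"]) (simp add: left_diff_distrib sum_subtractf)
 next
  fix r x assume "x \<in> ?S"
  then obtain s where "x = (\<Sum>j\<in>{1..CARD('n)}. s j * homog (a j) (F j))" by blast
  thus "r * x \<in> ?S" by (intro CollectI exI[of _ "\<lambda>j. r * s j"]) (simp add: sum_distrib_left mult_ac)
 qed
 moreover have "(\<lambda>j. homog (a j) (F j)) ` {1..CARD('n)} \<subseteq> ?S"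
 proof clarify
  fix j assume j: "j \<in> {1..CARD('n)}"
  have "(\<Sum>i\<in>{1..CARD('n)}. (if i = j then 1 else 0) * homog (a i) (F i)) = (\<Sum>i\<in>{1..CARD('n)}. if i = j then homog (a j) (F j) else 0)"
   by (intro sum.cong) auto
  thus "\<exists>s. homog (a j) (F j) = (\<Sum>i\<in>{1..CARD('n)}. s i * homog (a i) (F i))"
   using j by (intro exI[of _ "\<lambda>i. if i = j then 1 else 0"]) simp
 qed
 ultimately have "I \<subseteq> ?S" unfolding I_def by (intro ring.genideal_minimal[OF cring.axioms(1)[OF cring_cox]])
 thus "\<exists>s. f = (\<Sum>j\<in>{1..CARD('n)}. s j * homog (a j) (F j))" using \<open>f \<in> I\<close> by blast
next
 have "ideal I cox_ring" unfolding I_def by (rule ring.genideal_ideal[OF cring.axioms(1)[OF cring_cox]]) simp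
 hence s: "submod UNIV I" by (simp add: cox_ideal_iff)
 have "homog (a j) (F j) \<in> I" if "j \<in> {1..CARD('n)}" for j
  unfolding I_def using ring.genideal_self[OF cring.axioms(1)[OF cring_cox], of "(\<lambda>j. homog (a j) (F j)) ` {1..CARD('n)}"] that by auto
 moreover assume "\<exists>s. f = (\<Sum>j\<in>{1..CARD('n)}. s j * homog (a j) (F j))"
 ultimately show "f \<in> I" by (auto intro!: submod_sum[OF s] submod_mult[OF s])
qed

lemma submod_I: "submod UNIV I"
 unfolding cox_ideal_iff[symmetric] I_def by (rule ring.genideal_ideal[OF cring.axioms(1)[OF cring_cox]]) simp

text \<open>The coefficients of a presentation by the generators are arbitrary polynomials. Cutting
  them down to the complementary degrees loses nothing, because each generator is homogeneous, and
  what remains dehomogenizes.\<close>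

lemma homog_I_iff:
 assumes p: "p \<in> Ng b UNIV"
 shows "homog b p \<in> I \<longleftrightarrow> p \<in> Im b UNIV"
proof
 assume "homog b p \<in> I"
 then obtain s where s: "homog b p = (\<Sum>j\<in>{1..CARD('n)}. s j * homog (a j) (F j))" using I_iff by blast
 define S where "S c = {e. monomial_degree \<rho> e = cl c}" for c
 have "\<exists>q. q \<in> Ng (b - a j) UNIV \<and> homog (b - a j) q = restr (S (b - a j)) (s j)" for j
  using dehomog[of "restr (S (b - a j)) (s j)" "b - a j"] by (auto simp: graded_piece_def keys_restr S_def)
 then obtain q where q: "\<And>j. q j \<in> Ng (b - a j) UNIV" "\<And>j. homog (b - a j) (q j) = restr (S (b - a j)) (s j)" by metis
 have "restr (S b) (homog b p) = homog b p"
  using homog_graded[OF p] by (intro restr_id) (auto simp: spn_def S_def graded_piece_def)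
 moreover have "restr (S b) (s j * homog (a j) (F j)) = homog b (F j * q j)" if j: "j \<in> {1..CARD('n)}" for j
 proof -
  have "restr (S b) (s j * homog (a j) (F j)) = restr (S (b - a j)) (s j) * homog (a j) (F j)"
  proof (rule restr_mult)
   fix e' e assume "e \<in> keys (homog (a j) (F j))"
   hence "monomial_degree \<rho> e = cl (a j)" using homog_graded[OF F[OF j]] by (simp add: graded_piece_def)
   thus "e' + e \<in> S b \<longleftrightarrow> e' \<in> S (b - a j)" using monomial_degree_add[of e "a j" e' "b - a j"] by (simp add: S_def)
  qed
  also have "\<dots> = homog b (F j * q j)" using homog_mult[OF F[OF j] q(1)[of j]] by (simp add: q(2) mult.commute)
  finally show ?thesis .
 qed
 ultimately have "homog b p = homog b (\<Sum>j\<in>{1..CARD('n)}. F j * q j)"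
  using arg_cong[OF s, of "restr (S b)"] by (simp add: restr_sum homog_sum)
 moreover have "(\<Sum>j\<in>{1..CARD('n)}. F j * q j) \<in> Im b UNIV" using q(1) by (auto simp: Im_def)
 ultimately show "p \<in> Im b UNIV" using homog_inj[OF p] Im_sub by blast
next
 assume "p \<in> Im b UNIV"
 then obtain q where q: "p = (\<Sum>j\<in>{1..CARD('n)}. F j * q j)" "\<forall>j\<in>{1..CARD('n)}. q j \<in> Ng (b - a j) UNIV" by (auto simp: Im_def)
 have "homog b p = (\<Sum>j\<in>{1..CARD('n)}. homog (b - a j) (q j) * homog (a j) (F j))" unfolding q(1) homog_sum
 proof (rule sum.cong[OF refl])
  fix j assume j: "j \<in> {1..CARD('n)}"
  show "homog b (F j * q j) = homog (b - a j) (q j) * homog (a j) (F j)"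
   using homog_mult[OF F[OF j], of "q j" "b - a j"] q(2) j by (simp add: mult.commute)
 qed
 thus "homog b p \<in> I" unfolding I_iff by (rule exI[of _ "\<lambda>j. homog (b - a j) (q j)"])
qed

lemma Im_globalize:
 assumes "p \<in> Im b \<sigma>"
 shows "\<exists>L. \<forall>l\<ge>L. p \<in> Im (b + int l *s hat \<sigma>) UNIV"
proof -
 obtain q where q: "p = (\<Sum>j\<in>{1..CARD('n)}. F j * q j)" "\<forall>j\<in>{1..CARD('n)}. q j \<in> Ng (b - a j) \<sigma>" using assms by (auto simp: Im_def)
 have "\<forall>j. \<exists>L. j \<in> {1..CARD('n)} --> (\<forall>l\<ge>L. q j \<in> Ng (b - a j + int l *s hat \<sigma>) UNIV)" using q(2) Ng_globalize by simp
 from choice[OF this] obtain L where L': "\<forall>j. j \<in> {1..CARD('n)} --> (\<forall>l\<ge>L j. q j \<in> Ng (b - a j + int l *s hat \<sigma>) UNIV)" ..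
 have L: "q j \<in> Ng (b - a j + int l *s hat \<sigma>) UNIV" if "j \<in> {1..CARD('n)}" "l \<ge> L j" for j l using L' that by simp
 have "p \<in> Im (b + int l *s hat \<sigma>) UNIV" if l: "l \<ge> (\<Sum>j\<in>{1..CARD('n)}. L j)" for l
 proof -
  have "q j \<in> Ng (b + int l *s hat \<sigma> - a j) UNIV" if "j \<in> {1..CARD('n)}" for j
  proof -
   have "L j \<le> (\<Sum>j\<in>{1..CARD('n)}. L j)" using that by (intro member_le_sum) auto
   thus ?thesis using L[OF that, of l] l by (simp add: algebra_simps)
  qed
  thus ?thesis unfolding Im_def q(1) by blast
 qed
 thus ?thesis by blast
qed

lemma Im_local_iff: "p \<in> Im b \<sigma> \<longleftrightarrow> (\<exists>l. p \<in> Im (b + int l *s hat \<sigma>) UNIV)"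
proof
 assume "\<exists>l. p \<in> Im (b + int l *s hat \<sigma>) UNIV"
 then obtain l where l: "p \<in> Im (b + int l *s hat \<sigma>) UNIV" by blast
 then obtain q where q: "p = (\<Sum>j\<in>{1..CARD('n)}. F j * q j)" "\<forall>j\<in>{1..CARD('n)}. q j \<in> Ng (b + int l *s hat \<sigma> - a j) UNIV" by (auto simp: Im_def)
 have "q j \<in> Ng (b - a j) \<sigma>" if "j \<in> {1..CARD('n)}" for j
  using q(2) that Ng_hat[of "b - a j" l \<sigma>] by (auto simp: algebra_simps)
 thus "p \<in> Im b \<sigma>" unfolding Im_def q(1) by blast
qed (use Im_globalize in blast)

end

section \<open>Zero-dimensional ideals of chart rings\<close>

definition subring_set :: "'r::comm_ring_1 set => bool" where "subring_set A \<longleftrightarrow> 1 \<in> A \<and> submod A A"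

definition ideal_in :: "'r::comm_ring_1 set => 'r set => bool" where "ideal_in A J \<longleftrightarrow> submod A J \<and> J \<subseteq> A"

definition prime_in :: "'r::comm_ring_1 set => 'r set => bool" where
 "prime_in A P \<longleftrightarrow> ideal_in A P \<and> 1 \<notin> P \<and> (\<forall>x\<in>A. \<forall>y\<in>A. x * y \<in> P --> x \<in> P \<or> y \<in> P)"

lemma ideal_in_sum:
 assumes "subring_set A" "ideal_in A P" "x \<in> A"
 shows "ideal_in A {p + s * x | p s. p \<in> P \<and> s \<in> A}" "P \<subseteq> {p + s * x | p s. p \<in> P \<and> s \<in> A}"
  "x \<in> {p + s * x | p s. p \<in> P \<and> s \<in> A}"
proof -
 have A: "submod A A" "1 \<in> A" and P: "submod A P" "P \<subseteq> A" using assms by (auto simp: subring_set_def ideal_in_def)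
 note z = submod_zero[OF A(1)] submod_zero[OF P(1)]
 show "P \<subseteq> {p + s * x | p s. p \<in> P \<and> s \<in> A}"
 proof
  fix p assume "p \<in> P"
  thus "p \<in> {p + s * x | p s. p \<in> P \<and> s \<in> A}" using z by (intro CollectI exI[of _ p] exI[of _ 0]) simp
 qed
 show "x \<in> {p + s * x | p s. p \<in> P \<and> s \<in> A}" using z A(2) by (intro CollectI exI[of _ 0] exI[of _ 1]) simp
 show "ideal_in A {p + s * x | p s. p \<in> P \<and> s \<in> A}" unfolding ideal_in_def submod_def
 proof (intro conjI ballI)
  show "0 \<in> {p + s * x | p s. p \<in> P \<and> s \<in> A}" using z by (intro CollectI exI[of _ 0]) simp
  show "{p + s * x | p s. p \<in> P \<and> s \<in> A} \<subseteq> A" using P(2) submod_add[OF A(1)] submod_mult[OF A(1) _ assms(3)] by blast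
  fix y assume "y \<in> {p + s * x | p s. p \<in> P \<and> s \<in> A}"
  then obtain p s where y: "y = p + s * x" "p \<in> P" "s \<in> A" by blast
  show "y - y' \<in> {p + s * x | p s. p \<in> P \<and> s \<in> A}" if yy: "y' \<in> {p + s * x | p s. p \<in> P \<and> s \<in> A}" for y'
  proof -
   obtain p' s' where y': "y' = p' + s' * x" "p' \<in> P" "s' \<in> A" using yy by blast
   have "y - y' = (p - p') + (s - s') * x" by (simp add: y y' algebra_simps)
   thus ?thesis using submod_diff[OF P(1) y(2) y'(2)] submod_diff[OF A(1) y(3) y'(3)] by blast
  qed
  show "r * y \<in> {p + s * x | p s. p \<in> P \<and> s \<in> A}" if "r \<in> A" for r
  proof -
   have "r * y = r * p + (r * s) * x" by (simp add: y algebra_simps)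
   thus ?thesis using submod_mult[OF P(1) that y(2)] submod_mult[OF A(1) that y(3)] by blast
  qed
 qed
qed

text \<open>An ideal P maximal among those that avoid S is prime: enlarging it by x or by y outside
  P meets S, and the product of the two elements met lies in S, and also in P if x y does.\<close>

lemma krull_prime:
 assumes A: "subring_set A" and J: "ideal_in A J"
  and S: "S \<subseteq> A" "1 \<in> S" "\<And>x y. x \<in> S ==> y \<in> S ==> x * y \<in> S" and JS: "J \<inter> S = {}"
 obtains P where "prime_in A P" "J \<subseteq> P" "P \<inter> S = {}" "\<And>Q. ideal_in A Q ==> P \<subseteq> Q ==> Q \<inter> S = {} ==> Q = P"
proof -
 define C where "C = {Q. ideal_in A Q \<and> J \<subseteq> Q \<and> Q \<inter> S = {}}"
 have "\<exists>M\<in>C. \<forall>X\<in>C. M \<subseteq> X --> X = M"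
 proof (rule subset_Zorn_nonempty)
  show "C \<noteq> {}" using J JS by (auto simp: C_def)
  fix K assume K: "K \<noteq> {}" "subset.chain C K"
  have KC: "\<And>Q. Q \<in> K ==> Q \<in> C" and ch: "\<And>Q R. Q \<in> K ==> R \<in> K ==> Q \<subseteq> R \<or> R \<subseteq> Q" using K(2) by (auto simp: subset_chain_def)
  have "ideal_in A (\<Union>K)" unfolding ideal_in_def submod_def
  proof (intro conjI ballI)
   show "0 \<in> \<Union>K" using K(1) KC by (auto simp: C_def ideal_in_def submod_def)
   show "\<Union>K \<subseteq> A" using KC by (auto simp: C_def ideal_in_def)
   fix x assume x: "x \<in> \<Union>K"
   show "x - y \<in> \<Union>K" if y: "y \<in> \<Union>K" for y
   proof -
    obtain Q R where "x \<in> Q" "y \<in> R" "Q \<in> K" "R \<in> K" using x y by blast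
    then obtain T where "T \<in> K" "x \<in> T" "y \<in> T" using ch by blast
    thus ?thesis using KC[of T] by (auto simp: C_def ideal_in_def submod_def)
   qed
   show "r * x \<in> \<Union>K" if "r \<in> A" for r using x KC that by (fastforce simp: C_def ideal_in_def submod_def)
  qed
  thus "\<Union>K \<in> C" using K(1) KC unfolding C_def by blast
 qed
 then obtain P where P: "P \<in> C" "\<And>X. X \<in> C ==> P \<subseteq> X ==> X = P" by blast
 have Pi: "ideal_in A P" "J \<subseteq> P" "P \<inter> S = {}" using P(1) by (auto simp: C_def)
 have Ps: "submod A P" "P \<subseteq> A" and As: "submod A A" using Pi(1) A by (auto simp: ideal_in_def subring_set_def)
 have hit: "\<exists>p s. p \<in> P \<and> s \<in> A \<and> p + s * x \<in> S" if x: "x \<in> A" "x \<notin> P" for x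
 proof (rule ccontr)
  assume *: "\<nexists>p s. p \<in> P \<and> s \<in> A \<and> p + s * x \<in> S"
  let ?Q = "{p + s * x | p s. p \<in> P \<and> s \<in> A}"
  have "?Q \<in> C" using ideal_in_sum(1,2)[OF A Pi(1) x(1)] Pi(2) * unfolding C_def by blast
  hence "?Q = P" using P(2) ideal_in_sum(2)[OF A Pi(1) x(1)] by blast
  thus False using ideal_in_sum(3)[OF A Pi(1) x(1)] x(2) by blast
 qed
 have "prime_in A P" unfolding prime_in_def
 proof (intro conjI ballI impI)
  show "1 \<notin> P" using Pi(3) S(2) by blast
  fix x y assume xy: "x \<in> A" "y \<in> A" "x * y \<in> P"
  show "x \<in> P \<or> y \<in> P"
  proof (rule ccontr)
   assume "\<not> (x \<in> P \<or> y \<in> P)"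
   then obtain p s p' s' where 1: "p \<in> P" "s \<in> A" "p + s * x \<in> S" and 2: "p' \<in> P" "s' \<in> A" "p' + s' * y \<in> S"
    using hit xy(1,2) by metis
   have "(p + s * x) * (p' + s' * y) = (p' + s' * y) * p + ((s * x) * p' + (s * s') * (x * y))"
    by (simp add: algebra_simps)
   moreover have "\<dots> \<in> P" using submod_mult[OF Ps(1) _ 1(1)] submod_mult[OF Ps(1) _ 2(1)] submod_mult[OF Ps(1) _ xy(3)]
     submod_mult[OF As] 1(2) 2(1,2) xy(1,2) Ps(2) submod_add[OF As] by (intro submod_add[OF Ps(1)]) auto
   ultimately show False using S(3)[OF 1(3) 2(3)] Pi(3) by auto
  qed
 qed (rule Pi(1))
 thus ?thesis using that[of P] Pi P(2) unfolding C_def by blast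
qed

lemma maximal_prime:
 assumes A: "subring_set A" and J: "ideal_in A J" "1 \<notin> J"
 obtains P where "prime_in A P" "J \<subseteq> P"
proof -
 have S: "{1} \<subseteq> A" "1 \<in> {1 :: 'a}" "\<And>x y. x \<in> {1 :: 'a} ==> y \<in> {1} ==> x * y \<in> {1}" "J \<inter> {1} = {}"
  using A J(2) by (auto simp: subring_set_def)
 show ?thesis by (rule krull_prime[OF A J(1) S(1,2) S(3) S(4)]) (assumption | rule that)+
qed

section \<open>Elements that are algebraic modulo an ideal\<close>

definition peval :: "('g::comm_monoid_add \<Rightarrow>\<^sub>0 complex) => complex poly => ('g \<Rightarrow>\<^sub>0 complex)" where
 "peval y q = poly (map_poly (sgl 0) q) y"

lemma peval_0 [simp]: "peval y 0 = 0"
 and peval_pCons: "peval y (pCons c q) = sgl 0 c + y * peval y q" by (simp_all add: peval_def map_poly_pCons)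

lemma peval_add: "peval y (p + q) = peval y p + peval y q"
 by (induction p q rule: poly_induct2) (simp_all add: peval_pCons single_add algebra_simps)

lemma peval_smult: "peval y (Polynomial.smult c q) = sgl 0 c * peval y q"
 by (induction q) (simp_all add: peval_pCons mult_single algebra_simps)

lemma peval_mult: "peval y (p * q) = peval y p * peval y q"
 by (induction p) (simp_all add: peval_pCons peval_add peval_smult algebra_simps)

lemma peval_1 [simp]: "peval y 1 = 1" by (simp add: one_pCons peval_pCons)

lemma peval_linear: "peval y [:- c, 1:] = y - sgl 0 c" by (simp add: peval_pCons single_uminus)

lemma peval_prod: "peval y (prod f X) = (\<Prod>x\<in>X. peval y (f x))"
 by (induction X rule: infinite_finite_induct) (auto simp: peval_mult)

lemma peval_sum: "peval y (sum f X) = (\<Sum>x\<in>X. peval y (f x))"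
 by (induction X rule: infinite_finite_induct) (auto simp: peval_add)

lemma peval_in:
 assumes "subring_set A" "\<And>c. sgl 0 c \<in> A" "y \<in> A"
 shows "peval y q \<in> A" using assms by (induction q)
  (auto simp: peval_pCons subring_set_def intro: submod_add submod_mult submod_zero)

interpretation lv: vector_space "\<lambda>c (x :: 'g::comm_monoid_add \<Rightarrow>\<^sub>0 complex). sgl 0 c * x"
 by unfold_locales (simp_all add: single_add mult_single algebra_simps flip: mult.assoc)

text \<open>Over the uncountable field of complex numbers, an algebra of countable dimension contains no copy of
 \<open>\<complex>(y)\<close>, since the elements \<open>1 / (y - c)\<close> are linearly independent.\<close>

lemma algebraic_mod_maximal:
 fixes A :: "('g::{comm_monoid_add,countable} \<Rightarrow>\<^sub>0 complex) set"
 assumes A: "subring_set A" "\<And>c. sgl 0 c \<in> A" and P: "ideal_in A P" and y: "y \<in> A"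
  and inv: "\<And>c. \<exists>b\<in>A. b * (y - sgl 0 c) - 1 \<in> P"
 shows "\<exists>q. q \<noteq> 0 \<and> peval y q \<in> P"
proof (rule ccontr)
 assume no: "\<nexists>q. q \<noteq> 0 \<and> peval y q \<in> P"
 have Ps: "submod A P" and As: "submod A A" using P A by (auto simp: ideal_in_def subring_set_def)
 obtain b where b: "\<And>c. b c \<in> A" "\<And>c. b c * (y - sgl 0 c) - 1 \<in> P" using inv by metis
 \<comment> \<open>There are only countably many finite supports, so infinitely many of the inverses
   b c share one support K. They lie in a space of dimension at most card K, hence card K + 1 of
   them are dependent.\<close>
 have "\<exists>K. infinite {c. keys (b c) = K}"
 proof (rule ccontr)
  assume "\<nexists>K. infinite {c. keys (b c) = K}"
  hence "countable {c. keys (b c) = K}" for K using countable_finite by blast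
  moreover have "countable {K :: 'g set. finite K}" by (rule countable_Collect_finite)
  ultimately have "countable (\<Union>K\<in>{K. finite K}. {c. keys (b c) = K})" by (intro countable_UN)
  moreover have "(\<Union>K\<in>{K. finite K}. {c. keys (b c) = K}) = (UNIV :: complex set)"
  proof (rule UNIV_eq_I[symmetric])
   show "c \<in> (\<Union>K\<in>{K. finite K}. {c. keys (b c) = K})" for c by (rule UN_I[of "keys (b c)"]) simp_all
  qed
  ultimately show False using uncountable_UNIV_complex by simp
 qed
 then obtain K where K: "infinite {c. keys (b c) = K}" by blast
 then obtain c0 where "keys (b c0) = K" by (metis (mono_tags) empty_Collect_eq finite.emptyI)
 hence finK: "finite K" by (metis finite_keys)
 obtain \<Lambda> where \<Lambda>: "\<Lambda> \<subseteq> {c. keys (b c) = K}" "finite \<Lambda>" "card \<Lambda> = Suc (card K)"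
  using infinite_arbitrarily_large[OF K] by metis
 have inj: "inj_on b \<Lambda>"
 proof (rule inj_onI, rule ccontr)
  fix c c' assume c: "b c = b c'" "c \<noteq> c'"
  have "b c * (y - sgl 0 c') - 1 - (b c * (y - sgl 0 c) - 1) \<in> P"
   using submod_diff[OF Ps b(2)[of c'] b(2)[of c]] c(1) by simp
  hence "(y - sgl 0 c) * (b c * (y - sgl 0 c') - 1 - (b c * (y - sgl 0 c) - 1)) \<in> P"
   using submod_mult[OF Ps] submod_diff[OF As y A(2)] by blast
  moreover have "b c * (y - sgl 0 c') - 1 - (b c * (y - sgl 0 c) - 1) = b c * sgl 0 (c - c')"
   by (simp add: algebra_simps single_diff)
  moreover have "sgl 0 (c - c') * (b c * (y - sgl 0 c) - 1) \<in> P" using submod_mult[OF Ps A(2) b(2)] .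
  ultimately have "(y - sgl 0 c) * (b c * sgl 0 (c - c')) - sgl 0 (c - c') * (b c * (y - sgl 0 c) - 1) \<in> P"
   using submod_diff[OF Ps] by metis
  hence "sgl 0 (c - c') \<in> P" by (simp add: algebra_simps)
  hence "peval y [:c - c':] \<in> P" by (simp add: peval_pCons)
  moreover have "[:c - c':] \<noteq> 0" using c(2) by simp
  ultimately show False using no by blast
 qed
 have "b ` \<Lambda> \<subseteq> lv.span ((\<lambda>m. sgl m 1) ` K)"
 proof clarify
  fix c assume "c \<in> \<Lambda>"
  hence "keys (b c) = K" using \<Lambda>(1) by blast
  hence "b c = (\<Sum>m\<in>K. sgl 0 (lkp (b c) m) * sgl m 1)" using monomial_sum[of "b c"] by (simp add: mult_single)
  also have "\<dots> \<in> lv.span ((\<lambda>m. sgl m 1) ` K)" by (intro lv.span_sum lv.span_scale lv.span_base) auto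
  finally show "b c \<in> lv.span ((\<lambda>m. sgl m 1) ` K)" .
 qed
 moreover have "card (b ` \<Lambda>) > card ((\<lambda>m. sgl m (1::complex)) ` K)"
  using card_image[OF inj] \<Lambda>(3) card_image_le[OF finK, of "\<lambda>m. sgl m (1::complex)"] by simp
 ultimately have "lv.dependent (b ` \<Lambda>)"
  using lv.independent_span_bound[of "(\<lambda>m. sgl m 1) ` K" "b ` \<Lambda>"] finK by (meson finite_imageI not_le)
 then obtain d where d: "\<exists>v\<in>b ` \<Lambda>. d v \<noteq> 0" "(\<Sum>v\<in>b ` \<Lambda>. sgl 0 (d v) * v) = 0"
  using lv.dependent_finite[of "b ` \<Lambda>"] \<Lambda>(2) by auto
 define e where "e c = d (b c)" for c
 have e: "(\<Sum>c\<in>\<Lambda>. sgl 0 (e c) * b c) = 0" using d(2) by (simp add: sum.reindex[OF inj] e_def)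
 obtain c1 where c1: "c1 \<in> \<Lambda>" "e c1 \<noteq> 0" using d(1) by (auto simp: e_def)
 \<comment> \<open>Multiplying the linear relation between the b c by all factors y - x turns each b
   c into the product of the other factors, modulo P. So q evaluated at y lies in P, and q is
   nonzero because its value at c1 is e c1 times a product of nonzero differences.\<close>
 define q where "q = (\<Sum>c\<in>\<Lambda>. Polynomial.smult (e c) (\<Prod>x\<in>\<Lambda> - {c}. [:- x, 1:]))"
 have "poly q c1 = (\<Sum>c\<in>\<Lambda>. if c = c1 then e c1 * (\<Prod>x\<in>\<Lambda> - {c1}. c1 - x) else 0)" unfolding q_def poly_sum
 proof (rule sum.cong[OF refl])
  fix c assume "c \<in> \<Lambda>"
  have "(\<Prod>x\<in>\<Lambda> - {c}. c1 - x) = 0" if "c \<noteq> c1" using that c1(1) \<Lambda>(2) by (intro prod_zero) auto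
  thus "poly (Polynomial.smult (e c) (\<Prod>x\<in>\<Lambda> - {c}. [:- x, 1:])) c1 = (if c = c1 then e c1 * (\<Prod>x\<in>\<Lambda> - {c1}. c1 - x) else 0)"
   by (auto simp: poly_prod)
 qed
 hence "poly q c1 \<noteq> 0" using c1 \<Lambda>(2) by (auto simp: prod_zero_iff)
 hence "q \<noteq> 0" by auto
 have linA: "y - sgl 0 x \<in> A" for x by (rule submod_diff[OF As y A(2)])
 have prodA: "(\<Prod>x\<in>X. y - sgl 0 x) \<in> A" for X
  using A(1) linA by (induction X rule: infinite_finite_induct) (auto simp: subring_set_def intro: submod_mult)
 have "peval y q = (\<Sum>c\<in>\<Lambda>. sgl 0 (e c) * (\<Prod>x\<in>\<Lambda> - {c}. y - sgl 0 x))"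
  by (simp add: q_def peval_sum peval_smult peval_prod peval_linear)
 also have "\<dots> = (\<Prod>x\<in>\<Lambda>. y - sgl 0 x) * (\<Sum>c\<in>\<Lambda>. sgl 0 (e c) * b c)
   - (\<Sum>c\<in>\<Lambda>. (sgl 0 (e c) * (\<Prod>x\<in>\<Lambda> - {c}. y - sgl 0 x)) * (b c * (y - sgl 0 c) - 1))"
  unfolding sum_distrib_left sum_subtractf[symmetric]
 proof (rule sum.cong[OF refl])
  fix c assume "c \<in> \<Lambda>"
  have aux: "d * q = (l * q) * (d * k) - (d * q) * (k * l - 1)" for d q l k :: "'g \<Rightarrow>\<^sub>0 complex"
   by (simp add: algebra_simps)
  have "(\<Prod>x\<in>\<Lambda>. y - sgl 0 x) = (y - sgl 0 c) * (\<Prod>x\<in>\<Lambda> - {c}. y - sgl 0 x)" using prod.remove[OF \<Lambda>(2) \<open>c \<in> \<Lambda>\<close>] .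
  thus "sgl 0 (e c) * (\<Prod>x\<in>\<Lambda> - {c}. y - sgl 0 x) = (\<Prod>x\<in>\<Lambda>. y - sgl 0 x) * (sgl 0 (e c) * b c)
   - (sgl 0 (e c) * (\<Prod>x\<in>\<Lambda> - {c}. y - sgl 0 x)) * (b c * (y - sgl 0 c) - 1)" by (simp only: aux)
 qed
 also have "\<dots> = - (\<Sum>c\<in>\<Lambda>. (sgl 0 (e c) * (\<Prod>x\<in>\<Lambda> - {c}. y - sgl 0 x)) * (b c * (y - sgl 0 c) - 1))" by (simp add: e)
 also have "\<dots> \<in> P"
  by (intro submod_minus[OF Ps] submod_sum[OF Ps] submod_mult[OF Ps] submod_mult[OF As A(2) prodA] b(2))
 finally show False using no \<open>q \<noteq> 0\<close> by blast
qed

text \<open>The values q(y) with q nonzero are multiplicatively closed. If they avoid J, so does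
  some prime P containing J. In dimension zero P is maximal, hence every y - c is invertible modulo
  P, which makes y algebraic modulo P, a contradiction.\<close>

lemma algebraic_zero_dim:
 fixes A :: "('g::{comm_monoid_add,countable} \<Rightarrow>\<^sub>0 complex) set"
 assumes A: "subring_set A" "\<And>c. sgl 0 c \<in> A" and J: "ideal_in A J" and y: "y \<in> A"
  and dim0: "\<And>P P'. prime_in A P ==> prime_in A P' ==> J \<subseteq> P ==> P \<subseteq> P' ==> P = P'"
 shows "\<exists>q. q \<noteq> 0 \<and> peval y q \<in> J"
proof (rule ccontr)
 assume no: "\<nexists>q. q \<noteq> 0 \<and> peval y q \<in> J"
 define S where "S = {peval y q | q. q \<noteq> 0}"
 have "S \<subseteq> A" using peval_in[OF A y] by (auto simp: S_def)
 moreover have "1 \<in> S" unfolding S_def by (intro CollectI exI[of _ 1]) simp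
 moreover have "s * t \<in> S" if st: "s \<in> S" "t \<in> S" for s t
 proof -
  obtain p q where "s = peval y p" "t = peval y q" "p \<noteq> 0" "q \<noteq> 0" using st by (auto simp: S_def)
  thus ?thesis unfolding S_def by (intro CollectI exI[of _ "p * q"]) (simp add: peval_mult)
 qed
 moreover have "J \<inter> S = {}" using no by (auto simp: S_def)
 ultimately obtain P where P: "prime_in A P" "J \<subseteq> P" "P \<inter> S = {}" using krull_prime[OF A(1) J, of S] by metis
 have Pi: "ideal_in A P" using P(1) by (simp add: prime_in_def)
 have "\<exists>b\<in>A. b * (y - sgl 0 c) - 1 \<in> P" for c
 proof (rule ccontr)
  assume none: "\<not> (\<exists>b\<in>A. b * (y - sgl 0 c) - 1 \<in> P)"
  have yA: "y - sgl 0 c \<in> A" using A y by (auto simp: subring_set_def intro: submod_diff)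
  define Q where "Q = {p + s * (y - sgl 0 c) | p s. p \<in> P \<and> s \<in> A}"
  have Q: "ideal_in A Q" "P \<subseteq> Q" "y - sgl 0 c \<in> Q" unfolding Q_def by (rule ideal_in_sum[OF A(1) Pi yA])+
  have "1 \<notin> Q"
  proof
   assume "1 \<in> Q"
   then obtain p s where "1 = p + s * (y - sgl 0 c)" "p \<in> P" "s \<in> A" by (auto simp: Q_def)
   moreover from this have "s * (y - sgl 0 c) - 1 = - p" by (simp add: algebra_simps)
   ultimately show False using none Pi submod_minus[of A P p] by (auto simp: ideal_in_def)
  qed
  then obtain P' where P': "prime_in A P'" "Q \<subseteq> P'" using maximal_prime[OF A(1) Q(1)] by metis
  have "P = P'" using dim0[OF P(1) P'(1) P(2)] Q(2) P'(2) by blast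
  hence "y - sgl 0 c \<in> P" using Q(3) P'(2) by blast
  moreover have "y - sgl 0 c \<in> S" unfolding S_def by (intro CollectI exI[of _ "[:- c, 1:]"]) (simp add: peval_linear)
  ultimately show False using P(3) by blast
 qed
 from algebraic_mod_maximal[OF A Pi y this] show False using P(3) by (auto simp: S_def)
qed

lemma peval_root:
 assumes P: "prime_in A P" and A: "subring_set A" "\<And>c. sgl 0 c \<in> A" and y: "y \<in> A"
 shows "q \<noteq> 0 ==> peval y q \<in> P ==> \<exists>c. y - sgl 0 c \<in> P"
proof (induction "degree q" arbitrary: q)
 case 0
 then obtain c where c: "q = [:c:]" "c \<noteq> 0" by (metis degree_eq_zeroE pCons_0_0)
 have "sgl 0 (1 / c) * sgl 0 c \<in> P"
  by (rule submod_mult[of A]) (use P A(2) 0 c in \<open>auto simp: prime_in_def ideal_in_def peval_pCons\<close>)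
 thus ?case using P c(2) by (simp add: mult_single prime_in_def)
next
 case (Suc k)
 have "\<not> constant (poly q)" using Suc.hyps(2) constant_degree[of q] by simp
 then obtain z where "poly q z = 0" using fundamental_theorem_of_algebra by blast
 then obtain r where r: "q = [:- z, 1:] * r" using poly_eq_0_iff_dvd by (metis dvd_def)
 have r0: "r \<noteq> 0" using r Suc.prems(1) by auto
 have "degree q = Suc (degree r)" unfolding r by (subst degree_mult_eq) (use r0 in auto)
 hence dr: "k = degree r" using Suc.hyps(2) by simp
 have "peval y [:- z, 1:] * peval y r \<in> P" using Suc.prems(2) by (simp only: r peval_mult)
 moreover have "peval y [:- z, 1:] \<in> A" "peval y r \<in> A" by (rule peval_in[OF A y])+
 ultimately consider "peval y [:- z, 1:] \<in> P" | "peval y r \<in> P" using P by (auto simp: prime_in_def)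
 thus ?case
 proof cases
  case 1
  thus ?thesis by (auto simp: peval_linear)
 next
  case 2
  thus ?thesis using Suc.hyps(1)[OF dr r0] by blast
 qed
qed

text \<open>Splits off the root 0 of q. The cofactor has a nonzero constant term, so it is nonzero
  wherever y vanishes. This factorization supplies the inverses and idempotents of the
  finite-dimensional quotient.\<close>

lemma peval_fitting:
 assumes A: "subring_set A" "\<And>c. sgl 0 c \<in> A" and y: "y \<in> A"
 shows "q \<noteq> 0 ==> \<exists>k c r. c \<noteq> 0 \<and> r \<in> A \<and> peval y q = y ^ k * (sgl 0 c + y * r)"
proof (induction q)
 case (pCons c q)
 show ?case
 proof (cases "c = 0")
  case True
  then obtain k d r where "d \<noteq> 0" "r \<in> A" "peval y q = y ^ k * (sgl 0 d + y * r)" using pCons by auto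
  thus ?thesis using True by (intro exI[of _ "Suc k"] exI[of _ d] exI[of _ r]) (simp add: peval_pCons mult_ac)
 next
  case False
  thus ?thesis using peval_in[OF A y, of q]
   by (intro exI[of _ 0] exI[of _ c] exI[of _ "peval y q"]) (simp add: peval_pCons)
 qed
qed simp

section \<open>Gordan's lemma and finite codimension\<close>

lemma nat_seq_mono_subseq:
 fixes s :: "nat => nat"
 obtains r :: "nat => nat" where "strict_mono r" "mono (\<lambda>n. s (r n))"
proof -
 obtain f where f: "strict_mono f" "monoseq (\<lambda>n. s (f n))" using seq_monosub by blast
 show ?thesis
 proof (cases "\<forall>m. \<forall>n\<ge>m. s (f m) \<le> s (f n)")
  case True
  thus ?thesis using that[of f] f(1) by (simp add: mono_def)
 next
  case False
  hence dec: "\<forall>m. \<forall>n\<ge>m. s (f n) \<le> s (f m)" using f(2) by (auto simp: monoseq_def)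
  obtain N where N: "\<And>n. s (f N) \<le> s (f n)" using ex_has_least_nat[of "\<lambda>_. True" 0 "\<lambda>n. s (f n)"] by auto
  have "strict_mono (\<lambda>n. f (N + n))" using f(1) by (simp add: strict_mono_def)
  moreover have "mono (\<lambda>n. s (f (N + n)))"
  proof (rule monoI)
   fix m n :: nat
   have "s (f (N + m)) \<le> s (f N)" using dec by simp
   thus "s (f (N + m)) \<le> s (f (N + n))" using N[of "N + n"] by linarith
  qed
  ultimately show ?thesis using that by blast
 qed
qed

text \<open>A sequence of distinct points has a subsequence monotone in the first coordinate, a
  further one in the second, and so on; two of its terms are comparable.\<close>

lemma dickson:
 fixes S :: "('i::finite => nat) set"
 assumes "infinite S"
 obtains x y where "x \<in> S" "y \<in> S" "x \<noteq> y" "\<And>i. x i \<le> y i"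
proof -
 obtain f :: "nat => 'i => nat" where f: "inj f" "range f \<subseteq> S" using assms infinite_countable_subset by metis
 have "\<exists>r :: nat => nat. strict_mono r \<and> (\<forall>i\<in>J. mono (\<lambda>n. f (r n) i))" if "finite J" for J :: "'i set" using that
 proof (induction J rule: finite_induct)
  case empty
  thus ?case by (intro exI[of _ id]) (simp add: strict_mono_def)
 next
  case (insert i J)
  then obtain r :: "nat => nat" where r: "strict_mono r" "\<forall>i\<in>J. mono (\<lambda>n. f (r n) i)" by blast
  obtain r' :: "nat => nat" where r': "strict_mono r'" "mono (\<lambda>n. f (r (r' n)) i)"
   by (rule nat_seq_mono_subseq[of "\<lambda>n. f (r n) i"])
  have "mono (\<lambda>n. f (r (r' n)) j)" if "j \<in> J" for j
   using monoD[OF bspec[OF r(2) that]] monoD[OF strict_mono_mono[OF r'(1)]] by (intro monoI) blast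
  moreover have "strict_mono (\<lambda>n. r (r' n))" using r(1) r'(1) by (simp add: strict_mono_def)
  ultimately show ?case using r'(2) by (intro exI[of _ "\<lambda>n. r (r' n)"]) simp
 qed
 from this[of UNIV] obtain r :: "nat => nat" where r: "strict_mono r" "\<And>i. mono (\<lambda>n. f (r n) i)" by auto
 have "f (r 0) \<noteq> f (r 1)" using f(1) strict_monoD[OF r(1), of 0 1] by (auto dest: injD)
 thus ?thesis using that[of "f (r 0)" "f (r 1)"] f(2) monoD[OF r(2), of 0 1] by auto
qed

text \<open>Each orthant meets the dual cone in a pointed monoid, where the indecomposable elements generate.\<close>

lemma gordan:
 fixes w :: "'k::finite => int ^ 'n::finite" and R :: "'k set"
 defines "D \<equiv> {m. \<forall>i\<in>R. pairing m (w i) \<ge> 0}"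
 obtains G where "finite G" "G \<subseteq> D - {0}" "\<And>m. m \<in> D ==> m \<noteq> 0 ==> m \<notin> G ==> \<exists>x\<in>D. \<exists>y\<in>D. m = x + y \<and>
    (\<Sum>j\<in>UNIV. \<bar>x $ j\<bar>) < (\<Sum>j\<in>UNIV. \<bar>m $ j\<bar>) \<and> (\<Sum>j\<in>UNIV. \<bar>y $ j\<bar>) < (\<Sum>j\<in>UNIV. \<bar>m $ j\<bar>)"
proof -
 \<comment> \<open>Positive parts, negative parts and pairings. If \<phi> x is below \<phi> m, then
   m - x still lies in D and no coordinate cancels, so the sizes of x and m - x add up to that of
   m.\<close>
 define \<phi> :: "int ^ 'n => ('n + 'n) + 'k => nat" where
  "\<phi> m = (\<lambda>t. case t of Inl (Inl j) => nat (m $ j) | Inl (Inr j) => nat (- m $ j) | Inr i => if i \<in> R then nat (pairing m (w i)) else 0)" for m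
 have \<phi>inj: "inj \<phi>"
 proof (rule injI)
  fix m m' assume e: "\<phi> m = \<phi> m'"
  have "m $ j = m' $ j" for j
   using fun_cong[OF e, of "Inl (Inl j)"] fun_cong[OF e, of "Inl (Inr j)"] by (simp add: \<phi>_def)
  thus "m = m'" by (simp add: vec_eq_iff)
 qed
 define le where "le x m \<longleftrightarrow> (\<forall>t. \<phi> x t \<le> \<phi> m t)" for x m
 define G where "G = {m \<in> D - {0}. \<forall>x\<in>D - {0}. le x m --> x = m}"
 have "finite G"
 proof (rule ccontr)
  assume "infinite G"
  hence "infinite (\<phi> ` G)" using finite_imageD inj_on_subset[OF \<phi>inj] by blast
  then obtain p q where pq: "p \<in> \<phi> ` G" "q \<in> \<phi> ` G" "p \<noteq> q" "\<And>t. p t \<le> q t" using dickson by blast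
  then obtain x m where "p = \<phi> x" "q = \<phi> m" "x \<in> G" "m \<in> G" by blast
  thus False using pq(3,4) by (auto simp: G_def le_def)
 qed
 moreover have "\<exists>x\<in>D. \<exists>y\<in>D. m = x + y \<and>
    (\<Sum>j\<in>UNIV. \<bar>x $ j\<bar>) < (\<Sum>j\<in>UNIV. \<bar>m $ j\<bar>) \<and> (\<Sum>j\<in>UNIV. \<bar>y $ j\<bar>) < (\<Sum>j\<in>UNIV. \<bar>m $ j\<bar>)"
  if m: "m \<in> D" "m \<noteq> 0" "m \<notin> G" for m
 proof -
  obtain x where x: "x \<in> D" "x \<noteq> 0" "le x m" "x \<noteq> m" using m by (auto simp: G_def)
  have comp: "\<bar>m $ j\<bar> = \<bar>x $ j\<bar> + \<bar>(m - x) $ j\<bar>" for j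
  proof -
   have "nat (x $ j) \<le> nat (m $ j)" "nat (- x $ j) \<le> nat (- m $ j)"
    using x(3)[unfolded le_def, rule_format, of "Inl (Inl j)"] x(3)[unfolded le_def, rule_format, of "Inl (Inr j)"]
    by (simp_all add: \<phi>_def)
   thus ?thesis by auto
  qed
  have "m - x \<in> D"
  proof -
   have "pairing x (w i) \<le> pairing m (w i)" if "i \<in> R" for i
    using x(3)[unfolded le_def, rule_format, of "Inr i"] that x(1) m(1) by (auto simp: \<phi>_def D_def nat_le_eq_zle)
   thus ?thesis by (simp add: D_def pairing_diff)
  qed
  moreover have pos: "(\<Sum>j\<in>UNIV. \<bar>v $ j\<bar>) > 0" if "v \<noteq> 0" for v :: "int ^ 'n"
  proof -
   obtain j where "v $ j \<noteq> 0" using \<open>v \<noteq> 0\<close> by (auto simp: vec_eq_iff)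
   thus ?thesis by (intro sum_pos2[of _ j]) auto
  qed
  moreover have "(\<Sum>j\<in>UNIV. \<bar>m $ j\<bar>) = (\<Sum>j\<in>UNIV. \<bar>x $ j\<bar>) + (\<Sum>j\<in>UNIV. \<bar>(m - x) $ j\<bar>)"
   unfolding sum.distrib[symmetric] by (rule sum.cong[OF refl comp])
  ultimately show ?thesis using x pos[of x] pos[of "m - x"] by (intro bexI[of _ x] bexI[of _ "m - x"] conjI) auto
 qed
 ultimately show ?thesis using that[of G] by (auto simp: G_def)
qed

section \<open>Local-global principle for systems of dimension zero\<close>

lemma spn_shift: "(p :: 'g::comm_monoid_add \<Rightarrow>\<^sub>0 complex) \<in> spn S ==> (\<And>m. m \<in> S ==> c + m \<in> S') ==> sgl c 1 * p \<in> spn S'"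
 by (rule spn_mult[of _ "{c}"]) auto

lemma sgl_cancel: "sgl (- c) 1 * (sgl (c::int ^ 'n) (1::complex) * p) = p" "sgl c 1 * (sgl (- c) (1::complex) * p) = p"
 by (simp_all add: mult_single flip: mult.assoc)

lemma peval_monomial:
 fixes m :: "int ^ 'n"
 assumes "m \<noteq> 0" "q \<noteq> 0"
 shows "peval (sgl m 1) q \<noteq> 0" "keys (peval (sgl m 1) q) \<subseteq> range (\<lambda>k::nat. int k *s m)"
proof -
 have pow: "sgl m (1::complex) ^ k = sgl (int k *s m) 1" for k
  by (induction k) (simp_all add: mult_single vector_sadd_rdistrib)
 have dq: "degree (map_poly (sgl (0 :: int ^ 'n)) q) = degree q" by (intro degree_map_poly) (metis lookup_single_eq lookup_zero)
 have e: "peval (sgl m 1) q = (\<Sum>k\<le>degree q. sgl (int k *s m) (Polynomial.coeff q k))"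
  by (simp add: peval_def poly_altdef dq pow mult_single coeff_map_poly)
 have "keys (peval (sgl m 1) q) \<subseteq> (\<Union>k\<le>degree q. keys (sgl (int k *s m) (Polynomial.coeff q k)))"
  unfolding e by (rule keys_sum)
 thus "keys (peval (sgl m 1) q) \<subseteq> range (\<lambda>k::nat. int k *s m)" by (auto split: if_splits)
 have "lkp (peval (sgl m 1) q) (int (degree q) *s m) = (\<Sum>k\<le>degree q. if k = degree q then Polynomial.coeff q k else 0)"
  unfolding e lookup_sum using assms(1) by (intro sum.cong refl) (auto simp: lookup_single when_def vec_eq_iff)
 hence "lkp (peval (sgl m 1) q) (int (degree q) *s m) \<noteq> 0" using assms(2) by simp
 thus "peval (sgl m 1) q \<noteq> 0" by auto
qed

text \<open>In this locale, dimension zero of the scheme enters through \<open>algebraic\<close>.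
  The data \<open>l0\<close> and \<open>\<mu>0\<close> are support data of a multiple of
  \<open>a0\<close>, which is only Q-Cartier.\<close>

locale zero_dim_system = toric_system \<Sigma> \<rho> a F \<mu>
 for \<Sigma> :: "(real ^ 'n::finite) set set" and \<rho> :: "'k::finite => (real ^ 'n) set" and a F \<mu> +
 fixes a0 l0 \<mu>0
 assumes a0: "nef_support a0 l0 \<mu>0"
  and algebraic: "\<And>\<sigma> y. \<sigma> \<in> \<Sigma> ==> y \<in> Ng 0 \<sigma> ==> \<exists>q. q \<noteq> 0 \<and> peval y q \<in> Im 0 \<sigma>"
begin

definition \<beta> :: "int ^ 'k" where "\<beta> = a0 + (\<Sum>j\<in>{1..CARD('n)}. a j)"

text \<open>On the chart each Cartier divisor a j is trivialized by the character \<mu> j \<tau>, so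
  G j is a local equation of the j-th generator. Multiplying the component at J by the character -(s
  J) turns the twists depending on J into the single module \<open>Rg a0 \<tau>\<close>, the lattice
  points of a translated dual cone, to which \<open>conic_koszul_acyclic\<close> applies.\<close>

lemma chart_koszul:
 assumes t: "\<tau> \<in> \<Sigma>" and q: "1 \<le> q"
  and z: "\<And>J. z J \<in> Ng (a0 + (\<Sum>j\<in>{1..CARD('n)} - J. a j)) \<tau>" "\<And>J. z J \<noteq> 0 ==> J \<subseteq> {1..CARD('n)} \<and> card J = q"
   "\<And>J. J \<subseteq> {1..CARD('n)} ==> kd CARD('n) F z J = 0"
 shows "\<exists>y. (\<forall>J. y J \<in> Ng (a0 + (\<Sum>j\<in>{1..CARD('n)} - J. a j)) \<tau>) \<and>
  (\<forall>J. y J \<noteq> 0 --> J \<subseteq> {1..CARD('n)} \<and> card J = Suc q) \<and> (\<forall>J\<subseteq>{1..CARD('n)}. kd CARD('n) F y J = z J)"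
proof -
 define n where "n = CARD('n)"
 define s where "s J = (\<Sum>j\<in>{1..n} - J. \<mu> j \<tau>)" for J
 define V where "V = u ` {i. \<rho> i \<subseteq> \<tau>}"
 \<comment> \<open>The rational apex: it pairs with the generator of every ray of \<tau> to minus
   the coefficient of a0. Its existence is the Q-Cartier property.\<close>
 define v where "v = real_vec (\<mu>0 \<tau>) /\<^sub>R of_int l0"
 define G where "G j = sgl (- \<mu> j \<tau>) 1 * F j" for j
 have \<mu>a: "a j $ i = - pairing (\<mu> j \<tau>) (u i)" if "j \<in> {1..n}" "\<rho> i \<subseteq> \<tau>" for i j
  using \<mu>[of j] that t unfolding nef_support_def n_def by (smt (verit) mult_1)
 have D: "conic_points {} V 0 = Rg 0 \<tau>"
  by (auto simp: conic_points_def Rg_def V_def real_vec_inner pairing_commute[of "u _"])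
 have P: "conic_points {} V v = Rg a0 \<tau>"
 proof -
  have "(u i) \<star> (real_vec m - v) \<ge> 0 \<longleftrightarrow> pairing m (u i) + a0 $ i \<ge> 0" if "\<rho> i \<subseteq> \<tau>" for i m
  proof -
   have l0: "l0 > 0" and e: "pairing (\<mu>0 \<tau>) (u i) = - (l0 * a0 $ i)"
    using a0 t that unfolding nef_support_def by (blast, smt (verit))
   have "(u i) \<star> v = of_int (pairing (\<mu>0 \<tau>) (u i)) / of_int l0"
    by (simp add: v_def real_vec_inner pairing_commute[of "u i"] divide_inverse)
   also have "\<dots> = - of_int (a0 $ i)" using l0 by (simp add: e)
   finally show ?thesis by (simp add: inner_diff_right real_vec_inner pairing_commute[of "u i"]) linarith
  qed
  thus ?thesis by (auto simp: conic_points_def Rg_def V_def)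
 qed
 have shift: "m \<in> Rg (a0 + (\<Sum>j\<in>{1..n} - J. a j)) \<tau> \<longleftrightarrow> - s J + m \<in> Rg a0 \<tau>" for m J
 proof -
  have "(\<Sum>j\<in>{1..n} - J. a j) $ i = - pairing (s J) (u i)" if "\<rho> i \<subseteq> \<tau>" for i
   unfolding s_def pairing_sum sum_component sum_negf[symmetric] by (rule sum.cong) (use \<mu>a that in auto)
  thus ?thesis by (simp add: Rg_def pairing_add pairing_minus pairing_diff algebra_simps)
 qed
 have G: "G j \<in> spn (Rg 0 \<tau>)" if "j \<in> {1..n}" for j unfolding G_def
 proof (rule spn_shift)
  show "F j \<in> Ng (a j) \<tau>" using F_local that by (simp add: n_def)
  show "- \<mu> j \<tau> + m \<in> Rg 0 \<tau>" if "m \<in> Rg (a j) \<tau>" for m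
   using that \<mu>a[OF \<open>j \<in> {1..n}\<close>] by (auto simp: Rg_def pairing_add pairing_minus pairing_diff)
 qed
 have alg: "algebraic_monomials n G (Rg 0 \<tau>)" unfolding algebraic_monomials_def
 proof (intro ballI impI)
  fix m assume m: "m \<in> Rg 0 \<tau>" "m \<noteq> 0"
  obtain r where r: "r \<noteq> 0" "peval (sgl m 1) r \<in> Im 0 \<tau>" using algebraic[OF t, of "sgl m 1"] m(1) by auto
  then obtain c where c: "peval (sgl m 1) r = (\<Sum>j\<in>{1..n}. F j * c j)" "\<And>j. j \<in> {1..n} ==> c j \<in> Ng (0 - a j) \<tau>"
   by (auto simp: Im_def n_def)
  define b where "b j = (if j \<in> {1..n} then sgl (\<mu> j \<tau>) 1 * c j else 0)" for j
  have "b j \<in> spn (Rg 0 \<tau>)" for j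
  proof (cases "j \<in> {1..n}")
   case True
   have "sgl (\<mu> j \<tau>) 1 * c j \<in> spn (Rg 0 \<tau>)"
   proof (rule spn_shift[OF c(2)[OF True]])
    show "\<mu> j \<tau> + m \<in> Rg 0 \<tau>" if "m \<in> Rg (0 - a j) \<tau>" for m
     using that \<mu>a[OF True] by (auto simp: Rg_def pairing_add pairing_diff)
   qed
   thus ?thesis by (simp add: b_def)
  qed (auto simp: b_def)
  moreover have "peval (sgl m 1) r = (\<Sum>j\<in>{1..n}. b j * G j)" unfolding c(1)
  proof (rule sum.cong[OF refl])
   fix j assume "j \<in> {1..n}"
   have "sgl (\<mu> j \<tau>) 1 * c j * (sgl (- \<mu> j \<tau>) 1 * F j) = sgl (\<mu> j \<tau>) 1 * (sgl (- \<mu> j \<tau>) 1 * (F j * c j))"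
    by (simp only: mult_ac)
   thus "F j * c j = b j * G j" using \<open>j \<in> {1..n}\<close> by (simp only: b_def G_def sgl_cancel if_True)
  qed
  ultimately show "\<exists>h b. h \<noteq> 0 \<and> keys h \<subseteq> range (\<lambda>k. int k *s m) \<and> (\<forall>j. b j \<in> spn (Rg 0 \<tau>)) \<and> h = (\<Sum>j\<in>{1..n}. b j * G j)"
   using peval_monomial[OF m(2) r(1)] by blast
 qed
 \<comment> \<open>The direction of the sweep. The origin is a face of \<tau>, and its supporting
   character is strictly positive on every ray.\<close>
 obtain w where w: "\<And>i. \<rho> i \<subseteq> \<tau> ==> pairing w (u i) \<ge> 0" "\<And>i. \<rho> i \<subseteq> \<tau> ==> pairing w (u i) = 0 \<longleftrightarrow> \<rho> i \<subseteq> {0}"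
 proof (rule face_character[OF t zero_fan])
  have "{0} \<inter> \<tau> = {0}" using cone_zero[OF t] by auto
  thus "{0} face_of \<tau>" using inter_face(2)[OF zero_fan t] by simp
 qed (rule that)
 have wpos: "pairing v w > 0" if "v \<in> V" for v
 proof -
  obtain i where i: "v = u i" "\<rho> i \<subseteq> \<tau>" using \<open>v \<in> V\<close> by (auto simp: V_def)
  have "\<not> \<rho> i \<subseteq> {0}" using ray_subset_iff[OF zero_fan, of i] ray(2)[of i] by (auto simp: real_vec_eq[of _ 0, simplified])
  thus ?thesis using w[OF i(2)] i(1) pairing_commute by (metis order_le_less)
 qed
 have kz: "koszul_acyclic n G (Rg a0 \<tau>) q" unfolding n_def P[symmetric]
 proof (rule conic_koszul_acyclic[where E = "{}" and U = V and V = V and w = w])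
  show "finite V" by (simp add: V_def)
  show "G j \<in> spn (conic_points {} V 0)" if "j \<in> {1..CARD('n)}" for j using G that by (simp add: D n_def)
  show "algebraic_monomials CARD('n) G (conic_points {} V 0)" using alg by (simp add: D n_def)
 qed (use wpos q in auto)
 define T where "T y = (\<lambda>J. sgl (- s J) (1::complex) * y J)" for y
 have Tkd: "kd n G (T y) J = sgl (- s J) 1 * kd n F y J" if J: "J \<subseteq> {1..n}" for y J unfolding kd_def sum_distrib_left
 proof (rule sum.cong[OF refl])
  fix j assume j: "j \<in> {1..n} - J"
  have "{1..n} - insert j J = {1..n} - J - {j}" by blast
  hence "s J = \<mu> j \<tau> + s (insert j J)"
   using sum.remove[of "{1..n} - J" j "\<lambda>j. \<mu> j \<tau>"] j by (simp only: s_def finite_Diff finite_atLeastAtMost)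
  hence "sgl (- s J) (1::complex) = sgl (- \<mu> j \<tau>) 1 * sgl (- s (insert j J)) 1" by (simp add: mult_single algebra_simps)
  thus "ksign j J * G j * T y (insert j J) = sgl (- s J) 1 * (ksign j J * F j * y (insert j J))"
   by (simp only: G_def T_def mult_ac)
 qed
 have "T z \<in> kchain n q (spn (Rg a0 \<tau>))" unfolding kchain_def T_def
 proof (intro CollectI conjI allI impI)
  show "sgl (- s J) 1 * z J \<in> spn (Rg a0 \<tau>)" for J by (rule spn_shift[OF z(1)]) (use shift in \<open>simp add: n_def\<close>)
  fix J assume "sgl (- s J) 1 * z J \<noteq> 0"
  hence "z J \<noteq> 0" by auto
  thus "J \<subseteq> {1..n}" "card J = q" using z(2) by (auto simp: n_def)
 qed
 moreover have "restr (Rg a0 \<tau>) (kd n G (T z) J) = 0" if "J \<subseteq> {1..n}" for J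
  using Tkd[OF that] z(3)[of J] that by (simp add: n_def)
 ultimately obtain y' where y': "y' \<in> kchain n (Suc q) (spn (Rg a0 \<tau>))" "\<And>J. J \<subseteq> {1..n} ==> restr (Rg a0 \<tau>) (kd n G y' J) = T z J"
  using kz unfolding koszul_acyclic_def by blast
 have y'1: "y' J \<in> spn (Rg a0 \<tau>)" and y'2: "y' J \<noteq> 0 ==> J \<subseteq> {1..n} \<and> card J = Suc q" for J
  using y'(1) by (auto simp: kchain_def)
 have kdy': "kd n G y' J = T z J" if "J \<subseteq> {1..n}" for J
 proof -
  have "kd n G y' J \<in> spn (Rg a0 \<tau>)"
   by (rule kd_spn[of n G "Rg 0 \<tau>" y' "Rg a0 \<tau>"]) (use G y'1 Rg_add[of _ 0 \<tau> _ a0] in auto)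
  thus ?thesis using y'(2)[OF that] restr_id by metis
 qed
 define y where "y J = sgl (s J) 1 * y' J" for J
 have Ty: "T y = y'" by (rule ext) (simp only: T_def y_def sgl_cancel)
 show ?thesis
 proof (intro exI[of _ y] conjI allI impI)
  show "y J \<in> Ng (a0 + (\<Sum>j\<in>{1..CARD('n)} - J. a j)) \<tau>" for J
   unfolding y_def by (rule spn_shift[OF y'1]) (use shift[of _ J] in \<open>simp add: n_def\<close>)
  show "J \<subseteq> {1..CARD('n)}" "card J = Suc q" if "y J \<noteq> 0" for J
   using y'2[of J, folded n_def] that mult_zero_right unfolding y_def n_def by metis+
  fix J assume "J \<subseteq> {1..CARD('n)}"
  hence J: "J \<subseteq> {1..n}" by (simp add: n_def)
  have "sgl (- s J) 1 * kd n F y J = sgl (- s J) 1 * z J"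
   using Tkd[OF J, of y] kdy'[OF J] unfolding Ty by (simp add: T_def)
  thus "kd CARD('n) F y J = z J" using sgl_cancel(2) by (metis n_def)
 qed
qed

text \<open>The twist of J is nef with multiplier l0, for which the support data of the Cartier
  summands are scaled by l0.\<close>

definition Wb :: "nat set => int ^ 'n => (real ^ 'n) set" where
 "Wb J = bad_set l0 (\<lambda>\<sigma>. \<mu>0 \<sigma> + l0 *s (\<Sum>j\<in>{1..CARD('n)} - J. \<mu> j \<sigma>))"

lemma Wb_Rg:
 assumes "t \<in> lists \<Sigma>"
 shows "{m. \<not> meets (Wb J m) t} = Rg (a0 + (\<Sum>j\<in>{1..CARD('n)} - J. a j)) (\<Inter>(set t))"
proof -
 have "nef_support (a0 + (\<Sum>j\<in>{1..CARD('n)} - J. a j)) l0 (\<lambda>\<sigma>. \<mu>0 \<sigma> + l0 *s (\<Sum>j\<in>{1..CARD('n)} - J. \<mu> j \<sigma>))"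
  unfolding nef_support_def
 proof (intro conjI ballI allI impI)
  show l0: "0 < l0" using a0 by (simp add: nef_support_def)
  fix \<sigma> i assume s: "\<sigma> \<in> \<Sigma>"
  define T where "T j = pairing (\<mu> j \<sigma>) (u i) + a j $ i" for j
  have T: "T j \<ge> 0" "\<rho> i \<subseteq> \<sigma> ==> T j = 0" if "j \<in> {1..CARD('n)}" for j
   using \<mu>[OF that] s unfolding nef_support_def T_def by (metis mult_1)+
  have e: "pairing (\<mu>0 \<sigma> + l0 *s (\<Sum>j\<in>{1..CARD('n)} - J. \<mu> j \<sigma>)) (u i) + l0 * (a0 + (\<Sum>j\<in>{1..CARD('n)} - J. a j)) $ i =
   (pairing (\<mu>0 \<sigma>) (u i) + l0 * a0 $ i) + l0 * (\<Sum>j\<in>{1..CARD('n)} - J. T j)"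
   by (simp add: T_def pairing_add pairing_scale pairing_sum sum.distrib algebra_simps sum_component)
  have 0: "pairing (\<mu>0 \<sigma>) (u i) + l0 * a0 $ i \<ge> 0" "\<rho> i \<subseteq> \<sigma> ==> pairing (\<mu>0 \<sigma>) (u i) + l0 * a0 $ i = 0"
   using a0 s by (auto simp: nef_support_def)
  have "(\<Sum>j\<in>{1..CARD('n)} - J. T j) \<ge> 0" by (rule sum_nonneg) (use T(1) in auto)
  thus "pairing (\<mu>0 \<sigma> + l0 *s (\<Sum>j\<in>{1..CARD('n)} - J. \<mu> j \<sigma>)) (u i) + l0 * (a0 + (\<Sum>j\<in>{1..CARD('n)} - J. a j)) $ i \<ge> 0"
   unfolding e using 0(1) l0 by simp
  assume r: "\<rho> i \<subseteq> \<sigma>"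
  have "(\<Sum>j\<in>{1..CARD('n)} - J. T j) = 0" by (rule sum.neutral) (use T(2)[OF _ r] in auto)
  thus "pairing (\<mu>0 \<sigma> + l0 *s (\<Sum>j\<in>{1..CARD('n)} - J. \<mu> j \<sigma>)) (u i) + l0 * (a0 + (\<Sum>j\<in>{1..CARD('n)} - J. a j)) $ i = 0"
   unfolding e using 0(2)[OF r] by simp
 qed
 from Rg_iff_meets[OF this assms] show ?thesis unfolding Wb_def by auto
qed

lemma Gd_F:
 assumes "j \<in> {1..CARD('n)}" "j \<notin> J" "t \<in> lists \<Sigma>" "p \<in> spn {m. \<not> meets (Wb (insert j J) m) t}"
 shows "F j * p \<in> spn {m. \<not> meets (Wb J m) t}"
proof -
 have "{1..CARD('n)} - insert j J = {1..CARD('n)} - J - {j}" by blast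
 hence "a0 + (\<Sum>j\<in>{1..CARD('n)} - J. a j) = a j + (a0 + (\<Sum>j\<in>{1..CARD('n)} - insert j J. a j))"
  using sum.remove[of "{1..CARD('n)} - J" j a] assms(1,2) by (simp only: finite_Diff finite_atLeastAtMost DiffI not_False_eq_True add.left_commute)
 thus ?thesis using spn_Rg_mult[OF F_local[OF assms(1)]] assms(4) unfolding Wb_Rg[OF assms(3)] by metis
qed

sublocale cech: cech_koszul \<Sigma> Wb "CARD('n)" F
proof
 show "finite \<Sigma>" by (rule fin)
 show "\<Sigma> \<noteq> {}" using zero_fan by auto
 show "nerve_acyclic \<Sigma> (Wb J m)" for J m unfolding Wb_def by (rule fan_nerve_acyclic[OF convex_bad_set])
 show "F j * p \<in> spn {m. \<not> meets (Wb J m) t}"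
  if "j \<in> {1..CARD('n)}" "j \<notin> J" "t \<in> lists \<Sigma>" "p \<in> spn {m. \<not> meets (Wb (insert j J) m) t}" for j J t p
  by (rule Gd_F) (rule that)+
 fix t q z
 assume t: "t \<in> lists \<Sigma>" "t \<noteq> []" and q: "1 \<le> q" and z: "\<And>J. z J \<in> spn {m. \<not> meets (Wb J m) t}"
  "\<And>J. z J \<noteq> 0 ==> J \<subseteq> {1..CARD('n)} \<and> card J = q" "\<And>J. J \<subseteq> {1..CARD('n)} ==> kd CARD('n) F z J = 0"
 show "\<exists>y. (\<forall>J. y J \<in> spn {m. \<not> meets (Wb J m) t}) \<and> (\<forall>J. y J \<noteq> 0 --> J \<subseteq> {1..CARD('n)} \<and> card J = Suc q) \<and>
     (\<forall>J\<subseteq>{1..CARD('n)}. kd CARD('n) F y J = z J)"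
  unfolding Wb_Rg[OF t(1)] by (rule chart_koszul[OF Inter_fan[OF t] q z(1)[unfolded Wb_Rg[OF t(1)]] z(2,3)])
qed

lemma image_ideal_Im: "t \<in> lists \<Sigma> ==> cech.image_ideal t = Im \<beta> (\<Inter>(set t))"
proof -
 assume t: "t \<in> lists \<Sigma>"
 have "a0 + (\<Sum>i\<in>{1..CARD('n)} - {j}. a i) = \<beta> - a j" if "j \<in> {1..CARD('n)}" for j
  using that by (simp add: \<beta>_def sum_diff1)
 thus ?thesis unfolding cech.image_ideal_def Im_def Wb_Rg[OF t] by (intro Collect_cong) (metis (no_types, lifting))
qed

lemma Gd_\<beta>: "t \<in> lists \<Sigma> ==> spn {m. \<not> meets (Wb {} m) t} = Ng \<beta> (\<Inter>(set t))" unfolding Wb_Rg \<beta>_def by simp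

theorem Im_global:
 assumes "x \<in> Ng \<beta> UNIV" "\<And>\<sigma>. \<sigma> \<in> \<Sigma> ==> x \<in> Im \<beta> \<sigma>"
 shows "x \<in> Im \<beta> UNIV" using cech.image_ideal_global[of x] assms by (simp add: image_ideal_Im Gd_\<beta>)

theorem Im_glue:
 assumes "\<And>\<sigma>. \<sigma> \<in> \<Sigma> ==> x \<sigma> \<in> Ng \<beta> \<sigma>" "\<And>\<sigma> \<tau>. \<sigma> \<in> \<Sigma> ==> \<tau> \<in> \<Sigma> ==> x \<tau> - x \<sigma> \<in> Im \<beta> (\<sigma> \<inter> \<tau>)"
 obtains X where "X \<in> Ng \<beta> UNIV" "\<And>\<sigma>. \<sigma> \<in> \<Sigma> ==> X - x \<sigma> \<in> Im \<beta> \<sigma>"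
proof -
 have 1: "x \<sigma> \<in> spn {m. \<not> meets (Wb {} m) [\<sigma>]}" if "\<sigma> \<in> \<Sigma>" for \<sigma> using assms(1)[OF that] Gd_\<beta>[of "[\<sigma>]"] that by simp
 have 2: "x \<tau> - x \<sigma> \<in> cech.image_ideal [\<sigma>, \<tau>]" if "\<sigma> \<in> \<Sigma>" "\<tau> \<in> \<Sigma>" for \<sigma> \<tau>
  using assms(2)[OF that] image_ideal_Im[of "[\<sigma>, \<tau>]"] that by simp
 obtain X where X: "X \<in> spn {m. \<not> meets (Wb {} m) []}" "\<And>\<sigma>. \<sigma> \<in> \<Sigma> ==> X - x \<sigma> \<in> cech.image_ideal [\<sigma>]"
  using cech.image_ideal_glue[OF 1 2] by blast
 have "X - x \<sigma> \<in> Im \<beta> \<sigma>" if "\<sigma> \<in> \<Sigma>" for \<sigma> using X(2)[OF that] image_ideal_Im[of "[\<sigma>]"] that by simp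
 thus ?thesis using that[of X] X(1) Gd_\<beta>[of "[]"] by simp
qed

end

section \<open>Local vanishing\<close>

context toric_fan
begin

lemma subring_Ng: "subring_set (Ng 0 \<sigma>)" "sgl 0 c \<in> Ng 0 \<sigma>" using submod_spn[of "Rg 0 \<sigma>" "Rg 0 \<sigma>"] Rg_add[of _ 0 \<sigma> _ 0]
 by (auto simp: subring_set_def spn_def Rg_def)

lemma Ng_mult: "p \<in> Ng b \<sigma> ==> q \<in> Ng c \<sigma> ==> b + c = d ==> p * q \<in> Ng d \<sigma>" using spn_Rg_mult by metis

lemma Ng_mono: "p \<in> Ng b \<sigma> ==> \<tau> \<subseteq> \<sigma> ==> p \<in> Ng b \<tau>" using spn_mono[OF _ Rg_mono] by blast

lemma ev_mono_mult: "nv x \<sigma> ==> p \<in> Ng b \<sigma> ==> q \<in> Ng c \<sigma> ==> b + c = d ==>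
  ev (mono x d) (p * q) = ev (mono x b) p * ev (mono x c) q" by (rule ev_mult) (auto simp: spn_def intro: mono_add)

lemma ev_diff: "ev \<kappa> (p - q) = ev \<kappa> p - ev \<kappa> q" using ev_add[of \<kappa> "p - q" q] by simp

lemma ev_mono_const [simp]: "ev (mono x 0) (sgl 0 c) = c" "ev (mono x 0) 1 = 1"
 using ev_single[of "mono x 0" 0 1] by simp_all

lemma ev_mono_prod: "nv x \<sigma> ==> (\<And>i. i \<in> A ==> p i \<in> Ng 0 \<sigma>) ==>
  ev (mono x 0) (prod p A) = (\<Prod>i\<in>A. ev (mono x 0) (p i)) \<and> prod p A \<in> Ng 0 \<sigma>"
proof (induction A rule: infinite_finite_induct)
 case (insert i A)
 thus ?case using ev_mono_mult[of x \<sigma> "p i" 0 "prod p A" 0 0] Ng_mult[of "p i" 0 \<sigma> "prod p A" 0 0] by simp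
qed (use subring_Ng in \<open>auto simp: subring_set_def\<close>)

lemma ev_mono_power: "nv x \<sigma> ==> p \<in> Ng 0 \<sigma> ==> ev (mono x 0) (p ^ k) = ev (mono x 0) p ^ k \<and> p ^ k \<in> Ng 0 \<sigma>"
 using ev_mono_prod[of x \<sigma> "{..<k}" "\<lambda>_. p"] by simp

lemma cclass_eq:
 assumes "cclass x = cclass x'" "\<sigma> \<in> \<Sigma>" "nv x \<sigma>"
 shows "nv x' \<sigma>" "cpt x' \<sigma> = cpt x \<sigma>"
proof -
 have "(\<sigma>, cpt x \<sigma>) \<in> cclass x'" using assms by (auto simp: cclass_def)
 thus "nv x' \<sigma>" "cpt x' \<sigma> = cpt x \<sigma>" by (auto simp: cclass_def)
qed

lemma cpt_eq_cclass: "\<sigma> \<in> \<Sigma> ==> nv x \<sigma> ==> nv x' \<sigma> ==> cpt x' \<sigma> = cpt x \<sigma> ==> cclass x = cclass x'" using gluing_cpt by metis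

lemma ev_cpt:
 assumes "\<sigma> \<in> \<Sigma>" "cpt x' \<sigma> = cpt x \<sigma>" "p \<in> Ng 0 \<sigma>"
 shows "ev (mono x 0) p = ev (mono x' 0) p"
proof (rule ev_cong)
 fix m assume "m \<in> keys p"
 hence "m \<in> dual_semigroup \<sigma>" using assms(3) by (auto simp: dual_Rg[OF assms(1)] spn_def)
 thus "mono x 0 m = mono x' 0 m" using fun_cong[OF assms(2), of m] by (simp add: cpt_def)
qed

text \<open>The chart of a face is obtained by inverting one character w: a section on the smaller
  chart extends to the larger one after multiplication by any sufficiently high power.\<close>

lemma face_functional:
 assumes "\<sigma> \<in> \<Sigma>" "\<tau> \<in> \<Sigma>" "\<tau> \<subseteq> \<sigma>"
 obtains w where "w \<in> Rg 0 \<sigma>" "\<And>i. \<rho> i \<subseteq> \<sigma> ==> pairing w (u i) = 0 \<longleftrightarrow> \<rho> i \<subseteq> \<tau>" "\<And>x. nv x \<tau> ==> mono x 0 w \<noteq> 0"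
  "\<And>b p. p \<in> Ng b \<tau> ==> \<exists>k0. \<forall>k\<ge>k0. sgl (int k *s w) 1 * p \<in> Ng b \<sigma>"
proof -
 have face: "\<tau> face_of \<sigma>" using inter_face(2)[OF assms(2,1)] assms(3) by (simp add: Int_absorb2)
 obtain w where w: "\<And>i. \<rho> i \<subseteq> \<sigma> ==> pairing w (u i) \<ge> 0" "\<And>i. \<rho> i \<subseteq> \<sigma> ==> pairing w (u i) = 0 \<longleftrightarrow> \<rho> i \<subseteq> \<tau>"
  by (rule face_character[OF assms(1,2) face]) (rule that)
 show ?thesis
 proof (rule that)
  show "w \<in> Rg 0 \<sigma>" using w(1) by (simp add: Rg_def)
  show "pairing w (u i) = 0 \<longleftrightarrow> \<rho> i \<subseteq> \<tau>" if "\<rho> i \<subseteq> \<sigma>" for i using w(2)[OF that] .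
  show "mono x 0 w \<noteq> 0" if x: "nv x \<tau>" for x
  proof
   assume "mono x 0 w = 0"
   hence "\<exists>i\<in>UNIV. x $ i powi (pairing w (u i) + 0 $ i) = 0" unfolding mono_def by (simp only: prod_zero_iff finite)
   then obtain i where "x $ i powi pairing w (u i) = 0" by auto
   hence "x $ i = 0" "pairing w (u i) \<noteq> 0" by (auto simp: power_int_eq_0_iff)
   thus False using x w(2)[of i] assms(3) by (auto simp: nv_def)
  qed
  fix b p assume p: "p \<in> Ng b \<tau>"
  define L where "L = nat (\<Sum>m\<in>keys p. \<Sum>i\<in>UNIV. \<bar>pairing m (u i) + b $ i\<bar>)"
  have "sgl (int k *s w) 1 * p \<in> Ng b \<sigma>" if k: "k \<ge> L" for k
  proof (rule spn_shift)
   show "p \<in> spn (keys p)" by (simp add: spn_def)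
   fix m assume m: "m \<in> keys p"
   hence mt: "m \<in> Rg b \<tau>" using p by (auto simp: spn_def)
   have "pairing (int k *s w + m) (u i) + b $ i \<ge> 0" if i: "\<rho> i \<subseteq> \<sigma>" for i
   proof (cases "\<rho> i \<subseteq> \<tau>")
    case True
    hence "pairing m (u i) + b $ i \<ge> 0" "int k * pairing w (u i) \<ge> 0" using mt w(1)[OF i] by (auto simp: Rg_def)
    thus ?thesis by (simp add: pairing_add pairing_scale)
   next
    case False
    hence "pairing w (u i) \<ge> 1" using w[OF i] by linarith
    hence "int k * pairing w (u i) \<ge> int k" using mult_left_mono[of 1 "pairing w (u i)" "int k"] by simp
    moreover have "\<bar>pairing m (u i) + b $ i\<bar> \<le> (\<Sum>i\<in>UNIV. \<bar>pairing m (u i) + b $ i\<bar>)" by (rule member_le_sum) auto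
    moreover have "\<dots> \<le> (\<Sum>m\<in>keys p. \<Sum>i\<in>UNIV. \<bar>pairing m (u i) + b $ i\<bar>)"
     by (rule member_le_sum[OF m]) (auto intro: sum_nonneg)
    ultimately show ?thesis using k by (simp add: L_def pairing_add pairing_scale nat_le_iff)
   qed
   thus "int k *s w + m \<in> Rg b \<sigma>" by (simp add: Rg_def)
  qed
  thus "\<exists>k0. \<forall>k\<ge>k0. sgl (int k *s w) 1 * p \<in> Ng b \<sigma>" by blast
 qed
qed

lemma mono_power: "nv x \<sigma> ==> w \<in> Rg 0 \<sigma> ==> mono x 0 (int k *s w) = mono x 0 w ^ k \<and> int k *s w \<in> Rg 0 \<sigma>"
proof (induction k)
 case (Suc k)
 have e: "int (Suc k) *s w = w + int k *s w" by (simp add: vector_sadd_rdistrib)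
 show ?case unfolding e using Suc mono_add[of x \<sigma> w 0 "int k *s w" 0] Rg_add[of w 0 \<sigma> "int k *s w" 0] by simp
qed (simp add: Rg_def)

end

context toric_system
begin

lemma ideal_Im: "ideal_in (Ng 0 \<sigma>) (Im 0 \<sigma>)" using submod_Im Im_sub by (auto simp: ideal_in_def)

lemma Im_face:
 assumes w: "\<And>b p. p \<in> Ng b \<tau> ==> \<exists>k0. \<forall>k\<ge>k0. sgl (int k *s w) 1 * p \<in> Ng b \<sigma>" and y: "y \<in> Im b \<tau>"
 shows "\<exists>k0. \<forall>k\<ge>k0. sgl (int k *s w) 1 * y \<in> Im b \<sigma>"
proof -
 obtain q where q: "y = (\<Sum>j\<in>{1..CARD('n)}. F j * q j)" "\<forall>j\<in>{1..CARD('n)}. q j \<in> Ng (b - a j) \<tau>"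
  using y by (auto simp: Im_def)
 have "\<forall>j\<in>{1..CARD('n)}. \<exists>k0. \<forall>k\<ge>k0. sgl (int k *s w) 1 * q j \<in> Ng (b - a j) \<sigma>" using q(2) w by blast
 then obtain K where K: "\<forall>j\<in>{1..CARD('n)}. \<forall>k\<ge>K j. sgl (int k *s w) 1 * q j \<in> Ng (b - a j) \<sigma>" by metis
 have "sgl (int k *s w) 1 * y \<in> Im b \<sigma>" if k: "k \<ge> Max (K ` {1..CARD('n)})" for k
 proof -
  have "sgl (int k *s w) 1 * y = (\<Sum>j\<in>{1..CARD('n)}. F j * (sgl (int k *s w) 1 * q j))"
   unfolding q(1) sum_distrib_left by (intro sum.cong refl) (simp only: mult_ac)
  moreover have "k \<ge> K j" if "j \<in> {1..CARD('n)}" for j using Max_ge[of "K ` {1..CARD('n)}" "K j"] that k by auto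
  ultimately show ?thesis unfolding Im_def using K by (intro CollectI exI[of _ "\<lambda>j. sgl (int k *s w) 1 * q j"]) blast
 qed
 thus ?thesis by blast
qed

text \<open>The local section \<open>p\<close> of the twist by \<open>b\<close> vanishes in the stalk at the point with Cox coordinates \<open>x\<close> of the
 sheaf defined by \<open>I\<close>.\<close>

definition van :: "int ^ 'k => complex ^ 'k => 'n laurent => bool" where
 "van b x p \<longleftrightarrow> (\<exists>\<sigma>\<in>\<Sigma>. nv x \<sigma> \<and> (\<exists>s\<in>Ng 0 \<sigma>. ev (mono x 0) s \<noteq> 0 \<and> s * p \<in> Im b \<sigma>))"

lemma vanI: "\<sigma> \<in> \<Sigma> ==> nv x \<sigma> ==> s \<in> Ng 0 \<sigma> ==> ev (mono x 0) s \<noteq> 0 ==> s * p \<in> Im b \<sigma> ==> van b x p" by (auto simp: van_def)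

text \<open>Vanishing in the stalk does not depend on the chart. A witness on \<eta> restricts to
  the overlap, and a power of w, which is nonzero at x, carries it over to \<sigma>.\<close>

lemma vanE:
 assumes "van b x p" "\<sigma> \<in> \<Sigma>" "nv x \<sigma>"
 obtains s where "s \<in> Ng 0 \<sigma>" "ev (mono x 0) s \<noteq> 0" "s * p \<in> Im b \<sigma>"
proof -
 obtain \<eta> s where h: "\<eta> \<in> \<Sigma>" "nv x \<eta>" "s \<in> Ng 0 \<eta>" "ev (mono x 0) s \<noteq> 0" "s * p \<in> Im b \<eta>"
  using assms(1) by (auto simp: van_def)
 have t: "\<sigma> \<inter> \<eta> \<in> \<Sigma>" "nv x (\<sigma> \<inter> \<eta>)" using inter_fan[OF assms(2) h(1)] nv_Int assms(3) h(2) by blast+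
 obtain w where w: "w \<in> Rg 0 \<sigma>" "\<And>i. \<rho> i \<subseteq> \<sigma> ==> pairing w (u i) = 0 \<longleftrightarrow> \<rho> i \<subseteq> \<sigma> \<inter> \<eta>" "\<And>x. nv x (\<sigma> \<inter> \<eta>) ==> mono x 0 w \<noteq> 0"
  "\<And>b p. p \<in> Ng b (\<sigma> \<inter> \<eta>) ==> \<exists>k0. \<forall>k\<ge>k0. sgl (int k *s w) 1 * p \<in> Ng b \<sigma>"
  by (rule face_functional[OF assms(2) t(1) Int_lower1]) (rule that)
 have s: "s \<in> Ng 0 (\<sigma> \<inter> \<eta>)" by (rule Ng_mono[OF h(3) Int_lower2])
 obtain k1 where k1: "\<And>k. k \<ge> k1 ==> sgl (int k *s w) 1 * s \<in> Ng 0 \<sigma>" using w(4)[OF s] by blast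
 have "s * p \<in> Im b (\<sigma> \<inter> \<eta>)" using Im_mono[OF Int_lower2] h(5) by blast
 then obtain k2 where k2: "\<And>k. k \<ge> k2 ==> sgl (int k *s w) 1 * (s * p) \<in> Im b \<sigma>" using Im_face[OF w(4)] by blast
 define k where "k = max k1 k2"
 have wt: "w \<in> Rg 0 (\<sigma> \<inter> \<eta>)" using Rg_mono[OF Int_lower1] w(1) by blast
 have m: "mono x 0 (int k *s w) \<noteq> 0" "sgl (int k *s w) 1 \<in> Ng 0 (\<sigma> \<inter> \<eta>)"
  using mono_power[OF t(2) wt, of k] w(3)[OF t(2)] by auto
 show ?thesis
 proof (rule that)
  show "sgl (int k *s w) 1 * s \<in> Ng 0 \<sigma>" using k1 by (simp add: k_def)
  show "ev (mono x 0) (sgl (int k *s w) 1 * s) \<noteq> 0" using ev_mono_mult[OF t(2) m(2) s] m(1) h(4) by simp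
  show "sgl (int k *s w) 1 * s * p \<in> Im b \<sigma>" using k2[of k] by (simp add: k_def mult.assoc)
 qed
qed

lemma van_cong:
 assumes "cclass x = cclass x'" "van b x p"
 shows "van b x' p"
proof -
 obtain \<sigma> s where h: "\<sigma> \<in> \<Sigma>" "nv x \<sigma>" "s \<in> Ng 0 \<sigma>" "ev (mono x 0) s \<noteq> 0" "s * p \<in> Im b \<sigma>"
  using assms(2) by (auto simp: van_def)
 note c = cclass_eq[OF assms(1) h(1,2)]
 show ?thesis using vanI[OF h(1) c(1) h(3) _ h(5)] ev_cpt[OF h(1) c(2) h(3)] h(4) by simp
qed

lemma van_mult:
 assumes "van b x p" "\<sigma> \<in> \<Sigma>" "nv x \<sigma>" "y \<in> Ng c \<sigma>" "c + b = d"
 shows "van d x (y * p)"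
proof -
 obtain s where s: "s \<in> Ng 0 \<sigma>" "ev (mono x 0) s \<noteq> 0" "s * p \<in> Im b \<sigma>" using vanE[OF assms(1-3)] .
 have "s * (y * p) = y * (s * p)" by (simp only: mult_ac)
 thus ?thesis using vanI[OF assms(2,3) s(1,2)] Im_mult[OF s(3) assms(4)] assms(5) by metis
qed

lemma van_Im: "\<sigma> \<in> \<Sigma> ==> nv x \<sigma> ==> p \<in> Im b \<sigma> ==> van b x p"
 by (rule vanI[of \<sigma> _ 1]) (use subring_Ng in \<open>auto simp: subring_set_def\<close>)

lemma submod_van:
 assumes "\<sigma> \<in> \<Sigma>" "nv x \<sigma>"
 shows "submod (Ng 0 \<sigma>) {p. van b x p}" unfolding submod_def
proof (intro conjI ballI CollectI)
 show "van b x 0" using van_Im[OF assms] submod_zero[OF submod_Im] by blast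
 fix p assume "p \<in> {p. van b x p}"
 hence p: "van b x p" by simp
 show "van b x (r * p)" if "r \<in> Ng 0 \<sigma>" for r using van_mult[OF p assms that] by simp
 fix q assume "q \<in> {p. van b x p}"
 hence q: "van b x q" by simp
 obtain s where s: "s \<in> Ng 0 \<sigma>" "ev (mono x 0) s \<noteq> 0" "s * p \<in> Im b \<sigma>" using vanE[OF p assms] .
 obtain t where t: "t \<in> Ng 0 \<sigma>" "ev (mono x 0) t \<noteq> 0" "t * q \<in> Im b \<sigma>" using vanE[OF q assms] .
 have "s * t * (p - q) = t * (s * p) - s * (t * q)" by (simp add: algebra_simps)
 hence "s * t * (p - q) \<in> Im b \<sigma>"
  using submod_diff[OF submod_Im submod_mult[OF submod_Im t(1) s(3)] submod_mult[OF submod_Im s(1) t(3)]] by simp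
 thus "van b x (p - q)" using vanI[OF assms Ng_mult[OF s(1) t(1)]] ev_mono_mult[OF assms(2) s(1) t(1)] s(2) t(2) by simp
qed

lemma van_cancel:
 assumes "\<sigma> \<in> \<Sigma>" "nv x \<sigma>" "s \<in> Ng 0 \<sigma>" "ev (mono x 0) s \<noteq> 0" "van b x (s * p)"
 shows "van b x p"
proof -
 obtain t where t: "t \<in> Ng 0 \<sigma>" "ev (mono x 0) t \<noteq> 0" "t * (s * p) \<in> Im b \<sigma>" using vanE[OF assms(5,1,2)] .
 thus ?thesis using vanI[OF assms(1,2) Ng_mult[OF t(1) assms(3)]] ev_mono_mult[OF assms(2) t(1) assms(3)] assms(4)
  by (simp add: mult.assoc)
qed

text \<open>The points of the subscheme are those at which the constant \<open>1\<close> does not vanish.\<close>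

lemma van_one_iff:
 assumes "\<sigma> \<in> \<Sigma>" "nv x \<sigma>"
 shows "\<not> van 0 x 1 \<longleftrightarrow> (\<forall>p\<in>Im 0 \<sigma>. ev (mono x 0) p = 0)"
proof
 assume "\<forall>p\<in>Im 0 \<sigma>. ev (mono x 0) p = 0"
 thus "\<not> van 0 x 1" using vanE[OF _ assms, of 0 1] by fastforce
next
 assume n: "\<not> van 0 x 1"
 show "\<forall>p\<in>Im 0 \<sigma>. ev (mono x 0) p = 0"
 proof (rule ballI, rule ccontr)
  fix p assume "p \<in> Im 0 \<sigma>" "ev (mono x 0) p \<noteq> 0"
  thus False using n vanI[OF assms, of p 1 0] Im_sub by auto
 qed
qed

end

context zero_dim_system
begin

text \<open>A Nullstellensatz checked on monomials. Each monomial is algebraic modulo P and the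
  field is algebraically closed, so it is congruent to a constant c m. These constants are
  multiplicative in m, hence a point of the chart, and every function is congruent to its value
  there.\<close>

lemma prime_point:
 assumes s: "\<sigma> \<in> \<Sigma>" and P: "prime_in (Ng 0 \<sigma>) P" "Im 0 \<sigma> \<subseteq> P"
 obtains x where "nv x \<sigma>" "\<And>p. p \<in> P ==> ev (mono x 0) p = 0"
proof -
 have Ps: "submod (Ng 0 \<sigma>) P" "P \<subseteq> Ng 0 \<sigma>" and P1: "1 \<notin> P" using P(1) by (auto simp: prime_in_def ideal_in_def)
 have As: "submod (Ng 0 \<sigma>) (Ng 0 \<sigma>)" using subring_Ng(1) by (simp add: subring_set_def)
 have "\<exists>c. sgl m 1 - sgl 0 c \<in> P" if "m \<in> Rg 0 \<sigma>" for m
 proof -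
  have m: "sgl m 1 \<in> Ng 0 \<sigma>" using that by simp
  obtain q where "q \<noteq> 0" "peval (sgl m 1) q \<in> P" using algebraic[OF s m] P(2) by blast
  thus ?thesis using peval_root[OF P(1) subring_Ng m] by blast
 qed
 then obtain c where c: "\<And>m. m \<in> Rg 0 \<sigma> ==> sgl m 1 - sgl 0 (c m) \<in> P" by metis
 have uniq: "d = e" if de: "p - sgl 0 d \<in> P" "p - sgl 0 e \<in> P" for p d e
 proof (rule ccontr)
  assume "d \<noteq> e"
  have "sgl 0 (1 / (e - d)) * ((p - sgl 0 d) - (p - sgl 0 e)) \<in> P"
   by (rule submod_mult[OF Ps(1) subring_Ng(2) submod_diff[OF Ps(1) de]])
  moreover have "(p - sgl 0 d) - (p - sgl 0 e) = sgl 0 (e - d)" by (simp add: single_diff)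
  ultimately show False using P1 \<open>d \<noteq> e\<close> by (simp add: mult_single)
 qed
 have cm: "c (m + m') = c m * c m'" if m: "m \<in> Rg 0 \<sigma>" "m' \<in> Rg 0 \<sigma>" for m m'
 proof (rule uniq)
  show "sgl (m + m') 1 - sgl 0 (c (m + m')) \<in> P" using c Rg_add[OF m] by simp
  have "sgl (m + m') 1 - sgl 0 (c m * c m') = sgl m 1 * (sgl m' 1 - sgl 0 (c m')) + sgl 0 (c m') * (sgl m 1 - sgl 0 (c m))"
   by (simp add: algebra_simps mult_single)
  also have "\<dots> \<in> P"
   by (rule submod_add[OF Ps(1) submod_mult[OF Ps(1) _ c[OF m(2)]] submod_mult[OF Ps(1) subring_Ng(2) c[OF m(1)]]])
    (use m in simp)
  finally show "sgl (m + m') 1 - sgl 0 (c m * c m') \<in> P" .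
 qed
 have c0: "c 0 = 1" by (rule uniq[of "sgl 0 1"]) (use c[of 0] submod_zero[OF Ps(1)] in \<open>auto simp: Rg_def\<close>)
 have "restrict c (dual_semigroup \<sigma>) \<in> affine_points \<sigma>"
  unfolding affine_points_def dual_Rg[OF s] using cm c0 Rg_add[of _ 0 \<sigma> _ 0] by (auto simp: Rg_def)
 then obtain x where x: "nv x \<sigma>" "restrict c (dual_semigroup \<sigma>) = cpt x \<sigma>" using affine_point_lift[OF s] by metis
 have cx: "mono x 0 m = c m" if "m \<in> Rg 0 \<sigma>" for m
  using fun_cong[OF x(2), of m] that by (simp add: cpt_def dual_Rg[OF s])
 have ev: "p - sgl 0 (ev (mono x 0) p) \<in> P" if p: "p \<in> Ng 0 \<sigma>" for p
 proof -
  have k: "keys p \<subseteq> Rg 0 \<sigma>" using p by (simp add: spn_def)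
  have "p - sgl 0 (ev (mono x 0) p) = (\<Sum>m\<in>keys p. sgl m (lkp p m)) - (\<Sum>m\<in>keys p. sgl 0 (lkp p m * mono x 0 m))"
  proof -
   have "sgl (0 :: int ^ 'n) (sum f A) = (\<Sum>m\<in>A. sgl 0 (f m))" for f :: "int ^ 'n => complex" and A
    by (induction A rule: infinite_finite_induct) (auto simp: single_add)
   thus ?thesis using arg_cong[OF monomial_sum[of p], of "\<lambda>z. z - sgl 0 (ev (mono x 0) p)"] by (simp only: ev_def)
  qed
  also have "\<dots> = (\<Sum>m\<in>keys p. sgl 0 (lkp p m) * (sgl m 1 - sgl 0 (c m)))"
   unfolding sum_subtractf[symmetric] using k cx by (intro sum.cong refl) (auto simp: right_diff_distrib mult_single)
  also have "\<dots> \<in> P" using k c by (intro submod_sum[OF Ps(1)] submod_mult[OF Ps(1) subring_Ng(2)]) auto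
  finally show ?thesis .
 qed
 show ?thesis
 proof (rule that[OF x(1)])
  fix p assume p: "p \<in> P"
  show "ev (mono x 0) p = 0" by (rule uniq[of p]) (use ev Ps(2) p in auto)
 qed
qed

text \<open>If the functions multiplying X into the ideal formed a proper ideal J, a prime above J
  would give a point where all of them vanish. J contains the ideal of the scheme, so the point lies
  on the scheme, and there the vanishing of X in the stalk provides a multiplier with nonzero
  value.\<close>

lemma local_global:
 assumes s: "\<sigma> \<in> \<Sigma>" and X: "X \<in> Ng b \<sigma>" and loc: "\<And>x. nv x \<sigma> ==> \<not> van 0 x 1 ==> van b x X"
 shows "X \<in> Im b \<sigma>"
proof (rule ccontr)
 assume n: "X \<notin> Im b \<sigma>"
 define J where "J = {t \<in> Ng 0 \<sigma>. t * X \<in> Im b \<sigma>}"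
 have As: "submod (Ng 0 \<sigma>) (Ng 0 \<sigma>)" using subring_Ng(1) by (simp add: subring_set_def)
 have J: "ideal_in (Ng 0 \<sigma>) J" unfolding ideal_in_def submod_def J_def
  using submod_zero[OF As] submod_diff[OF As] submod_mult[OF As] submod_zero[OF submod_Im]
   submod_diff[OF submod_Im] submod_mult[OF submod_Im] by (auto simp: left_diff_distrib mult.assoc)
 have "1 \<notin> J" using n by (simp add: J_def)
 then obtain P where P: "prime_in (Ng 0 \<sigma>) P" "J \<subseteq> P" using maximal_prime[OF subring_Ng(1) J] by blast
 have IJ: "Im 0 \<sigma> \<subseteq> J"
 proof
  fix t assume t: "t \<in> Im 0 \<sigma>"
  thus "t \<in> J" using Im_mult[OF t X] Im_sub by (auto simp: J_def mult.commute)
 qed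
 obtain x where x: "nv x \<sigma>" "\<And>p. p \<in> P ==> ev (mono x 0) p = 0"
  using prime_point[OF s P(1)] IJ P(2) by (metis subset_trans)
 have "\<not> van 0 x 1" unfolding van_one_iff[OF s x(1)] using x(2) IJ P(2) by blast
 then obtain t where "t \<in> Ng 0 \<sigma>" "ev (mono x 0) t \<noteq> 0" "t * X \<in> Im b \<sigma>" using vanE[OF loc[OF x(1)] s x(1)] by metis
 thus False using x(2)[of t] P(2) by (auto simp: J_def)
qed

text \<open>The element t ^ k * (c + t * r) lies in the ideal and t ^ k is a unit at x, so c + t r
  vanishes in the stalk and -r / c inverts t. The inverse is thus a function on the whole
  chart.\<close>

lemma van_inverse:
 assumes s: "\<sigma> \<in> \<Sigma>" "nv x \<sigma>" and t: "t \<in> Ng 0 \<sigma>" "ev (mono x 0) t \<noteq> 0"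
 obtains c where "c \<in> Ng 0 \<sigma>" "van 0 x (c * t - 1)"
proof -
 obtain q where q: "q \<noteq> 0" "peval t q \<in> Im 0 \<sigma>" using algebraic[OF s(1) t(1)] by blast
 obtain k c r where f: "c \<noteq> 0" "r \<in> Ng 0 \<sigma>" "peval t q = t ^ k * (sgl 0 c + t * r)"
  using peval_fitting[OF subring_Ng t(1) q(1)] by blast
 have v: "van 0 x (sgl 0 c + t * r)"
  by (rule vanI[OF s, of "t ^ k"]) (use ev_mono_power[OF s(2) t(1), of k] t(2) q(2) f(3) in auto)
 define c' where "c' = - (sgl 0 (1 / c) * r)"
 have "c' \<in> Ng 0 \<sigma>" unfolding c'_def using subring_Ng f(2) submod_minus submod_mult unfolding subring_set_def by metis
 moreover have "c' * t - 1 = - (sgl 0 (1 / c) * (sgl 0 c + t * r))"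
  using f(1) by (simp add: c'_def algebra_simps mult_single)
 hence "van 0 x (c' * t - 1)"
  using submod_minus[OF submod_van[OF s]] submod_mult[OF submod_van[OF s] subring_Ng(2)] v by (metis mem_Collect_eq)
 ultimately show ?thesis using that by blast
qed

text \<open>The product t of functions separating x from the points of Q vanishes on Q but not at x.
  The element t ^ k * (c + t * r) lies in the ideal. On Q the second factor is a unit, so t ^ k
  vanishes in the stalk; at x the power t ^ k is invertible, and its inverse normalizes it to
  1.\<close>

lemma separating_idempotent:
 assumes s: "\<sigma> \<in> \<Sigma>" "nv x \<sigma>" and Q: "finite Q" "\<And>y. y \<in> Q ==> nv y \<sigma> \<and> cclass y \<noteq> cclass x"
 obtains e where "e \<in> Ng 0 \<sigma>" "van 0 x (e - 1)" "\<And>y. y \<in> Q ==> van 0 y e"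
proof -
 have "\<exists>m\<in>Rg 0 \<sigma>. mono x 0 m \<noteq> mono y 0 m" if y: "y \<in> Q" for y
 proof (rule ccontr)
  assume "\<not> (\<exists>m\<in>Rg 0 \<sigma>. mono x 0 m \<noteq> mono y 0 m)"
  hence "cpt y \<sigma> = cpt x \<sigma>" by (auto simp: cpt_def dual_Rg[OF s(1)] restrict_def)
  thus False using cpt_eq_cclass[OF s] Q(2)[OF y] by metis
 qed
 then obtain m where m: "\<And>y. y \<in> Q ==> m y \<in> Rg 0 \<sigma>" "\<And>y. y \<in> Q ==> mono x 0 (m y) \<noteq> mono y 0 (m y)" by metis
 define h where "h y = sgl (m y) 1 - sgl 0 (mono y 0 (m y))" for y
 have h: "h y \<in> Ng 0 \<sigma>" if "y \<in> Q" for y unfolding h_def using m(1)[OF that] subring_Ng(2) by (intro spn_diff) auto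
 define t where "t = prod h Q"
 have t: "t \<in> Ng 0 \<sigma>" "ev (mono x 0) t \<noteq> 0" "\<And>y. y \<in> Q ==> ev (mono y 0) t = 0"
  using ev_mono_prod[of _ \<sigma> Q h] h s(2) Q m(2) by (auto simp: t_def h_def ev_diff)
 obtain q where q: "q \<noteq> 0" "peval t q \<in> Im 0 \<sigma>" using algebraic[OF s(1) t(1)] by blast
 obtain k c r where f: "c \<noteq> 0" "r \<in> Ng 0 \<sigma>" "peval t q = t ^ k * (sgl 0 c + t * r)"
  using peval_fitting[OF subring_Ng t(1) q(1)] by blast
 have tk: "t ^ k \<in> Ng 0 \<sigma>" "ev (mono x 0) (t ^ k) \<noteq> 0" using ev_mono_power[OF s(2) t(1)] t(2) by auto
 obtain c' where c': "c' \<in> Ng 0 \<sigma>" "van 0 x (c' * t ^ k - 1)" using van_inverse[OF s tk] .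
 show ?thesis
 proof (rule that)
  show "c' * t ^ k \<in> Ng 0 \<sigma>" "van 0 x (c' * t ^ k - 1)" using Ng_mult[OF c'(1) tk(1)] c'(2) by auto
  fix y assume y: "y \<in> Q"
  have y': "nv y \<sigma>" using Q(2)[OF y] by blast
  have "van 0 y (t ^ k)"
  proof (rule vanI[OF s(1) y', of "sgl 0 c + t * r"])
   show "sgl 0 c + t * r \<in> Ng 0 \<sigma>" using subring_Ng(2) Ng_mult[OF t(1) f(2)] by (intro spn_add) auto
   show "ev (mono y 0) (sgl 0 c + t * r) \<noteq> 0" using ev_mono_mult[OF y' t(1) f(2)] t(3)[OF y] f(1) by (simp add: ev_add)
   show "(sgl 0 c + t * r) * t ^ k \<in> Im 0 \<sigma>" using q(2) f(3) by (simp add: mult.commute)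
  qed
  thus "van 0 y (c' * t ^ k)" using van_mult[OF _ s(1) y' c'(1)] by simp
 qed
qed

text \<open>The denominator of p on the larger chart is a power of w, nonzero at x. In the stalk it
  may be replaced by multiplication with its inverse from \<open>van_inverse\<close>, which is
  regular on the larger chart.\<close>

lemma van_extend:
 assumes s: "\<sigma> \<in> \<Sigma>" "\<tau> \<in> \<Sigma>" "\<tau> \<subseteq> \<sigma>" and x: "nv x \<tau>" and p: "p \<in> Ng b \<tau>"
 obtains p' where "p' \<in> Ng b \<sigma>" "van b x (p' - p)"
proof -
 obtain w where w: "w \<in> Rg 0 \<sigma>" "\<And>i. \<rho> i \<subseteq> \<sigma> ==> pairing w (u i) = 0 \<longleftrightarrow> \<rho> i \<subseteq> \<tau>" "\<And>x. nv x \<tau> ==> mono x 0 w \<noteq> 0"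
  "\<And>b p. p \<in> Ng b \<tau> ==> \<exists>k0. \<forall>k\<ge>k0. sgl (int k *s w) 1 * p \<in> Ng b \<sigma>" by (rule face_functional[OF s]) (rule that)
 obtain k where k: "sgl (int k *s w) 1 * p \<in> Ng b \<sigma>" using w(4)[OF p] by blast
 have xs: "nv x \<sigma>" using x s(3) by (auto simp: nv_def)
 have m: "sgl (int k *s w) 1 \<in> Ng 0 \<sigma>" "ev (mono x 0) (sgl (int k *s w) 1) \<noteq> 0"
  using mono_power[OF xs w(1), of k] w(3)[OF x] by auto
 obtain c where c: "c \<in> Ng 0 \<sigma>" "van 0 x (c * sgl (int k *s w) 1 - 1)" using van_inverse[OF s(1) xs m] .
 show ?thesis
 proof (rule that)
  show "c * (sgl (int k *s w) 1 * p) \<in> Ng b \<sigma>" by (rule Ng_mult[OF c(1) k]) simp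
  have "van b x (p * (c * sgl (int k *s w) 1 - 1))" by (rule van_mult[OF c(2) s(2) x p]) simp
  thus "van b x (c * (sgl (int k *s w) 1 * p) - p)" by (simp add: algebra_simps)
 qed
qed

end

section \<open>Bases modulo a subspace\<close>

text \<open>A basis of the image of V modulo K, given as an indexed family so that the bases of
  several stalks can be joined over a disjoint union of index sets.\<close>

definition basis_mod ::
 "('g::comm_monoid_add \<Rightarrow>\<^sub>0 complex) set => ('g \<Rightarrow>\<^sub>0 complex) set => 'i set => ('i => ('g \<Rightarrow>\<^sub>0 complex)) => bool" where
 "basis_mod V K N v \<longleftrightarrow> finite N \<and> (\<forall>i\<in>N. v i \<in> V) \<and> (\<forall>p\<in>V. \<exists>c. p - (\<Sum>i\<in>N. sgl 0 (c i) * v i) \<in> K) \<and>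
   (\<forall>c. (\<Sum>i\<in>N. sgl 0 (c i) * v i) \<in> K --> (\<forall>i\<in>N. c i = 0))"

text \<open>A subset of B that spans modulo K and has least size is independent: a nontrivial
  relation would express one of its elements by the others.\<close>

lemma basis_mod_exists:
 assumes K: "submod (range (sgl 0)) K" and B: "finite B" "B \<subseteq> V" "\<And>p. p \<in> V ==> \<exists>q\<in>lv.span B. p - q \<in> K"
 shows "\<exists>N\<subseteq>B. basis_mod V K N (\<lambda>p. p)"
proof -
 define S where "S N \<longleftrightarrow> N \<subseteq> B \<and> (\<forall>p\<in>V. \<exists>c. p - (\<Sum>i\<in>N. sgl 0 (c i) * i) \<in> K)" for N
 have "S B" using B(3) unfolding S_def lv.span_finite[OF B(1)] by auto
 then obtain N where N: "S N" "\<And>N'. S N' ==> card N \<le> card N'" using ex_has_least_nat[of S B card] by blast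
 have NB: "N \<subseteq> B" "finite N" using N(1) B(1) finite_subset by (auto simp: S_def)
 have "c j = 0" if c: "(\<Sum>i\<in>N. sgl 0 (c i) * i) \<in> K" and j: "j \<in> N" for c j
 proof (rule ccontr)
  assume cj: "c j \<noteq> 0"
  have "S (N - {j})" unfolding S_def
  proof (intro conjI ballI)
   show "N - {j} \<subseteq> B" using NB by blast
   fix p assume "p \<in> V"
   then obtain d where d: "p - (\<Sum>i\<in>N. sgl 0 (d i) * i) \<in> K" using N(1) by (auto simp: S_def)
   have "(\<Sum>i\<in>N - {j}. sgl 0 (d i - d j / c j * c i) * i) = (\<Sum>i\<in>N. sgl 0 (d i - d j / c j * c i) * i)"
    by (rule sum.mono_neutral_left) (use NB cj in auto)
   also have "\<dots> = (\<Sum>i\<in>N. sgl 0 (d i) * i) - sgl 0 (d j / c j) * (\<Sum>i\<in>N. sgl 0 (c i) * i)"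
    unfolding sum_distrib_left sum_subtractf[symmetric]
    by (intro sum.cong refl) (simp add: single_diff left_diff_distrib mult_single flip: mult.assoc)
   finally have e: "p - (\<Sum>i\<in>N - {j}. sgl 0 (d i - d j / c j * c i) * i) =
     (p - (\<Sum>i\<in>N. sgl 0 (d i) * i)) + sgl 0 (d j / c j) * (\<Sum>i\<in>N. sgl 0 (c i) * i)" by simp
   show "\<exists>c. p - (\<Sum>i\<in>N - {j}. sgl 0 (c i) * i) \<in> K"
    by (rule exI, subst e) (rule submod_add[OF K d submod_mult[OF K rangeI c]])
  qed
  hence "card N \<le> card (N - {j})" by (rule N(2))
  thus False using card_Diff1_less[OF NB(2) j] by simp
 qed
 hence "basis_mod V K N (\<lambda>p. p)"
  unfolding basis_mod_def using N(1)[unfolded S_def] NB B(2) by (intro conjI allI impI ballI) auto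
 thus ?thesis using NB(1) by blast
qed

lemma lv_span_mult: "p \<in> lv.span X ==> q \<in> lv.span Y ==> p * q \<in> lv.span {x * y | x y. x \<in> X \<and> y \<in> Y}"
proof (induction p rule: lv.span_induct_alt)
 case (step c x p)
 have "x * q \<in> lv.span {x * y | x y. x \<in> X \<and> y \<in> Y}" using step.prems
 proof (induction q rule: lv.span_induct_alt)
  case (step d y q)
  have "x * (sgl 0 d * y + q) = sgl 0 d * (x * y) + x * q" by (simp add: algebra_simps)
  moreover have "x * y \<in> lv.span {x * y | x y. x \<in> X \<and> y \<in> Y}" using step(1) \<open>x \<in> X\<close> by (intro lv.span_base) blast
  ultimately show ?case using lv.span_add[OF lv.span_scale step(2)] by simp
 qed (simp add: lv.span_zero)
 hence "sgl 0 c * (x * q) + p * q \<in> lv.span {x * y | x y. x \<in> X \<and> y \<in> Y}"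
  by (rule lv.span_add[OF lv.span_scale step(2)[OF step(3)]])
 thus ?case by (simp add: algebra_simps)
qed (simp add: lv.span_zero)

lemma lv_span_in:
 assumes "subring_set A" "\<And>c. sgl 0 c \<in> A" "B \<subseteq> A" "q \<in> lv.span B"
 shows "q \<in> A" using assms(4) by (induction q rule: lv.span_induct_alt)
  (use assms(1-3) in \<open>auto simp: subring_set_def intro: submod_add submod_mult submod_zero\<close>)

text \<open>Division with remainder by an annihilating polynomial of g brings each power of g into
  the span of the finite set P. The products of elements of P with a finite set that works for the
  remaining generators form the new finite set.\<close>

lemma algebraic_finite_codim:
 fixes A :: "('g::comm_monoid_add \<Rightarrow>\<^sub>0 complex) set"
 assumes A: "subring_set A" "\<And>c. sgl 0 c \<in> A" and J: "ideal_in A J"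
  and G: "finite G" "G \<subseteq> A" "\<And>g. g \<in> G ==> \<exists>q. q \<noteq> 0 \<and> peval g q \<in> J"
 shows "\<exists>B. finite B \<and> B \<subseteq> A \<and> (\<forall>n::_ => nat. \<exists>q\<in>lv.span B. (\<Prod>g\<in>G. g ^ n g) - q \<in> J)" using G
proof (induction G rule: finite_induct)
 case empty
 show ?case using A(1) J submod_zero[of A J]
  by (intro exI[of _ "{1}"]) (auto simp: subring_set_def ideal_in_def intro!: bexI[of _ 1] lv.span_base)
next
 case (insert g G)
 have As: "submod A A" "1 \<in> A" and Js: "submod A J" using A J by (auto simp: subring_set_def ideal_in_def)
 obtain B where B: "finite B" "B \<subseteq> A" "\<And>n::_ => nat. \<exists>q\<in>lv.span B. (\<Prod>g\<in>G. g ^ n g) - q \<in> J" using insert by auto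
 obtain q0 where q0: "q0 \<noteq> 0" "peval g q0 \<in> J" using insert.prems by blast
 have g: "g \<in> A" using insert.prems by blast
 have gk: "g ^ k \<in> A" for k using As g by (induction k) (auto intro: submod_mult)
 define P where "P = (\<lambda>k. g ^ k) ` {..degree q0}"
 define B' where "B' = {x * y | x y. x \<in> P \<and> y \<in> B}"
 have peval_altdef: "peval g r = (\<Sum>k\<le>degree r. sgl 0 (Polynomial.coeff r k) * g ^ k)" for r
 proof -
  have "degree (map_poly (sgl (0::'g)) r) = degree r" by (intro degree_map_poly) (metis lookup_single_eq lookup_zero)
  thus ?thesis by (simp add: peval_def poly_altdef coeff_map_poly)
 qed
 have red: "\<exists>r\<in>lv.span P. g ^ N - r \<in> J" for N
 proof -
  let ?M = "Polynomial.monom (1::complex) N"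
  have pm: "peval g ?M = g ^ N" by (induction N) (simp_all add: monom_0 monom_Suc peval_pCons)
  have "degree (?M mod q0) \<le> degree q0" using degree_mod_less'[of q0 ?M] q0(1) by (cases "?M mod q0 = 0") auto
  hence "peval g (?M mod q0) \<in> lv.span P"
   unfolding peval_altdef by (intro lv.span_sum lv.span_scale lv.span_base) (auto simp: P_def)
  moreover have "peval g ?M - peval g (?M mod q0) = peval g (?M div q0) * peval g q0"
   by (subst (1) div_mult_mod_eq[of ?M q0, symmetric]) (simp only: peval_add peval_mult add_diff_cancel_right')
  hence "g ^ N - peval g (?M mod q0) \<in> J" unfolding pm using submod_mult[OF Js peval_in[OF A g] q0(2)] by metis
  ultimately show ?thesis by blast
 qed
 have PA: "P \<subseteq> A" using gk by (auto simp: P_def)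
 have fB: "finite B'"
 proof -
  have "B' = (\<lambda>(x, y). x * y) ` (P \<times> B)" by (auto simp: B'_def)
  thus ?thesis using B(1) by (simp add: P_def)
 qed
 moreover have "B' \<subseteq> A" using PA B(2) submod_mult[OF As(1)] by (auto simp: B'_def)
 moreover have "\<exists>q\<in>lv.span B'. (\<Prod>h\<in>insert g G. h ^ n h) - q \<in> J" for n :: "_ => nat"
 proof -
  obtain r where r: "r \<in> lv.span P" "g ^ n g - r \<in> J" using red by blast
  obtain q where q: "q \<in> lv.span B" "(\<Prod>g\<in>G. g ^ n g) - q \<in> J" using B(3) by blast
  have qA: "q \<in> A" by (rule lv_span_in[OF A B(2) q(1)])
  have "g ^ n g * (\<Prod>g\<in>G. g ^ n g) - r * q = g ^ n g * ((\<Prod>g\<in>G. g ^ n g) - q) + q * (g ^ n g - r)"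
   by (simp add: algebra_simps)
  moreover have "\<dots> \<in> J" using submod_add[OF Js submod_mult[OF Js gk q(2)] submod_mult[OF Js qA r(2)]] .
  moreover have "(\<Prod>h\<in>insert g G. h ^ n h) = g ^ n g * (\<Prod>g\<in>G. g ^ n g)" using insert.hyps by simp
  ultimately show ?thesis using lv_span_mult[OF r(1) q(1)] by (auto simp: B'_def intro!: bexI[of _ "r * q"])
 qed
 ultimately show ?case by blast
qed

context toric_fan
begin

text \<open>Generation is stated as an induction principle, the form in which it is used for values
  of monomials and for products of generators.\<close>

definition monoid_generators :: "(int ^ 'n) set => (real ^ 'n) set => bool" where
 "monoid_generators G \<sigma> \<longleftrightarrow> finite G \<and> G \<subseteq> Rg 0 \<sigma> \<and> (\<forall>P. P 0 --> (\<forall>g\<in>G. P g) -->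
   (\<forall>x\<in>Rg 0 \<sigma>. \<forall>y\<in>Rg 0 \<sigma>. P x --> P y --> P (x + y)) --> (\<forall>m\<in>Rg 0 \<sigma>. P m))"

lemma monoid_generators_induct:
 assumes "monoid_generators G \<sigma>" "m \<in> Rg 0 \<sigma>" "P 0" "\<And>g. g \<in> G ==> P g"
  "\<And>x y. x \<in> Rg 0 \<sigma> ==> y \<in> Rg 0 \<sigma> ==> P x ==> P y ==> P (x + y)"
 shows "P m"
 using assms(1)[unfolded monoid_generators_def, THEN conjunct2, THEN conjunct2, THEN spec, of P] assms(2-) by blast

lemma monoid_generators_exist: "\<exists>G. monoid_generators G \<sigma>"
proof -
 have D: "{m. \<forall>i\<in>{i. \<rho> i \<subseteq> \<sigma>}. pairing m (u i) \<ge> 0} = Rg 0 \<sigma>" by (auto simp: Rg_def)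
 define N where "N m = (\<Sum>j\<in>UNIV. \<bar>m $ j\<bar>)" for m :: "int ^ 'n"
 obtain G where G: "finite G" "G \<subseteq> Rg 0 \<sigma> - {0}"
  "\<And>m. m \<in> Rg 0 \<sigma> ==> m \<noteq> 0 ==> m \<notin> G ==> \<exists>x\<in>Rg 0 \<sigma>. \<exists>y\<in>Rg 0 \<sigma>. m = x + y \<and> N x < N m \<and> N y < N m"
  by (rule gordan[of "{i. \<rho> i \<subseteq> \<sigma>}" u, unfolded D, folded N_def]) (rule that)
 have main: "\<forall>m\<in>Rg 0 \<sigma>. P m" if P: "P 0" "\<forall>g\<in>G. P g" "\<forall>x\<in>Rg 0 \<sigma>. \<forall>y\<in>Rg 0 \<sigma>. P x --> P y --> P (x + y)" for P
 proof
  fix m assume m: "m \<in> Rg 0 \<sigma>"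
  have N0: "N x \<ge> 0" for x unfolding N_def by (rule sum_nonneg) simp
  show "P m" using m
  proof (induction "nat (N m)" arbitrary: m rule: less_induct)
   case less
   show ?case
   proof (cases "m = 0 \<or> m \<in> G")
    case False
    then obtain x y where xy: "x \<in> Rg 0 \<sigma>" "y \<in> Rg 0 \<sigma>" "m = x + y" "N x < N m" "N y < N m" using G(3)[OF less.prems] by blast
    have "nat (N x) < nat (N m)" "nat (N y) < nat (N m)" using xy(4,5) N0[of x] N0[of y] by linarith+
    thus ?thesis using P(3) xy(1,2) less.hyps[OF _ xy(1)] less.hyps[OF _ xy(2)] xy(3) by simp
   qed (use P in auto)
  qed
 qed
 have "G \<subseteq> Rg 0 \<sigma>" using G(2) by blast
 have "monoid_generators G \<sigma>" unfolding monoid_generators_def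
 proof (intro conjI allI impI)
  fix P :: "int ^ 'n => bool"
  assume "P 0" "\<forall>g\<in>G. P g" "\<forall>x\<in>Rg 0 \<sigma>. \<forall>y\<in>Rg 0 \<sigma>. P x --> P y --> P (x + y)"
  thus "\<forall>m\<in>Rg 0 \<sigma>. P m" by (rule main[of P])
 qed (fact G(1), fact \<open>G \<subseteq> Rg 0 \<sigma>\<close>)
 thus ?thesis ..
qed

lemma ev_peval: "nv x \<sigma> ==> y \<in> Ng 0 \<sigma> ==> ev (mono x 0) (peval y q) = poly q (ev (mono x 0) y)"
proof (induction q)
 case (pCons c q)
 thus ?case using ev_mono_mult[of x \<sigma> y 0 "peval y q" 0 0] peval_in[OF subring_Ng, of y] by (simp add: peval_pCons ev_add)
qed simp

end

context toric_system
begin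

definition Zs :: "'n toric_point set" where "Zs = {cclass x | x \<sigma>. \<sigma> \<in> \<Sigma> \<and> nv x \<sigma> \<and> \<not> van 0 x 1}"

end

context zero_dim_system
begin

lemma finite_codim:
 assumes s: "\<sigma> \<in> \<Sigma>"
 shows "\<exists>B. finite B \<and> B \<subseteq> Ng 0 \<sigma> \<and> (\<forall>p\<in>Ng 0 \<sigma>. \<exists>q\<in>lv.span B. p - q \<in> Im 0 \<sigma>)"
proof -
 obtain G where gen: "monoid_generators G \<sigma>" using monoid_generators_exist by blast
 hence G: "finite G" "G \<subseteq> Rg 0 \<sigma>" by (auto simp: monoid_generators_def)
 define H where "H = (\<lambda>g. sgl g (1::complex)) ` G"
 have H: "finite H" "H \<subseteq> Ng 0 \<sigma>" using G(1,2) by (auto simp: H_def)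
 have "\<exists>q. q \<noteq> 0 \<and> peval h q \<in> Im 0 \<sigma>" if "h \<in> H" for h using algebraic[OF s] H(2) that by blast
 from algebraic_finite_codim[OF subring_Ng ideal_Im H this]
 obtain B where B: "finite B" "B \<subseteq> Ng 0 \<sigma>" "\<And>n::_ => nat. \<exists>q\<in>lv.span B. (\<Prod>g\<in>H. g ^ n g) - q \<in> Im 0 \<sigma>" by auto
 have prodH: "\<exists>n::_ => nat. sgl m 1 = (\<Prod>h\<in>H. h ^ n h)" if "m \<in> Rg 0 \<sigma>" for m using that
 proof (rule monoid_generators_induct[OF gen])
  show "\<exists>n::_ => nat. sgl 0 1 = (\<Prod>h\<in>H. h ^ n h)" by (intro exI[of _ "\<lambda>_. 0"]) simp
  show "\<exists>n::_ => nat. sgl g 1 = (\<Prod>h\<in>H. h ^ n h)" if "g \<in> G" for g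
  proof (intro exI[of _ "\<lambda>h. if h = sgl g 1 then 1 else 0"])
   have "(\<Prod>h\<in>H. h ^ (if h = sgl g 1 then 1 else 0)) = (\<Prod>h\<in>H. if h = sgl g 1 then h else 1)" by (rule prod.cong) auto
   thus "sgl g 1 = (\<Prod>h\<in>H. h ^ (if h = sgl g 1 then 1 else 0))" using that H(1) by (simp add: H_def)
  qed
  fix x y assume "\<exists>n::_ => nat. sgl x 1 = (\<Prod>h\<in>H. h ^ n h)" "\<exists>n::_ => nat. sgl y 1 = (\<Prod>h\<in>H. h ^ n h)"
  then obtain n n' :: "_ => nat" where "sgl x 1 = (\<Prod>h\<in>H. h ^ n h)" "sgl y 1 = (\<Prod>h\<in>H. h ^ n' h)" by blast
  hence "sgl x 1 * sgl y (1::complex) = (\<Prod>h\<in>H. h ^ (n h + n' h))" by (simp add: power_add prod.distrib)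
  thus "\<exists>n::_ => nat. sgl (x + y) 1 = (\<Prod>h\<in>H. h ^ n h)" by (intro exI[of _ "\<lambda>h. n h + n' h"]) (simp add: mult_single)
 qed
 have mB: "\<exists>q\<in>lv.span B. sgl m 1 - q \<in> Im 0 \<sigma>" if m: "m \<in> Rg 0 \<sigma>" for m using prodH[OF m] B(3) by metis
 show ?thesis
 proof (intro exI[of _ B] conjI ballI B(1,2))
  fix p assume p: "p \<in> Ng 0 \<sigma>"
  hence k: "keys p \<subseteq> Rg 0 \<sigma>" by (simp add: spn_def)
  have "\<forall>m\<in>keys p. \<exists>q. q \<in> lv.span B \<and> sgl m 1 - q \<in> Im 0 \<sigma>" using mB k by blast
  then obtain q where q: "\<And>m. m \<in> keys p ==> q m \<in> lv.span B" "\<And>m. m \<in> keys p ==> sgl m 1 - q m \<in> Im 0 \<sigma>" by metis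
  have "(\<Sum>m\<in>keys p. sgl m (lkp p m)) - (\<Sum>m\<in>keys p. sgl 0 (lkp p m) * q m) = (\<Sum>m\<in>keys p. sgl 0 (lkp p m) * (sgl m 1 - q m))"
   unfolding sum_subtractf[symmetric] by (intro sum.cong refl) (simp add: right_diff_distrib mult_single)
  also have "\<dots> \<in> Im 0 \<sigma>" by (intro submod_sum[OF submod_Im] submod_mult[OF submod_Im subring_Ng(2)] q(2))
  finally have "p - (\<Sum>m\<in>keys p. sgl 0 (lkp p m) * q m) \<in> Im 0 \<sigma>" unfolding monomial_sum[of p, symmetric] .
  moreover have "(\<Sum>m\<in>keys p. sgl 0 (lkp p m) * q m) \<in> lv.span B" by (intro lv.span_sum lv.span_scale q(1))
  ultimately show "\<exists>q\<in>lv.span B. p - q \<in> Im 0 \<sigma>" by blast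
 qed
qed

lemma local_basis_exists:
 assumes s: "\<sigma> \<in> \<Sigma>" "nv x \<sigma>"
 shows "\<exists>N :: 'n laurent set. basis_mod (Ng 0 \<sigma>) {p. van 0 x p} N (\<lambda>p. p)"
proof -
 obtain B where B: "finite B" "B \<subseteq> Ng 0 \<sigma>" "\<And>p. p \<in> Ng 0 \<sigma> ==> \<exists>q\<in>lv.span B. p - q \<in> Im 0 \<sigma>"
  using finite_codim[OF s(1)] by blast
 have "submod (range (sgl 0)) {p. van 0 x p}" using submod_van[OF s, of 0] subring_Ng(2) unfolding submod_def by blast
 thus ?thesis using basis_mod_exists[OF _ B(1,2), of "{p. van 0 x p}"] B(3) van_Im[OF s] by blast
qed

text \<open>A point of a chart is determined by its values on the finitely many generators of the
  dual monoid, and on the scheme each value is a root of a fixed nonzero polynomial.\<close>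

lemma finite_Zs: "finite Zs"
proof -
 have "finite (cclass ` {x. nv x \<sigma> \<and> \<not> van 0 x 1})" if s: "\<sigma> \<in> \<Sigma>" for \<sigma>
 proof -
  obtain G where gen: "monoid_generators G \<sigma>" using monoid_generators_exist by blast
  hence G: "finite G" "G \<subseteq> Rg 0 \<sigma>" by (auto simp: monoid_generators_def)
  have "\<forall>g\<in>G. \<exists>q. q \<noteq> 0 \<and> peval (sgl g 1) q \<in> Im 0 \<sigma>" using algebraic[OF s] G(2) by (metis spn_single subsetD)
  then obtain q where q: "\<And>g. g \<in> G ==> q g \<noteq> 0" "\<And>g. g \<in> G ==> peval (sgl g 1) (q g) \<in> Im 0 \<sigma>" by metis
  define X where "X = {x. nv x \<sigma> \<and> \<not> van 0 x 1}"
  define f where "f x = restrict (mono x 0) G" for x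
  have "f ` X \<subseteq> PiE G (\<lambda>g. {z. poly (q g) z = 0})"
  proof
   fix y assume "y \<in> f ` X"
   then obtain x where x: "y = f x" "nv x \<sigma>" "\<not> van 0 x 1" by (auto simp: X_def)
   have "poly (q g) (mono x 0 g) = 0" if "g \<in> G" for g
    using ev_peval[OF x(2), of "sgl g 1" "q g"] van_one_iff[OF s x(2)] x(3) q(2)[OF that] G(2) that by auto
   thus "y \<in> PiE G (\<lambda>g. {z. poly (q g) z = 0})" by (auto simp: x(1) f_def)
  qed
  moreover have "finite (PiE G (\<lambda>g. {z. poly (q g) z = 0}))"
   using G(1) q(1) poly_roots_finite by (intro finite_PiE) auto
  ultimately have fin: "finite (f ` X)" using finite_subset by blast
  have inj: "cclass x = cclass x'" if x: "x \<in> X" "x' \<in> X" "f x = f x'" for x x'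
  proof -
   have nv: "nv x \<sigma>" "nv x' \<sigma>" using x by (auto simp: X_def)
   have "mono x 0 m = mono x' 0 m" if "m \<in> Rg 0 \<sigma>" for m using that
   proof (rule monoid_generators_induct[OF gen])
    show "mono x 0 g = mono x' 0 g" if "g \<in> G" for g using fun_cong[OF x(3), of g] that by (simp add: f_def)
    show "mono x 0 (m + m') = mono x' 0 (m + m')"
     if "m \<in> Rg 0 \<sigma>" "m' \<in> Rg 0 \<sigma>" "mono x 0 m = mono x' 0 m" "mono x 0 m' = mono x' 0 m'" for m m'
     using mono_add[OF nv(1) that(1,2)] mono_add[OF nv(2) that(1,2)] that(3,4) by simp
   qed simp
   hence "cpt x' \<sigma> = cpt x \<sigma>" by (auto simp: cpt_def dual_Rg[OF s] restrict_def)
   thus ?thesis using cpt_eq_cclass[OF s nv] by simp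
  qed
  have "cclass ` X \<subseteq> (\<lambda>y. cclass (inv_into X f y)) ` (f ` X)"
  proof
   fix z assume "z \<in> cclass ` X"
   then obtain x where x: "x \<in> X" "z = cclass x" by blast
   have "z = cclass (inv_into X f (f x))"
    unfolding x(2) using inj[OF x(1) inv_into_into] f_inv_into_f[of "f x" f X] x(1) by (metis imageI)
   thus "z \<in> (\<lambda>y. cclass (inv_into X f y)) ` (f ` X)" using x(1) by blast
  qed
  thus ?thesis using fin finite_surj unfolding X_def by blast
 qed
 moreover have "Zs = (\<Union>\<sigma>\<in>\<Sigma>. cclass ` {x. nv x \<sigma> \<and> \<not> van 0 x 1})" by (auto simp: Zs_def)
 ultimately show ?thesis using fin by simp
qed

end

section \<open>Counting\<close>

text \<open>The assumption covers every Cox representative x of a point of the scheme, in particular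
  the one in the closed orbit of the fibre. There a section that is nonzero on the whole fibre has a
  nonzero monomial.\<close>

locale regular_system = zero_dim_system \<Sigma> \<rho> a F \<mu> a0 l0 \<mu>0
 for \<Sigma> :: "(real ^ 'n::finite) set set" and \<rho> :: "'k::finite => (real ^ 'n) set" and a F \<mu> a0 l0 \<mu>0 +
 assumes sections: "\<And>\<sigma> x. \<sigma> \<in> \<Sigma> ==> nv x \<sigma> ==> \<not> van 0 x 1 ==> \<exists>m\<in>Rg a0 UNIV. mono x a0 m \<noteq> 0"
begin

lemma mono_nonzero_iff: "mono x b m \<noteq> 0 \<longleftrightarrow> (\<forall>i. x $ i = 0 --> pairing m (u i) + b $ i = 0)"
 by (auto simp: mono_def prod_zero_iff)

text \<open>To a monomial section of a0 that is nonzero at x, add the characters \<mu> j \<sigma>,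
  which are sections of the a j without zeros on the chart.\<close>

lemma beta_section:
 assumes s: "\<sigma> \<in> \<Sigma>" "nv x \<sigma>" "\<not> van 0 x 1"
 shows "\<exists>m\<in>Rg \<beta> UNIV. mono x \<beta> m \<noteq> 0"
proof -
 obtain m0 where m0: "m0 \<in> Rg a0 UNIV" "mono x a0 m0 \<noteq> 0" using sections[OF s] by blast
 define T where "T j i = pairing (\<mu> j \<sigma>) (u i) + a j $ i" for j i
 have T: "T j i \<ge> 0" "\<rho> i \<subseteq> \<sigma> ==> T j i = 0" if "j \<in> {1..CARD('n)}" for j i
  using \<mu>[OF that] s(1) unfolding nef_support_def T_def by (metis mult_1)+
 have e: "pairing (m0 + (\<Sum>j\<in>{1..CARD('n)}. \<mu> j \<sigma>)) (u i) + \<beta> $ i =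
   (pairing m0 (u i) + a0 $ i) + (\<Sum>j\<in>{1..CARD('n)}. T j i)" for i
  by (simp add: \<beta>_def T_def pairing_add pairing_sum sum.distrib sum_component)
 show ?thesis
 proof (rule bexI)
  have "(pairing m0 (u i) + a0 $ i) + (\<Sum>j\<in>{1..CARD('n)}. T j i) \<ge> 0" for i
   using m0(1) T(1) by (intro add_nonneg_nonneg[OF _ sum_nonneg]) (auto simp: Rg_def)
  thus "m0 + (\<Sum>j\<in>{1..CARD('n)}. \<mu> j \<sigma>) \<in> Rg \<beta> UNIV" unfolding Rg_def e[symmetric] by blast
  show "mono x \<beta> (m0 + (\<Sum>j\<in>{1..CARD('n)}. \<mu> j \<sigma>)) \<noteq> 0" unfolding mono_nonzero_iff e
  proof (intro allI impI)
   fix i assume i: "x $ i = 0"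
   hence "\<rho> i \<subseteq> \<sigma>" using s(2) by (auto simp: nv_def)
   hence "(\<Sum>j\<in>{1..CARD('n)}. T j i) = 0" using T(2) by (intro sum.neutral) blast
   thus "pairing m0 (u i) + a0 $ i + (\<Sum>j\<in>{1..CARD('n)}. T j i) = 0" using m0(2) i by (simp add: mono_nonzero_iff)
  qed
 qed
qed

text \<open>Passing to the representative x' in the closed orbit, a monomial section m that is
  nonzero at x' has exponent 0 at every ray where x' vanishes. At the other rays of \<sigma> the
  character w is positive, so m' = k w - m is a local section of -\<beta> for k large. As k w does
  not vanish at x, the section m generates the twist \<beta> near the point.\<close>

lemma local_generator:
 assumes s: "\<sigma> \<in> \<Sigma>" "nv x \<sigma>" "\<not> van 0 x 1"
 obtains m m' where "m \<in> Rg \<beta> UNIV" "m' \<in> Rg (- \<beta>) \<sigma>" "m' + m \<in> Rg 0 \<sigma>" "mono x 0 (m' + m) \<noteq> 0"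
proof -
 obtain x' w where x': "nv x' \<sigma>" "cpt x \<sigma> = cpt x' \<sigma>" "w \<in> Rg 0 \<sigma>" "mono x' 0 w \<noteq> 0"
  "\<And>i. \<rho> i \<subseteq> \<sigma> ==> x' $ i = 0 \<longleftrightarrow> pairing w (u i) = 0"
  by (rule affine_point_lift[OF s(1) cpt_affine[OF s(1,2)]]) (rule that)
 have c: "cclass x' = cclass x" by (rule cpt_eq_cclass[OF s(1) x'(1) s(2) x'(2)])
 have v: "\<not> van 0 x' 1" using van_cong[OF c] s(3) by blast
 obtain m where m: "m \<in> Rg \<beta> UNIV" "mono x' \<beta> m \<noteq> 0" using beta_section[OF s(1) x'(1) v] by blast
 define k where "k = (\<Sum>i\<in>UNIV. \<bar>pairing m (u i) + \<beta> $ i\<bar>)"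
 have k: "pairing m (u i) + \<beta> $ i \<le> k" "k \<ge> 0" for i
  using member_le_sum[of i UNIV "\<lambda>i. \<bar>pairing m (u i) + \<beta> $ i\<bar>"] by (auto simp: k_def intro: sum_nonneg)
 define m' where "m' = k *s w - m"
 have wi: "pairing w (u i) \<ge> 0" if "\<rho> i \<subseteq> \<sigma>" for i using x'(3) that by (auto simp: Rg_def)
 have mm: "m' + m = k *s w" by (simp add: m'_def)
 have "pairing m' (u i) + (- \<beta>) $ i \<ge> 0" if i: "\<rho> i \<subseteq> \<sigma>" for i
 proof (cases "pairing w (u i) = 0")
  case True
  hence "x' $ i = 0" using x'(5)[OF i] by simp
  hence "pairing m (u i) + \<beta> $ i = 0" using m(2) by (simp add: mono_nonzero_iff)
  thus ?thesis using True by (simp add: m'_def pairing_diff pairing_scale)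
 next
  case False
  hence "1 \<le> pairing w (u i)" using wi[OF i] by linarith
  hence "k * 1 \<le> k * pairing w (u i)" using k(2) by (rule mult_left_mono)
  thus ?thesis using k(1)[of i] by (simp add: m'_def pairing_diff pairing_scale)
 qed
 hence "m' \<in> Rg (- \<beta>) \<sigma>" by (simp add: Rg_def)
 moreover have r: "m' + m \<in> Rg 0 \<sigma>" using wi k(2) by (simp add: mm Rg_def pairing_scale)
 moreover have "mono x 0 (m' + m) \<noteq> 0"
 proof -
  have "mono x' 0 (m' + m) \<noteq> 0" using x'(4) by (auto simp: mm mono_nonzero_iff pairing_scale)
  thus ?thesis using ev_cpt[OF s(1) x'(2), of "sgl (m' + m) 1"] r by simp
 qed
 ultimately show ?thesis using that m(1) by blast
qed

lemma beta_global:
 assumes "X \<in> Ng \<beta> UNIV" "\<And>\<sigma> x. \<sigma> \<in> \<Sigma> ==> nv x \<sigma> ==> \<not> van 0 x 1 ==> van \<beta> x X"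
 shows "X \<in> Im \<beta> UNIV"
proof (rule Im_global[OF assms(1)])
 fix \<sigma> assume s: "\<sigma> \<in> \<Sigma>"
 show "X \<in> Im \<beta> \<sigma>" by (rule local_global[OF s Ng_mono[OF assms(1) subset_UNIV]]) (rule assms(2)[OF s])
qed

text \<open>On each chart sum sections adapted to one point each: equal to the prescribed one in
  that stalk, and zero in the stalks of the other points of the chart. On an overlap two such sums
  agree in all stalks of the scheme, hence modulo the ideal by \<open>local_global\<close>, and
  \<open>Im_glue\<close> lifts them to a global section.\<close>

theorem interpolation:
 assumes x: "\<And>\<zeta>. \<zeta> \<in> Zs ==> cclass (x \<zeta>) = \<zeta>" and s: "\<And>\<zeta>. \<zeta> \<in> Zs ==> \<sigma> \<zeta> \<in> \<Sigma> \<and> nv (x \<zeta>) (\<sigma> \<zeta>)"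
  and Y: "\<And>\<zeta>. \<zeta> \<in> Zs ==> Y \<zeta> \<in> Ng \<beta> (\<sigma> \<zeta>)"
 obtains X where "X \<in> Ng \<beta> UNIV" "\<And>\<zeta>. \<zeta> \<in> Zs ==> van \<beta> (x \<zeta>) (X - Y \<zeta>)"
proof -
 define Q where "Q \<eta> \<zeta> y \<longleftrightarrow> y \<in> Ng \<beta> \<eta> \<and> van \<beta> (x \<zeta>) (y - Y \<zeta>) \<and> (\<forall>\<xi>\<in>Zs. nv (x \<xi>) \<eta> --> \<xi> \<noteq> \<zeta> --> van \<beta> (x \<xi>) y)" for \<eta> \<zeta> y
 have "\<exists>y. Q \<eta> \<zeta> y" if h: "\<eta> \<in> \<Sigma>" and z: "\<zeta> \<in> Zs" "nv (x \<zeta>) \<eta>" for \<eta> \<zeta>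
 proof -
  have t: "\<eta> \<inter> \<sigma> \<zeta> \<in> \<Sigma>" "nv (x \<zeta>) (\<eta> \<inter> \<sigma> \<zeta>)" using inter_fan[OF h] s[OF z(1)] nv_Int z(2) by blast+
  obtain y' where y': "y' \<in> Ng \<beta> \<eta>" "van \<beta> (x \<zeta>) (y' - Y \<zeta>)"
   by (rule van_extend[OF h t(1) Int_lower1 t(2) Ng_mono[OF Y[OF z(1)] Int_lower2]]) (rule that)
  obtain e where e: "e \<in> Ng 0 \<eta>" "van 0 (x \<zeta>) (e - 1)" "\<And>y. y \<in> x ` {\<xi> \<in> Zs. nv (x \<xi>) \<eta> \<and> \<xi> \<noteq> \<zeta>} ==> van 0 y e"
  proof (rule separating_idempotent[OF h z(2)])
   show "finite (x ` {\<xi> \<in> Zs. nv (x \<xi>) \<eta> \<and> \<xi> \<noteq> \<zeta>})" using finite_Zs by simp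
   show "nv y \<eta> \<and> cclass y \<noteq> cclass (x \<zeta>)" if "y \<in> x ` {\<xi> \<in> Zs. nv (x \<xi>) \<eta> \<and> \<xi> \<noteq> \<zeta>}" for y using that x z(1) by auto
  qed (rule that)
  have "van \<beta> (x \<zeta>) (y' * (e - 1))" by (rule van_mult[OF e(2) h z(2) y'(1)]) simp
  hence "van \<beta> (x \<zeta>) (y' * (e - 1) + (y' - Y \<zeta>))" using submod_add[OF submod_van[OF h z(2)]] y'(2) by blast
  hence "van \<beta> (x \<zeta>) (y' * e - Y \<zeta>)" by (simp add: algebra_simps)
  moreover have "van \<beta> (x \<xi>) (y' * e)" if "\<xi> \<in> Zs" "nv (x \<xi>) \<eta>" "\<xi> \<noteq> \<zeta>" for \<xi>
   by (rule van_mult[OF e(3) h that(2) y'(1)]) (use that in auto)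
  moreover have "y' * e \<in> Ng \<beta> \<eta>" by (rule Ng_mult[OF y'(1) e(1)]) simp
  ultimately show ?thesis unfolding Q_def by blast
 qed
 then obtain y where "\<And>\<eta> \<zeta>. \<eta> \<in> \<Sigma> ==> \<zeta> \<in> Zs ==> nv (x \<zeta>) \<eta> ==> Q \<eta> \<zeta> (y \<eta> \<zeta>)" by metis
 hence y: "\<And>\<eta> \<zeta>. \<eta> \<in> \<Sigma> ==> \<zeta> \<in> Zs ==> nv (x \<zeta>) \<eta> ==> y \<eta> \<zeta> \<in> Ng \<beta> \<eta> \<and> van \<beta> (x \<zeta>) (y \<eta> \<zeta> - Y \<zeta>) \<and>
   (\<forall>\<xi>\<in>Zs. nv (x \<xi>) \<eta> --> \<xi> \<noteq> \<zeta> --> van \<beta> (x \<xi>) (y \<eta> \<zeta>))" unfolding Q_def by blast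
 define L where "L \<eta> = (\<Sum>\<zeta> | \<zeta> \<in> Zs \<and> nv (x \<zeta>) \<eta>. y \<eta> \<zeta>)" for \<eta>
 have L: "L \<eta> \<in> Ng \<beta> \<eta>" if "\<eta> \<in> \<Sigma>" for \<eta> unfolding L_def using y[OF that] by (intro spn_sum) auto
 have LY: "van \<beta> (x \<zeta>) (L \<eta> - Y \<zeta>)" if h: "\<eta> \<in> \<Sigma>" and z: "\<zeta> \<in> Zs" "nv (x \<zeta>) \<eta>" for \<eta> \<zeta>
 proof -
  have e: "L \<eta> - Y \<zeta> = (y \<eta> \<zeta> - Y \<zeta>) + (\<Sum>\<xi>\<in>{\<xi> \<in> Zs. nv (x \<xi>) \<eta>} - {\<zeta>}. y \<eta> \<xi>)"
   unfolding L_def using finite_Zs z by (subst sum.remove[of _ \<zeta>]) auto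
  have "(\<Sum>\<xi>\<in>{\<xi> \<in> Zs. nv (x \<xi>) \<eta>} - {\<zeta>}. y \<eta> \<xi>) \<in> {p. van \<beta> (x \<zeta>) p}"
   using y[OF h] z by (intro submod_sum[OF submod_van[OF h z(2)]]) auto
  hence "L \<eta> - Y \<zeta> \<in> {p. van \<beta> (x \<zeta>) p}"
   unfolding e using y[OF h z] by (intro submod_add[OF submod_van[OF h z(2)]]) auto
  thus ?thesis by simp
 qed
 obtain X where X: "X \<in> Ng \<beta> UNIV" "\<And>\<eta>. \<eta> \<in> \<Sigma> ==> X - L \<eta> \<in> Im \<beta> \<eta>"
 proof (rule Im_glue[of L])
  fix \<eta> \<theta> assume e: "\<eta> \<in> \<Sigma>" "\<theta> \<in> \<Sigma>"
  show "L \<eta> \<in> Ng \<beta> \<eta>" by (rule L[OF e(1)])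
  show "L \<theta> - L \<eta> \<in> Im \<beta> (\<eta> \<inter> \<theta>)"
  proof (rule local_global[OF inter_fan[OF e]])
   show "L \<theta> - L \<eta> \<in> Ng \<beta> (\<eta> \<inter> \<theta>)"
    by (rule spn_diff[OF Ng_mono[OF L[OF e(2)] Int_lower2] Ng_mono[OF L[OF e(1)] Int_lower1]])
   fix x' assume x': "nv x' (\<eta> \<inter> \<theta>)" "\<not> van 0 x' 1"
   have z: "cclass x' \<in> Zs" using x' inter_fan[OF e] unfolding Zs_def by blast
   have c: "cclass x' = cclass (x (cclass x'))" using x[OF z] by simp
   have n: "nv (x (cclass x')) \<eta>" "nv (x (cclass x')) \<theta>"
    using cclass_eq(1)[OF c inter_fan[OF e] x'(1)] by (auto simp: nv_Int)
   have "(L \<theta> - Y (cclass x')) - (L \<eta> - Y (cclass x')) \<in> {p. van \<beta> (x (cclass x')) p}"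
    using submod_diff[OF submod_van[OF e(1) n(1)]] LY[OF e(1) z n(1)] LY[OF e(2) z n(2)] by blast
   hence "van \<beta> (x (cclass x')) (L \<theta> - L \<eta>)" by simp
   thus "van \<beta> x' (L \<theta> - L \<eta>)" by (rule van_cong[OF c[symmetric]])
  qed
 qed (rule that)
 show ?thesis
 proof (rule that[OF X(1)])
  fix \<zeta> assume z: "\<zeta> \<in> Zs"
  hence h: "\<sigma> \<zeta> \<in> \<Sigma>" "nv (x \<zeta>) (\<sigma> \<zeta>)" using s by auto
  have "(X - L (\<sigma> \<zeta>)) + (L (\<sigma> \<zeta>) - Y \<zeta>) \<in> {p. van \<beta> (x \<zeta>) p}"
   using submod_add[OF submod_van[OF h]] van_Im[OF h X(2)[OF h(1)]] LY[OF h(1) z h(2)] by blast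
  thus "van \<beta> (x \<zeta>) (X - Y \<zeta>)" by simp
 qed
qed

text \<open>Sections of degree \<beta> map onto the product of the stalks by
  \<open>interpolation\<close>, with kernel \<open>Im \<beta> UNIV\<close> by
  \<open>beta_global\<close>. So the disjoint union of the stalk bases lifts to a basis.\<close>

theorem global_basis:
 fixes v :: "'n toric_point => 'i => 'n laurent"
 assumes x: "\<And>\<zeta>. \<zeta> \<in> Zs ==> cclass (x \<zeta>) = \<zeta>" and s: "\<And>\<zeta>. \<zeta> \<in> Zs ==> \<sigma> \<zeta> \<in> \<Sigma> \<and> nv (x \<zeta>) (\<sigma> \<zeta>)"
  and B: "\<And>\<zeta>. \<zeta> \<in> Zs ==> basis_mod (Ng 0 (\<sigma> \<zeta>)) {p. van 0 (x \<zeta>) p} (N \<zeta>) (v \<zeta>)"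
 obtains V where "basis_mod (Ng \<beta> UNIV) (Im \<beta> UNIV) (SIGMA \<zeta>:Zs. N \<zeta>) V"
proof -
 have nz: "\<not> van 0 (x \<zeta>) 1" if z: "\<zeta> \<in> Zs" for \<zeta>
 proof -
  obtain y where "\<zeta> = cclass y" "\<not> van 0 y 1" using z by (auto simp: Zs_def)
  thus ?thesis using van_cong[of "x \<zeta>" y] x[OF z] by metis
 qed
 have "\<exists>m m'. m \<in> Rg \<beta> UNIV \<and> m' \<in> Rg (- \<beta>) (\<sigma> \<zeta>) \<and> m' + m \<in> Rg 0 (\<sigma> \<zeta>) \<and> mono (x \<zeta>) 0 (m' + m) \<noteq> 0"
  if z: "\<zeta> \<in> Zs" for \<zeta> by (rule local_generator[of "\<sigma> \<zeta>" "x \<zeta>"]) (use s[OF z] nz[OF z] in blast)+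
 then obtain m m' where m: "\<And>\<zeta>. \<zeta> \<in> Zs ==> m \<zeta> \<in> Rg \<beta> UNIV \<and> m' \<zeta> \<in> Rg (- \<beta>) (\<sigma> \<zeta>) \<and>
   m' \<zeta> + m \<zeta> \<in> Rg 0 (\<sigma> \<zeta>) \<and> mono (x \<zeta>) 0 (m' \<zeta> + m \<zeta>) \<noteq> 0" by metis
 define t where "t \<zeta> = sgl (m' \<zeta> + m \<zeta>) (1::complex)" for \<zeta>
 have t: "t \<zeta> \<in> Ng 0 (\<sigma> \<zeta>)" "ev (mono (x \<zeta>) 0) (t \<zeta>) \<noteq> 0" if "\<zeta> \<in> Zs" for \<zeta> using m[OF that] by (auto simp: t_def)
 have "\<exists>c. c \<in> Ng 0 (\<sigma> \<zeta>) \<and> van 0 (x \<zeta>) (c * t \<zeta> - 1)" if z: "\<zeta> \<in> Zs" for \<zeta>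
  by (rule van_inverse[of "\<sigma> \<zeta>" "x \<zeta>" "t \<zeta>"]) (use s[OF z] t[OF z] in blast)+
 then obtain c where c: "\<And>\<zeta>. \<zeta> \<in> Zs ==> c \<zeta> \<in> Ng 0 (\<sigma> \<zeta>) \<and> van 0 (x \<zeta>) (c \<zeta> * t \<zeta> - 1)" by metis
 \<comment> \<open>Multiplication by the local section m' \<zeta> of -\<beta> compares the twist
   \<beta> with the structure sheaf in the stalk. Going back with m \<zeta> composes to
   multiplication by t \<zeta>, a unit there.\<close>
 define D where "D \<zeta> X = sgl (m' \<zeta>) (1::complex) * X" for \<zeta> X
 have D: "D \<zeta> X \<in> Ng 0 (\<sigma> \<zeta>)" if "\<zeta> \<in> Zs" "X \<in> Ng \<beta> (\<sigma> \<zeta>)" for \<zeta> X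
  unfolding D_def by (rule Ng_mult[OF _ that(2), of _ "- \<beta>"]) (use m[OF that(1)] in auto)
 have Dvan: "van 0 (x \<zeta>) (D \<zeta> X) \<longleftrightarrow> van \<beta> (x \<zeta>) X" if z: "\<zeta> \<in> Zs" for \<zeta> X
 proof
  assume "van \<beta> (x \<zeta>) X"
  thus "van 0 (x \<zeta>) (D \<zeta> X)" unfolding D_def by (rule van_mult[of _ _ _ "\<sigma> \<zeta>" _ "- \<beta>"]) (use s[OF z] m[OF z] in auto)
 next
  assume "van 0 (x \<zeta>) (D \<zeta> X)"
  hence "van \<beta> (x \<zeta>) (sgl (m \<zeta>) 1 * D \<zeta> X)"
   by (rule van_mult[of _ _ _ "\<sigma> \<zeta>" _ "\<beta>"]) (use s[OF z] m[OF z] Rg_mono[OF subset_UNIV] in auto)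
  moreover have "sgl (m \<zeta>) 1 * D \<zeta> X = t \<zeta> * X" by (simp add: D_def t_def mult_single add.commute flip: mult.assoc)
  ultimately show "van \<beta> (x \<zeta>) X" using van_cancel[of "\<sigma> \<zeta>" "x \<zeta>" "t \<zeta>"] s[OF z] t[OF z] by metis
 qed
 have interp: "\<exists>X. X \<in> Ng \<beta> UNIV \<and> (\<forall>\<zeta>\<in>Zs. van 0 (x \<zeta>) (D \<zeta> X - p \<zeta>))" if p: "\<And>\<zeta>. \<zeta> \<in> Zs ==> p \<zeta> \<in> Ng 0 (\<sigma> \<zeta>)" for p
 proof -
  \<comment> \<open>The factor c \<zeta> cancels t \<zeta>, so that D maps this section to p \<zeta>
    in the stalk.\<close>
  define Y where "Y \<zeta> = sgl (m \<zeta>) (1::complex) * (c \<zeta> * p \<zeta>)" for \<zeta>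
  have Y: "Y \<zeta> \<in> Ng \<beta> (\<sigma> \<zeta>)" if z: "\<zeta> \<in> Zs" for \<zeta>
   unfolding Y_def by (rule Ng_mult[OF _ Ng_mult[of "c \<zeta>" 0 "\<sigma> \<zeta>" "p \<zeta>" 0 0], of _ \<beta>])
    (use m[OF z] c[OF z] p[OF z] Rg_mono[OF subset_UNIV] in auto)
  obtain X where X: "X \<in> Ng \<beta> UNIV" "\<And>\<zeta>. \<zeta> \<in> Zs ==> van \<beta> (x \<zeta>) (X - Y \<zeta>)"
   by (rule interpolation[OF x s Y]) (assumption | rule that)+
  have "van 0 (x \<zeta>) (D \<zeta> X - p \<zeta>)" if z: "\<zeta> \<in> Zs" for \<zeta>
  proof -
   have h: "\<sigma> \<zeta> \<in> \<Sigma>" "nv (x \<zeta>) (\<sigma> \<zeta>)" using s[OF z] by auto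
   have "van 0 (x \<zeta>) (D \<zeta> (X - Y \<zeta>))" using Dvan[OF z] X(2)[OF z] by simp
   moreover have "van 0 (x \<zeta>) (p \<zeta> * (c \<zeta> * t \<zeta> - 1))" by (rule van_mult[OF _ h p[OF z]]) (use c[OF z] in auto)
   moreover have eq: "D \<zeta> X - p \<zeta> = D \<zeta> (X - Y \<zeta>) + p \<zeta> * (c \<zeta> * t \<zeta> - 1)"
   proof -
    have "D \<zeta> (Y \<zeta>) = p \<zeta> * (c \<zeta> * t \<zeta>)"
     unfolding D_def Y_def t_def mult.assoc[symmetric] mult_single by (simp add: mult_ac)
    thus ?thesis by (simp add: D_def algebra_simps)
   qed
   ultimately have "D \<zeta> X - p \<zeta> \<in> {p. van 0 (x \<zeta>) p}" unfolding eq by (intro submod_add[OF submod_van[OF h]]) auto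
   thus ?thesis by simp
  qed
  thus ?thesis using X(1) by blast
 qed
 define Nn where "Nn = (SIGMA \<zeta>:Zs. N \<zeta>)"
 have finN: "finite (N \<zeta>)" if "\<zeta> \<in> Zs" for \<zeta> using B[OF that] by (simp add: basis_mod_def)
 have "\<exists>X. X \<in> Ng \<beta> UNIV \<and> (\<forall>\<zeta>\<in>Zs. van 0 (x \<zeta>) (D \<zeta> X - (if \<zeta> = fst i then v (fst i) (snd i) else 0)))" if i: "i \<in> Nn" for i
  by (rule interp) (use i B in \<open>auto simp: Nn_def basis_mod_def\<close>)
 then obtain V where V: "\<And>i. i \<in> Nn ==> V i \<in> Ng \<beta> UNIV"
  "\<And>i \<zeta>. i \<in> Nn ==> \<zeta> \<in> Zs ==> van 0 (x \<zeta>) (D \<zeta> (V i) - (if \<zeta> = fst i then v (fst i) (snd i) else 0))" by metis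
 have fin: "finite Nn" unfolding Nn_def using finite_Zs finN by simp
 have Dsum: "van 0 (x \<zeta>) (D \<zeta> (\<Sum>i\<in>Nn. sgl 0 (e i) * V i) - (\<Sum>j\<in>N \<zeta>. sgl 0 (e (\<zeta>, j)) * v \<zeta> j))" if z: "\<zeta> \<in> Zs" for \<zeta> e
 proof -
  have h: "\<sigma> \<zeta> \<in> \<Sigma>" "nv (x \<zeta>) (\<sigma> \<zeta>)" using s[OF z] by auto
  have "(\<Sum>i\<in>Nn. sgl 0 (e i) * (if \<zeta> = fst i then v (fst i) (snd i) else 0)) = (\<Sum>i\<in>Pair \<zeta> ` N \<zeta>. sgl 0 (e i) * v (fst i) (snd i))"
   using z fin by (intro sum.mono_neutral_cong_right) (auto simp: Nn_def)
  also have "\<dots> = (\<Sum>j\<in>N \<zeta>. sgl 0 (e (\<zeta>, j)) * v \<zeta> j)" by (subst sum.reindex) (auto simp: inj_on_def)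
  finally have 1: "(\<Sum>i\<in>Nn. sgl 0 (e i) * (if \<zeta> = fst i then v (fst i) (snd i) else 0)) = (\<Sum>j\<in>N \<zeta>. sgl 0 (e (\<zeta>, j)) * v \<zeta> j)" .
  have 2: "D \<zeta> (\<Sum>i\<in>Nn. sgl 0 (e i) * V i) = (\<Sum>i\<in>Nn. sgl 0 (e i) * D \<zeta> (V i))"
   unfolding D_def sum_distrib_left by (intro sum.cong refl) (simp only: mult_ac)
  have "(\<Sum>i\<in>Nn. sgl 0 (e i) * (D \<zeta> (V i) - (if \<zeta> = fst i then v (fst i) (snd i) else 0))) \<in> {p. van 0 (x \<zeta>) p}"
   using V(2)[OF _ z] by (intro submod_sum[OF submod_van[OF h]] submod_mult[OF submod_van[OF h] subring_Ng(2)]) auto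
  thus ?thesis unfolding 2 1[symmetric] sum_subtractf[symmetric] by (simp only: mem_Collect_eq right_diff_distrib)
 qed
 have "basis_mod (Ng \<beta> UNIV) (Im \<beta> UNIV) Nn V" unfolding basis_mod_def
 proof (intro conjI ballI allI impI)
  show "finite Nn" by (rule fin)
  show "V i \<in> Ng \<beta> UNIV" if "i \<in> Nn" for i by (rule V(1)[OF that])
  show "\<exists>e. p - (\<Sum>i\<in>Nn. sgl 0 (e i) * V i) \<in> Im \<beta> UNIV" if p: "p \<in> Ng \<beta> UNIV" for p
  proof -
   have "\<exists>e. van 0 (x \<zeta>) (D \<zeta> p - (\<Sum>j\<in>N \<zeta>. sgl 0 (e j) * v \<zeta> j))" if z: "\<zeta> \<in> Zs" for \<zeta>
    using B[OF z] D[OF z Ng_mono[OF p subset_UNIV]] by (auto simp: basis_mod_def)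
   hence "\<forall>\<zeta>\<in>Zs. \<exists>e. van 0 (x \<zeta>) (D \<zeta> p - (\<Sum>j\<in>N \<zeta>. sgl 0 (e j) * v \<zeta> j))" by blast
   from bchoice[OF this] obtain e where
    e: "\<And>\<zeta>. \<zeta> \<in> Zs ==> van 0 (x \<zeta>) (D \<zeta> p - (\<Sum>j\<in>N \<zeta>. sgl 0 (e \<zeta> j) * v \<zeta> j))" by blast
   define f where "f i = e (fst i) (snd i)" for i
   define X where "X = p - (\<Sum>i\<in>Nn. sgl 0 (f i) * V i)"
   have vX: "van \<beta> (x \<zeta>) X" if z: "\<zeta> \<in> Zs" for \<zeta>
   proof -
    have h: "\<sigma> \<zeta> \<in> \<Sigma>" "nv (x \<zeta>) (\<sigma> \<zeta>)" using s[OF z] by auto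
    have eq: "D \<zeta> X = (D \<zeta> p - (\<Sum>j\<in>N \<zeta>. sgl 0 (e \<zeta> j) * v \<zeta> j)) -
      (D \<zeta> (\<Sum>i\<in>Nn. sgl 0 (f i) * V i) - (\<Sum>j\<in>N \<zeta>. sgl 0 (f (\<zeta>, j)) * v \<zeta> j))"
     by (simp add: D_def X_def f_def right_diff_distrib)
    have "D \<zeta> X \<in> {p. van 0 (x \<zeta>) p}"
     unfolding eq by (rule submod_diff[OF submod_van[OF h]]) (use e[OF z] Dsum[OF z, of f] in auto)
    thus ?thesis using Dvan[OF z] by simp
   qed
   have "X \<in> Im \<beta> UNIV"
   proof (rule beta_global)
    show "X \<in> Ng \<beta> UNIV" unfolding X_def by (intro spn_diff p spn_sum Ng_mult[OF subring_Ng(2) V(1)]) auto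
    fix \<eta> y assume h: "\<eta> \<in> \<Sigma>" "nv y \<eta>" "\<not> van 0 y 1"
    hence z: "cclass y \<in> Zs" unfolding Zs_def by blast
    show "van \<beta> y X" using van_cong[OF _ vX[OF z], of y] x[OF z] by simp
   qed
   thus ?thesis unfolding X_def by blast
  qed
  fix e i assume e: "(\<Sum>i\<in>Nn. sgl 0 (e i) * V i) \<in> Im \<beta> UNIV" and i: "i \<in> Nn"
  obtain \<zeta> j where ij: "i = (\<zeta>, j)" "\<zeta> \<in> Zs" "j \<in> N \<zeta>" using i by (auto simp: Nn_def)
  have h: "\<sigma> \<zeta> \<in> \<Sigma>" "nv (x \<zeta>) (\<sigma> \<zeta>)" using s[OF ij(2)] by auto
  have "(\<Sum>i\<in>Nn. sgl 0 (e i) * V i) \<in> Im \<beta> (\<sigma> \<zeta>)" using Im_mono[OF subset_UNIV] e by blast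
  hence 1: "van 0 (x \<zeta>) (D \<zeta> (\<Sum>i\<in>Nn. sgl 0 (e i) * V i))" using Dvan[OF ij(2)] van_Im[OF h] by blast
  have "D \<zeta> (\<Sum>i\<in>Nn. sgl 0 (e i) * V i) - (D \<zeta> (\<Sum>i\<in>Nn. sgl 0 (e i) * V i) - (\<Sum>j\<in>N \<zeta>. sgl 0 (e (\<zeta>, j)) * v \<zeta> j))
    \<in> {p. van 0 (x \<zeta>) p}" using submod_diff[OF submod_van[OF h]] 1 Dsum[OF ij(2), of e] by blast
  hence "(\<Sum>j\<in>N \<zeta>. sgl 0 (e (\<zeta>, j)) * v \<zeta> j) \<in> {p. van 0 (x \<zeta>) p}" by simp
  hence "\<forall>j\<in>N \<zeta>. e (\<zeta>, j) = 0"
   using B[OF ij(2), unfolded basis_mod_def, THEN conjunct2, THEN conjunct2, THEN conjunct2, THEN spec, of "\<lambda>j. e (\<zeta>, j)"] by blast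
  thus "e i = 0" using ij by simp
 qed
 thus ?thesis using that unfolding Nn_def by blast
qed

end

section \<open>Rings presented by a subring of a commutative ring\<close>

text \<open>A bridge between subsets of the Laurent ring and record rings: L is the image of A under
  \<phi>, which may have a kernel. It serves the chart ring, its quotient by the ideal and the local
  rings alike.\<close>

locale ring_presentation =
 fixes A :: "'r::comm_ring_1 set" and L :: "('l, 'm) ring_scheme" (structure) and \<phi> :: "'r => 'l"
 assumes A: "subring_set A" and onto: "carrier L = \<phi> ` A"
  and mult: "\<And>p q. p \<in> A ==> q \<in> A ==> \<phi> p \<otimes> \<phi> q = \<phi> (p * q)"
  and add: "\<And>p q. p \<in> A ==> q \<in> A ==> \<phi> p \<oplus> \<phi> q = \<phi> (p + q)"
  and one: "\<phi> 1 = \<one>" and zero: "\<phi> 0 = \<zero>"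
begin

lemma As: "submod A A" "1 \<in> A" using A by (auto simp: subring_set_def)

lemmas A_closed = submod_zero[OF As(1)] As(2) submod_add[OF As(1)] submod_mult[OF As(1)] submod_diff[OF As(1)] submod_minus[OF As(1)]

lemma cring: "cring L"
proof (rule cringI)
 show "abelian_group L"
 proof (rule abelian_groupI)
  fix x assume "x \<in> carrier L"
  then obtain p where p: "p \<in> A" "x = \<phi> p" by (auto simp: onto)
  thus "\<exists>y\<in>carrier L. y \<oplus> x = \<zero>" using add[of "- p" p] A_closed zero by (intro bexI[of _ "\<phi> (- p)"]) (auto simp: onto)
 qed (use A_closed in \<open>auto simp: onto add add_ac simp flip: zero\<close>)
 show "comm_monoid L" by (rule comm_monoidI) (use A_closed in \<open>auto simp: onto mult mult_ac simp flip: one\<close>)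
qed (use A_closed in \<open>auto simp: onto mult add algebra_simps\<close>)

sublocale cring L by (rule cring)

lemma \<phi>_carrier: "p \<in> A ==> \<phi> p \<in> carrier L" by (simp add: onto)

lemma \<phi>_eq_iff: "p \<in> A ==> q \<in> A ==> \<phi> p = \<phi> q \<longleftrightarrow> \<phi> (p - q) = \<zero>"
proof -
 assume pq: "p \<in> A" "q \<in> A"
 hence d: "p - q \<in> A" by (rule A_closed)
 have "\<phi> p = \<phi> (p - q) \<oplus> \<phi> q" using add[OF d pq(2)] by simp
 thus ?thesis using \<phi>_carrier[OF d] \<phi>_carrier[OF pq(2)] add.r_cancel_one by simp
qed

lemma image_ideal_in: "ideal_in A J ==> ideal (\<phi> ` J) L"
proof -
 assume J: "ideal_in A J"
 hence Js: "submod A J" "J \<subseteq> A" by (auto simp: ideal_in_def)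
 have neg: "\<ominus> \<phi> p = \<phi> (- p)" if "p \<in> A" for p
  by (rule minus_equality) (use add[of "- p" p] that A_closed(6)[OF that] zero \<phi>_carrier in simp_all)
 have m: "\<phi> q \<otimes> \<phi> p \<in> \<phi> ` J" "\<phi> p \<otimes> \<phi> q \<in> \<phi> ` J" if "p \<in> J" "q \<in> A" for p q
  using mult[of q p] mult[of p q] that submod_mult[OF Js(1) that(2,1)] Js(2) by (auto simp: mult.commute)
 show ?thesis
 proof (rule idealI)
  show "ring L" by (rule ring_axioms)
  show "subgroup (\<phi> ` J) (add_monoid L)"
  proof (rule add.subgroupI)
   show "\<phi> ` J \<subseteq> carrier L" using Js(2) by (auto simp: onto)
   show "\<phi> ` J \<noteq> {}" using submod_zero[OF Js(1)] by auto
   show "\<ominus> x \<in> \<phi> ` J" if "x \<in> \<phi> ` J" for x using that neg Js(2) submod_minus[OF Js(1)] by auto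
   show "x \<oplus> y \<in> \<phi> ` J" if "x \<in> \<phi> ` J" "y \<in> \<phi> ` J" for x y
    using that add Js(2) submod_add[OF Js(1)] by (auto simp: subset_iff)
  qed
 qed (use m in \<open>auto simp: onto\<close>)
qed

lemma image_mem_iff:
 assumes "submod A P" "P \<subseteq> A" "\<And>p. p \<in> A ==> \<phi> p = \<zero> ==> p \<in> P" "p \<in> A"
 shows "\<phi> p \<in> \<phi> ` P \<longleftrightarrow> p \<in> P"
proof
 assume "\<phi> p \<in> \<phi> ` P"
 then obtain q where q: "q \<in> P" "\<phi> p = \<phi> q" by blast
 hence "p - q \<in> P" using \<phi>_eq_iff[of p q] assms A_closed(5)[of p q] by blast
 thus "p \<in> P" using submod_add[OF assms(1) _ q(1), of "p - q"] by simp
qed simp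

lemma image_prime_in:
 assumes P: "prime_in A P" and k: "\<And>p. p \<in> A ==> \<phi> p = \<zero> ==> p \<in> P"
 shows "primeideal (\<phi> ` P) L"
proof -
 have Ps: "ideal_in A P" "submod A P" "P \<subseteq> A" "1 \<notin> P" using P by (auto simp: prime_in_def ideal_in_def)
 have iff: "\<phi> p \<in> \<phi> ` P \<longleftrightarrow> p \<in> P" if "p \<in> A" for p by (rule image_mem_iff[OF Ps(2,3) _ that]) (rule k)
 show ?thesis
 proof (rule primeidealI[OF image_ideal_in[OF Ps(1)] cring])
  show "carrier L \<noteq> \<phi> ` P" using iff[OF A_closed(2)] Ps(4) \<phi>_carrier[OF A_closed(2)] by blast
  fix x y assume "x \<in> carrier L" "y \<in> carrier L" "x \<otimes> y \<in> \<phi> ` P"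
  then obtain p q where pq: "x = \<phi> p" "y = \<phi> q" "p \<in> A" "q \<in> A" "\<phi> (p * q) \<in> \<phi> ` P" using mult by (auto simp: onto)
  hence "p * q \<in> P" using iff A_closed(4) by blast
  hence "p \<in> P \<or> q \<in> P" using P pq(3,4) by (auto simp: prime_in_def)
  thus "x \<in> \<phi> ` P \<or> y \<in> \<phi> ` P" using pq(1,2) by blast
 qed
qed

text \<open>Primes of A containing the kernel map to primes of L, and a strict inclusion stays
  strict, giving a chain of length 1.\<close>

lemma krull_dim_zero_prime:
 assumes "krull_dim L \<le> 0" "prime_in A P" "prime_in A P'" "P \<subseteq> P'" and k: "\<And>p. p \<in> A ==> \<phi> p = \<zero> ==> p \<in> P"
 shows "P = P'"
proof (rule ccontr)
 assume ne: "P \<noteq> P'"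
 have k': "\<And>p. p \<in> A ==> \<phi> p = \<zero> ==> p \<in> P'" using k assms(4) by blast
 have P: "submod A P" "P \<subseteq> A" and P': "P' \<subseteq> A" using assms(2,3) by (auto simp: prime_in_def ideal_in_def)
 have "\<phi> ` P \<subset> \<phi> ` P'"
 proof
  show "\<phi> ` P \<subseteq> \<phi> ` P'" using assms(4) by blast
  obtain p where p: "p \<in> P'" "p \<notin> P" using ne assms(4) by blast
  have "\<phi> p \<in> \<phi> ` P \<longleftrightarrow> p \<in> P" by (rule image_mem_iff[OF P]) (use k P' p in auto)
  thus "\<phi> ` P \<noteq> \<phi> ` P'" using p by blast
 qed
 moreover have "primeideal (\<phi> ` P) L" "primeideal (\<phi> ` P') L" using image_prime_in assms(2,3) k k' by blast+
 ultimately have "\<exists>C :: nat => 'l set. (\<forall>i\<le>1. primeideal (C i) L) \<and> (\<forall>i<1. C i \<subset> C (Suc i))"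
  by (intro exI[of _ "\<lambda>i. if i = 0 then \<phi> ` P else \<phi> ` P'"]) auto
 hence "ereal (real 1) \<le> krull_dim L" unfolding krull_dim_def by (intro Sup_upper) blast
 hence "ereal 1 \<le> 0" using assms(1) order_trans by fastforce
 thus False by simp
qed

lemma quotient:
 assumes J: "ideal_in A J" and k: "\<And>p. p \<in> A ==> \<phi> p = \<zero> ==> p \<in> J"
 shows "ring_presentation A (L Quot (\<phi> ` J)) (\<lambda>p. \<phi> ` J +> \<phi> p)" "\<And>p. p \<in> A ==> \<phi> ` J +> \<phi> p = \<zero>\<^bsub>L Quot (\<phi> ` J)\<^esub> \<longleftrightarrow> p \<in> J"
proof -
 interpret J: ideal "\<phi> ` J" L by (rule image_ideal_in[OF J])
 have Js: "submod A J" "J \<subseteq> A" using J by (auto simp: ideal_in_def)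
 note h = ring_hom_memE[OF J.rcos_ring_hom]
 have iff: "\<phi> p \<in> \<phi> ` J \<longleftrightarrow> p \<in> J" if "p \<in> A" for p by (rule image_mem_iff[OF Js _ that]) (rule k)
 show z: "\<phi> ` J +> \<phi> p = \<zero>\<^bsub>L Quot (\<phi> ` J)\<^esub> \<longleftrightarrow> p \<in> J" if p: "p \<in> A" for p
  using J.a_rcos_const[of "\<phi> p"] J.rcos_const_imp_mem[OF \<phi>_carrier[OF p]] iff[OF p] by (auto simp: FactRing_def)
 show "ring_presentation A (L Quot (\<phi> ` J)) (\<lambda>p. \<phi> ` J +> \<phi> p)"
 proof
  show "carrier (L Quot (\<phi> ` J)) = (\<lambda>p. \<phi> ` J +> \<phi> p) ` A" by (auto simp: FactRing_def A_RCOSETS_def' onto)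
  show "\<phi> ` J +> \<phi> 0 = \<zero>\<^bsub>L Quot (\<phi> ` J)\<^esub>" using z A_closed(1) submod_zero[OF Js(1)] by blast
  show "(\<phi> ` J +> \<phi> p) \<otimes>\<^bsub>L Quot (\<phi> ` J)\<^esub> (\<phi> ` J +> \<phi> q) = \<phi> ` J +> \<phi> (p * q)"
   "(\<phi> ` J +> \<phi> p) \<oplus>\<^bsub>L Quot (\<phi> ` J)\<^esub> (\<phi> ` J +> \<phi> q) = \<phi> ` J +> \<phi> (p + q)" if "p \<in> A" "q \<in> A" for p q
   using h(2,3)[OF \<phi>_carrier[OF that(1)] \<phi>_carrier[OF that(2)]] mult[OF that] add[OF that] by simp_all
  show "\<phi> ` J +> \<phi> 1 = \<one>\<^bsub>L Quot (\<phi> ` J)\<^esub>" using h(4) one by simp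
 qed (rule A)
qed

end

lemma krull_dim_prime: "krull_dim L \<noteq> -\<infinity> ==> \<exists>P. primeideal P L"
proof (rule ccontr)
 assume a: "krull_dim L \<noteq> -\<infinity>" "\<nexists>P. primeideal P L"
 hence "{ereal (real l) | l. \<exists>P :: nat => 'a set. (\<forall>i\<le>l. primeideal (P i) L) \<and> (\<forall>i<l. P i \<subset> P (Suc i))} = {}" by auto
 hence "krull_dim L = Sup {}" unfolding krull_dim_def by (rule arg_cong)
 thus False using a(1) by (simp add: bot_ereal_def)
qed

section \<open>Dimensions over the image of the complex numbers\<close>

lemma (in cring) subfield_range:
 fixes sc :: "complex => 'a"
 assumes sc: "\<And>c. sc c \<in> carrier R" "sc 1 = \<one>" "\<And>c d. sc (c + d) = sc c \<oplus> sc d" "\<And>c d. sc (c * d) = sc c \<otimes> sc d"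
  and ne: "\<one> \<noteq> \<zero>"
 shows "subfield (range sc) R"
proof -
 have sc0: "sc 0 = \<zero>" using sc(3)[of 0 0] sc(1)[of 0] by (metis add.l_cancel_one' add_0)
 have neg: "\<ominus> sc c = sc (- c)" for c using sc(3)[of "- c" c] sc0 sc(1) by (intro minus_equality) auto
 have sub: "subcring (range sc) R"
 proof (rule subcringI', rule subringI)
  show "\<one> \<in> range sc" using sc(2) by (metis rangeI)
 qed (use sc neg in \<open>auto simp flip: sc(3,4)\<close>)
 have nz: "sc c \<noteq> \<zero>" if "c \<noteq> 0" for c
 proof
  assume "sc c = \<zero>"
  hence "sc (1 / c * c) = \<zero>" using sc(4)[of "1 / c" c] sc(1) by simp
  thus False using that sc(2) ne by simp
 qed
 show ?thesis
 proof (rule subfieldI[OF sub])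
  show "Units (R\<lparr>carrier := range sc\<rparr>) = range sc - {\<zero>}"
  proof (intro subset_antisym subsetI)
   fix x assume x: "x \<in> Units (R\<lparr>carrier := range sc\<rparr>)"
   then obtain y where "y \<in> range sc" "x \<otimes> y = \<one>" "x \<in> range sc" by (auto simp: Units_def)
   thus "x \<in> range sc - {\<zero>}" using ne sc(1) by auto
  next
   fix x assume "x \<in> range sc - {\<zero>}"
   then obtain c where c: "x = sc c" "c \<noteq> 0" using sc0 by auto
   have "sc c \<otimes> sc (1 / c) = \<one>" "sc (1 / c) \<otimes> sc c = \<one>" using c(2) sc(2) by (simp_all flip: sc(4))
   thus "x \<in> Units (R\<lparr>carrier := range sc\<rparr>)" unfolding Units_def c(1) by auto
  qed
 qed
qed

text \<open>Spans of lists grow by one line at a time, so the basis is fed in vector by vector with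
  its coefficients made explicit. A new vector inside the span of the previous ones would give a
  relation with coefficient 1 at that vector.\<close>

lemma (in ring) dim_basis_mod:
 fixes \<phi> :: "('g::comm_monoid_add \<Rightarrow>\<^sub>0 complex) => 'a" and sc :: "complex => 'a"
 assumes K: "subfield (range sc) R" and sc0: "sc 1 = \<one>"
  and V: "0 \<in> V" "\<And>p q. p \<in> V ==> q \<in> V ==> p + q \<in> V" "\<And>c p. p \<in> V ==> sgl 0 c * p \<in> V"
  and \<phi>: "\<And>p. p \<in> V ==> \<phi> p \<in> carrier R" "\<And>p q. p \<in> V ==> q \<in> V ==> \<phi> (p + q) = \<phi> p \<oplus> \<phi> q"
   "\<And>c p. p \<in> V ==> \<phi> (sgl 0 c * p) = sc c \<otimes> \<phi> p" "\<And>p. p \<in> V ==> \<phi> p = \<zero> \<longleftrightarrow> p \<in> Ker"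
  and B: "basis_mod V Ker N v"
 shows "dim (range sc) (\<phi> ` V) = card N"
proof -
 have N: "finite N" "\<And>i. i \<in> N ==> v i \<in> V" "\<And>p. p \<in> V ==> \<exists>c. p - (\<Sum>i\<in>N. sgl 0 (c i) * v i) \<in> Ker"
  using B by (auto simp: basis_mod_def)
 have indep: "c i = 0" if "(\<Sum>i\<in>N. sgl 0 (c i) * v i) \<in> Ker" "i \<in> N" for c i
  using B that unfolding basis_mod_def by blast
 have sumV: "(\<Sum>i\<in>M. sgl 0 (c i) * v i) \<in> V" if "M \<subseteq> N" for c M
  using that V N(2) by (induction M rule: infinite_finite_induct) auto
 have diffV: "p - q \<in> V" if "p \<in> V" "q \<in> V" for p q
  using V(2)[OF that(1) V(3)[OF that(2), of "- 1"]] by (simp add: single_uminus)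
 have eq_iff: "\<phi> p = \<phi> q \<longleftrightarrow> p - q \<in> Ker" if pq: "p \<in> V" "q \<in> V" for p q
 proof -
  have "\<phi> p = \<phi> (p - q) \<oplus> \<phi> q" using \<phi>(2)[OF diffV[OF pq] pq(2)] by simp
  hence "\<phi> p = \<phi> q \<longleftrightarrow> \<phi> (p - q) = \<zero>" using \<phi>(1)[OF diffV[OF pq]] \<phi>(1)[OF pq(2)] add.r_cancel_one by simp
  thus ?thesis using \<phi>(4)[OF diffV[OF pq]] by simp
 qed
 have zero: "\<phi> 0 = \<zero>" using \<phi>(2)[OF V(1,1)] \<phi>(1)[OF V(1)] by (metis add.l_cancel_one' add_0)
 have main: "Span (range sc) (map (\<lambda>i. \<phi> (v i)) us) = {\<phi> (\<Sum>i\<in>set us. sgl 0 (c i) * v i) | c. True} \<and>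
   independent (range sc) (map (\<lambda>i. \<phi> (v i)) us)" if "distinct us" "set us \<subseteq> N" for us using that
 proof (induction us)
  case Nil
  thus ?case using zero by simp
 next
  case (Cons i us)
  let ?f = "\<lambda>i. \<phi> (v i)"
  have i: "i \<in> N" "i \<notin> set us" "set us \<subseteq> N" and sub: "insert i (set us) \<subseteq> N" using Cons.prems by auto
  have IH: "Span (range sc) (map ?f us) = {\<phi> (\<Sum>j\<in>set us. sgl 0 (c j) * v j) | c. True}"
   "independent (range sc) (map ?f us)" using Cons by auto
  have sum: "\<phi> (\<Sum>j\<in>insert i (set us). sgl 0 (c j) * v j) = sc (c i) \<otimes> ?f i \<oplus> \<phi> (\<Sum>j\<in>set us. sgl 0 (c j) * v j)" for c
   using i \<phi>(2)[OF V(3)[OF N(2)[OF i(1)]] sumV[OF i(3)]] \<phi>(3)[OF N(2)[OF i(1)]] by simp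
  have "Span (range sc) (map ?f (i # us)) = line_extension (range sc) (?f i) (Span (range sc) (map ?f us))" by simp
  also have "\<dots> = {\<phi> (\<Sum>j\<in>insert i (set us). sgl 0 (c j) * v j) | c. True}"
  proof (intro subset_antisym subsetI)
   fix x assume "x \<in> line_extension (range sc) (?f i) (Span (range sc) (map ?f us))"
   then obtain d c where x: "x = sc d \<otimes> ?f i \<oplus> \<phi> (\<Sum>j\<in>set us. sgl 0 (c j) * v j)"
    unfolding line_extension_mem_iff IH(1) by auto
   have "(\<Sum>j\<in>set us. sgl 0 ((c(i := d)) j) * v j) = (\<Sum>j\<in>set us. sgl 0 (c j) * v j)" using i(2) by (intro sum.cong) auto
   hence "x = \<phi> (\<Sum>j\<in>insert i (set us). sgl 0 ((c(i := d)) j) * v j)" using x sum[of "c(i := d)"] by simp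
   thus "x \<in> {\<phi> (\<Sum>j\<in>insert i (set us). sgl 0 (c j) * v j) | c. True}" by blast
  next
   fix x assume "x \<in> {\<phi> (\<Sum>j\<in>insert i (set us). sgl 0 (c j) * v j) | c. True}"
   then obtain c where "x = sc (c i) \<otimes> ?f i \<oplus> \<phi> (\<Sum>j\<in>set us. sgl 0 (c j) * v j)" using sum by blast
   thus "x \<in> line_extension (range sc) (?f i) (Span (range sc) (map ?f us))"
    unfolding line_extension_mem_iff IH(1) by blast
  qed
  finally have 1: "Span (range sc) (map ?f (i # us)) = {\<phi> (\<Sum>j\<in>set (i # us). sgl 0 (c j) * v j) | c. True}" by simp
  have "?f i \<notin> Span (range sc) (map ?f us)"
  proof
   assume "?f i \<in> Span (range sc) (map ?f us)"
   then obtain c where c: "?f i = \<phi> (\<Sum>j\<in>set us. sgl 0 (c j) * v j)" unfolding IH(1) by blast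
   hence k: "v i - (\<Sum>j\<in>set us. sgl 0 (c j) * v j) \<in> Ker" using eq_iff[OF N(2)[OF i(1)] sumV[OF i(3)]] by blast
   define d where "d j = (if j = i then 1 else if j \<in> set us then - c j else 0)" for j
   have "(\<Sum>j\<in>N. sgl 0 (d j) * v j) = (\<Sum>j\<in>insert i (set us). sgl 0 (d j) * v j)"
    by (rule sum.mono_neutral_right[OF N(1) sub]) (auto simp: d_def)
   also have "\<dots> = v i + (\<Sum>j\<in>set us. sgl 0 (d j) * v j)" using i(2) by (simp add: d_def)
   also have "(\<Sum>j\<in>set us. sgl 0 (d j) * v j) = - (\<Sum>j\<in>set us. sgl 0 (c j) * v j)"
    unfolding sum_negf[symmetric] using i(2) by (intro sum.cong refl) (auto simp: d_def single_uminus)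
   finally have "(\<Sum>j\<in>N. sgl 0 (d j) * v j) \<in> Ker" using k by simp
   hence "d i = 0" by (rule indep[OF _ i(1)])
   thus False by (simp add: d_def)
  qed
  hence "independent (range sc) (?f i # map ?f us)" by (rule li_Cons[OF \<phi>(1)[OF N(2)[OF i(1)]] _ IH(2)])
  thus ?case using 1 by simp
 qed
 obtain us where us: "set us = N" "distinct us" using finite_distinct_list[OF N(1)] by blast
 have "\<phi> ` V = {\<phi> (\<Sum>i\<in>N. sgl 0 (c i) * v i) | c. True}"
 proof (intro subset_antisym subsetI)
  fix x assume "x \<in> \<phi> ` V"
  then obtain p c where "x = \<phi> p" "p \<in> V" "p - (\<Sum>i\<in>N. sgl 0 (c i) * v i) \<in> Ker" using N(3) by blast
  thus "x \<in> {\<phi> (\<Sum>i\<in>N. sgl 0 (c i) * v i) | c. True}" using eq_iff[OF _ sumV[OF order_refl]] by blast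
 qed (use sumV[OF order_refl] in blast)
 hence "Span (range sc) (map (\<lambda>i. \<phi> (v i)) us) = \<phi> ` V" using main[OF us(2)] us(1) by simp
 hence "dimension (card N) (range sc) (\<phi> ` V)"
  using dimension_independent[of "range sc" "map (\<lambda>i. \<phi> (v i)) us"] main[OF us(2)] us distinct_card[OF us(2)] by simp
 thus ?thesis using dimI[OF K] by (simp add: over_def)
qed

section \<open>Localization\<close>

text \<open>The operations of \<open>localization\<close> are unions over representatives. Once the
  value is known not to depend on them, the union collapses; nonemptiness of both index sets is
  essential.\<close>

lemma Union_const2:
 assumes "x \<in> X" "y \<in> Y" "\<And>p q. p \<in> X ==> q \<in> Y ==> g p q = c"
 shows "(\<Union>p\<in>X. \<Union>q\<in>Y. g p q) = c"
proof -
 have "(\<Union>p\<in>X. \<Union>q\<in>Y. g p q) = (\<Union>p\<in>X. \<Union>q\<in>Y. c)" using assms(3) by (intro SUP_cong refl)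
 thus ?thesis using assms(1,2) by auto
qed

locale localizing = cring R for R (structure) +
 fixes S
 assumes S: "S \<subseteq> carrier R" "\<one> \<in> S" "\<And>s t. s \<in> S ==> t \<in> S ==> s \<otimes> t \<in> S"
begin

abbreviation "fr \<equiv> fraction R S"

lemma fr_mem: "(b, t) \<in> fr a s \<longleftrightarrow> b \<in> carrier R \<and> t \<in> S \<and> (\<exists>u\<in>S. u \<otimes> (a \<otimes> t) = u \<otimes> (b \<otimes> s))" by (simp add: fraction_def)

lemma fr_self: "a \<in> carrier R ==> s \<in> S ==> (a, s) \<in> fr a s" using S by (auto simp: fr_mem)

lemma fr_trans:
 assumes "a \<in> carrier R" "b \<in> carrier R" "s \<in> S" "t \<in> S" "(b, t) \<in> fr a s" "(c, r) \<in> fr b t"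
 shows "(c, r) \<in> fr a s"
proof -
 obtain u v where u: "u \<in> S" "u \<otimes> (a \<otimes> t) = u \<otimes> (b \<otimes> s)" and v: "v \<in> S" "v \<otimes> (b \<otimes> r) = v \<otimes> (c \<otimes> t)"
  and c: "c \<in> carrier R" "r \<in> S" using assms(5,6) by (auto simp: fr_mem)
 have cl: "a \<in> carrier R" "b \<in> carrier R" "c \<in> carrier R" "s \<in> carrier R" "t \<in> carrier R" "r \<in> carrier R"
  "u \<in> carrier R" "v \<in> carrier R" using assms u(1) v(1) c S(1) by auto
 have "(t \<otimes> (u \<otimes> v)) \<otimes> (a \<otimes> r) = (v \<otimes> r) \<otimes> (u \<otimes> (a \<otimes> t))" using cl by (simp add: m_ac)
 also have "\<dots> = (u \<otimes> s) \<otimes> (v \<otimes> (b \<otimes> r))" unfolding u(2) using cl by (simp add: m_ac)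
 also have "\<dots> = (t \<otimes> (u \<otimes> v)) \<otimes> (c \<otimes> s)" unfolding v(2) using cl by (simp add: m_ac)
 finally show ?thesis using S(3)[OF assms(4) S(3)[OF u(1) v(1)]] c by (auto simp: fr_mem)
qed

lemma fr_sym: "(b, t) \<in> fr a s ==> a \<in> carrier R ==> s \<in> S ==> (a, s) \<in> fr b t" by (auto simp: fr_mem) metis

lemma fr_eq_iff:
 assumes "a \<in> carrier R" "b \<in> carrier R" "s \<in> S" "t \<in> S"
 shows "fr a s = fr b t \<longleftrightarrow> (\<exists>u\<in>S. u \<otimes> (a \<otimes> t) = u \<otimes> (b \<otimes> s))"
proof
 assume "fr a s = fr b t"
 hence "(b, t) \<in> fr a s" using fr_self[OF assms(2,4)] by simp
 thus "\<exists>u\<in>S. u \<otimes> (a \<otimes> t) = u \<otimes> (b \<otimes> s)" by (simp add: fr_mem)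
next
 assume "\<exists>u\<in>S. u \<otimes> (a \<otimes> t) = u \<otimes> (b \<otimes> s)"
 hence 1: "(b, t) \<in> fr a s" using assms by (simp add: fr_mem)
 note 2 = fr_sym[OF 1 assms(1,3)]
 have "(c, r) \<in> fr a s \<longleftrightarrow> (c, r) \<in> fr b t" for c r
  using fr_trans[OF assms(1,2,3,4) 1] fr_trans[OF assms(2,1,4,3) 2] by blast
 thus "fr a s = fr b t" by auto
qed

lemma fr_mult:
 assumes "a \<in> carrier R" "b \<in> carrier R" "s \<in> S" "t \<in> S"
 shows "fr a s \<otimes>\<^bsub>localization R S\<^esub> fr b t = fr (a \<otimes> b) (s \<otimes> t)"
proof -
 have "fr (c \<otimes> d) (r \<otimes> q) = fr (a \<otimes> b) (s \<otimes> t)" if cd: "(c, r) \<in> fr a s" "(d, q) \<in> fr b t" for c r d q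
 proof -
  obtain u v where u: "u \<in> S" "u \<otimes> (a \<otimes> r) = u \<otimes> (c \<otimes> s)" and v: "v \<in> S" "v \<otimes> (b \<otimes> q) = v \<otimes> (d \<otimes> t)"
   and c: "c \<in> carrier R" "r \<in> S" "d \<in> carrier R" "q \<in> S" using cd by (auto simp: fr_mem)
  have cl: "a \<in> carrier R" "b \<in> carrier R" "c \<in> carrier R" "d \<in> carrier R" "s \<in> carrier R" "t \<in> carrier R" "r \<in> carrier R"
   "q \<in> carrier R" "u \<in> carrier R" "v \<in> carrier R" using assms u(1) v(1) c S(1) by auto
  have "(u \<otimes> v) \<otimes> ((c \<otimes> d) \<otimes> (s \<otimes> t)) = (u \<otimes> (c \<otimes> s)) \<otimes> (v \<otimes> (d \<otimes> t))" using cl by (simp add: m_ac)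
  also have "\<dots> = (u \<otimes> v) \<otimes> ((a \<otimes> b) \<otimes> (r \<otimes> q))" unfolding u(2)[symmetric] v(2)[symmetric] using cl by (simp add: m_ac)
  finally show ?thesis using S(3)[OF u(1) v(1)] fr_eq_iff[of "c \<otimes> d" "a \<otimes> b" "r \<otimes> q" "s \<otimes> t"] cl S(3) assms c by auto
 qed
 hence "(\<Union>p\<in>fr a s. \<Union>q\<in>fr b t. fr (fst p \<otimes> fst q) (snd p \<otimes> snd q)) = fr (a \<otimes> b) (s \<otimes> t)"
  by (intro Union_const2[OF fr_self[OF assms(1,3)] fr_self[OF assms(2,4)]]) auto
 thus ?thesis by (simp add: localization_def)
qed

lemma fr_add:
 assumes "a \<in> carrier R" "b \<in> carrier R" "s \<in> S" "t \<in> S"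
 shows "fr a s \<oplus>\<^bsub>localization R S\<^esub> fr b t = fr ((a \<otimes> t) \<oplus> (b \<otimes> s)) (s \<otimes> t)"
proof -
 have "fr ((c \<otimes> q) \<oplus> (d \<otimes> r)) (r \<otimes> q) = fr ((a \<otimes> t) \<oplus> (b \<otimes> s)) (s \<otimes> t)"
  if cd: "(c, r) \<in> fr a s" "(d, q) \<in> fr b t" for c r d q
 proof -
  obtain u v where u: "u \<in> S" "u \<otimes> (a \<otimes> r) = u \<otimes> (c \<otimes> s)" and v: "v \<in> S" "v \<otimes> (b \<otimes> q) = v \<otimes> (d \<otimes> t)"
   and c: "c \<in> carrier R" "r \<in> S" "d \<in> carrier R" "q \<in> S" using cd by (auto simp: fr_mem)
  have cl: "a \<in> carrier R" "b \<in> carrier R" "c \<in> carrier R" "d \<in> carrier R" "s \<in> carrier R" "t \<in> carrier R" "r \<in> carrier R"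
   "q \<in> carrier R" "u \<in> carrier R" "v \<in> carrier R" using assms u(1) v(1) c S(1) by auto
  have "(u \<otimes> v) \<otimes> (((c \<otimes> q) \<oplus> (d \<otimes> r)) \<otimes> (s \<otimes> t)) =
    (v \<otimes> q \<otimes> t) \<otimes> (u \<otimes> (c \<otimes> s)) \<oplus> (u \<otimes> r \<otimes> s) \<otimes> (v \<otimes> (d \<otimes> t))" using cl by (simp add: m_ac r_distr l_distr)
  also have "\<dots> = (u \<otimes> v) \<otimes> (((a \<otimes> t) \<oplus> (b \<otimes> s)) \<otimes> (r \<otimes> q))"
   unfolding u(2)[symmetric] v(2)[symmetric] using cl by (simp add: m_ac r_distr l_distr)
  finally show ?thesis
   using S(3)[OF u(1) v(1)] fr_eq_iff[of "(c \<otimes> q) \<oplus> (d \<otimes> r)" "(a \<otimes> t) \<oplus> (b \<otimes> s)" "r \<otimes> q" "s \<otimes> t"] cl S(3) assms c by auto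
 qed
 hence "(\<Union>p\<in>fr a s. \<Union>q\<in>fr b t. fr ((fst p \<otimes> snd q) \<oplus> (fst q \<otimes> snd p)) (snd p \<otimes> snd q)) = fr ((a \<otimes> t) \<oplus> (b \<otimes> s)) (s \<otimes> t)"
  by (intro Union_const2[OF fr_self[OF assms(1,3)] fr_self[OF assms(2,4)]]) auto
 thus ?thesis by (simp add: localization_def)
qed

lemma localization_simps: "\<one>\<^bsub>localization R S\<^esub> = fr \<one> \<one>" "\<zero>\<^bsub>localization R S\<^esub> = fr \<zero> \<one>"
 "carrier (localization R S) = {fr a s | a s. a \<in> carrier R \<and> s \<in> S}" by (simp_all add: localization_def)

end

section \<open>Coordinate rings of charts\<close>

context toric_fan
begin

lemma localizing_cone: "localizing cox_ring (cone_powers \<rho> \<sigma>)"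
proof (intro localizing.intro localizing_axioms.intro cring_cox)
 show "\<one>\<^bsub>cox_ring\<^esub> \<in> cone_powers \<rho> \<sigma>" unfolding cone_powers_def by (intro range_eqI[of _ _ 0]) simp
 show "s \<otimes>\<^bsub>cox_ring\<^esub> t \<in> cone_powers \<rho> \<sigma>" if st: "s \<in> cone_powers \<rho> \<sigma>" "t \<in> cone_powers \<rho> \<sigma>" for s t
 proof -
  obtain l l' where "s = cone_monomial \<rho> \<sigma> ^ l" "t = cone_monomial \<rho> \<sigma> ^ l'" using st by (auto simp: cone_powers_def)
  thus ?thesis unfolding cone_powers_def by (intro range_eqI[of _ _ "l + l'"]) (simp add: power_add)
 qed
qed simp

abbreviation "hl \<sigma> l \<equiv> int l *s hat \<sigma>"
abbreviation "cm \<sigma> l \<equiv> cone_monomial \<rho> \<sigma> ^ l"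
abbreviation "CR \<sigma> \<equiv> chart_ring \<rho> \<sigma>"
abbreviation "cfr \<sigma> \<equiv> fraction cox_ring (cone_powers \<rho> \<sigma>)"

lemma cm_mem [simp]: "cm \<sigma> l \<in> cone_powers \<rho> \<sigma>" by (simp add: cone_powers_def)

lemma hl_add: "hl \<sigma> (l + l') = hl \<sigma> l + hl \<sigma> l'" by (simp add: vector_sadd_rdistrib)

lemma homog_cm: "p \<in> Ng b UNIV ==> homog b p * cm \<sigma> l = homog (b + hl \<sigma> l) p"
 using homog_mult[OF _ one_Rg_hat[of l \<sigma>], of p b] by (simp add: cone_monomial_power)

lemma Ng_hl_mono: "p \<in> Ng b UNIV ==> p \<in> Ng (b + hl \<sigma> l) UNIV"
 using Ng_mult[OF _ one_Rg_hat[of l \<sigma>], of p b "b + hl \<sigma> l"] by simp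

text \<open>A function on the chart as a fraction over a power of the cone monomial. The exponent is
  an arbitrary admissible one, and \<open>psi_eq\<close> shows that every admissible exponent gives
  the same fraction.\<close>

definition psi :: "(real ^ 'n) set => 'n laurent => ('k cox \<times> 'k cox) set" where
 "psi \<sigma> p = (let l = (SOME l. p \<in> Ng (hl \<sigma> l) UNIV) in cfr \<sigma> (homog (hl \<sigma> l) p) (cm \<sigma> l))"

lemma psi_eq:
 assumes "p \<in> Ng (hl \<sigma> l) UNIV"
 shows "psi \<sigma> p = cfr \<sigma> (homog (hl \<sigma> l) p) (cm \<sigma> l)"
proof -
 interpret localizing cox_ring "cone_powers \<rho> \<sigma>" by (rule localizing_cone)
 define l' where "l' = (SOME l. p \<in> Ng (hl \<sigma> l) UNIV)"
 have l': "p \<in> Ng (hl \<sigma> l') UNIV" unfolding l'_def by (rule someI[of _ l]) (rule assms)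
 have "homog (hl \<sigma> l') p * cm \<sigma> l = homog (hl \<sigma> l) p * cm \<sigma> l'"
  unfolding homog_cm[OF assms] homog_cm[OF l'] by (simp add: add.commute)
 hence "cfr \<sigma> (homog (hl \<sigma> l') p) (cm \<sigma> l') = cfr \<sigma> (homog (hl \<sigma> l) p) (cm \<sigma> l)"
  by (subst fr_eq_iff) (auto intro!: bexI[of _ 1] S(2)[simplified])
 thus ?thesis by (simp add: psi_def l'_def Let_def)
qed

lemma Ng_globalize0:
 assumes "p \<in> Ng 0 \<sigma>"
 obtains L where "\<And>l. l \<ge> L ==> p \<in> Ng (hl \<sigma> l) UNIV" using Ng_globalize[OF assms] by (metis add_0)

lemma Ng_hl: "p \<in> Ng (hl \<sigma> l) UNIV ==> p \<in> Ng 0 \<sigma>" using Ng_hat[of 0 l \<sigma>] by auto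

lemma psi_fraction_eq:
 assumes p: "p \<in> Ng (hl \<sigma> l) UNIV" and e: "psi \<sigma> p = cfr \<sigma> f (cm \<sigma> l')"
 obtains j where "homog (hl \<sigma> (l + l' + j)) p = cm \<sigma> j * (f * cm \<sigma> l)"
proof -
 interpret localizing cox_ring "cone_powers \<rho> \<sigma>" by (rule localizing_cone)
 obtain w where "w \<in> cone_powers \<rho> \<sigma>" "w * (homog (hl \<sigma> l) p * cm \<sigma> l') = w * (f * cm \<sigma> l)"
  using e unfolding psi_eq[OF p] by (subst (asm) fr_eq_iff) auto
 then obtain j where "cm \<sigma> j * (homog (hl \<sigma> l) p * cm \<sigma> l') = cm \<sigma> j * (f * cm \<sigma> l)" by (auto simp: cone_powers_def)
 moreover have "homog (hl \<sigma> (l + l' + j)) p = (homog (hl \<sigma> l) p * cm \<sigma> l') * cm \<sigma> j"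
  unfolding homog_cm[OF p] homog_cm[OF Ng_hl_mono[OF p]] by (simp add: hl_add del: of_nat_add)
 ultimately show ?thesis using that by (metis mult.commute)
qed

lemma psi_inj:
 assumes "p \<in> Ng 0 \<sigma>" "q \<in> Ng 0 \<sigma>" "psi \<sigma> p = psi \<sigma> q"
 shows "p = q"
proof -
 obtain L L' where L: "\<And>l. l \<ge> L ==> p \<in> Ng (hl \<sigma> l) UNIV" "\<And>l. l \<ge> L' ==> q \<in> Ng (hl \<sigma> l) UNIV"
  using Ng_globalize0[OF assms(1)] Ng_globalize0[OF assms(2)] by metis
 define l where "l = max L L'"
 have l: "p \<in> Ng (hl \<sigma> l) UNIV" "q \<in> Ng (hl \<sigma> l) UNIV" using L by (auto simp: l_def)
 have "psi \<sigma> p = cfr \<sigma> (homog (hl \<sigma> l) q) (cm \<sigma> l)" using assms(3) psi_eq[OF l(2)] by simp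
 then obtain j where j: "homog (hl \<sigma> (l + l + j)) p = cm \<sigma> j * (homog (hl \<sigma> l) q * cm \<sigma> l)"
  using psi_fraction_eq[OF l(1)] by metis
 also have "\<dots> = homog (hl \<sigma> (l + l + j)) q"
  using homog_cm[OF l(2), of \<sigma> l] homog_cm[OF Ng_hl_mono[OF l(2), of l \<sigma>], of \<sigma> j] by (simp add: hl_add mult.commute del: of_nat_add)
 finally show ?thesis
  using homog_inj Ng_hl_mono[OF Ng_hl_mono[OF l(1), of l \<sigma>], of j \<sigma>] Ng_hl_mono[OF Ng_hl_mono[OF l(2), of l \<sigma>], of j \<sigma>]
  by (simp add: hl_add del: of_nat_add)
qed

lemma graded_piece_unique: "f \<in> graded_piece \<rho> \<alpha> ==> f \<in> graded_piece \<rho> \<alpha>' ==> f \<noteq> 0 ==> \<alpha> = \<alpha>'"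
 unfolding graded_piece_def using keys_eq_empty by fastforce

lemma cm_graded: "cm \<sigma> l \<in> graded_piece \<rho> (cl (hl \<sigma> l))" "cm \<sigma> l \<noteq> 0"
 using homog_graded[OF one_Rg_hat, of l \<sigma>] homog_eq_0[OF one_Rg_hat, of l \<sigma>] by (simp_all add: cone_monomial_power)

lemma homog_0_const: "homog 0 (sgl 0 c) = scalar c" "homog 0 1 = 1"
proof -
 have e: "expo (0 :: int ^ 'k) = 0" by (rule poly_mapping_eqI) simp
 show "homog 0 (sgl 0 c) = scalar c" for c by (simp add: homog_def scalar_def e)
 from this[of 1] show "homog 0 1 = 1" by (simp add: scalar_def)
qed

lemma psi_const: "psi \<sigma> (sgl 0 c) = cfr \<sigma> (scalar c) 1"
 using psi_eq[of "sgl 0 c" 0 \<sigma>] homog_0_const(1) by (simp add: Rg_def)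

text \<open>In a fraction of degree zero the numerator has the degree of the denominator, a power of
  the cone monomial. So it dehomogenizes with respect to the corresponding multiple of
  \<open>hat \<sigma>\<close>, and the denominator disappears.\<close>

lemma chart_ring_presentation: "ring_presentation (Ng 0 \<sigma>) (CR \<sigma>) (psi \<sigma>)"
proof
 interpret localizing cox_ring "cone_powers \<rho> \<sigma>" by (rule localizing_cone)
 show "subring_set (Ng 0 \<sigma>)" by (rule subring_Ng)
 have ops: "\<And>x y. x \<otimes>\<^bsub>CR \<sigma>\<^esub> y = x \<otimes>\<^bsub>localization cox_ring (cone_powers \<rho> \<sigma>)\<^esub> y"
  "\<And>x y. x \<oplus>\<^bsub>CR \<sigma>\<^esub> y = x \<oplus>\<^bsub>localization cox_ring (cone_powers \<rho> \<sigma>)\<^esub> y" by (simp_all add: chart_ring_def)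
 show "psi \<sigma> 1 = \<one>\<^bsub>CR \<sigma>\<^esub>" using psi_eq[of 1 0 \<sigma>] subring_Ng(1)
  by (simp add: chart_ring_def localization_simps homog_0_const subring_set_def)
 show "psi \<sigma> 0 = \<zero>\<^bsub>CR \<sigma>\<^esub>" using psi_eq[of 0 0 \<sigma>] by (simp add: chart_ring_def localization_simps)
 show "carrier (CR \<sigma>) = psi \<sigma> ` Ng 0 \<sigma>"
 proof (intro subset_antisym subsetI)
  fix x assume "x \<in> carrier (CR \<sigma>)"
  then obtain f l \<alpha> where x: "x = cfr \<sigma> f (cm \<sigma> l)" "f \<in> graded_piece \<rho> \<alpha>" "cm \<sigma> l \<in> graded_piece \<rho> \<alpha>"
   by (auto simp: chart_ring_def cone_powers_def)
  have "\<alpha> = cl (hl \<sigma> l)" using graded_piece_unique[OF x(3) cm_graded] .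
  then obtain p where p: "p \<in> Ng (hl \<sigma> l) UNIV" "f = homog (hl \<sigma> l) p" using dehomog[of f "hl \<sigma> l"] x(2) by metis
  thus "x \<in> psi \<sigma> ` Ng 0 \<sigma>" using psi_eq[OF p(1)] Ng_hl[OF p(1)] x(1) by blast
 next
  fix x assume "x \<in> psi \<sigma> ` Ng 0 \<sigma>"
  then obtain p where p: "x = psi \<sigma> p" "p \<in> Ng 0 \<sigma>" by blast
  then obtain l where l: "p \<in> Ng (hl \<sigma> l) UNIV" using Ng_globalize0 by (metis order_refl)
  show "x \<in> carrier (CR \<sigma>)"
   using p(1) psi_eq[OF l] homog_graded[OF l] cm_graded(1)[of \<sigma> l] cm_mem unfolding chart_ring_def by fastforce
 qed
 fix p q assume "p \<in> Ng 0 \<sigma>" "q \<in> Ng 0 \<sigma>"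
 then obtain l l' where l: "p \<in> Ng (hl \<sigma> l) UNIV" "q \<in> Ng (hl \<sigma> l') UNIV" using Ng_globalize0 by (metis order_refl)
 have pq: "p * q \<in> Ng (hl \<sigma> (l + l')) UNIV" by (rule Ng_mult[OF l]) (simp only: hl_add)
 show "psi \<sigma> p \<otimes>\<^bsub>CR \<sigma>\<^esub> psi \<sigma> q = psi \<sigma> (p * q)"
  using homog_mult[OF l] unfolding ops psi_eq[OF l(1)] psi_eq[OF l(2)] psi_eq[OF pq]
  by (subst fr_mult) (simp_all add: hl_add power_add del: of_nat_add)
 have "p \<in> Ng (hl \<sigma> (l + l')) UNIV" "q \<in> Ng (hl \<sigma> (l + l')) UNIV"
  using Ng_hl_mono[OF l(1), of l' \<sigma>] Ng_hl_mono[OF l(2), of l \<sigma>] by (simp_all add: hl_add add.commute del: of_nat_add)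
 hence "p + q \<in> Ng (hl \<sigma> (l + l')) UNIV" by (rule spn_add)
 note s = psi_eq[OF this]
 show "psi \<sigma> p \<oplus>\<^bsub>CR \<sigma>\<^esub> psi \<sigma> q = psi \<sigma> (p + q)"
  using homog_cm[OF l(1), of \<sigma> l'] homog_cm[OF l(2), of \<sigma> l] unfolding ops psi_eq[OF l(1)] psi_eq[OF l(2)] s
  by (subst fr_add) (simp_all add: hl_add homog_add power_add add.commute mult.commute del: of_nat_add)
qed

text \<open>\<open>point_ideal\<close> asks for some representative fraction and some point of the
  fibre. Vanishing depends on neither: cone monomials have no zeros on the fibre over the chart, and
  functions on the chart are constant along fibres.\<close>

lemma point_ideal_psi:
 assumes s: "\<sigma> \<in> \<Sigma>" "nv x \<sigma>"
 shows "point_ideal \<Sigma> \<rho> \<sigma> (cclass x) = psi \<sigma> ` {p \<in> Ng 0 \<sigma>. ev (mono x 0) p = 0}"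
proof -
 interpret localizing cox_ring "cone_powers \<rho> \<sigma>" by (rule localizing_cone)
 interpret pr: ring_presentation "Ng 0 \<sigma>" "CR \<sigma>" "psi \<sigma>" by (rule chart_ring_presentation)
 have key: "(\<exists>x'\<in>cox_fibre \<Sigma> \<rho> (cclass x). \<exists>(f, h)\<in>psi \<sigma> p. cox_eval x' f = 0) \<longleftrightarrow> ev (mono x 0) p = 0"
  if p: "p \<in> Ng 0 \<sigma>" for p
 proof -
  obtain l where l: "p \<in> Ng (hl \<sigma> l) UNIV" using Ng_globalize0[OF p] by (metis order_refl)
  have *: "cox_eval y f = 0 \<longleftrightarrow> ev (mono x 0) p = 0" if y: "y \<in> cox_fibre \<Sigma> \<rho> (cclass x)" and fh: "(f, h) \<in> psi \<sigma> p" for y f h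
  proof -
   have c: "cclass x = cclass y" using y cox_fibre_iff by blast
   note n = cclass_eq[OF c s]
   have nz: "cox_eval y (cm \<sigma> j) \<noteq> 0" for j using cone_monomial_nv n(1) by (induction j) (auto simp: cox_eval_mult)
   obtain j j' where e: "cm \<sigma> j * (homog (hl \<sigma> l) p * cm \<sigma> j') = cm \<sigma> j * (f * cm \<sigma> l)"
    using fh unfolding psi_eq[OF l] fr_mem by (auto simp: cone_powers_def)
   have "cox_eval y (homog (hl \<sigma> l) p) = ev (mono y (hl \<sigma> l)) (p * 1)" using cox_eval_homog[OF l] by simp
   also have "\<dots> = ev (mono y 0) p * ev (mono y (hl \<sigma> l)) 1"
    by (rule ev_mono_mult[OF n(1) p]) (use Ng_mono[OF one_Rg_hat subset_UNIV] in auto)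
   also have "ev (mono y (hl \<sigma> l)) 1 = cox_eval y (cm \<sigma> l)" using cox_eval_homog[OF one_Rg_hat] by (simp add: cone_monomial_power)
   finally have "cox_eval y (homog (hl \<sigma> l) p) = 0 \<longleftrightarrow> ev (mono y 0) p = 0" using nz[of l] by simp
   moreover have "cox_eval y (homog (hl \<sigma> l) p) = 0 \<longleftrightarrow> cox_eval y f = 0"
    using arg_cong[OF e, of "cox_eval y"] nz by (auto simp: cox_eval_mult)
   ultimately show ?thesis using ev_cpt[OF s(1) n(2) p] by simp
  qed
  have "x \<in> cox_fibre \<Sigma> \<rho> (cclass x)" using cox_fibre_iff s by blast
  moreover have "(homog (hl \<sigma> l) p, cm \<sigma> l) \<in> psi \<sigma> p" unfolding psi_eq[OF l] by (rule fr_self) auto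
  ultimately show ?thesis using * by blast
 qed
 have "point_ideal \<Sigma> \<rho> \<sigma> (cclass x) = {g \<in> psi \<sigma> ` Ng 0 \<sigma>. \<exists>x'\<in>cox_fibre \<Sigma> \<rho> (cclass x). \<exists>(f, h)\<in>g. cox_eval x' f = 0}"
  by (simp only: point_ideal_def pr.onto)
 also have "\<dots> = psi \<sigma> ` {p \<in> Ng 0 \<sigma>. \<exists>x'\<in>cox_fibre \<Sigma> \<rho> (cclass x). \<exists>(f, h)\<in>psi \<sigma> p. cox_eval x' f = 0}" by blast
 also have "{p \<in> Ng 0 \<sigma>. \<exists>x'\<in>cox_fibre \<Sigma> \<rho> (cclass x). \<exists>(f, h)\<in>psi \<sigma> p. cox_eval x' f = 0} = {p \<in> Ng 0 \<sigma>. ev (mono x 0) p = 0}"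
  using key by (intro Collect_cong conj_cong refl)
 finally show ?thesis .
qed

section \<open>Points of charts and the closed subscheme\<close>

lemma toric_variety_cclass: "\<zeta> \<in> toric_variety \<Sigma> ==> \<exists>x \<sigma>. \<sigma> \<in> \<Sigma> \<and> nv x \<sigma> \<and> \<zeta> = cclass x"
proof -
 assume "\<zeta> \<in> toric_variety \<Sigma>"
 then obtain \<sigma> \<gamma> where z: "\<sigma> \<in> \<Sigma>" "\<gamma> \<in> affine_points \<sigma>" "\<zeta> = gluing \<Sigma> `` {(\<sigma>, \<gamma>)}"
  by (auto simp: toric_variety_def quotient_def)
 obtain x where "nv x \<sigma>" "\<gamma> = cpt x \<sigma>" by (rule affine_point_lift[OF z(1,2)])
 thus ?thesis using gluing_cpt z by metis
qed

lemma chart_points_iff: "\<sigma> \<in> \<Sigma> ==> \<zeta> \<in> chart_points \<Sigma> \<sigma> \<longleftrightarrow> (\<exists>x. nv x \<sigma> \<and> \<zeta> = cclass x)"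
proof
 assume "\<zeta> \<in> chart_points \<Sigma> \<sigma>"
 then obtain \<gamma> where "\<zeta> \<in> toric_variety \<Sigma>" "(\<sigma>, \<gamma>) \<in> \<zeta>" by (auto simp: chart_points_def)
 moreover from this obtain x where "\<zeta> = cclass x" using toric_variety_cclass by blast
 ultimately show "\<exists>x. nv x \<sigma> \<and> \<zeta> = cclass x" by (auto simp: cclass_def)
next
 assume s: "\<sigma> \<in> \<Sigma>" and "\<exists>x. nv x \<sigma> \<and> \<zeta> = cclass x"
 then obtain x where x: "nv x \<sigma>" "\<zeta> = cclass x" by blast
 hence "(\<sigma>, cpt x \<sigma>) \<in> \<zeta>" using s by (auto simp: cclass_def)
 thus "\<zeta> \<in> chart_points \<Sigma> \<sigma>" using cclass_toric[OF s x(1)] x(2) by (auto simp: chart_points_def)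
qed

end

context toric_system
begin

abbreviation "CQ \<sigma> \<equiv> chart_quotient \<rho> I \<sigma>"
abbreviation "LR \<sigma> x \<equiv> local_ring \<Sigma> \<rho> I \<sigma> (cclass x)"

text \<open>A function equal to a fraction with numerator in \<open>I\<close> has, after
  multiplication by cone monomials, a homogenization in \<open>I\<close>, where membership is
  decided degree by degree by \<open>homog_I_iff\<close>.\<close>

lemma chart_ideal_psi: "chart_ideal \<rho> I \<sigma> = psi \<sigma> ` Im 0 \<sigma>"
proof -
 interpret localizing cox_ring "cone_powers \<rho> \<sigma>" by (rule localizing_cone)
 interpret pr: ring_presentation "Ng 0 \<sigma>" "CR \<sigma>" "psi \<sigma>" by (rule chart_ring_presentation)
 show ?thesis
 proof (intro subset_antisym subsetI)
  fix y assume "y \<in> chart_ideal \<rho> I \<sigma>"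
  then obtain f l' p where y: "y = cfr \<sigma> f (cm \<sigma> l')" "f \<in> I" "y = psi \<sigma> p" "p \<in> Ng 0 \<sigma>"
   unfolding chart_ideal_def pr.onto by (auto simp: cone_powers_def)
  obtain l where l: "p \<in> Ng (hl \<sigma> l) UNIV" using Ng_globalize0[OF y(4)] by (metis order_refl)
  obtain j where "homog (hl \<sigma> (l + l' + j)) p = cm \<sigma> j * (f * cm \<sigma> l)" using psi_fraction_eq[OF l] y(1,3) by metis
  moreover have "cm \<sigma> j * (f * cm \<sigma> l) \<in> I"
   using submod_mult[OF submod_I UNIV_I y(2), of "cm \<sigma> j * cm \<sigma> l"] by (simp add: mult_ac)
  ultimately have "p \<in> Im (0 + hl \<sigma> (l + l' + j)) UNIV"
   using homog_I_iff[OF Ng_hl_mono[OF Ng_hl_mono[OF l, of l' \<sigma>], of j \<sigma>]] by (simp add: hl_add del: of_nat_add)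
  thus "y \<in> psi \<sigma> ` Im 0 \<sigma>" using Im_local_iff y(3) by blast
 next
  fix y assume "y \<in> psi \<sigma> ` Im 0 \<sigma>"
  then obtain p where p: "y = psi \<sigma> p" "p \<in> Im 0 \<sigma>" by blast
  obtain l where l: "p \<in> Im (hl \<sigma> l) UNIV" using p(2) Im_local_iff[of p 0] by auto
  have pN: "p \<in> Ng (hl \<sigma> l) UNIV" using l Im_sub by blast
  have "homog (hl \<sigma> l) p \<in> I" using homog_I_iff[OF pN] l by blast
  moreover have "y \<in> carrier (CR \<sigma>)" unfolding pr.onto p(1) using p(2) Im_sub by blast
  ultimately show "y \<in> chart_ideal \<rho> I \<sigma>" unfolding chart_ideal_def p(1) psi_eq[OF pN] using cm_mem by blast
 qed
qed

definition phi :: "(real ^ 'n) set => 'n laurent => ('k cox \<times> 'k cox) set set" where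
 "phi \<sigma> p = chart_ideal \<rho> I \<sigma> +>\<^bsub>CR \<sigma>\<^esub> psi \<sigma> p"

lemma chart_quotient_presentation: "ring_presentation (Ng 0 \<sigma>) (CQ \<sigma>) (phi \<sigma>)"
 "p \<in> Ng 0 \<sigma> ==> phi \<sigma> p = \<zero>\<^bsub>CQ \<sigma>\<^esub> \<longleftrightarrow> p \<in> Im 0 \<sigma>"
proof -
 interpret pr: ring_presentation "Ng 0 \<sigma>" "CR \<sigma>" "psi \<sigma>" by (rule chart_ring_presentation)
 have k: "p \<in> Im 0 \<sigma>" if "p \<in> Ng 0 \<sigma>" "psi \<sigma> p = \<zero>\<^bsub>CR \<sigma>\<^esub>" for p
  using psi_inj[of p \<sigma> 0] that pr.zero submod_zero[OF submod_Im] by simp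
 have e: "phi \<sigma> = (\<lambda>p. psi \<sigma> ` Im 0 \<sigma> +>\<^bsub>CR \<sigma>\<^esub> psi \<sigma> p)" by (simp add: fun_eq_iff phi_def chart_ideal_psi)
 show "ring_presentation (Ng 0 \<sigma>) (CQ \<sigma>) (phi \<sigma>)"
  unfolding e chart_quotient_def chart_ideal_psi by (rule pr.quotient(1)[OF ideal_Im]) (rule k)
 show "p \<in> Ng 0 \<sigma> ==> phi \<sigma> p = \<zero>\<^bsub>CQ \<sigma>\<^esub> \<longleftrightarrow> p \<in> Im 0 \<sigma>"
  unfolding e chart_quotient_def chart_ideal_psi by (rule pr.quotient(2)[OF ideal_Im]) (rule k)
qed

lemma reduced_variety_Zs: "reduced_variety \<Sigma> \<rho> I = Zs"
proof -
 have iff: "chart_ideal \<rho> I \<sigma> \<subseteq> point_ideal \<Sigma> \<rho> \<sigma> (cclass x) \<longleftrightarrow> \<not> van 0 x 1" if s: "\<sigma> \<in> \<Sigma>" "nv x \<sigma>" for \<sigma> x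
 proof -
  have "p \<in> Ng 0 \<sigma> ==> psi \<sigma> p \<in> psi \<sigma> ` {p \<in> Ng 0 \<sigma>. ev (mono x 0) p = 0} \<longleftrightarrow> ev (mono x 0) p = 0" for p
   using psi_inj by blast
  thus ?thesis unfolding chart_ideal_psi point_ideal_psi[OF s] van_one_iff[OF s] using Im_sub[of 0 \<sigma>] by blast
 qed
 show ?thesis
 proof (intro subset_antisym subsetI)
  fix \<zeta> assume "\<zeta> \<in> reduced_variety \<Sigma> \<rho> I"
  then obtain \<sigma> where s: "\<sigma> \<in> \<Sigma>" "\<zeta> \<in> chart_points \<Sigma> \<sigma>" "chart_ideal \<rho> I \<sigma> \<subseteq> point_ideal \<Sigma> \<rho> \<sigma> \<zeta>"
   by (auto simp: reduced_variety_def)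
  obtain x where x: "nv x \<sigma>" "\<zeta> = cclass x" using s(2) chart_points_iff[OF s(1)] by blast
  thus "\<zeta> \<in> Zs" using iff[OF s(1) x(1)] s(1,3) unfolding Zs_def by blast
 next
  fix \<zeta> assume "\<zeta> \<in> Zs"
  then obtain \<sigma> x where x: "\<zeta> = cclass x" "\<sigma> \<in> \<Sigma>" "nv x \<sigma>" "\<not> van 0 x 1" by (auto simp: Zs_def)
  thus "\<zeta> \<in> reduced_variety \<Sigma> \<rho> I"
   using iff[OF x(2,3)] chart_points_iff[OF x(2)] cclass_toric[OF x(2,3)] unfolding reduced_variety_def by blast
 qed
qed

text \<open>The upper bound gives algebraicity on each chart. The second claim uses dimension 0
  against -\<infinity>: if 1 were in \<open>I\<close>, no chart quotient would have a prime ideal.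
  It makes S / I a nonzero ring, in which the constants form a field.\<close>

lemma scheme_dim_zero:
 assumes "scheme_dim \<Sigma> \<rho> I = 0"
 shows "\<sigma> \<in> \<Sigma> ==> y \<in> Ng 0 \<sigma> ==> \<exists>q. q \<noteq> 0 \<and> peval y q \<in> Im 0 \<sigma>" "1 \<notin> I"
proof -
 assume s: "\<sigma> \<in> \<Sigma>" and y: "y \<in> Ng 0 \<sigma>"
 interpret pr: ring_presentation "Ng 0 \<sigma>" "CQ \<sigma>" "phi \<sigma>" by (rule chart_quotient_presentation)
 have d: "krull_dim (CQ \<sigma>) \<le> 0" using assms SUP_upper[OF s, of "\<lambda>\<sigma>. krull_dim (CQ \<sigma>)"] by (simp add: scheme_dim_def)
 show "\<exists>q. q \<noteq> 0 \<and> peval y q \<in> Im 0 \<sigma>"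
 proof (rule algebraic_zero_dim[OF subring_Ng ideal_Im y])
  fix P P' assume "prime_in (Ng 0 \<sigma>) P" "prime_in (Ng 0 \<sigma>) P'" "Im 0 \<sigma> \<subseteq> P" "P \<subseteq> P'"
  thus "P = P'" using pr.krull_dim_zero_prime[OF d] chart_quotient_presentation(2) by blast
 qed
next
 show "1 \<notin> I"
 proof
  assume "1 \<in> I"
  hence "1 \<in> Im 0 UNIV" using homog_I_iff[of 1 0] subring_Ng(1) homog_0_const(2) by (simp add: subring_set_def)
  have "krull_dim (CQ \<sigma>) = -\<infinity>" if s: "\<sigma> \<in> \<Sigma>" for \<sigma>
  proof (rule ccontr)
   interpret pr: ring_presentation "Ng 0 \<sigma>" "CQ \<sigma>" "phi \<sigma>" by (rule chart_quotient_presentation)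
   assume "krull_dim (CQ \<sigma>) \<noteq> -\<infinity>"
   then obtain P where "primeideal P (CQ \<sigma>)" using krull_dim_prime by blast
   then interpret P: primeideal P "CQ \<sigma>" .
   have "1 \<in> Im 0 \<sigma>" using \<open>1 \<in> Im 0 UNIV\<close> Im_mono[OF subset_UNIV] by blast
   hence "phi \<sigma> 1 = \<zero>\<^bsub>CQ \<sigma>\<^esub>" using chart_quotient_presentation(2)[OF pr.A_closed(2)] by simp
   hence "\<one>\<^bsub>CQ \<sigma>\<^esub> \<in> P" using pr.one P.zero_closed P.additive_subgroup_axioms additive_subgroup.zero_closed by metis
   thus False using P.one_imp_carrier P.I_notcarr by blast
  qed
  hence "scheme_dim \<Sigma> \<rho> I \<le> -\<infinity>" unfolding scheme_dim_def by (intro SUP_least) simp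
  thus False using assms by simp
 qed
qed

end

section \<open>Multiplicities, Hilbert function and saturation\<close>

context zero_dim_system
begin

lemma nonvanishing_at_phi:
 assumes s: "\<sigma> \<in> \<Sigma>" "nv x \<sigma>" "\<not> van 0 x 1"
 shows "nonvanishing_at \<Sigma> \<rho> I \<sigma> (cclass x) = phi \<sigma> ` {p \<in> Ng 0 \<sigma>. ev (mono x 0) p \<noteq> 0}"
proof -
 interpret pr: ring_presentation "Ng 0 \<sigma>" "CQ \<sigma>" "phi \<sigma>" by (rule chart_quotient_presentation)
 define m where "m = {p \<in> Ng 0 \<sigma>. ev (mono x 0) p = 0}"
 have m: "submod (Ng 0 \<sigma>) m" "m \<subseteq> Ng 0 \<sigma>"
  using pr.A_closed ev_mono_mult[OF s(2), of _ 0 _ 0 0] by (auto simp: submod_def m_def ev_diff)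
 have iff: "phi \<sigma> p \<in> phi \<sigma> ` m \<longleftrightarrow> p \<in> m" if p: "p \<in> Ng 0 \<sigma>" for p
 proof (rule pr.image_mem_iff[OF m _ p])
  fix q assume "q \<in> Ng 0 \<sigma>" "phi \<sigma> q = \<zero>\<^bsub>CQ \<sigma>\<^esub>"
  thus "q \<in> m" using chart_quotient_presentation(2) s(3) unfolding van_one_iff[OF s(1,2)] by (auto simp: m_def)
 qed
 have e: "(\<lambda>g. chart_ideal \<rho> I \<sigma> +>\<^bsub>chart_ring \<rho> \<sigma>\<^esub> g) ` point_ideal \<Sigma> \<rho> \<sigma> (cclass x) = phi \<sigma> ` m"
  unfolding point_ideal_psi[OF s(1,2)] phi_def[abs_def] image_image m_def ..
 show ?thesis unfolding nonvanishing_at_def e pr.onto using iff unfolding m_def by blast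
qed

text \<open>By \<open>van_inverse\<close> every denominator has an inverse in the chart ring modulo
  functions vanishing in the stalk. So the chart ring maps onto the local ring, and the kernel
  consists of the functions that vanish in the stalk.\<close>

lemma local_ring_presentation:
 assumes s: "\<sigma> \<in> \<Sigma>" "nv x \<sigma>" "\<not> van 0 x 1"
 defines "lam \<equiv> \<lambda>p. fraction (CQ \<sigma>) (nonvanishing_at \<Sigma> \<rho> I \<sigma> (cclass x)) (phi \<sigma> p) \<one>\<^bsub>CQ \<sigma>\<^esub>"
 shows "ring_presentation (Ng 0 \<sigma>) (LR \<sigma> x) lam" "\<And>p. p \<in> Ng 0 \<sigma> ==> lam p = \<zero>\<^bsub>LR \<sigma> x\<^esub> \<longleftrightarrow> van 0 x p"
proof -
 define Q where "Q = CQ \<sigma>"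
 define S where "S = phi \<sigma> ` {p \<in> Ng 0 \<sigma>. ev (mono x 0) p \<noteq> 0}"
 have Sn: "nonvanishing_at \<Sigma> \<rho> I \<sigma> (cclass x) = S" unfolding S_def by (rule nonvanishing_at_phi[OF s(1-3)])
 interpret pr: ring_presentation "Ng 0 \<sigma>" Q "phi \<sigma>" unfolding Q_def by (rule chart_quotient_presentation)
 have ker: "phi \<sigma> p = \<zero>\<^bsub>Q\<^esub> \<longleftrightarrow> p \<in> Im 0 \<sigma>" if "p \<in> Ng 0 \<sigma>" for p
  unfolding Q_def by (rule chart_quotient_presentation(2)[OF that])
 interpret localizing Q S
 proof
  show "S \<subseteq> carrier Q" unfolding S_def pr.onto by blast
  show "\<one>\<^bsub>Q\<^esub> \<in> S" unfolding S_def using pr.one pr.A_closed(2) by (intro image_eqI[of _ _ 1]) auto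
  fix y z assume "y \<in> S" "z \<in> S"
  then obtain p q where pq: "y = phi \<sigma> p" "z = phi \<sigma> q" "p \<in> Ng 0 \<sigma>" "q \<in> Ng 0 \<sigma>" "ev (mono x 0) p \<noteq> 0" "ev (mono x 0) q \<noteq> 0"
   by (auto simp: S_def)
  have "ev (mono x 0) (p * q) \<noteq> 0" using ev_mono_mult[OF s(2) pq(3,4), of 0] pq(5,6) by simp
  thus "y \<otimes>\<^bsub>Q\<^esub> z \<in> S" unfolding S_def pq(1,2) using pr.mult[OF pq(3,4)] pr.A_closed(4)[OF pq(3,4)] by blast
 qed
 have lam_fr: "lam = (\<lambda>p. fr (phi \<sigma> p) \<one>\<^bsub>Q\<^esub>)" unfolding lam_def Sn Q_def ..
 have L: "LR \<sigma> x = localization Q S" unfolding local_ring_def Sn Q_def ..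
 have S1: "\<one>\<^bsub>Q\<^esub> \<in> S" by (rule S(2))
 have eqI: "fr (phi \<sigma> p) (phi \<sigma> t) = fr (phi \<sigma> q) \<one>\<^bsub>Q\<^esub>"
  if a: "p \<in> Ng 0 \<sigma>" "q \<in> Ng 0 \<sigma>" "t \<in> Ng 0 \<sigma>" "ev (mono x 0) t \<noteq> 0" "van 0 x (p - q * t)" for p q t
 proof -
  obtain r where r: "r \<in> Ng 0 \<sigma>" "ev (mono x 0) r \<noteq> 0" "r * (p - q * t) \<in> Im 0 \<sigma>" using vanE[OF a(5) s(1,2)] .
  have c: "q * t \<in> Ng 0 \<sigma>" "r * p \<in> Ng 0 \<sigma>" "r * (q * t) \<in> Ng 0 \<sigma>" using a(1-3) r(1) pr.A_closed(4) by blast+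
  have "phi \<sigma> (r * p) = phi \<sigma> (r * (q * t))"
   using pr.\<phi>_eq_iff[OF c(2,3)] ker[OF pr.A_closed(5)[OF c(2,3)]] r(3) by (simp add: right_diff_distrib)
  hence "phi \<sigma> r \<otimes>\<^bsub>Q\<^esub> (phi \<sigma> p \<otimes>\<^bsub>Q\<^esub> \<one>\<^bsub>Q\<^esub>) = phi \<sigma> r \<otimes>\<^bsub>Q\<^esub> (phi \<sigma> q \<otimes>\<^bsub>Q\<^esub> phi \<sigma> t)"
   using pr.mult[OF r(1) a(1)] pr.mult[OF r(1) c(1)] pr.mult[OF a(2,3)] pr.\<phi>_carrier[OF a(1)] by simp
  moreover have "phi \<sigma> r \<in> S" "phi \<sigma> t \<in> S" unfolding S_def using r a by blast+
  ultimately show ?thesis using pr.\<phi>_carrier a(1,2) S1 by (subst fr_eq_iff) auto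
 qed
 show "ring_presentation (Ng 0 \<sigma>) (LR \<sigma> x) lam" unfolding L lam_fr
 proof
  show "subring_set (Ng 0 \<sigma>)" by (rule subring_Ng)
  show "carrier (localization Q S) = (\<lambda>p. fr (phi \<sigma> p) \<one>\<^bsub>Q\<^esub>) ` Ng 0 \<sigma>"
  proof (intro subset_antisym subsetI)
   fix y assume "y \<in> carrier (localization Q S)"
   then obtain y0 s0 where y0: "y = fr y0 s0" "y0 \<in> carrier Q" "s0 \<in> S" unfolding localization_simps by blast
   obtain p where "p \<in> Ng 0 \<sigma>" "y0 = phi \<sigma> p" using y0(2) unfolding pr.onto by blast
   moreover obtain t where "t \<in> Ng 0 \<sigma>" "ev (mono x 0) t \<noteq> 0" "s0 = phi \<sigma> t" using y0(3) S_def by auto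
   ultimately obtain p t where y: "y = fr (phi \<sigma> p) (phi \<sigma> t)" "p \<in> Ng 0 \<sigma>" "t \<in> Ng 0 \<sigma>" "ev (mono x 0) t \<noteq> 0"
    using y0(1) by blast
   obtain c where c: "c \<in> Ng 0 \<sigma>" "van 0 x (c * t - 1)" using van_inverse[OF s(1,2) y(3,4)] .
   have "van 0 x (- p * (c * t - 1))" by (rule van_mult[OF c(2) s(1,2)]) (use pr.A_closed(6)[OF y(2)] in auto)
   moreover have "- p * (c * t - 1) = p - (p * c) * t" by (simp add: algebra_simps)
   ultimately have "y = fr (phi \<sigma> (p * c)) \<one>\<^bsub>Q\<^esub>" unfolding y(1) by (intro eqI y(2-4) pr.A_closed(4) c(1)) simp
   thus "y \<in> (\<lambda>p. fr (phi \<sigma> p) \<one>\<^bsub>Q\<^esub>) ` Ng 0 \<sigma>" using pr.A_closed(4)[OF y(2) c(1)] by blast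
  next
   fix y assume "y \<in> (\<lambda>p. fr (phi \<sigma> p) \<one>\<^bsub>Q\<^esub>) ` Ng 0 \<sigma>"
   thus "y \<in> carrier (localization Q S)" unfolding localization_simps using pr.\<phi>_carrier S1 by blast
  qed
  show "fr (phi \<sigma> p) \<one>\<^bsub>Q\<^esub> \<otimes>\<^bsub>localization Q S\<^esub> fr (phi \<sigma> q) \<one>\<^bsub>Q\<^esub> = fr (phi \<sigma> (p * q)) \<one>\<^bsub>Q\<^esub>"
   "fr (phi \<sigma> p) \<one>\<^bsub>Q\<^esub> \<oplus>\<^bsub>localization Q S\<^esub> fr (phi \<sigma> q) \<one>\<^bsub>Q\<^esub> = fr (phi \<sigma> (p + q)) \<one>\<^bsub>Q\<^esub>"
   if "p \<in> Ng 0 \<sigma>" "q \<in> Ng 0 \<sigma>" for p q using fr_mult[OF pr.\<phi>_carrier[OF that(1)] pr.\<phi>_carrier[OF that(2)] S1 S1]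
    fr_add[OF pr.\<phi>_carrier[OF that(1)] pr.\<phi>_carrier[OF that(2)] S1 S1] pr.mult[OF that] pr.add[OF that] pr.\<phi>_carrier that
   by simp_all
 qed (simp_all add: localization_simps pr.one pr.zero)
 show "lam p = \<zero>\<^bsub>LR \<sigma> x\<^esub> \<longleftrightarrow> van 0 x p" if p: "p \<in> Ng 0 \<sigma>" for p
 proof -
  have "lam p = \<zero>\<^bsub>LR \<sigma> x\<^esub> \<longleftrightarrow> (\<exists>w\<in>S. w \<otimes>\<^bsub>Q\<^esub> phi \<sigma> p = \<zero>\<^bsub>Q\<^esub>)"
  proof -
   have "w \<otimes>\<^bsub>Q\<^esub> \<zero>\<^bsub>Q\<^esub> = \<zero>\<^bsub>Q\<^esub>" if "w \<in> S" for w using S(1) that by (intro pr.r_null) blast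
   thus ?thesis unfolding L lam_fr localization_simps using pr.\<phi>_carrier[OF p] S1 by (subst fr_eq_iff) auto
  qed
  also have "\<dots> \<longleftrightarrow> (\<exists>r\<in>Ng 0 \<sigma>. ev (mono x 0) r \<noteq> 0 \<and> r * p \<in> Im 0 \<sigma>)"
   unfolding S_def using pr.mult[OF _ p] ker[OF pr.A_closed(4)[OF _ p]] by auto
  also have "\<dots> \<longleftrightarrow> van 0 x p" using vanI[OF s(1,2)] vanE[OF _ s(1,2), of 0 p] by metis
  finally show ?thesis .
 qed
qed

lemma local_dim:
 assumes s: "\<sigma> \<in> \<Sigma>" "nv x \<sigma>" "\<not> van 0 x 1" and B: "basis_mod (Ng 0 \<sigma>) {p. van 0 x p} N v"
 shows "ring.dim (LR \<sigma> x) (local_scalars \<Sigma> \<rho> I \<sigma> (cclass x)) (carrier (LR \<sigma> x)) = card N"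
proof -
 define l where "l = (\<lambda>p. fraction (CQ \<sigma>) (nonvanishing_at \<Sigma> \<rho> I \<sigma> (cclass x)) (phi \<sigma> p) \<one>\<^bsub>CQ \<sigma>\<^esub>)"
 interpret pr: ring_presentation "Ng 0 \<sigma>" "LR \<sigma> x" l unfolding l_def by (rule local_ring_presentation(1)[OF s])
 have lz: "l p = \<zero>\<^bsub>LR \<sigma> x\<^esub> \<longleftrightarrow> van 0 x p" if "p \<in> Ng 0 \<sigma>" for p
  unfolding l_def by (rule local_ring_presentation(2)[OF s that])
 define sc where "sc c = l (sgl 0 c)" for c
 have scal: "local_scalars \<Sigma> \<rho> I \<sigma> (cclass x) = range sc"
  by (simp add: local_scalars_def sc_def[abs_def] l_def phi_def psi_const)
 have sub: "subfield (range sc) (LR \<sigma> x)"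
 proof (rule pr.subfield_range)
  show "sc c \<in> carrier (LR \<sigma> x)" for c unfolding sc_def by (rule pr.\<phi>_carrier[OF subring_Ng(2)])
  show "sc 1 = \<one>\<^bsub>LR \<sigma> x\<^esub>" by (simp add: sc_def pr.one)
  show "sc (c + d) = sc c \<oplus>\<^bsub>LR \<sigma> x\<^esub> sc d" "sc (c * d) = sc c \<otimes>\<^bsub>LR \<sigma> x\<^esub> sc d" for c d
   using pr.add[OF subring_Ng(2) subring_Ng(2)] pr.mult[OF subring_Ng(2) subring_Ng(2)] by (simp_all add: sc_def single_add mult_single)
  show "\<one>\<^bsub>LR \<sigma> x\<^esub> \<noteq> \<zero>\<^bsub>LR \<sigma> x\<^esub>" using lz[OF pr.A_closed(2)] s(3) pr.one by simp
 qed
 have "pr.dim (range sc) (l ` Ng 0 \<sigma>) = card N"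
 proof (rule pr.dim_basis_mod[OF sub _ _ _ _ _ _ _ _ B])
  show "sc 1 = \<one>\<^bsub>LR \<sigma> x\<^esub>" by (simp add: sc_def pr.one)
  show "l (sgl 0 c * p) = sc c \<otimes>\<^bsub>LR \<sigma> x\<^esub> l p" if "p \<in> Ng 0 \<sigma>" for c p
   using pr.mult[OF subring_Ng(2) that] by (simp add: sc_def)
  show "l p = \<zero>\<^bsub>LR \<sigma> x\<^esub> \<longleftrightarrow> p \<in> {p. van 0 x p}" if "p \<in> Ng 0 \<sigma>" for p using lz[OF that] by simp
 qed (use pr.A_closed pr.\<phi>_carrier pr.add subring_Ng(2) in auto)
 thus ?thesis unfolding scal pr.onto .
qed

text \<open>The chart is the one selected by the choice operator in \<open>multiplicity_at\<close>,
  in general different from the chart where the point was found; \<open>van_cong\<close> transfers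
  the statement to a representative over it.\<close>

lemma multiplicity_at_basis:
 assumes "\<zeta> \<in> Zs"
 shows "\<exists>\<sigma> x N. \<sigma> \<in> \<Sigma> \<and> nv x \<sigma> \<and> cclass x = \<zeta> \<and> basis_mod (Ng 0 \<sigma>) {p. van 0 x p} N (\<lambda>p. p) \<and>
  multiplicity_at \<Sigma> \<rho> I \<zeta> = card N"
proof -
 obtain y \<eta> where y: "\<zeta> = cclass y" "\<eta> \<in> \<Sigma>" "nv y \<eta>" "\<not> van 0 y 1" using assms by (auto simp: Zs_def)
 define \<sigma> where "\<sigma> = (SOME \<sigma>. \<sigma> \<in> \<Sigma> \<and> \<zeta> \<in> chart_points \<Sigma> \<sigma>)"
 have "\<sigma> \<in> \<Sigma> \<and> \<zeta> \<in> chart_points \<Sigma> \<sigma>" unfolding \<sigma>_def by (rule someI[of _ \<eta>]) (use y chart_points_iff in blast)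
 then obtain x where x: "\<sigma> \<in> \<Sigma>" "nv x \<sigma>" "\<zeta> = cclass x" using chart_points_iff by blast
 have v: "\<not> van 0 x 1" using van_cong[of x y 0 1] y(1,4) x(3) by auto
 obtain N :: "'n laurent set" where N: "basis_mod (Ng 0 \<sigma>) {p. van 0 x p} N (\<lambda>p. p)"
  using local_basis_exists[OF x(1,2)] by blast
 have "multiplicity_at \<Sigma> \<rho> I \<zeta> = card N"
  using local_dim[OF x(1,2) v N] unfolding multiplicity_at_def Let_def \<sigma>_def[symmetric] x(3)[symmetric] .
 thus ?thesis using x N by blast
qed

text \<open>If f is saturated, its product with the l-th power of each cone monomial lies in
  \<open>I\<close>, which says that f lies in the ideal on every chart; \<open>Im_global\<close>
  applies in degree \<beta>. The other inclusion takes l = 0, where the power of the irrelevant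
  ideal is the whole ring.\<close>

lemma saturated:
 assumes bS: "\<beta>' = cl \<beta>"
 shows "I \<inter> graded_piece \<rho> \<beta>' = saturation cox_ring I (irrelevant_ideal \<Sigma> \<rho>) \<inter> graded_piece \<rho> \<beta>'"
proof (intro subset_antisym subsetI)
 fix f assume f: "f \<in> I \<inter> graded_piece \<rho> \<beta>'"
 have "\<forall>b\<in>ideal_power cox_ring (irrelevant_ideal \<Sigma> \<rho>) 0. f \<otimes>\<^bsub>cox_ring\<^esub> b \<in> I"
  using submod_mult[OF submod_I UNIV_I, of f] f by (auto simp: mult.commute)
 thus "f \<in> saturation cox_ring I (irrelevant_ideal \<Sigma> \<rho>) \<inter> graded_piece \<rho> \<beta>'"
  using f unfolding saturation_def by (auto intro!: exI[of _ 0])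
next
 fix f assume f: "f \<in> saturation cox_ring I (irrelevant_ideal \<Sigma> \<rho>) \<inter> graded_piece \<rho> \<beta>'"
 then obtain l where l: "\<And>b. b \<in> ideal_power cox_ring (irrelevant_ideal \<Sigma> \<rho>) l ==> f * b \<in> I" by (auto simp: saturation_def)
 obtain p where p: "p \<in> Ng \<beta> UNIV" "homog \<beta> p = f" using f bS dehomog[of f \<beta>] by blast
 interpret cring "cox_ring :: 'k cox ring" by (rule cring_cox)
 have "cone_monomial \<rho> \<sigma> \<in> irrelevant_ideal \<Sigma> \<rho>" if "\<sigma> \<in> \<Sigma>" for \<sigma>
  unfolding irrelevant_ideal_def using genideal_self[of "cone_monomial \<rho> ` \<Sigma>"] that by auto
 hence cmB: "cm \<sigma> l \<in> ideal_power cox_ring (irrelevant_ideal \<Sigma> \<rho>) l" if "\<sigma> \<in> \<Sigma>" for \<sigma> l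
  using that ideal_prod.prod[of "cone_monomial \<rho> \<sigma>" "irrelevant_ideal \<Sigma> \<rho>" _ _ cox_ring]
  by (induction l) (auto simp: ideal_power_def)
 have "p \<in> Im \<beta> UNIV"
 proof (rule Im_global[OF p(1)])
  fix \<sigma> assume "\<sigma> \<in> \<Sigma>"
  have "homog (\<beta> + hl \<sigma> l) p = f * cm \<sigma> l" by (simp only: homog_cm[OF p(1), symmetric] p(2))
  hence "homog (\<beta> + hl \<sigma> l) p \<in> I" using l[OF cmB[OF \<open>\<sigma> \<in> \<Sigma>\<close>]] by (simp only:)
  thus "p \<in> Im \<beta> \<sigma>" using homog_I_iff[OF Ng_hl_mono[OF p(1)]] Im_local_iff by blast
 qed
 thus "f \<in> I \<inter> graded_piece \<rho> \<beta>'" using homog_I_iff[OF p(1)] p(2) f by auto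
qed

end

context toric_system
begin

text \<open>Homogenization identifies the sections of b with the graded piece and
  \<open>Im b UNIV\<close> with its part in \<open>I\<close>. That 1 is outside \<open>I\<close>
  makes the constants a subfield of the quotient, over which dimension is taken.\<close>

lemma hilbert_function_basis:
 assumes one: "1 \<notin> I" and B: "basis_mod (Ng b UNIV) (Im b UNIV) N V"
 shows "hilbert_function \<rho> I (cl b) = card N"
proof -
 have "ideal I cox_ring" using cox_ideal_iff submod_I by blast
 then interpret J: ideal I "cox_ring :: 'k cox ring" .
 interpret Q: cring "cox_ring Quot I" by (rule J.quotient_is_cring[OF cring_cox])
 note h = ring_hom_memE[OF J.rcos_ring_hom, simplified]
 define sc where "sc c = I +>\<^bsub>cox_ring\<^esub> (scalar c :: 'k cox)" for c
 define q where "q p = I +>\<^bsub>cox_ring\<^esub> homog b p" for p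
 have zero: "I +>\<^bsub>cox_ring\<^esub> f = \<zero>\<^bsub>cox_ring Quot I\<^esub> \<longleftrightarrow> f \<in> I" for f
  using J.a_rcos_const[of f] J.rcos_const_imp_mem[of f] by (auto simp: FactRing_def)
 have one': "scalar 1 = (1 :: 'k cox)" by (simp add: scalar_def)
 have sub: "subfield (range sc) (cox_ring Quot I)"
  by (rule Q.subfield_range) (use h one one' zero in \<open>auto simp: sc_def scalar_def single_add simp flip: h(2,3) mult_single[of 0 _ 0, simplified]\<close>)
 have img: "(\<lambda>f. I +>\<^bsub>cox_ring\<^esub> f) ` graded_piece \<rho> (cl b) = q ` Ng b UNIV"
 proof (intro subset_antisym subsetI)
  fix y assume "y \<in> (\<lambda>f. I +>\<^bsub>cox_ring\<^esub> f) ` graded_piece \<rho> (cl b)"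
  then obtain f where f: "f \<in> graded_piece \<rho> (cl b)" "y = I +>\<^bsub>cox_ring\<^esub> f" by blast
  obtain p where "p \<in> Ng b UNIV" "homog b p = f" using dehomog[OF f(1)] .
  thus "y \<in> q ` Ng b UNIV" using f(2) by (auto simp: q_def)
 qed (use homog_graded in \<open>auto simp: q_def\<close>)
 have scale: "homog b (sgl 0 c * p) = scalar c * homog b p" if "p \<in> Ng b UNIV" for c p
  using homog_mult[OF subring_Ng(2) that] homog_0_const(1) by simp
 have "Q.dim (range sc) (q ` Ng b UNIV) = card N"
 proof (rule Q.dim_basis_mod[OF sub _ _ _ _ _ _ _ _ B])
  show "q p = \<zero>\<^bsub>cox_ring Quot I\<^esub> \<longleftrightarrow> p \<in> Im b UNIV" if "p \<in> Ng b UNIV" for p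
   unfolding q_def zero by (rule homog_I_iff[OF that])
  show "sc 1 = \<one>\<^bsub>cox_ring Quot I\<^esub>" using h(4) by (simp add: sc_def one')
  show "q (sgl 0 c * p) = sc c \<otimes>\<^bsub>cox_ring Quot I\<^esub> q p" if "p \<in> Ng b UNIV" for c p
   using h(2) by (simp add: q_def sc_def scale[OF that])
  show "q (p + p') = q p \<oplus>\<^bsub>cox_ring Quot I\<^esub> q p'" for p p' using h(3) by (simp add: q_def homog_add)
  show "q p \<in> carrier (cox_ring Quot I)" for p using h(1) by (simp add: q_def)
  show "sgl 0 c * p \<in> Ng b UNIV" if "p \<in> Ng b UNIV" for c p by (rule Ng_mult[OF subring_Ng(2) that]) simp
 qed (auto intro: spn_add)
 thus ?thesis unfolding hilbert_function_def img sc_def[abs_def] .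
qed

end

context regular_system
begin

text \<open>Both numbers count the disjoint union of the stalk bases: one through its lift to a
  basis of sections modulo the ideal, the other point by point.\<close>

lemma degree_count:
 assumes "1 \<notin> I"
 shows "hilbert_function \<rho> I (cl \<beta>) = scheme_degree \<Sigma> \<rho> I"
proof -
 define P where "P \<zeta> \<sigma> x N \<longleftrightarrow> \<sigma> \<in> \<Sigma> \<and> nv x \<sigma> \<and> cclass x = \<zeta> \<and> basis_mod (Ng 0 \<sigma>) {p. van 0 x p} N (\<lambda>p. p) \<and>
  multiplicity_at \<Sigma> \<rho> I \<zeta> = card N" for \<zeta> \<sigma> x and N :: "'n laurent set"
 have "\<forall>\<zeta>\<in>Zs. \<exists>\<sigma> x N. P \<zeta> \<sigma> x N" unfolding P_def using multiplicity_at_basis by blast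
 then obtain \<sigma> x N where "\<And>\<zeta>. \<zeta> \<in> Zs ==> P \<zeta> (\<sigma> \<zeta>) (x \<zeta>) (N \<zeta>)" by metis
 hence P: "\<And>\<zeta>. \<zeta> \<in> Zs ==> cclass (x \<zeta>) = \<zeta>" "\<And>\<zeta>. \<zeta> \<in> Zs ==> \<sigma> \<zeta> \<in> \<Sigma> \<and> nv (x \<zeta>) (\<sigma> \<zeta>)"
  "\<And>\<zeta>. \<zeta> \<in> Zs ==> basis_mod (Ng 0 (\<sigma> \<zeta>)) {p. van 0 (x \<zeta>) p} (N \<zeta>) (\<lambda>p. p)"
  "\<And>\<zeta>. \<zeta> \<in> Zs ==> multiplicity_at \<Sigma> \<rho> I \<zeta> = card (N \<zeta>)" unfolding P_def by blast+
 obtain V where "basis_mod (Ng \<beta> UNIV) (Im \<beta> UNIV) (SIGMA \<zeta>:Zs. N \<zeta>) V" by (rule global_basis[OF P(1-3)])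
 hence "hilbert_function \<rho> I (cl \<beta>) = card (SIGMA \<zeta>:Zs. N \<zeta>)" by (rule hilbert_function_basis[OF assms])
 also have "\<dots> = (\<Sum>\<zeta>\<in>Zs. card (N \<zeta>))" using finite_Zs P(3) by (intro card_SigmaI) (auto simp: basis_mod_def)
 also have "\<dots> = scheme_degree \<Sigma> \<rho> I" unfolding scheme_degree_def reduced_variety_Zs using P(4) by (intro sum.cong) auto
 finally show ?thesis .
qed

end

section \<open>Regularity\<close>

context toric_fan
begin

text \<open>A hypersurface contains \<zeta> as soon as one point of the fibre is a zero, so avoiding
  \<zeta> is a condition on the whole fibre. This strength is what the closed-orbit representative
  in \<open>local_generator\<close> relies on.\<close>

lemma not_basepoint_iff:
 assumes "\<zeta> \<in> toric_variety \<Sigma>"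
 shows "\<not> basepoint \<Sigma> \<rho> (cl b) \<zeta> \<longleftrightarrow> (\<exists>p\<in>Ng b UNIV. \<forall>x\<in>cox_fibre \<Sigma> \<rho> \<zeta>. cox_eval x (homog b p) \<noteq> 0)"
proof
 assume "\<not> basepoint \<Sigma> \<rho> (cl b) \<zeta>"
 then obtain f where f: "f \<in> graded_piece \<rho> (cl b)" "\<zeta> \<notin> hypersurface \<Sigma> \<rho> f" using assms by (auto simp: basepoint_def)
 obtain p where p: "p \<in> Ng b UNIV" "homog b p = f" using dehomog[OF f(1)] .
 have "\<forall>x\<in>cox_fibre \<Sigma> \<rho> \<zeta>. cox_eval x (homog b p) \<noteq> 0" using f(2) assms unfolding p(2) by (auto simp: hypersurface_def)
 thus "\<exists>p\<in>Ng b UNIV. \<forall>x\<in>cox_fibre \<Sigma> \<rho> \<zeta>. cox_eval x (homog b p) \<noteq> 0" using p(1) by blast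
next
 assume "\<exists>p\<in>Ng b UNIV. \<forall>x\<in>cox_fibre \<Sigma> \<rho> \<zeta>. cox_eval x (homog b p) \<noteq> 0"
 then obtain p where "p \<in> Ng b UNIV" "\<zeta> \<notin> hypersurface \<Sigma> \<rho> (homog b p)" by (auto simp: hypersurface_def)
 thus "\<not> basepoint \<Sigma> \<rho> (cl b) \<zeta>" using homog_graded unfolding basepoint_def by blast
qed

lemma not_basepoint_add:
 assumes "\<zeta> \<in> toric_variety \<Sigma>" "\<not> basepoint \<Sigma> \<rho> (cl b) \<zeta>" "\<not> basepoint \<Sigma> \<rho> (cl c) \<zeta>"
 shows "\<not> basepoint \<Sigma> \<rho> (cl (b + c)) \<zeta>"
proof -
 obtain p q where p: "p \<in> Ng b UNIV" "\<forall>x\<in>cox_fibre \<Sigma> \<rho> \<zeta>. cox_eval x (homog b p) \<noteq> 0"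
  and q: "q \<in> Ng c UNIV" "\<forall>x\<in>cox_fibre \<Sigma> \<rho> \<zeta>. cox_eval x (homog c q) \<noteq> 0"
  using assms(2,3) unfolding not_basepoint_iff[OF assms(1)] by blast
 have "\<forall>x\<in>cox_fibre \<Sigma> \<rho> \<zeta>. cox_eval x (homog (b + c) (p * q)) \<noteq> 0"
  unfolding homog_mult[OF p(1) q(1)] cox_eval_mult using p(2) q(2) by simp
 thus ?thesis unfolding not_basepoint_iff[OF assms(1)] using Ng_mult[OF p(1) q(1) refl] by blast
qed

lemma not_basepoint_zero: "\<zeta> \<in> toric_variety \<Sigma> ==> \<not> basepoint \<Sigma> \<rho> (cl 0) \<zeta>"
 using subring_Ng(1)[of UNIV] unfolding not_basepoint_iff
 by (intro bexI[of _ 1]) (simp_all add: homog_0_const subring_set_def)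

lemma not_basepoint_sum:
 assumes "\<zeta> \<in> toric_variety \<Sigma>" "finite J" "\<And>j. j \<in> J ==> \<not> basepoint \<Sigma> \<rho> (cl (b j)) \<zeta>"
 shows "\<not> basepoint \<Sigma> \<rho> (cl (\<Sum>j\<in>J. b j)) \<zeta>" using assms(2,3)
 by (induction J rule: finite_induct) (auto simp: not_basepoint_zero[OF assms(1)] not_basepoint_add[OF assms(1)])

lemma nef_support_multiple: "nef_support (int l *s b) 1 \<nu> ==> l > 0 ==> nef_support b (int l) \<nu>"
 by (simp add: nef_support_def)

end

context toric_system
begin

lemma regularity_sum:
 assumes dim: "scheme_dim \<Sigma> \<rho> I = 0" and a0: "nef_support a0 l0 \<mu>0" and bp0: "basepoint_free_on \<Sigma> \<rho> I (cl a0)"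
  and bp: "\<And>j. j \<in> {1..CARD('n)} ==> basepoint_free \<Sigma> \<rho> (cl (a j))"
 shows "cl (a0 + (\<Sum>j\<in>{1..CARD('n)}. a j)) \<in> regularity \<Sigma> \<rho> I"
proof -
 interpret zero_dim_system \<Sigma> \<rho> a F \<mu> a0 l0 \<mu>0 by unfold_locales (use a0 scheme_dim_zero(1)[OF dim] in blast)+
 interpret regular_system \<Sigma> \<rho> a F \<mu> a0 l0 \<mu>0
 proof
  fix \<sigma> x assume s: "\<sigma> \<in> \<Sigma>" "nv x \<sigma>" "\<not> van 0 x 1"
  have "cclass x \<in> reduced_variety \<Sigma> \<rho> I" unfolding reduced_variety_Zs Zs_def using s by blast
  hence "\<not> basepoint \<Sigma> \<rho> (cl a0) (cclass x)" using bp0 by (auto simp: basepoint_free_on_def)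
  then obtain p where p: "p \<in> Ng a0 UNIV" "\<forall>y\<in>cox_fibre \<Sigma> \<rho> (cclass x). cox_eval y (homog a0 p) \<noteq> 0"
   unfolding not_basepoint_iff[OF cclass_toric[OF s(1,2)]] by blast
  have "cox_eval x (homog a0 p) \<noteq> 0" using p(2) cox_fibre_iff s(1,2) by blast
  hence "ev (mono x a0) p \<noteq> 0" using cox_eval_homog[OF p(1)] by simp
  then obtain m where "m \<in> keys p" "mono x a0 m \<noteq> 0" unfolding ev_def by (metis (no_types, lifting) mult_zero_right sum.neutral)
  thus "\<exists>m\<in>Rg a0 UNIV. mono x a0 m \<noteq> 0" using p(1) by (auto simp: spn_def)
 qed
 have "\<not> basepoint \<Sigma> \<rho> (cl \<beta>) \<zeta>" if z: "\<zeta> \<in> reduced_variety \<Sigma> \<rho> I" for \<zeta>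
 proof -
  have t: "\<zeta> \<in> toric_variety \<Sigma>" using z by (simp add: reduced_variety_def)
  show ?thesis unfolding \<beta>_def by (rule not_basepoint_add[OF t _ not_basepoint_sum[OF t]])
    (use z bp0 bp in \<open>auto simp: basepoint_free_on_def basepoint_free_def\<close>)
 qed
 hence "basepoint_free_on \<Sigma> \<rho> I (cl \<beta>)" by (simp add: basepoint_free_on_def)
 hence "cl \<beta> \<in> regularity \<Sigma> \<rho> I"
  using degree_count[OF scheme_dim_zero(2)[OF dim]] saturated[OF refl] class_carrier by (auto simp: regularity_def)
 thus ?thesis by (simp add: \<beta>_def)
qed

end

theorem theorem4p4:
  fixes \<Sigma> :: "(real ^ 'n::finite) set set"
    and \<rho> :: "'k::finite \<Rightarrow> (real ^ 'n) set"
    and \<alpha> :: "nat \<Rightarrow> (int ^ 'k) set"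
    and f :: "nat \<Rightarrow> 'k cox"
    and I :: "'k cox set"
  assumes "complete_rational_fan \<Sigma>"
    and "ray_enumeration \<Sigma> \<rho>"
    and "\<And>i. i \<in> {1..CARD('n)} \<Longrightarrow> \<alpha> i \<in> nef_pic \<Sigma> \<rho>"
    and "\<And>i. i \<in> {1..CARD('n)} \<Longrightarrow> f i \<in> graded_piece \<rho> (\<alpha> i)"
    and "I = Idl\<^bsub>cox_ring\<^esub> (f ` {1..CARD('n)})"
    and "scheme_dim \<Sigma> \<rho> I = 0"
  shows "(\<forall>\<alpha>\<^sub>0\<in>nef_rat_pic \<Sigma> \<rho>. basepoint_free_on \<Sigma> \<rho> I \<alpha>\<^sub>0 \<longrightarrow>
            finprod (class_group \<rho>) \<alpha> {1..CARD('n)} \<otimes>\<^bsub>class_group \<rho>\<^esub> \<alpha>\<^sub>0 \<in> regularity \<Sigma> \<rho> I) \<and>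
         finprod (class_group \<rho>) \<alpha> {1..CARD('n)} \<in> regularity \<Sigma> \<rho> I \<and>
         (\<forall>\<alpha>\<^sub>0\<in>nef_rat_pic \<Sigma> \<rho>. basepoint_free_on \<Sigma> \<rho> I \<alpha>\<^sub>0 \<longrightarrow>
            regularity_pair \<Sigma> \<rho> I (finprod (class_group \<rho>) \<alpha> {1..CARD('n)}) \<alpha>\<^sub>0)"
proof -
 interpret toric_fan \<Sigma> \<rho> using assms(1,2) by unfold_locales
 define Q where "Q i a F \<mu> \<longleftrightarrow> \<alpha> i = cl a \<and> basepoint_free \<Sigma> \<rho> (cl a) \<and> F \<in> Ng a UNIV \<and> homog a F = f i \<and> nef_support a 1 \<mu>"
  for i a F \<mu>
 have "\<exists>a F \<mu>. Q i a F \<mu>" if i: "i \<in> {1..CARD('n)}" for i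
 proof -
  obtain a where a: "\<alpha> i = cl a" "basepoint_free \<Sigma> \<rho> (cl a)"
   using assms(3)[OF i] by (auto simp: nef_pic_def picard_group_def)
  obtain F where "F \<in> Ng a UNIV" "homog a F = f i" using assms(4)[OF i] unfolding a(1) by (rule dehomog)
  thus ?thesis unfolding Q_def using a basepoint_free_support[OF a(2)] by blast
 qed
 then obtain a F \<mu> where "\<And>i. i \<in> {1..CARD('n)} ==> Q i (a i) (F i) (\<mu> i)" by metis
 hence q: "\<And>i. i \<in> {1..CARD('n)} ==> \<alpha> i = cl (a i)" "\<And>i. i \<in> {1..CARD('n)} ==> basepoint_free \<Sigma> \<rho> (cl (a i))"
  "\<And>i. i \<in> {1..CARD('n)} ==> F i \<in> Ng (a i) UNIV" "\<And>i. i \<in> {1..CARD('n)} ==> homog (a i) (F i) = f i"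
  "\<And>i. i \<in> {1..CARD('n)} ==> nef_support (a i) 1 (\<mu> i)" unfolding Q_def by blast+
 interpret ts: toric_system \<Sigma> \<rho> a F \<mu> by unfold_locales (use q(3,5) in blast)+
 have I: "I = ts.I"
 proof -
  have "f ` {1..CARD('n)} = (\<lambda>j. homog (a j) (F j)) ` {1..CARD('n)}" using q(4) by (intro image_cong) auto
  thus ?thesis unfolding assms(5) ts.I_def by simp
 qed
 interpret G: comm_group "class_group \<rho>" by (rule comm_group_class)
 define A where "A = (\<Sum>j\<in>{1..CARD('n)}. a j)"
 have fp: "finprod (class_group \<rho>) \<alpha> {1..CARD('n)} = cl A"
 proof -
  have "finprod (class_group \<rho>) \<alpha> {1..CARD('n)} = finprod (class_group \<rho>) (\<lambda>j. cl (a j)) {1..CARD('n)}"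
   by (rule G.finprod_cong') (use q(1) class_carrier in auto)
  thus ?thesis unfolding A_def using class_finprod[of "{1..CARD('n)}" a] by simp
 qed
 have reg: "cl A \<otimes>\<^bsub>class_group \<rho>\<^esub> \<alpha>\<^sub>0 \<in> regularity \<Sigma> \<rho> I"
  if h: "\<alpha>\<^sub>0 \<in> nef_rat_pic \<Sigma> \<rho>" "basepoint_free_on \<Sigma> \<rho> I \<alpha>\<^sub>0" for \<alpha>\<^sub>0
 proof -
  obtain a0 and l :: nat where a0: "\<alpha>\<^sub>0 = cl a0" "l > 0" "basepoint_free \<Sigma> \<rho> (cl (int l *s a0))"
   using h(1) class_pow by (auto simp: nef_rat_pic_def nef_pic_def class_carrier)
  \<comment> \<open>Support data of the Cartier multiple l a0 serve a0 itself, with multiplier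
    l.\<close>
  obtain \<mu>0 where "nef_support (int l *s a0) 1 \<mu>0" using basepoint_free_support[OF a0(3)] by blast
  hence ns: "nef_support a0 (int l) \<mu>0" using a0(2) by (rule nef_support_multiple)
  have "cl (a0 + A) \<in> regularity \<Sigma> \<rho> I"
   unfolding A_def I by (rule ts.regularity_sum[OF _ ns _ q(2)]) (use assms(6) h(2) a0(1) in \<open>auto simp: I\<close>)
  thus ?thesis by (simp add: a0(1) class_mult add.commute)
 qed
 have A: "cl A \<in> regularity \<Sigma> \<rho> I"
 proof -
  \<comment> \<open>The sum of the \<alpha>_i by itself is the case \<alpha>_0 = 0, whose constant
    section 1 vanishes nowhere.\<close>
  have ns: "nef_support 0 1 (\<lambda>_. 0)" by (simp add: nef_support_def)
  have bp: "basepoint_free_on \<Sigma> \<rho> I (cl 0)"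
   using not_basepoint_zero by (auto simp: basepoint_free_on_def reduced_variety_def)
  have "cl (0 + A) \<in> regularity \<Sigma> \<rho> I"
   unfolding A_def I by (rule ts.regularity_sum[OF _ ns _ q(2)]) (use assms(6) bp in \<open>auto simp: I\<close>)
  thus ?thesis by simp
 qed
 have "\<alpha>\<^sub>0 \<in> carrier (class_group \<rho>)" if "\<alpha>\<^sub>0 \<in> nef_rat_pic \<Sigma> \<rho>" for \<alpha>\<^sub>0 using that by (simp add: nef_rat_pic_def)
 thus ?thesis using reg A class_carrier unfolding fp regularity_pair_def by blast
qed

end
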